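(* Let $\mathbf I$ and $\mathbf C$ be $2$-categories, and let $F\colon\mathbf I\to\mathbf C$ and $W\colon\mathbf I\to\mathbf{Cat}$ be normal pseudo-functors. The following statements are equivalent. (i) There is a weighted bi-limit $(X,\lambda)$ of $F$ by $W$. (ii) There is an object $X\in \mathbf C$ together with a pseudo-natural transformation $\lambda\colon W\Rightarrow\mathbf C(X,F-)$ in $\mathbf{Ps}(\mathbf I,\mathbf{Cat})$ such that $(X,\lambda)$ is double bi-initial in the pseudo-slice double category $W\downarrow\downarrow\mathbb H\mathbf C(-,F)$. (iii) There is an object $X\in \mathbf C$ together with a pseudo-natural transformation $\lambda\colon W\Rightarrow\mathbf C(X,F-)$ in $\mathbf{Ps}(\mathbf I,\mathbf{Cat})$ such that $(X,\lambda)$ is bi-initial in the pseudo-slice $2$-category $W\downarrow\mathbf C(-,F)$ and $(X,\mathrm{id}_\lambda)$ is bi-initial in the pseudo-slice $2$-category $W\downarrow\mathrm{Ar}_*\mathbf C(-,F)$. (iv) There is an object $X\in \mathbf C$ together with a pseudo-natural transformation $\lambda\colon W\Rightarrow\mathbf C(X,F-)$ in $\mathbf{Ps}(\mathbf I,\mathbf{Cat})$ such that $(X,\mathrm{id}_\lambda)$ is bi-initial in $W\downarrow\mathrm{Ar}_*\mathbf C(-,F)$.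
   Context: **$2$-categories.** $\mathbf{Cat}$ is the $2$-category of categories, functors and natural transformations; $\mathbf C^{\mathrm{op}}$ reverses morphisms but not $2$-morphisms. A normal pseudo-functor $F\colon\mathbf A\to\mathbf B$ between (strict) $2$-categories consists of an assignment on objects, functors $\mathbf A(A,A')\to\mathbf B(FA,FA')$, and invertible compositors $\phi_{a,a'}\colon (Fa')(Fa)\Rightarrow F(a'a)$ satisfying the usual naturality, associativity and unit axioms, with all unitors identities (so $F\mathrm{id}_A=\mathrm{id}_{FA}$). $\mathbf{Ps}(\mathbf A,\mathbf B)$ is the $2$-category of normal pseudo-functors, pseudo-natural transformations (with invertible $2$-morphism components) and modifications. $\mathbf C(-,F)\colon\mathbf C^{\mathrm{op}}\to\mathbf{Ps}(\mathbf I,\mathbf{Cat})$ sends $C$ to the normal pseudo-functor $\mathbf C(C,F-)\colon\mathbf I\to\mathbf{Cat}$. **Weighted bi-limit.** A weighted bi-limit of $F$ by $W$ is a pair $(X,\lambda)$ of an object $X\in\mathbf C$ and a pseudo-natural transformation $\lambda\colon W\Rightarrow\mathbf C(X,F-)$ such that for every $C\in\mathbf C$ the functor $\lambda^*\circ\mathbf C(-,F)\colon\mathbf C(C,X)\to\mathbf{Ps}(\mathbf I,\mathbf{Cat})(W,\mathbf C(C,F-))$, $f\mapsto\mathbf C(f,F-)\circ\lambda$, is an adjoint equivalence of categories. **Pseudo-slice $2$-categories.** For a normal pseudo-functor $G\colon\mathbf B\to\mathbf A$ and an object $I\in\mathbf A$, $I\downarrow G$ has objects $(B,f\colon I\to GB)$;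 morphisms $(B,f)\to(B',f')$ pairs $(b,\psi)$ of $b\colon B\to B'$ in $\mathbf B$ and an invertible $\psi\colon f'\Rightarrow (Gb)f$ (composed using the compositors of $G$); $2$-morphisms $(b,\psi)\Rightarrow(c,\varphi)$ the $\beta\colon b\Rightarrow c$ with $(G\beta\, f)\circ\psi=\varphi$. Write $I\downarrow\mathbf A$ for $G=\mathrm{id}_{\mathbf A}$. $W\downarrow\mathbf C(-,F)$ is the case $G=\mathbf C(-,F)\colon\mathbf C^{\mathrm{op}}\to\mathbf{Ps}(\mathbf I,\mathbf{Cat})$, $I=W$. **$\mathrm{Ar}_*$.** For a $2$-category $\mathbf A$, $\mathrm{Ar}_*\mathbf A$ is the $2$-category with the same objects and hom-categories the arrow categories $\mathrm{Ar}_*\mathbf A(A,A')=\mathbf A(A,A')^{\mathbb 2}$, $\mathbb 2=\{0\to1\}$: morphisms are $2$-morphisms of $\mathbf A$ (composed horizontally), and $2$-morphisms are commutative squares of vertical composites of $2$-morphisms. $\mathrm{Ar}_*G$ acts as $G$ on objects and as $G^{\mathbb 2}$ on hom-categories, with compositors given component-wise by those of $G$. $W\downarrow\mathrm{Ar}_*\mathbf C(-,F)$ is the pseudo-slice for $\mathrm{Ar}_*\mathbf C(-,F)\colon\mathrm{Ar}_*\mathbf C^{\mathrm{op}}\to\mathrm{Ar}_*\mathbf{Ps}(\mathbf I,\mathbf{Cat})$ and the object $W$; its objects are pairs of $C\in\mathbf C$ and a modification between pseudo-natural transformations $W\Rightarrow\mathbf C(C,F-)$. **Double categories** are strict. They have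 objects, horizontal morphisms, vertical morphisms and squares; a square has a top and a bottom horizontal morphism and a left and a right vertical morphism. $\mathrm e_A$ denotes the vertical identity at $A$. A square whose left and right boundaries are vertical identities is vertically invertible if it has an inverse for vertical composition. **$W\downarrow\downarrow\mathbb H\mathbf C(-,F)$.** ($\mathbb H$ views a $2$-category as a double category with only identity vertical morphisms.) Objects: $(C,\kappa)$ with $C\in\mathbf C$ and $\kappa\colon W\Rightarrow\mathbf C(C,F-)$ pseudo-natural. Horizontal morphisms $(C',\kappa')\to(C,\kappa)$: pairs $(c,\Psi)$ of $c\colon C\to C'$ in $\mathbf C$ and an invertible modification $\Psi$ from $\kappa$ to $\mathbf C(c,F-)\kappa'$. Vertical morphisms from $(C,\kappa)$ to $(C,\mu)$: modifications from $\kappa$ to $\mu$ (none between objects with different first components). Squares with top $(c,\Psi)\colon(C',\kappa')\to(C,\kappa)$, bottom $(d,\Phi)\colon(C',\mu')\to(C,\mu)$, left $\Theta'\colon\kappa'\to\mu'$, right $\Theta\colon\kappa\to\mu$: $2$-morphisms $\gamma\colon c\Rightarrow d$ of $\mathbf C$ with $\Phi\circ\Theta=(\mathbf C(\gamma,F-)*\Theta')\circ\Psi$, where $*$ is horizontal composition. **Bi-initial objects.** A $2$-functor is a trivial fibration if it is surjective on objects, full on morphisms (every morphism $GA\to GA'$ is the image of some morphism $A\to A'$) and fully faithful on $2$-morphisms. An object $I$ of a $2$-category $\mathbf A$ is bi-initial if the projection $I\downarrow\mathbf A\to\mathbf A$ is a trivial fibration. **Double bi-initial objects.** For an object $I$ of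 a double category $\mathbb A$, the pseudo-slice double category $I\downarrow\downarrow\mathbb A$ has: objects $(A,f)$ with $f\colon I\to A$ horizontal; horizontal morphisms $(A,f)\to(A',f')$: pairs $(a,\psi)$ of a horizontal $a\colon A\to A'$ and a vertically invertible square $\psi$ with top $f'$, bottom $af$, left $\mathrm e_I$, right $\mathrm e_{A'}$; vertical morphisms from $(A,f)$ to $(B,g)$: pairs $(u,\gamma)$ of a vertical morphism $u$ from $A$ to $B$ and a square $\gamma$ with top $f$, bottom $g$, left $\mathrm e_I$, right $u$; squares with top $(a,\psi)$, bottom $(b,\varphi)$, left $(u,\gamma)$, right $(u',\gamma')$: squares $\alpha$ of $\mathbb A$ with top $a$, bottom $b$, left $u$, right $u'$ such that $\psi$ pasted vertically above the horizontal composite of $\gamma$ and $\alpha$ equals $\gamma'$ pasted vertically above $\varphi$. A double functor is a double trivial fibration if it is surjective on objects, full on horizontal morphisms, surjective on vertical morphisms, and fully faithful on squares (every square whose boundary is the image of a given boundary is the image of a unique square with that given boundary). $I$ is double bi-initial if the projection $I\downarrow\downarrow\mathbb A\to\mathbb A$ is a double trivial fibration. *)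

theory Defs
  imports "HOL-Library.FuncSet"
begin

section \<open>Categories, functors, natural transformations\<close>

record ('a, 'b) cat =
  Obj   :: "'a set"
  Arr   :: "'b set"
  Dom   :: "'b \<Rightarrow> 'a"
  Cod   :: "'b \<Rightarrow> 'a"
  Ident :: "'a \<Rightarrow> 'b"
  Comp  :: "'b \<Rightarrow> 'b \<Rightarrow> 'b"  (infixr "\<cdot>\<index>" 70)

definition hom :: "('a, 'b) cat \<Rightarrow> 'a \<Rightarrow> 'a \<Rightarrow> 'b set" where
  "hom C x y = {f \<in> Arr C. Dom C f = x \<and> Cod C f = y}"

locale category =
  fixes C :: "('a, 'b) cat" (structure)
  assumes dom_obj: "f \<in> Arr C \<Longrightarrow> Dom C f \<in> Obj C"
    and cod_obj: "f \<in> Arr C \<Longrightarrow> Cod C f \<in> Obj C"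
    and ident_hom: "x \<in> Obj C \<Longrightarrow> Ident C x \<in> hom C x x"
    and comp_hom: "f \<in> hom C x y \<Longrightarrow> g \<in> hom C y z \<Longrightarrow> g \<cdot> f \<in> hom C x z"
    and comp_ident: "f \<in> hom C x y \<Longrightarrow> f \<cdot> Ident C x = f"
    and ident_comp: "f \<in> hom C x y \<Longrightarrow> Ident C y \<cdot> f = f"
    and comp_assoc: "f \<in> hom C w x \<Longrightarrow> g \<in> hom C x y \<Longrightarrow> h \<in> hom C y z
      \<Longrightarrow> (h \<cdot> g) \<cdot> f = h \<cdot> (g \<cdot> f)"

definition invertible :: "('a, 'b) cat \<Rightarrow> 'b \<Rightarrow> bool" where
  "invertible C f \<longleftrightarrow> f \<in> Arr C \<and>
    (\<exists>g \<in> hom C (Cod C f) (Dom C f).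
      g \<cdot>\<^bsub>C\<^esub> f = Ident C (Dom C f) \<and> f \<cdot>\<^bsub>C\<^esub> g = Ident C (Cod C f))"

record ('a, 'b, 'p, 'q) func =
  FObj :: "'a \<Rightarrow> 'p"
  FArr :: "'b \<Rightarrow> 'q"

definition is_functor :: "('a, 'b) cat \<Rightarrow> ('p, 'q) cat \<Rightarrow> ('a, 'b, 'p, 'q) func \<Rightarrow> bool" where
  "is_functor A B F \<longleftrightarrow>
    (\<forall>x \<in> Obj A. FObj F x \<in> Obj B) \<and>
    (\<forall>f \<in> Arr A. FArr F f \<in> hom B (FObj F (Dom A f)) (FObj F (Cod A f))) \<and>
    (\<forall>x \<in> Obj A. FArr F (Ident A x) = Ident B (FObj F x)) \<and>
    (\<forall>f \<in> Arr A. \<forall>g \<in> Arr A. Cod A f = Dom A g \<longrightarrow>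
      FArr F (g \<cdot>\<^bsub>A\<^esub> f) = FArr F g \<cdot>\<^bsub>B\<^esub> FArr F f)"

definition nat_trans :: "('a, 'b) cat \<Rightarrow> ('p, 'q) cat \<Rightarrow> ('a, 'b, 'p, 'q) func
    \<Rightarrow> ('a, 'b, 'p, 'q) func \<Rightarrow> ('a \<Rightarrow> 'q) \<Rightarrow> bool" where
  "nat_trans A B F G \<eta> \<longleftrightarrow>
    (\<forall>x \<in> Obj A. \<eta> x \<in> hom B (FObj F x) (FObj G x)) \<and>
    (\<forall>f \<in> Arr A. \<eta> (Cod A f) \<cdot>\<^bsub>B\<^esub> FArr F f = FArr G f \<cdot>\<^bsub>B\<^esub> \<eta> (Dom A f))"

definition id_func :: "('a, 'b, 'a, 'b) func" where
  "id_func = \<lparr>FObj = \<lambda>x. x, FArr = \<lambda>f. f\<rparr>"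

definition comp_func :: "('p, 'q, 'r, 's) func \<Rightarrow> ('a, 'b, 'p, 'q) func \<Rightarrow> ('a, 'b, 'r, 's) func" where
  "comp_func G F = \<lparr>FObj = FObj G \<circ> FObj F, FArr = FArr G \<circ> FArr F\<rparr>"

definition adjoint_equivalence :: "('a, 'b) cat \<Rightarrow> ('p, 'q) cat \<Rightarrow> ('a, 'b, 'p, 'q) func \<Rightarrow> bool" where
  "adjoint_equivalence A B F \<longleftrightarrow> is_functor A B F \<and>
    (\<exists>G \<eta> \<epsilon>. is_functor B A G \<and>
      nat_trans A A id_func (comp_func G F) \<eta> \<and> (\<forall>x \<in> Obj A. invertible A (\<eta> x)) \<and>
      nat_trans B B (comp_func F G) id_func \<epsilon> \<and> (\<forall>y \<in> Obj B. invertible B (\<epsilon> y)) \<and>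
      (\<forall>x \<in> Obj A. \<epsilon> (FObj F x) \<cdot>\<^bsub>B\<^esub> FArr F (\<eta> x) = Ident B (FObj F x)) \<and>
      (\<forall>y \<in> Obj B. FArr G (\<epsilon> y) \<cdot>\<^bsub>A\<^esub> \<eta> (FObj G y) = Ident A (FObj G y)))"

text \<open>Data packaged with its source and target: \<open>(source, target, data)\<close>.\<close>

type_synonym ('x, 'd) arrow = "'x \<times> 'x \<times> 'd"

abbreviation asrc :: "('x, 'd) arrow \<Rightarrow> 'x" where "asrc p \<equiv> fst p"
abbreviation atrg :: "('x, 'd) arrow \<Rightarrow> 'x" where "atrg p \<equiv> fst (snd p)"
abbreviation adat :: "('x, 'd) arrow \<Rightarrow> 'd" where "adat p \<equiv> snd (snd p)"

definition arrow_cat :: "('a, 'b) cat \<Rightarrow> ('b, ('b, 'b \<times> 'b) arrow) cat" where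
  "arrow_cat C = \<lparr>
    Obj = Arr C,
    Arr = {(\<alpha>, \<beta>, (s, t)). \<alpha> \<in> Arr C \<and> \<beta> \<in> Arr C \<and>
      s \<in> hom C (Dom C \<alpha>) (Dom C \<beta>) \<and> t \<in> hom C (Cod C \<alpha>) (Cod C \<beta>) \<and>
      t \<cdot>\<^bsub>C\<^esub> \<alpha> = \<beta> \<cdot>\<^bsub>C\<^esub> s},
    Dom = (\<lambda>p. asrc p),
    Cod = (\<lambda>p. atrg p),
    Ident = (\<lambda>\<alpha>. (\<alpha>, \<alpha>, (Ident C (Dom C \<alpha>), Ident C (Cod C \<alpha>)))),
    Comp = (\<lambda>(\<beta>, \<gamma>, (s', t')) (\<alpha>, _, (s, t)). (\<alpha>, \<gamma>, (s' \<cdot>\<^bsub>C\<^esub> s, t' \<cdot>\<^bsub>C\<^esub> t)))\<rparr>"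


section \<open>Strict 2-categories\<close>

text \<open>\<open>Vert\<close> is the disjoint union of all hom-categories: its objects are the 1-morphisms, its
  arrows the 2-morphisms, its composition is vertical composition. \<open>g \<odot> f\<close> and \<open>\<beta> \<star> \<alpha>\<close> are
  horizontal composites in applicative order (\<open>f\<close> first).\<close>

record ('o, 'm, 'c) two_cat =
  Ob   :: "'o set"
  Vert :: "('m, 'c) cat"
  Src  :: "'m \<Rightarrow> 'o"
  Trg  :: "'m \<Rightarrow> 'o"
  Unit :: "'o \<Rightarrow> 'm"
  HC1  :: "'m \<Rightarrow> 'm \<Rightarrow> 'm"  (infixr "\<odot>\<index>" 75)
  HC2  :: "'c \<Rightarrow> 'c \<Rightarrow> 'c"  (infixr "\<star>\<index>" 75)

abbreviation Mor :: "('o, 'm, 'c) two_cat \<Rightarrow> 'm set" where "Mor A \<equiv> Obj (Vert A)"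
abbreviation Cell :: "('o, 'm, 'c) two_cat \<Rightarrow> 'c set" where "Cell A \<equiv> Arr (Vert A)"
abbreviation id2 :: "('o, 'm, 'c) two_cat \<Rightarrow> 'm \<Rightarrow> 'c" where "id2 A f \<equiv> Ident (Vert A) f"

abbreviation vcomp :: "'c \<Rightarrow> ('o, 'm, 'c) two_cat \<Rightarrow> 'c \<Rightarrow> 'c"  ("(_ \<bullet>\<^bsub>_\<^esub>/ _)" [71, 0, 70] 70)
  where "\<beta> \<bullet>\<^bsub>A\<^esub> \<alpha> \<equiv> Comp (Vert A) \<beta> \<alpha>"

definition hom1 :: "('o, 'm, 'c) two_cat \<Rightarrow> 'o \<Rightarrow> 'o \<Rightarrow> 'm set" where
  "hom1 A x y = {f \<in> Mor A. Src A f = x \<and> Trg A f = y}"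

abbreviation hom2 :: "('o, 'm, 'c) two_cat \<Rightarrow> 'm \<Rightarrow> 'm \<Rightarrow> 'c set" where
  "hom2 A f g \<equiv> hom (Vert A) f g"

definition hom_cat :: "('o, 'm, 'c) two_cat \<Rightarrow> 'o \<Rightarrow> 'o \<Rightarrow> ('m, 'c) cat" where
  "hom_cat A x y = (Vert A)\<lparr>Obj := hom1 A x y, Arr := {\<alpha> \<in> Cell A. Dom (Vert A) \<alpha> \<in> hom1 A x y}\<rparr>"

locale two_category =
  fixes A :: "('o, 'm, 'c) two_cat" (structure)
  assumes vert: "category (Vert A)"
    and src_ob: "f \<in> Mor A \<Longrightarrow> Src A f \<in> Ob A"
    and trg_ob: "f \<in> Mor A \<Longrightarrow> Trg A f \<in> Ob A"
    and src_cell: "\<alpha> \<in> hom2 A f g \<Longrightarrow> Src A f = Src A g"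
    and trg_cell: "\<alpha> \<in> hom2 A f g \<Longrightarrow> Trg A f = Trg A g"
    and unit_hom: "x \<in> Ob A \<Longrightarrow> Unit A x \<in> hom1 A x x"
    and HC1_hom: "f \<in> hom1 A x y \<Longrightarrow> g \<in> hom1 A y z \<Longrightarrow> g \<odot> f \<in> hom1 A x z"
    and HC2_hom: "f \<in> hom1 A x y \<Longrightarrow> g \<in> hom1 A y z \<Longrightarrow> \<alpha> \<in> hom2 A f f' \<Longrightarrow> \<beta> \<in> hom2 A g g'
      \<Longrightarrow> \<beta> \<star> \<alpha> \<in> hom2 A (g \<odot> f) (g' \<odot> f')"
    and HC1_unit: "f \<in> hom1 A x y \<Longrightarrow> f \<odot> Unit A x = f"
    and unit_HC1: "f \<in> hom1 A x y \<Longrightarrow> Unit A y \<odot> f = f"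
    and HC1_assoc: "f \<in> hom1 A w x \<Longrightarrow> g \<in> hom1 A x y \<Longrightarrow> h \<in> hom1 A y z
      \<Longrightarrow> (h \<odot> g) \<odot> f = h \<odot> (g \<odot> f)"
    and HC2_unit: "f \<in> hom1 A x y \<Longrightarrow> \<alpha> \<in> hom2 A f f' \<Longrightarrow> \<alpha> \<star> id2 A (Unit A x) = \<alpha>"
    and unit_HC2: "f \<in> hom1 A x y \<Longrightarrow> \<alpha> \<in> hom2 A f f' \<Longrightarrow> id2 A (Unit A y) \<star> \<alpha> = \<alpha>"
    and HC2_assoc: "f \<in> hom1 A w x \<Longrightarrow> g \<in> hom1 A x y \<Longrightarrow> h \<in> hom1 A y z
      \<Longrightarrow> \<alpha> \<in> hom2 A f f' \<Longrightarrow> \<beta> \<in> hom2 A g g' \<Longrightarrow> \<gamma> \<in> hom2 A h h'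
      \<Longrightarrow> (\<gamma> \<star> \<beta>) \<star> \<alpha> = \<gamma> \<star> (\<beta> \<star> \<alpha>)"
    and HC2_id: "f \<in> hom1 A x y \<Longrightarrow> g \<in> hom1 A y z \<Longrightarrow> id2 A g \<star> id2 A f = id2 A (g \<odot> f)"
    and interchange: "f \<in> hom1 A x y \<Longrightarrow> g \<in> hom1 A y z
      \<Longrightarrow> \<alpha> \<in> hom2 A f f' \<Longrightarrow> \<alpha>' \<in> hom2 A f' f'' \<Longrightarrow> \<beta> \<in> hom2 A g g' \<Longrightarrow> \<beta>' \<in> hom2 A g' g''
      \<Longrightarrow> (\<beta>' \<bullet>\<^bsub>A\<^esub> \<beta>) \<star> (\<alpha>' \<bullet>\<^bsub>A\<^esub> \<alpha>) = (\<beta>' \<star> \<alpha>') \<bullet>\<^bsub>A\<^esub> (\<beta> \<star> \<alpha>)"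

definition two_op :: "('o, 'm, 'c) two_cat \<Rightarrow> ('o, 'm, 'c) two_cat" where
  "two_op A = A\<lparr>Src := Trg A, Trg := Src A, HC1 := \<lambda>g f. f \<odot>\<^bsub>A\<^esub> g, HC2 := \<lambda>\<beta> \<alpha>. \<alpha> \<star>\<^bsub>A\<^esub> \<beta>\<rparr>"

definition Ar2 :: "('o, 'm, 'c) two_cat \<Rightarrow> ('o, 'c, ('c, 'c \<times> 'c) arrow) two_cat" where
  "Ar2 A = \<lparr>
    Ob = Ob A,
    Vert = arrow_cat (Vert A),
    Src = (\<lambda>\<alpha>. Src A (Dom (Vert A) \<alpha>)),
    Trg = (\<lambda>\<alpha>. Trg A (Dom (Vert A) \<alpha>)),
    Unit = (\<lambda>x. id2 A (Unit A x)),
    HC1 = HC2 A,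
    HC2 = (\<lambda>(\<beta>, \<beta>', (u, v)) (\<alpha>, \<alpha>', (s, t)). (\<beta> \<star>\<^bsub>A\<^esub> \<alpha>, \<beta>' \<star>\<^bsub>A\<^esub> \<alpha>', (u \<star>\<^bsub>A\<^esub> s, v \<star>\<^bsub>A\<^esub> t)))\<rparr>"

text \<open>The 2-category of small categories, a category being small if its objects and arrows lie in
  the types \<open>'a\<close> and \<open>'b\<close>. As functors and natural transformations have to be compared for
  equality, they are taken to be \<open>undefined\<close> outside the category they live on.\<close>

type_synonym ('a, 'b) cat_func = "(('a, 'b) cat, ('a, 'b, 'a, 'b) func) arrow"
type_synonym ('a, 'b) cat_nat = "(('a, 'b) cat_func, 'a \<Rightarrow> 'b) arrow"

definition restrict_func :: "('a, 'b) cat \<Rightarrow> ('a, 'b, 'p, 'q) func \<Rightarrow> ('a, 'b, 'p, 'q) func" where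
  "restrict_func A F = \<lparr>FObj = restrict (FObj F) (Obj A), FArr = restrict (FArr F) (Arr A)\<rparr>"

definition cat_funcs :: "('a, 'b) cat_func set" where
  "cat_funcs = {(A, B, F). category A \<and> category B \<and> is_functor A B F \<and>
    FObj F \<in> extensional (Obj A) \<and> FArr F \<in> extensional (Arr A)}"

definition cat_nats :: "('a, 'b) cat_nat set" where
  "cat_nats = {(F, G, \<eta>). F \<in> cat_funcs \<and> G \<in> cat_funcs \<and> asrc F = asrc G \<and> atrg F = atrg G \<and>
    nat_trans (asrc F) (atrg F) (adat F) (adat G) \<eta> \<and> \<eta> \<in> extensional (Obj (asrc F))}"

definition CAT :: "(('a, 'b) cat, ('a, 'b) cat_func, ('a, 'b) cat_nat) two_cat" where
  "CAT = \<lparr>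
    Ob = {A. category A},
    Vert = \<lparr>
      Obj = cat_funcs,
      Arr = cat_nats,
      Dom = (\<lambda>\<eta>. asrc \<eta>),
      Cod = (\<lambda>\<eta>. atrg \<eta>),
      Ident = (\<lambda>(A, B, F). ((A, B, F), (A, B, F), \<lambda>x \<in> Obj A. Ident B (FObj F x))),
      Comp = (\<lambda>(G, H, \<theta>) (F, _, \<eta>). (F, H, \<lambda>x \<in> Obj (asrc F). \<theta> x \<cdot>\<^bsub>atrg F\<^esub> \<eta> x))\<rparr>,
    Src = (\<lambda>F. asrc F),
    Trg = (\<lambda>F. atrg F),
    Unit = (\<lambda>A. (A, A, restrict_func A id_func)),
    HC1 = (\<lambda>(B, C, G) (A, _, F). (A, C, restrict_func A (comp_func G F))),
    HC2 = (\<lambda>((B, C, G), (_, _, G'), \<theta>) ((A, _, F), (_, _, F'), \<eta>).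
      ((A, C, restrict_func A (comp_func G F)), (A, C, restrict_func A (comp_func G' F')),
        \<lambda>x \<in> Obj A. \<theta> (FObj F' x) \<cdot>\<^bsub>C\<^esub> FArr G (\<eta> x)))\<rparr>"


section \<open>The 2-category of normal pseudo-functors\<close>

text \<open>\<open>PC F b a\<close> is the compositor \<open>(F b)(F a) \<Rightarrow> F (b a)\<close>.\<close>

record ('o, 'm, 'c, 'p, 'n, 'd) psfun =
  PO :: "'o \<Rightarrow> 'p"
  P1 :: "'m \<Rightarrow> 'n"
  P2 :: "'c \<Rightarrow> 'd"
  PC :: "'m \<Rightarrow> 'm \<Rightarrow> 'd"

definition normal_pseudofunctor ::
    "('o, 'm, 'c) two_cat \<Rightarrow> ('p, 'n, 'd) two_cat \<Rightarrow> ('o, 'm, 'c, 'p, 'n, 'd) psfun \<Rightarrow> bool" where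
  "normal_pseudofunctor A B F \<longleftrightarrow>
    (\<forall>x \<in> Ob A. PO F x \<in> Ob B) \<and>
    (\<forall>x \<in> Ob A. \<forall>y \<in> Ob A. is_functor (hom_cat A x y) (hom_cat B (PO F x) (PO F y))
      \<lparr>FObj = P1 F, FArr = P2 F\<rparr>) \<and>
    (\<forall>x \<in> Ob A. P1 F (Unit A x) = Unit B (PO F x)) \<and>
    (\<forall>a \<in> Mor A. \<forall>b \<in> Mor A. Trg A a = Src A b \<longrightarrow>
      PC F b a \<in> hom2 B (P1 F b \<odot>\<^bsub>B\<^esub> P1 F a) (P1 F (b \<odot>\<^bsub>A\<^esub> a)) \<and> invertible (Vert B) (PC F b a)) \<and>
    (\<forall>a a' b b'. \<forall>\<alpha> \<in> hom2 A a a'. \<forall>\<beta> \<in> hom2 A b b'. Trg A a = Src A b \<longrightarrow>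
      PC F b' a' \<bullet>\<^bsub>B\<^esub> (P2 F \<beta> \<star>\<^bsub>B\<^esub> P2 F \<alpha>) = P2 F (\<beta> \<star>\<^bsub>A\<^esub> \<alpha>) \<bullet>\<^bsub>B\<^esub> PC F b a) \<and>
    (\<forall>a \<in> Mor A. \<forall>b \<in> Mor A. \<forall>c \<in> Mor A. Trg A a = Src A b \<longrightarrow> Trg A b = Src A c \<longrightarrow>
      PC F c (b \<odot>\<^bsub>A\<^esub> a) \<bullet>\<^bsub>B\<^esub> (id2 B (P1 F c) \<star>\<^bsub>B\<^esub> PC F b a) =
      PC F (c \<odot>\<^bsub>A\<^esub> b) a \<bullet>\<^bsub>B\<^esub> (PC F c b \<star>\<^bsub>B\<^esub> id2 B (P1 F a))) \<and>
    (\<forall>a \<in> Mor A. PC F a (Unit A (Src A a)) = id2 B (P1 F a) \<and>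
      PC F (Unit A (Trg A a)) a = id2 B (P1 F a))"

definition id_psfun :: "('o, 'm, 'c) two_cat \<Rightarrow> ('o, 'm, 'c, 'o, 'm, 'c) psfun" where
  "id_psfun A = \<lparr>PO = \<lambda>x. x, P1 = \<lambda>f. f, P2 = \<lambda>\<alpha>. \<alpha>, PC = \<lambda>g f. id2 A (g \<odot>\<^bsub>A\<^esub> f)\<rparr>"

text \<open>For a pseudo-natural transformation \<open>\<sigma> : F \<Rightarrow> G\<close> and \<open>a : x \<rightarrow> y\<close>, the 2-morphism component
  is directed as \<open>Sq \<sigma> a : (G a) \<sigma>\<^sub>x \<Rightarrow> \<sigma>\<^sub>y (F a)\<close>.\<close>

record ('o, 'm, 'n, 'd) ptrans =
  Cmp :: "'o \<Rightarrow> 'n"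
  Sq  :: "'m \<Rightarrow> 'd"

definition pseudo_natural :: "('o, 'm, 'c) two_cat \<Rightarrow> ('p, 'n, 'd) two_cat
    \<Rightarrow> ('o, 'm, 'c, 'p, 'n, 'd) psfun \<Rightarrow> ('o, 'm, 'c, 'p, 'n, 'd) psfun
    \<Rightarrow> ('o, 'm, 'n, 'd) ptrans \<Rightarrow> bool" where
  "pseudo_natural A B F G \<sigma> \<longleftrightarrow>
    (\<forall>x \<in> Ob A. Cmp \<sigma> x \<in> hom1 B (PO F x) (PO G x)) \<and>
    (\<forall>x \<in> Ob A. \<forall>y \<in> Ob A. \<forall>a \<in> hom1 A x y.
      Sq \<sigma> a \<in> hom2 B (P1 G a \<odot>\<^bsub>B\<^esub> Cmp \<sigma> x) (Cmp \<sigma> y \<odot>\<^bsub>B\<^esub> P1 F a) \<and> invertible (Vert B) (Sq \<sigma> a)) \<and>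
    (\<forall>x \<in> Ob A. \<forall>y \<in> Ob A. \<forall>a \<in> hom1 A x y. \<forall>b \<in> hom1 A x y. \<forall>\<alpha> \<in> hom2 A a b.
      Sq \<sigma> b \<bullet>\<^bsub>B\<^esub> (P2 G \<alpha> \<star>\<^bsub>B\<^esub> id2 B (Cmp \<sigma> x)) = (id2 B (Cmp \<sigma> y) \<star>\<^bsub>B\<^esub> P2 F \<alpha>) \<bullet>\<^bsub>B\<^esub> Sq \<sigma> a) \<and>
    (\<forall>x \<in> Ob A. Sq \<sigma> (Unit A x) = id2 B (Cmp \<sigma> x)) \<and>
    (\<forall>x \<in> Ob A. \<forall>y \<in> Ob A. \<forall>z \<in> Ob A. \<forall>a \<in> hom1 A x y. \<forall>b \<in> hom1 A y z.
      Sq \<sigma> (b \<odot>\<^bsub>A\<^esub> a) \<bullet>\<^bsub>B\<^esub> (PC G b a \<star>\<^bsub>B\<^esub> id2 B (Cmp \<sigma> x)) =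
      (id2 B (Cmp \<sigma> z) \<star>\<^bsub>B\<^esub> PC F b a) \<bullet>\<^bsub>B\<^esub> (Sq \<sigma> b \<star>\<^bsub>B\<^esub> id2 B (P1 F a)) \<bullet>\<^bsub>B\<^esub>
        (id2 B (P1 G b) \<star>\<^bsub>B\<^esub> Sq \<sigma> a))"

definition is_modification :: "('o, 'm, 'c) two_cat \<Rightarrow> ('p, 'n, 'd) two_cat
    \<Rightarrow> ('o, 'm, 'c, 'p, 'n, 'd) psfun \<Rightarrow> ('o, 'm, 'c, 'p, 'n, 'd) psfun
    \<Rightarrow> ('o, 'm, 'n, 'd) ptrans \<Rightarrow> ('o, 'm, 'n, 'd) ptrans \<Rightarrow> ('o \<Rightarrow> 'd) \<Rightarrow> bool" where
  "is_modification A B F G \<sigma> \<tau> \<mu> \<longleftrightarrow>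
    (\<forall>x \<in> Ob A. \<mu> x \<in> hom2 B (Cmp \<sigma> x) (Cmp \<tau> x)) \<and>
    (\<forall>x \<in> Ob A. \<forall>y \<in> Ob A. \<forall>a \<in> hom1 A x y.
      Sq \<tau> a \<bullet>\<^bsub>B\<^esub> (id2 B (P1 G a) \<star>\<^bsub>B\<^esub> \<mu> x) = (\<mu> y \<star>\<^bsub>B\<^esub> id2 B (P1 F a)) \<bullet>\<^bsub>B\<^esub> Sq \<sigma> a)"

type_synonym ('o, 'm, 'c, 'p, 'n, 'd) ps_mor =
  "(('o, 'm, 'c, 'p, 'n, 'd) psfun, ('o, 'm, 'n, 'd) ptrans) arrow"
type_synonym ('o, 'm, 'c, 'p, 'n, 'd) ps_cell =
  "(('o, 'm, 'c, 'p, 'n, 'd) ps_mor, 'o \<Rightarrow> 'd) arrow"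

definition ps_mors :: "('o, 'm, 'c) two_cat \<Rightarrow> ('p, 'n, 'd) two_cat
    \<Rightarrow> ('o, 'm, 'c, 'p, 'n, 'd) ps_mor set" where
  "ps_mors A B = {(F, G, \<sigma>). normal_pseudofunctor A B F \<and> normal_pseudofunctor A B G \<and>
    pseudo_natural A B F G \<sigma> \<and> Cmp \<sigma> \<in> extensional (Ob A) \<and> Sq \<sigma> \<in> extensional (Mor A)}"

definition ps_cells :: "('o, 'm, 'c) two_cat \<Rightarrow> ('p, 'n, 'd) two_cat
    \<Rightarrow> ('o, 'm, 'c, 'p, 'n, 'd) ps_cell set" where
  "ps_cells A B = {(\<sigma>, \<tau>, \<mu>). \<sigma> \<in> ps_mors A B \<and> \<tau> \<in> ps_mors A B \<and>
    asrc \<sigma> = asrc \<tau> \<and> atrg \<sigma> = atrg \<tau> \<and>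
    is_modification A B (asrc \<sigma>) (atrg \<sigma>) (adat \<sigma>) (adat \<tau>) \<mu> \<and> \<mu> \<in> extensional (Ob A)}"

definition ps_comp :: "('o, 'm, 'c) two_cat \<Rightarrow> ('p, 'n, 'd) two_cat
    \<Rightarrow> ('o, 'm, 'c, 'p, 'n, 'd) ps_mor \<Rightarrow> ('o, 'm, 'c, 'p, 'n, 'd) ps_mor
    \<Rightarrow> ('o, 'm, 'c, 'p, 'n, 'd) ps_mor" where
  "ps_comp A B = (\<lambda>(G, H, \<tau>) (F, _, \<sigma>). (F, H, \<lparr>
    Cmp = \<lambda>x \<in> Ob A. Cmp \<tau> x \<odot>\<^bsub>B\<^esub> Cmp \<sigma> x,
    Sq = \<lambda>a \<in> Mor A. (id2 B (Cmp \<tau> (Trg A a)) \<star>\<^bsub>B\<^esub> Sq \<sigma> a) \<bullet>\<^bsub>B\<^esub>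
      (Sq \<tau> a \<star>\<^bsub>B\<^esub> id2 B (Cmp \<sigma> (Src A a)))\<rparr>))"

definition Ps :: "('o, 'm, 'c) two_cat \<Rightarrow> ('p, 'n, 'd) two_cat
    \<Rightarrow> (('o, 'm, 'c, 'p, 'n, 'd) psfun, ('o, 'm, 'c, 'p, 'n, 'd) ps_mor,
        ('o, 'm, 'c, 'p, 'n, 'd) ps_cell) two_cat" where
  "Ps A B = \<lparr>
    Ob = {F. normal_pseudofunctor A B F},
    Vert = \<lparr>
      Obj = ps_mors A B,
      Arr = ps_cells A B,
      Dom = (\<lambda>\<mu>. asrc \<mu>),
      Cod = (\<lambda>\<mu>. atrg \<mu>),
      Ident = (\<lambda>\<sigma>. (\<sigma>, \<sigma>, \<lambda>x \<in> Ob A. id2 B (Cmp (adat \<sigma>) x))),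
      Comp = (\<lambda>(\<tau>, \<upsilon>, \<nu>) (\<sigma>, _, \<mu>). (\<sigma>, \<upsilon>, \<lambda>x \<in> Ob A. \<nu> x \<bullet>\<^bsub>B\<^esub> \<mu> x))\<rparr>,
    Src = (\<lambda>\<sigma>. asrc \<sigma>),
    Trg = (\<lambda>\<sigma>. atrg \<sigma>),
    Unit = (\<lambda>F. (F, F, \<lparr>Cmp = \<lambda>x \<in> Ob A. Unit B (PO F x), Sq = \<lambda>a \<in> Mor A. id2 B (P1 F a)\<rparr>)),
    HC1 = ps_comp A B,
    HC2 = (\<lambda>(\<tau>, \<tau>', \<nu>) (\<sigma>, \<sigma>', \<mu>).
      (ps_comp A B \<tau> \<sigma>, ps_comp A B \<tau>' \<sigma>', \<lambda>x \<in> Ob A. \<nu> x \<star>\<^bsub>B\<^esub> \<mu> x))\<rparr>"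

definition Ar2_psfun :: "('o, 'm, 'c) two_cat \<Rightarrow> ('p, 'n, 'd) two_cat \<Rightarrow> ('o, 'm, 'c, 'p, 'n, 'd) psfun
    \<Rightarrow> ('o, 'c, ('c, 'c \<times> 'c) arrow, 'p, 'd, ('d, 'd \<times> 'd) arrow) psfun" where
  "Ar2_psfun A B G = \<lparr>
    PO = PO G,
    P1 = P2 G,
    P2 = (\<lambda>(\<alpha>, \<beta>, (s, t)). (P2 G \<alpha>, P2 G \<beta>, (P2 G s, P2 G t))),
    PC = (\<lambda>\<beta> \<alpha>. (P2 G \<beta> \<star>\<^bsub>B\<^esub> P2 G \<alpha>, P2 G (\<beta> \<star>\<^bsub>A\<^esub> \<alpha>),
      (PC G (Dom (Vert A) \<beta>) (Dom (Vert A) \<alpha>), PC G (Cod (Vert A) \<beta>) (Cod (Vert A) \<alpha>))))\<rparr>"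


section \<open>The 2-functor \<open>C(-,F)\<close> and weighted bi-limits\<close>

text \<open>The 1- and 2-morphisms of \<open>C\<close> lie in the types over which \<open>CAT\<close> is formed, so that the
  hom-categories of \<open>C\<close> are objects of \<open>CAT\<close>, i.e. \<open>C\<close> is locally small.\<close>

definition whisker_func :: "('o, 'm, 'c) two_cat \<Rightarrow> 'o \<Rightarrow> 'm \<Rightarrow> ('m, 'c) cat_func" where
  \<comment> \<open>\<open>C(X,u) : C(X,Src u) \<rightarrow> C(X,Trg u)\<close>\<close>
  "whisker_func C X u = (hom_cat C X (Src C u), hom_cat C X (Trg C u),
    restrict_func (hom_cat C X (Src C u)) \<lparr>FObj = \<lambda>f. u \<odot>\<^bsub>C\<^esub> f, FArr = \<lambda>\<alpha>. id2 C u \<star>\<^bsub>C\<^esub> \<alpha>\<rparr>)"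

definition cowhisker_func :: "('o, 'm, 'c) two_cat \<Rightarrow> 'm \<Rightarrow> 'o \<Rightarrow> ('m, 'c) cat_func" where
  \<comment> \<open>\<open>C(c,Z) : C(Trg c,Z) \<rightarrow> C(Src c,Z)\<close>\<close>
  "cowhisker_func C c Z = (hom_cat C (Trg C c) Z, hom_cat C (Src C c) Z,
    restrict_func (hom_cat C (Trg C c) Z) \<lparr>FObj = \<lambda>f. f \<odot>\<^bsub>C\<^esub> c, FArr = \<lambda>\<alpha>. \<alpha> \<star>\<^bsub>C\<^esub> id2 C c\<rparr>)"

definition hom_psfun :: "('i, 'im, 'ic) two_cat \<Rightarrow> ('o, 'm, 'c) two_cat
    \<Rightarrow> ('i, 'im, 'ic, 'o, 'm, 'c) psfun \<Rightarrow> 'o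
    \<Rightarrow> ('i, 'im, 'ic, ('m, 'c) cat, ('m, 'c) cat_func, ('m, 'c) cat_nat) psfun" where
  \<comment> \<open>\<open>C(X,F-)\<close>\<close>
  "hom_psfun I C F X = \<lparr>
    PO = (\<lambda>i. hom_cat C X (PO F i)),
    P1 = (\<lambda>u. whisker_func C X (P1 F u)),
    P2 = (\<lambda>\<theta>. (whisker_func C X (P1 F (Dom (Vert I) \<theta>)), whisker_func C X (P1 F (Cod (Vert I) \<theta>)),
      \<lambda>f \<in> hom1 C X (PO F (Src I (Dom (Vert I) \<theta>))). P2 F \<theta> \<star>\<^bsub>C\<^esub> id2 C f)),
    PC = (\<lambda>v u. (whisker_func C X (P1 F v) \<odot>\<^bsub>CAT\<^esub> whisker_func C X (P1 F u),
      whisker_func C X (P1 F (v \<odot>\<^bsub>I\<^esub> u)),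
      \<lambda>f \<in> hom1 C X (PO F (Src I u)). PC F v u \<star>\<^bsub>C\<^esub> id2 C f))\<rparr>"

definition hom_ptrans :: "('i, 'im, 'ic) two_cat \<Rightarrow> ('o, 'm, 'c) two_cat
    \<Rightarrow> ('i, 'im, 'ic, 'o, 'm, 'c) psfun \<Rightarrow> 'm
    \<Rightarrow> ('i, 'im, 'ic, ('m, 'c) cat, ('m, 'c) cat_func, ('m, 'c) cat_nat) ps_mor" where
  \<comment> \<open>\<open>C(c,F-) : C(Trg c,F-) \<Rightarrow> C(Src c,F-)\<close>, a strict 2-natural transformation\<close>
  "hom_ptrans I C F c = (hom_psfun I C F (Trg C c), hom_psfun I C F (Src C c), \<lparr>
    Cmp = \<lambda>i \<in> Ob I. cowhisker_func C c (PO F i),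
    Sq = \<lambda>u \<in> Mor I. id2 CAT (whisker_func C (Src C c) (P1 F u) \<odot>\<^bsub>CAT\<^esub>
      cowhisker_func C c (PO F (Src I u)))\<rparr>)"

definition HomF :: "('i, 'im, 'ic) two_cat \<Rightarrow> ('o, 'm, 'c) two_cat
    \<Rightarrow> ('i, 'im, 'ic, 'o, 'm, 'c) psfun
    \<Rightarrow> ('o, 'm, 'c,
        ('i, 'im, 'ic, ('m, 'c) cat, ('m, 'c) cat_func, ('m, 'c) cat_nat) psfun,
        ('i, 'im, 'ic, ('m, 'c) cat, ('m, 'c) cat_func, ('m, 'c) cat_nat) ps_mor,
        ('i, 'im, 'ic, ('m, 'c) cat, ('m, 'c) cat_func, ('m, 'c) cat_nat) ps_cell) psfun" where
  \<comment> \<open>\<open>C(-,F)\<close>, from \<open>two_op C\<close> to \<open>Ps I CAT\<close>; a strict 2-functor\<close>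
  "HomF I C F = \<lparr>
    PO = hom_psfun I C F,
    P1 = hom_ptrans I C F,
    P2 = (\<lambda>\<gamma>. (hom_ptrans I C F (Dom (Vert C) \<gamma>), hom_ptrans I C F (Cod (Vert C) \<gamma>),
      \<lambda>i \<in> Ob I. (cowhisker_func C (Dom (Vert C) \<gamma>) (PO F i), cowhisker_func C (Cod (Vert C) \<gamma>) (PO F i),
        \<lambda>f \<in> hom1 C (Trg C (Dom (Vert C) \<gamma>)) (PO F i). id2 C f \<star>\<^bsub>C\<^esub> \<gamma>))),
    PC = (\<lambda>d c. id2 (Ps I CAT) (hom_ptrans I C F (d \<odot>\<^bsub>two_op C\<^esub> c)))\<rparr>"

definition weighted_bilimit :: "('i, 'im, 'ic) two_cat \<Rightarrow> ('o, 'm, 'c) two_cat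
    \<Rightarrow> ('i, 'im, 'ic, 'o, 'm, 'c) psfun
    \<Rightarrow> ('i, 'im, 'ic, ('m, 'c) cat, ('m, 'c) cat_func, ('m, 'c) cat_nat) psfun \<Rightarrow> 'o
    \<Rightarrow> ('i, 'im, 'ic, ('m, 'c) cat, ('m, 'c) cat_func, ('m, 'c) cat_nat) ps_mor \<Rightarrow> bool" where
  "weighted_bilimit I C F W X l \<longleftrightarrow>
    X \<in> Ob C \<and> l \<in> hom1 (Ps I CAT) W (PO (HomF I C F) X) \<and>
    (\<forall>Y \<in> Ob C. adjoint_equivalence
      (hom_cat C Y X) (hom_cat (Ps I CAT) W (PO (HomF I C F) Y))
      \<lparr>FObj = \<lambda>f. P1 (HomF I C F) f \<odot>\<^bsub>Ps I CAT\<^esub> l,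
       FArr = \<lambda>\<alpha>. P2 (HomF I C F) \<alpha> \<star>\<^bsub>Ps I CAT\<^esub> id2 (Ps I CAT) l\<rparr>)"


section \<open>Pseudo-slice 2-categories and bi-initial objects\<close>

text \<open>\<open>slice B A G I\<close> is \<open>I \<down> G\<close> for \<open>G\<close> from \<open>B\<close> to \<open>A\<close>. A 1-morphism \<open>(x, f) \<rightarrow> (y, g)\<close> carries
  data \<open>(b, \<psi>)\<close> with \<open>b : x \<rightarrow> y\<close> and \<open>\<psi> : g \<Rightarrow> (G b) f\<close>.\<close>

definition slice_obs :: "('p, 'n, 'd) two_cat \<Rightarrow> ('o, 'm, 'c) two_cat
    \<Rightarrow> ('p, 'n, 'd, 'o, 'm, 'c) psfun \<Rightarrow> 'o \<Rightarrow> ('p \<times> 'm) set" where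
  "slice_obs B A G I = {(x, f). x \<in> Ob B \<and> f \<in> hom1 A I (PO G x)}"

type_synonym ('p, 'n, 'm, 'c) slice_mor = "('p \<times> 'm, 'n \<times> 'c) arrow"
type_synonym ('p, 'n, 'd, 'm, 'c) slice_cell = "(('p, 'n, 'm, 'c) slice_mor, 'd) arrow"

definition slice_mors :: "('p, 'n, 'd) two_cat \<Rightarrow> ('o, 'm, 'c) two_cat
    \<Rightarrow> ('p, 'n, 'd, 'o, 'm, 'c) psfun \<Rightarrow> 'o \<Rightarrow> ('p, 'n, 'm, 'c) slice_mor set" where
  "slice_mors B A G I = {((x, f), (y, g), (b, \<psi>)).
    (x, f) \<in> slice_obs B A G I \<and> (y, g) \<in> slice_obs B A G I \<and>
    b \<in> hom1 B x y \<and> \<psi> \<in> hom2 A g (P1 G b \<odot>\<^bsub>A\<^esub> f) \<and> invertible (Vert A) \<psi>}"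

definition slice_cells :: "('p, 'n, 'd) two_cat \<Rightarrow> ('o, 'm, 'c) two_cat
    \<Rightarrow> ('p, 'n, 'd, 'o, 'm, 'c) psfun \<Rightarrow> 'o \<Rightarrow> ('p, 'n, 'd, 'm, 'c) slice_cell set" where
  "slice_cells B A G I = {(((x, f), (y, g), (b, \<psi>)), ((x', f'), (y', g'), (c, \<phi>)), \<beta>).
    ((x, f), (y, g), (b, \<psi>)) \<in> slice_mors B A G I \<and>
    ((x', f'), (y', g'), (c, \<phi>)) \<in> slice_mors B A G I \<and>
    (x, f) = (x', f') \<and> (y, g) = (y', g') \<and>
    \<beta> \<in> hom2 B b c \<and> (P2 G \<beta> \<star>\<^bsub>A\<^esub> id2 A f) \<bullet>\<^bsub>A\<^esub> \<psi> = \<phi>}"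

definition slice_unit :: "('p, 'n, 'd) two_cat \<Rightarrow> ('o, 'm, 'c) two_cat
    \<Rightarrow> 'p \<times> 'm \<Rightarrow> ('p, 'n, 'm, 'c) slice_mor" where
  "slice_unit B A = (\<lambda>(x, f). ((x, f), (x, f), (Unit B x, id2 A f)))"

definition slice_comp :: "('p, 'n, 'd) two_cat \<Rightarrow> ('o, 'm, 'c) two_cat
    \<Rightarrow> ('p, 'n, 'd, 'o, 'm, 'c) psfun
    \<Rightarrow> ('p, 'n, 'm, 'c) slice_mor \<Rightarrow> ('p, 'n, 'm, 'c) slice_mor \<Rightarrow> ('p, 'n, 'm, 'c) slice_mor" where
  "slice_comp B A G = (\<lambda>((y, g), (z, h), (c, \<chi>)) ((x, f), _, (b, \<psi>)).
    ((x, f), (z, h), (c \<odot>\<^bsub>B\<^esub> b,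
      (PC G c b \<star>\<^bsub>A\<^esub> id2 A f) \<bullet>\<^bsub>A\<^esub> (id2 A (P1 G c) \<star>\<^bsub>A\<^esub> \<psi>) \<bullet>\<^bsub>A\<^esub> \<chi>)))"

definition slice :: "('p, 'n, 'd) two_cat \<Rightarrow> ('o, 'm, 'c) two_cat
    \<Rightarrow> ('p, 'n, 'd, 'o, 'm, 'c) psfun \<Rightarrow> 'o
    \<Rightarrow> ('p \<times> 'm, ('p, 'n, 'm, 'c) slice_mor, ('p, 'n, 'd, 'm, 'c) slice_cell) two_cat" where
  "slice B A G I = \<lparr>
    Ob = slice_obs B A G I,
    Vert = \<lparr>
      Obj = slice_mors B A G I,
      Arr = slice_cells B A G I,
      Dom = (\<lambda>\<beta>. asrc \<beta>),
      Cod = (\<lambda>\<beta>. atrg \<beta>),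
      Ident = (\<lambda>p. (p, p, id2 B (fst (adat p)))),
      Comp = (\<lambda>(q, r, \<gamma>) (p, _, \<beta>). (p, r, \<gamma> \<bullet>\<^bsub>B\<^esub> \<beta>))\<rparr>,
    Src = (\<lambda>p. asrc p),
    Trg = (\<lambda>p. atrg p),
    Unit = slice_unit B A,
    HC1 = slice_comp B A G,
    HC2 = (\<lambda>(q, q', \<gamma>) (p, p', \<beta>). (slice_comp B A G q p, slice_comp B A G q' p', \<gamma> \<star>\<^bsub>B\<^esub> \<beta>))\<rparr>"

definition slice_proj :: "('p, 'n, 'd) two_cat
    \<Rightarrow> ('p \<times> 'm, ('p, 'n, 'm, 'c) slice_mor, ('p, 'n, 'd, 'm, 'c) slice_cell, 'p, 'n, 'd) psfun" where
  "slice_proj B = \<lparr>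
    PO = (\<lambda>p. fst p),
    P1 = (\<lambda>p. fst (adat p)),
    P2 = (\<lambda>\<beta>. adat \<beta>),
    PC = (\<lambda>q p. id2 B (fst (adat q) \<odot>\<^bsub>B\<^esub> fst (adat p)))\<rparr>"

definition trivial_fibration :: "('o, 'm, 'c) two_cat \<Rightarrow> ('p, 'n, 'd) two_cat
    \<Rightarrow> ('o, 'm, 'c, 'p, 'n, 'd) psfun \<Rightarrow> bool" where
  "trivial_fibration A B G \<longleftrightarrow>
    (\<forall>y \<in> Ob B. \<exists>x \<in> Ob A. PO G x = y) \<and>
    (\<forall>x \<in> Ob A. \<forall>x' \<in> Ob A. \<forall>g \<in> hom1 B (PO G x) (PO G x'). \<exists>f \<in> hom1 A x x'. P1 G f = g) \<and>
    (\<forall>x \<in> Ob A. \<forall>x' \<in> Ob A. \<forall>f \<in> hom1 A x x'. \<forall>f' \<in> hom1 A x x'.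
      \<forall>\<beta> \<in> hom2 B (P1 G f) (P1 G f'). \<exists>!\<alpha>. \<alpha> \<in> hom2 A f f' \<and> P2 G \<alpha> = \<beta>)"

definition bi_initial :: "('o, 'm, 'c) two_cat \<Rightarrow> 'o \<Rightarrow> bool" where
  "bi_initial A I \<longleftrightarrow> I \<in> Ob A \<and> trivial_fibration (slice A A (id_psfun A) I) A (slice_proj A)"


section \<open>Double categories and double bi-initial objects\<close>

text \<open>A double category has two categories \<open>Hor\<close> and \<open>Ver\<close> with the same objects, and two
  categories \<open>HSq\<close> and \<open>VSq\<close> with the same arrows, the squares. Objects of \<open>HSq\<close> are the vertical
  morphisms, \<open>Dom\<close> and \<open>Cod\<close> being left and right boundary, and composition is horizontal; objects
  of \<open>VSq\<close> are the horizontal morphisms, \<open>Dom\<close> and \<open>Cod\<close> being top and bottom boundary, and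
  composition is vertical. Composition is applicative in all four, so \<open>\<alpha> \<cdot>\<^bsub>HSq D\<^esub> \<gamma>\<close> has \<open>\<gamma>\<close> on
  the left and \<open>\<alpha> \<cdot>\<^bsub>VSq D\<^esub> \<gamma>\<close> has \<open>\<gamma>\<close> on top.\<close>

record ('o, 'h, 'v, 's) dbl_cat =
  Hor :: "('o, 'h) cat"
  Ver :: "('o, 'v) cat"
  HSq :: "('v, 's) cat"
  VSq :: "('h, 's) cat"

definition squares :: "('o, 'h, 'v, 's) dbl_cat \<Rightarrow> 'h \<Rightarrow> 'h \<Rightarrow> 'v \<Rightarrow> 'v \<Rightarrow> 's set" where
  \<comment> \<open>order of the boundary: top, bottom, left, right\<close>
  "squares D t b l r = hom (VSq D) t b \<inter> hom (HSq D) l r"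

definition square_boundary :: "('o, 'h, 'v, 's) dbl_cat \<Rightarrow> 'h \<Rightarrow> 'h \<Rightarrow> 'v \<Rightarrow> 'v \<Rightarrow> bool" where
  "square_boundary D t b l r \<longleftrightarrow>
    t \<in> Arr (Hor D) \<and> b \<in> Arr (Hor D) \<and> l \<in> Arr (Ver D) \<and> r \<in> Arr (Ver D) \<and>
    Dom (Hor D) t = Dom (Ver D) l \<and> Cod (Hor D) t = Dom (Ver D) r \<and>
    Dom (Hor D) b = Cod (Ver D) l \<and> Cod (Hor D) b = Cod (Ver D) r"

locale double_category =
  fixes D :: "('o, 'h, 'v, 's) dbl_cat"
  assumes hor: "category (Hor D)" and ver: "category (Ver D)"
    and hsq: "category (HSq D)" and vsq: "category (VSq D)"
    and obj_eq: "Obj (Ver D) = Obj (Hor D)"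
    and hsq_obj: "Obj (HSq D) = Arr (Ver D)" and vsq_obj: "Obj (VSq D) = Arr (Hor D)"
    and sq_eq: "Arr (HSq D) = Arr (VSq D)"
    and boundary: "s \<in> squares D t b l r \<Longrightarrow> square_boundary D t b l r"
    and hcomp_boundary: "s \<in> squares D t b l r \<Longrightarrow> s' \<in> squares D t' b' r r'
      \<Longrightarrow> s' \<cdot>\<^bsub>HSq D\<^esub> s \<in> squares D (t' \<cdot>\<^bsub>Hor D\<^esub> t) (b' \<cdot>\<^bsub>Hor D\<^esub> b) l r'"
    and vcomp_boundary: "s \<in> squares D t b l r \<Longrightarrow> s' \<in> squares D b b' l' r'
      \<Longrightarrow> s' \<cdot>\<^bsub>VSq D\<^esub> s \<in> squares D t b' (l' \<cdot>\<^bsub>Ver D\<^esub> l) (r' \<cdot>\<^bsub>Ver D\<^esub> r)"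
    and hident_boundary: "v \<in> hom (Ver D) x y
      \<Longrightarrow> Ident (HSq D) v \<in> squares D (Ident (Hor D) x) (Ident (Hor D) y) v v"
    and vident_boundary: "h \<in> hom (Hor D) x y
      \<Longrightarrow> Ident (VSq D) h \<in> squares D h h (Ident (Ver D) x) (Ident (Ver D) y)"
    and ident_ident: "x \<in> Obj (Hor D)
      \<Longrightarrow> Ident (HSq D) (Ident (Ver D) x) = Ident (VSq D) (Ident (Hor D) x)"
    and hident_vcomp: "u \<in> hom (Ver D) x y \<Longrightarrow> v \<in> hom (Ver D) y z
      \<Longrightarrow> Ident (HSq D) (v \<cdot>\<^bsub>Ver D\<^esub> u) = Ident (HSq D) v \<cdot>\<^bsub>VSq D\<^esub> Ident (HSq D) u"
    and vident_hcomp: "h \<in> hom (Hor D) x y \<Longrightarrow> k \<in> hom (Hor D) y z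
      \<Longrightarrow> Ident (VSq D) (k \<cdot>\<^bsub>Hor D\<^esub> h) = Ident (VSq D) k \<cdot>\<^bsub>HSq D\<^esub> Ident (VSq D) h"
    and sq_interchange: "s \<in> squares D t b l m \<Longrightarrow> s' \<in> squares D t' b' m r
      \<Longrightarrow> w \<in> squares D b d l' m' \<Longrightarrow> w' \<in> squares D b' d' m' r'
      \<Longrightarrow> (w' \<cdot>\<^bsub>VSq D\<^esub> s') \<cdot>\<^bsub>HSq D\<^esub> (w \<cdot>\<^bsub>VSq D\<^esub> s) = (w' \<cdot>\<^bsub>HSq D\<^esub> w) \<cdot>\<^bsub>VSq D\<^esub> (s' \<cdot>\<^bsub>HSq D\<^esub> s)"

record ('o, 'h, 'v, 's, 'o1, 'h1, 'v1, 's1) dbl_fun =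
  DO :: "'o \<Rightarrow> 'o1"
  DH :: "'h \<Rightarrow> 'h1"
  DV :: "'v \<Rightarrow> 'v1"
  DS :: "'s \<Rightarrow> 's1"

definition double_trivial_fibration :: "('o, 'h, 'v, 's) dbl_cat \<Rightarrow> ('o1, 'h1, 'v1, 's1) dbl_cat
    \<Rightarrow> ('o, 'h, 'v, 's, 'o1, 'h1, 'v1, 's1) dbl_fun \<Rightarrow> bool" where
  "double_trivial_fibration D E P \<longleftrightarrow>
    (\<forall>y \<in> Obj (Hor E). \<exists>x \<in> Obj (Hor D). DO P x = y) \<and>
    (\<forall>x \<in> Obj (Hor D). \<forall>x' \<in> Obj (Hor D). \<forall>g \<in> hom (Hor E) (DO P x) (DO P x').
      \<exists>f \<in> hom (Hor D) x x'. DH P f = g) \<and>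
    (\<forall>v \<in> Arr (Ver E). \<exists>u \<in> Arr (Ver D). DV P u = v) \<and>
    (\<forall>t b l r. square_boundary D t b l r \<longrightarrow>
      (\<forall>s \<in> squares E (DH P t) (DH P b) (DV P l) (DV P r).
        \<exists>!w. w \<in> squares D t b l r \<and> DS P w = s))"

text \<open>Squares of a constructed double category: \<open>(top, bottom, left, right, data)\<close>.\<close>

type_synonym ('h, 'v, 'd) square = "'h \<times> 'h \<times> 'v \<times> 'v \<times> 'd"

abbreviation stop :: "('h, 'v, 'd) square \<Rightarrow> 'h" where "stop s \<equiv> fst s"
abbreviation sbot :: "('h, 'v, 'd) square \<Rightarrow> 'h" where "sbot s \<equiv> fst (snd s)"
abbreviation sleft :: "('h, 'v, 'd) square \<Rightarrow> 'v" where "sleft s \<equiv> fst (snd (snd s))"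
abbreviation sright :: "('h, 'v, 'd) square \<Rightarrow> 'v" where "sright s \<equiv> fst (snd (snd (snd s)))"
abbreviation sdat :: "('h, 'v, 'd) square \<Rightarrow> 'd" where "sdat s \<equiv> snd (snd (snd (snd s)))"

definition dbl_slice_Hor :: "('o, 'h, 'v, 's) dbl_cat \<Rightarrow> 'o
    \<Rightarrow> ('o \<times> 'h, ('o \<times> 'h, 'h \<times> 's) arrow) cat" where
  "dbl_slice_Hor D I = \<lparr>
    Obj = {(x, f). x \<in> Obj (Hor D) \<and> f \<in> hom (Hor D) I x},
    Arr = {((x, f), (y, g), (a, \<psi>)).
      f \<in> hom (Hor D) I x \<and> g \<in> hom (Hor D) I y \<and> a \<in> hom (Hor D) x y \<and>
      \<psi> \<in> squares D g (a \<cdot>\<^bsub>Hor D\<^esub> f) (Ident (Ver D) I) (Ident (Ver D) y) \<and>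
      invertible (VSq D) \<psi>},
    Dom = (\<lambda>p. asrc p),
    Cod = (\<lambda>p. atrg p),
    Ident = (\<lambda>(x, f). ((x, f), (x, f), (Ident (Hor D) x, Ident (VSq D) f))),
    Comp = (\<lambda>((y, g), (z, h), (b, \<chi>)) ((x, f), _, (a, \<psi>)).
      ((x, f), (z, h), (b \<cdot>\<^bsub>Hor D\<^esub> a, (Ident (VSq D) b \<cdot>\<^bsub>HSq D\<^esub> \<psi>) \<cdot>\<^bsub>VSq D\<^esub> \<chi>)))\<rparr>"

definition dbl_slice_Ver :: "('o, 'h, 'v, 's) dbl_cat \<Rightarrow> 'o
    \<Rightarrow> ('o \<times> 'h, ('o \<times> 'h, 'v \<times> 's) arrow) cat" where
  "dbl_slice_Ver D I = \<lparr>
    Obj = {(x, f). x \<in> Obj (Hor D) \<and> f \<in> hom (Hor D) I x},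
    Arr = {((x, f), (y, g), (u, \<gamma>)).
      f \<in> hom (Hor D) I x \<and> g \<in> hom (Hor D) I y \<and> u \<in> hom (Ver D) x y \<and>
      \<gamma> \<in> squares D f g (Ident (Ver D) I) u},
    Dom = (\<lambda>p. asrc p),
    Cod = (\<lambda>p. atrg p),
    Ident = (\<lambda>(x, f). ((x, f), (x, f), (Ident (Ver D) x, Ident (VSq D) f))),
    Comp = (\<lambda>(q, r, (v, \<delta>)) (p, _, (u, \<gamma>)). (p, r, (v \<cdot>\<^bsub>Ver D\<^esub> u, \<delta> \<cdot>\<^bsub>VSq D\<^esub> \<gamma>)))\<rparr>"

definition dbl_slice :: "('o, 'h, 'v, 's) dbl_cat \<Rightarrow> 'o
    \<Rightarrow> ('o \<times> 'h, ('o \<times> 'h, 'h \<times> 's) arrow, ('o \<times> 'h, 'v \<times> 's) arrow,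
        (('o \<times> 'h, 'h \<times> 's) arrow, ('o \<times> 'h, 'v \<times> 's) arrow, 's) square) dbl_cat" where
  "dbl_slice D I = (
    let H = dbl_slice_Hor D I; V = dbl_slice_Ver D I;
      S = {((p, p', (a, \<psi>)), (q, q', (b, \<phi>)), (p1, q1, (u, \<gamma>)), (p1', q1', (u', \<gamma>')), \<alpha>).
        (p, p', (a, \<psi>)) \<in> Arr H \<and> (q, q', (b, \<phi>)) \<in> Arr H \<and>
        (p1, q1, (u, \<gamma>)) \<in> Arr V \<and> (p1', q1', (u', \<gamma>')) \<in> Arr V \<and>
        p1 = p \<and> q1 = q \<and> p1' = p' \<and> q1' = q' \<and>
        \<alpha> \<in> squares D a b u u' \<and>
        (\<alpha> \<cdot>\<^bsub>HSq D\<^esub> \<gamma>) \<cdot>\<^bsub>VSq D\<^esub> \<psi> = \<phi> \<cdot>\<^bsub>VSq D\<^esub> \<gamma>'}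
    in \<lparr>
      Hor = H,
      Ver = V,
      HSq = \<lparr>Obj = Arr V, Arr = S, Dom = (\<lambda>s. sleft s), Cod = (\<lambda>s. sright s),
        Ident = (\<lambda>(p, q, (u, \<gamma>)). (Ident H p, Ident H q, (p, q, (u, \<gamma>)), (p, q, (u, \<gamma>)), Ident (HSq D) u)),
        Comp = (\<lambda>(t', b', _, r', \<alpha>') (t, b, l, _, \<alpha>). (t' \<cdot>\<^bsub>H\<^esub> t, b' \<cdot>\<^bsub>H\<^esub> b, l, r', \<alpha>' \<cdot>\<^bsub>HSq D\<^esub> \<alpha>))\<rparr>,
      VSq = \<lparr>Obj = Arr H, Arr = S, Dom = (\<lambda>s. stop s), Cod = (\<lambda>s. sbot s),
        Ident = (\<lambda>(p, p', (a, \<psi>)). ((p, p', (a, \<psi>)), (p, p', (a, \<psi>)), Ident V p, Ident V p', Ident (VSq D) a)),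
        Comp = (\<lambda>(_, b', l', r', \<alpha>') (t, b, l, r, \<alpha>). (t, b', l' \<cdot>\<^bsub>V\<^esub> l, r' \<cdot>\<^bsub>V\<^esub> r, \<alpha>' \<cdot>\<^bsub>VSq D\<^esub> \<alpha>))\<rparr>\<rparr>)"

definition dbl_slice_proj :: "('o \<times> 'h, ('o \<times> 'h, 'h \<times> 's) arrow, ('o \<times> 'h, 'v \<times> 's) arrow,
    (('o \<times> 'h, 'h \<times> 's) arrow, ('o \<times> 'h, 'v \<times> 's) arrow, 's) square, 'o, 'h, 'v, 's) dbl_fun" where
  "dbl_slice_proj = \<lparr>DO = (\<lambda>p. fst p), DH = (\<lambda>p. fst (adat p)), DV = (\<lambda>p. fst (adat p)), DS = (\<lambda>s. sdat s)\<rparr>"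

definition double_bi_initial :: "('o, 'h, 'v, 's) dbl_cat \<Rightarrow> 'o \<Rightarrow> bool" where
  "double_bi_initial D I \<longleftrightarrow>
    I \<in> Obj (Hor D) \<and> double_trivial_fibration (dbl_slice D I) D dbl_slice_proj"

text \<open>\<open>Hslice B A G I\<close> is the pseudo-slice double category of \<open>I\<close> over the normal pseudo-functor
  \<open>G\<close> from \<open>B\<close> to \<open>A\<close>, both regarded as double categories with only identity vertical morphisms.
  Its horizontal category is the underlying category of \<open>slice B A G I\<close>.
  \<open>Hslice (two_op C) (Ps I CAT) (HomF I C F) W\<close> is the double category of pairs
  \<open>(X, \<kappa> : W \<Rightarrow> C(X,F-))\<close>; since \<open>two_op\<close> reverses 1-morphisms, a horizontal morphism from
  \<open>(X', \<kappa>')\<close> to \<open>(X, \<kappa>)\<close> consists of \<open>c : X \<rightarrow> X'\<close> in \<open>C\<close> and an invertible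
  \<open>\<Psi> : \<kappa> \<Rightarrow> C(c,F-) \<kappa>'\<close>.\<close>

definition Hslice :: "('p, 'n, 'd) two_cat \<Rightarrow> ('o, 'm, 'c) two_cat
    \<Rightarrow> ('p, 'n, 'd, 'o, 'm, 'c) psfun \<Rightarrow> 'o
    \<Rightarrow> ('p \<times> 'm, ('p, 'n, 'm, 'c) slice_mor, ('p \<times> 'm, 'c) arrow,
        (('p, 'n, 'm, 'c) slice_mor, ('p \<times> 'm, 'c) arrow, 'd) square) dbl_cat" where
  "Hslice B A G I = (
    let H = \<lparr>
          Obj = slice_obs B A G I,
          Arr = slice_mors B A G I,
          Dom = (\<lambda>p. asrc p),
          Cod = (\<lambda>p. atrg p),
          Ident = slice_unit B A,
          Comp = slice_comp B A G\<rparr>;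
      V = \<lparr>
          Obj = slice_obs B A G I,
          Arr = {((x, f), (y, g), \<theta>). (x, f) \<in> slice_obs B A G I \<and> (y, g) \<in> slice_obs B A G I \<and>
            x = y \<and> \<theta> \<in> hom2 A f g},
          Dom = (\<lambda>p. asrc p),
          Cod = (\<lambda>p. atrg p),
          Ident = (\<lambda>(x, f). ((x, f), (x, f), id2 A f)),
          Comp = (\<lambda>(q, r, \<theta>') (p, _, \<theta>). (p, r, \<theta>' \<bullet>\<^bsub>A\<^esub> \<theta>))\<rparr>;
      S = {((p, p', (c, \<psi>)), (q, q', (d, \<phi>)), (p1, q1, \<theta>), (p1', q1', \<theta>'), \<gamma>).
        (p, p', (c, \<psi>)) \<in> Arr H \<and> (q, q', (d, \<phi>)) \<in> Arr H \<and>
        (p1, q1, \<theta>) \<in> Arr V \<and> (p1', q1', \<theta>') \<in> Arr V \<and>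
        p1 = p \<and> q1 = q \<and> p1' = p' \<and> q1' = q' \<and>
        \<gamma> \<in> hom2 B c d \<and> \<phi> \<bullet>\<^bsub>A\<^esub> \<theta>' = (P2 G \<gamma> \<star>\<^bsub>A\<^esub> \<theta>) \<bullet>\<^bsub>A\<^esub> \<psi>}
    in \<lparr>
      Hor = H,
      Ver = V,
      HSq = \<lparr>Obj = Arr V, Arr = S, Dom = (\<lambda>s. sleft s), Cod = (\<lambda>s. sright s),
        Ident = (\<lambda>(p, q, \<theta>). (Ident H p, Ident H q, (p, q, \<theta>), (p, q, \<theta>), id2 B (Unit B (fst p)))),
        Comp = (\<lambda>(t', b', _, r', \<gamma>') (t, b, l, _, \<gamma>). (t' \<cdot>\<^bsub>H\<^esub> t, b' \<cdot>\<^bsub>H\<^esub> b, l, r', \<gamma>' \<star>\<^bsub>B\<^esub> \<gamma>))\<rparr>,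
      VSq = \<lparr>Obj = Arr H, Arr = S, Dom = (\<lambda>s. stop s), Cod = (\<lambda>s. sbot s),
        Ident = (\<lambda>(p, p', (c, \<psi>)). ((p, p', (c, \<psi>)), (p, p', (c, \<psi>)), Ident V p, Ident V p', id2 B c)),
        Comp = (\<lambda>(_, b', l', r', \<gamma>') (t, b, l, r, \<gamma>). (t, b', l' \<cdot>\<^bsub>V\<^esub> l, r' \<cdot>\<^bsub>V\<^esub> r, \<gamma>' \<bullet>\<^bsub>B\<^esub> \<gamma>))\<rparr>\<rparr>)"

end

theory Submission
  imports Defs
begin

text \<open>
  Write \<open>G\<close> for the pseudo-functor \<open>C(-,F)\<close>. A pair \<open>(X, \<lambda>)\<close> with \<open>\<lambda> : W \<Rightarrow> G X\<close> determines for every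
  \<open>Y\<close> the evaluation functor \<open>b \<mapsto> (G b) \<lambda>\<close>, from \<open>C(Y,X)\<close> to the category of pseudo-natural
  transformations \<open>W \<Rightarrow> G Y\<close>. Each of the four conditions is shown to be equivalent to the statement
  that, for some \<open>(X, \<lambda>)\<close>, all evaluation functors are fully faithful and essentially surjective.
  Nothing in this argument is special to \<open>C(-,F)\<close>: it works for an arbitrary normal pseudo-functor
  between 2-categories.

  \<^item> A functor is an adjoint equivalence if and only if it is fully faithful and essentially
    surjective (\<open>adjoint_equivalence_iff\<close>). This settles weighted bi-limits.

  \<^item> Bi-initiality in a pseudo-slice speaks about the evaluation functors only through isomorphisms,
    because 1-morphisms of a pseudo-slice carry invertible 2-morphisms. It says that they are
    essentially surjective and that isomorphisms lift uniquely (\<open>bi_initial_slice_iff\<close>). This is weaker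
    than being an equivalence.

  \<^item> The passage to arrows repairs the defect. The hom-categories of \<open>Ar2 A\<close> are the arrow categories
    of those of \<open>A\<close>, and evaluation becomes the induced functor on arrow categories. For that functor,
    essential surjectivity and unique lifting of isomorphisms amount to full faithfulness and
    essential surjectivity of the original functor (\<open>arrow_functor_equivalence_iff\<close>), since a square
    of arrows with invertible sides already sees arrows that are not invertible.

  \<^item> In the pseudo-slice double category the modifications themselves are the vertical morphisms.
    Surjectivity of the projection on vertical morphisms gives fullness, and the lifting of squares
    gives faithfulness (\<open>double_bi_initial_Hslice_iff\<close>).

  To apply these characterisations to \<open>C(-,F)\<close> one needs that categories and normal pseudo-functors
  form 2-categories (\<open>two_category_CAT\<close>, \<open>two_category_Ps\<close>) and that \<open>C(-,F)\<close> is a normal pseudo-functor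
  (\<open>normal_pseudofunctor_HomF\<close>). The latter rests on the fact that precomposition and postcomposition
  are strict 2-functors that commute with each other.
\<close>

section \<open>Categories, functors and equivalences\<close>

lemma homI: "f \<in> Arr C \<Longrightarrow> Dom C f = x \<Longrightarrow> Cod C f = y \<Longrightarrow> f \<in> hom C x y"
  by (simp add: hom_def)

text \<open>The laws of a category are restated with equations between domains and codomains in place of
membership in hom-sets. All their premises then concern subterms of the term that is rewritten, so
that the simplifier can check composability on its own. The same is done for 2-categories,
pseudo-functors and pseudo-natural transformations.\<close>

context category
begin

lemma dom_in [simp]: "f \<in> Arr C \<Longrightarrow> Dom C f \<in> Obj C"
  by (rule dom_obj)

lemma cod_in [simp]: "f \<in> Arr C \<Longrightarrow> Cod C f \<in> Obj C"
  by (rule cod_obj)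

lemma ident_type [simp]:
  "x \<in> Obj C \<Longrightarrow> Ident C x \<in> Arr C"
  "x \<in> Obj C \<Longrightarrow> Dom C (Ident C x) = x"
  "x \<in> Obj C \<Longrightarrow> Cod C (Ident C x) = x"
  using ident_hom by (auto simp: hom_def)

lemma comp_type [simp]:
  assumes "f \<in> Arr C" "g \<in> Arr C" "Cod C f = Dom C g"
  shows "g \<cdot> f \<in> Arr C" "Dom C (g \<cdot> f) = Dom C f" "Cod C (g \<cdot> f) = Cod C g"
  using comp_hom[of f "Dom C f" "Cod C f" g "Cod C g"] assms by (auto simp: hom_def)

lemma comp_ident_right [simp]: "f \<in> Arr C \<Longrightarrow> Dom C f = x \<Longrightarrow> f \<cdot> Ident C x = f"
  using comp_ident[of f x "Cod C f"] by (auto simp: hom_def)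

lemma comp_ident_left [simp]: "f \<in> Arr C \<Longrightarrow> Cod C f = x \<Longrightarrow> Ident C x \<cdot> f = f"
  using ident_comp[of f "Dom C f" x] by (auto simp: hom_def)

lemma comp_assoc_right [simp]:
  "f \<in> Arr C \<Longrightarrow> g \<in> Arr C \<Longrightarrow> h \<in> Arr C \<Longrightarrow> Cod C f = Dom C g \<Longrightarrow> Cod C g = Dom C h
    \<Longrightarrow> (h \<cdot> g) \<cdot> f = h \<cdot> (g \<cdot> f)"
  using comp_assoc[of f "Dom C f" "Cod C f" g "Cod C g" h "Cod C h"] by (auto simp: hom_def)

definition inv_of :: "'b \<Rightarrow> 'b" where
  "inv_of f = (SOME g. g \<in> hom C (Cod C f) (Dom C f) \<and>
    g \<cdot> f = Ident C (Dom C f) \<and> f \<cdot> g = Ident C (Cod C f))"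

lemma invertible_arr [simp]: "invertible C f \<Longrightarrow> f \<in> Arr C"
  by (simp add: invertible_def)

lemma inv_of_props:
  assumes "invertible C f"
  shows "inv_of f \<in> hom C (Cod C f) (Dom C f) \<and>
    inv_of f \<cdot> f = Ident C (Dom C f) \<and> f \<cdot> inv_of f = Ident C (Cod C f)"
  using assms unfolding invertible_def inv_of_def by - (rule someI_ex, blast)

lemma inv_of [simp]:
  assumes "invertible C f"
  shows "inv_of f \<in> Arr C" "Dom C (inv_of f) = Cod C f" "Cod C (inv_of f) = Dom C f"
    "inv_of f \<cdot> f = Ident C (Dom C f)" "f \<cdot> inv_of f = Ident C (Cod C f)"
  using inv_of_props[OF assms] by (auto simp: hom_def)

lemma inv_of_cancel [simp]:
  assumes "invertible C f"
  shows "h \<in> Arr C \<Longrightarrow> Cod C h = Dom C f \<Longrightarrow> inv_of f \<cdot> (f \<cdot> h) = h"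
    "h \<in> Arr C \<Longrightarrow> Cod C h = Cod C f \<Longrightarrow> f \<cdot> (inv_of f \<cdot> h) = h"
proof -
  show "inv_of f \<cdot> (f \<cdot> h) = h" if "h \<in> Arr C" "Cod C h = Dom C f"
  proof -
    have "inv_of f \<cdot> (f \<cdot> h) = (inv_of f \<cdot> f) \<cdot> h"
      by (rule comp_assoc_right[symmetric]) (use assms that in simp_all)
    then show ?thesis
      using assms that by (simp del: comp_assoc_right)
  qed
  show "f \<cdot> (inv_of f \<cdot> h) = h" if "h \<in> Arr C" "Cod C h = Cod C f"
  proof -
    have "f \<cdot> (inv_of f \<cdot> h) = (f \<cdot> inv_of f) \<cdot> h"
      by (rule comp_assoc_right[symmetric]) (use assms that in simp_all)
    then show ?thesis
      using assms that by (simp del: comp_assoc_right)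
  qed
qed

lemma invertibleI:
  assumes "f \<in> Arr C" "g \<in> Arr C" "Dom C g = Cod C f" "Cod C g = Dom C f"
    "g \<cdot> f = Ident C (Dom C f)" "f \<cdot> g = Ident C (Cod C f)"
  shows "invertible C f"
  unfolding invertible_def using assms by (intro conjI bexI[of _ g] homI)

lemma invertible_ident [simp]: "x \<in> Obj C \<Longrightarrow> invertible C (Ident C x)"
  by (rule invertibleI[of _ "Ident C x"]) auto

lemma invertible_inv_of [simp]: "invertible C f \<Longrightarrow> invertible C (inv_of f)"
  by (rule invertibleI[of _ f]) auto

lemma invertible_comp [simp]:
  assumes "invertible C f" "invertible C g" "Cod C f = Dom C g"
  shows "invertible C (g \<cdot> f)"
  using assms by (intro invertibleI[of _ "inv_of f \<cdot> inv_of g"]) auto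

lemma invertible_cancel_right:
  assumes "invertible C f" "g \<in> Arr C" "h \<in> Arr C" "Dom C g = Cod C f" "Dom C h = Cod C f"
    "g \<cdot> f = h \<cdot> f"
  shows "g = h"
proof -
  have "(g \<cdot> f) \<cdot> inv_of f = (h \<cdot> f) \<cdot> inv_of f"
    using assms by simp
  then show ?thesis
    using assms(1-5) by simp
qed

lemma invertible_cancel_left:
  assumes "invertible C f" "g \<in> Arr C" "h \<in> Arr C" "Cod C g = Dom C f" "Cod C h = Dom C f"
    "f \<cdot> g = f \<cdot> h"
  shows "g = h"
proof -
  have "inv_of f \<cdot> (f \<cdot> g) = inv_of f \<cdot> (f \<cdot> h)"
    using assms by simp
  then show ?thesis
    using assms(1-5) by simp
qed

end

locale cat_functor = A: category A + B: category B
  for A :: "('a, 'b) cat" and B :: "('p, 'q) cat" +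
  fixes F :: "('a, 'b, 'p, 'q) func"
  assumes is_fun: "is_functor A B F"
begin

lemma fobj [simp]: "x \<in> Obj A \<Longrightarrow> FObj F x \<in> Obj B"
  using is_fun by (auto simp: is_functor_def)

lemma farr [simp]:
  assumes "f \<in> Arr A"
  shows "FArr F f \<in> Arr B" "Dom B (FArr F f) = FObj F (Dom A f)" "Cod B (FArr F f) = FObj F (Cod A f)"
  using is_fun assms by (auto simp: is_functor_def hom_def)

lemma fident [simp]: "x \<in> Obj A \<Longrightarrow> FArr F (Ident A x) = Ident B (FObj F x)"
  using is_fun by (auto simp: is_functor_def)

lemma fcomp [simp]:
  "f \<in> Arr A \<Longrightarrow> g \<in> Arr A \<Longrightarrow> Cod A f = Dom A g \<Longrightarrow> FArr F (g \<cdot>\<^bsub>A\<^esub> f) = FArr F g \<cdot>\<^bsub>B\<^esub> FArr F f"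
  using is_fun by (auto simp: is_functor_def)

end

definition fully_faithful :: "('a, 'b) cat \<Rightarrow> ('p, 'q) cat \<Rightarrow> ('a, 'b, 'p, 'q) func \<Rightarrow> bool" where
  "fully_faithful A B F \<longleftrightarrow> (\<forall>x \<in> Obj A. \<forall>y \<in> Obj A. \<forall>g \<in> hom B (FObj F x) (FObj F y).
    \<exists>!f. f \<in> hom A x y \<and> FArr F f = g)"

definition ess_surjective :: "('a, 'b) cat \<Rightarrow> ('p, 'q) cat \<Rightarrow> ('a, 'b, 'p, 'q) func \<Rightarrow> bool" where
  "ess_surjective A B F \<longleftrightarrow> (\<forall>y \<in> Obj B. \<exists>x \<in> Obj A. \<exists>g \<in> hom B y (FObj F x). invertible B g)"

text \<open>What bi-initiality in a pseudo-slice says about a functor: isomorphisms lift uniquely. The lift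
is required to be unique among all arrows, not only among the isomorphisms.\<close>

definition iso_lifting :: "('a, 'b) cat \<Rightarrow> ('p, 'q) cat \<Rightarrow> ('a, 'b, 'p, 'q) func \<Rightarrow> bool" where
  "iso_lifting A B F \<longleftrightarrow> (\<forall>x \<in> Obj A. \<forall>y \<in> Obj A. \<forall>g \<in> hom B (FObj F x) (FObj F y). invertible B g \<longrightarrow>
    (\<exists>f \<in> hom A x y. invertible A f \<and> FArr F f = g \<and> (\<forall>f' \<in> hom A x y. FArr F f' = g \<longrightarrow> f' = f)))"

context cat_functor
begin

lemma fully_faithful_full:
  assumes "fully_faithful A B F" "x \<in> Obj A" "y \<in> Obj A"
    "g \<in> Arr B" "Dom B g = FObj F x" "Cod B g = FObj F y"
  obtains f where "f \<in> Arr A" "Dom A f = x" "Cod A f = y" "FArr F f = g"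
proof -
  have "\<exists>!f. f \<in> hom A x y \<and> FArr F f = g"
    using assms unfolding fully_faithful_def by (auto simp: hom_def)
  then show thesis
    using that by (auto simp: hom_def)
qed

lemma fully_faithful_eqI:
  assumes "fully_faithful A B F" "f \<in> Arr A" "g \<in> Arr A"
    "Dom A f = Dom A g" "Cod A f = Cod A g" "FArr F f = FArr F g"
  shows "f = g"
proof -
  have "\<exists>!h. h \<in> hom A (Dom A g) (Cod A g) \<and> FArr F h = FArr F g"
    using assms unfolding fully_faithful_def by (auto simp: hom_def)
  then show ?thesis
    using assms by (auto simp: hom_def)
qed

text \<open>A preimage of the inverse is an inverse, because both composites are mapped to identities.\<close>

lemma fully_faithful_reflects_invertible:
  assumes ff: "fully_faithful A B F" and f: "f \<in> Arr A" and inv: "invertible B (FArr F f)"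
  shows "invertible A f"
proof -
  obtain h where h: "h \<in> Arr A" "Dom A h = Cod A f" "Cod A h = Dom A f"
      "FArr F h = B.inv_of (FArr F f)"
    by (rule fully_faithful_full[OF ff, of "Cod A f" "Dom A f" "B.inv_of (FArr F f)"])
      (use f inv in auto)
  show ?thesis
    by (rule A.invertibleI[of f h])
      (use f h inv in \<open>auto intro!: fully_faithful_eqI[OF ff]\<close>)
qed

lemma fully_faithful_imp_iso_lifting:
  assumes ff: "fully_faithful A B F"
  shows "iso_lifting A B F"
  unfolding iso_lifting_def
proof (intro ballI impI)
  fix x y g
  assume xy: "x \<in> Obj A" "y \<in> Obj A" and g: "g \<in> hom B (FObj F x) (FObj F y)" and inv: "invertible B g"
  obtain f where f: "f \<in> Arr A" "Dom A f = x" "Cod A f = y" "FArr F f = g"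
    by (rule fully_faithful_full[OF ff xy, of g]) (use g in \<open>auto simp: hom_def\<close>)
  show "\<exists>f \<in> hom A x y. invertible A f \<and> FArr F f = g \<and> (\<forall>f' \<in> hom A x y. FArr F f' = g \<longrightarrow> f' = f)"
    using f inv fully_faithful_reflects_invertible[OF ff, of f] fully_faithful_eqI[OF ff]
    by (intro bexI[of _ f]) (auto simp: hom_def)
qed

text \<open>Naturality of the unit makes \<open>F\<close> faithful, since \<open>\<eta> (Cod f) f\<close> is determined by \<open>F f\<close>;
naturality of the counit makes \<open>G\<close> faithful. The only candidate for a preimage of \<open>g\<close> is the
conjugate of \<open>G g\<close> by the unit; its image and \<open>g\<close> agree after applying \<open>G\<close>.\<close>

lemma adjoint_equivalence_imp:
  assumes "adjoint_equivalence A B F"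
  shows "fully_faithful A B F" "ess_surjective A B F"
proof -
  obtain G \<eta> \<epsilon> where G: "is_functor B A G"
    and eta: "nat_trans A A id_func (comp_func G F) \<eta>" "\<forall>x \<in> Obj A. invertible A (\<eta> x)"
    and eps: "nat_trans B B (comp_func F G) id_func \<epsilon>" "\<forall>y \<in> Obj B. invertible B (\<epsilon> y)"
    using assms by (auto simp: adjoint_equivalence_def)
  interpret G: cat_functor B A G
    by unfold_locales (rule G)
  have eta_type [simp]: "\<eta> x \<in> Arr A" "Dom A (\<eta> x) = x" "Cod A (\<eta> x) = FObj G (FObj F x)"
    if "x \<in> Obj A" for x
    using eta(1) that by (auto simp: nat_trans_def hom_def id_func_def comp_func_def)
  have eps_type [simp]: "\<epsilon> y \<in> Arr B" "Dom B (\<epsilon> y) = FObj F (FObj G y)" "Cod B (\<epsilon> y) = y"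
    if "y \<in> Obj B" for y
    using eps(1) that by (auto simp: nat_trans_def hom_def id_func_def comp_func_def)
  have eta_nat: "\<eta> (Cod A f) \<cdot>\<^bsub>A\<^esub> f = FArr G (FArr F f) \<cdot>\<^bsub>A\<^esub> \<eta> (Dom A f)" if "f \<in> Arr A" for f
    using eta(1) that by (auto simp: nat_trans_def id_func_def comp_func_def)
  have eps_nat: "\<epsilon> (Cod B f) \<cdot>\<^bsub>B\<^esub> FArr F (FArr G f) = f \<cdot>\<^bsub>B\<^esub> \<epsilon> (Dom B f)" if "f \<in> Arr B" for f
    using eps(1) that by (auto simp: nat_trans_def id_func_def comp_func_def)
  have eta_inv [simp]: "invertible A (\<eta> x)" if "x \<in> Obj A" for x
    using eta(2) that by auto
  have eps_inv [simp]: "invertible B (\<epsilon> x)" if "x \<in> Obj B" for x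
    using eps(2) that by auto
  have faithfulF: "f = g" if "f \<in> Arr A" "g \<in> Arr A" "Dom A f = Dom A g" "Cod A f = Cod A g"
    "FArr F f = FArr F g" for f g
    using that eta_nat[of f] eta_nat[of g]
    by (intro A.invertible_cancel_left[of "\<eta> (Cod A g)" f g]) auto
  have faithfulG: "f = g" if "f \<in> Arr B" "g \<in> Arr B" "Dom B f = Dom B g" "Cod B f = Cod B g"
    "FArr G f = FArr G g" for f g
    using that eps_nat[of f] eps_nat[of g]
    by (intro B.invertible_cancel_right[of "\<epsilon> (Dom B g)" f g]) auto
  show "fully_faithful A B F"
    unfolding fully_faithful_def
  proof (intro ballI)
    fix x y g
    assume xy: "x \<in> Obj A" "y \<in> Obj A" and g: "g \<in> hom B (FObj F x) (FObj F y)"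
    define f where "f = A.inv_of (\<eta> y) \<cdot>\<^bsub>A\<^esub> (FArr G g \<cdot>\<^bsub>A\<^esub> \<eta> x)"
    have f: "f \<in> Arr A" "Dom A f = x" "Cod A f = y"
      using xy g by (auto simp: f_def hom_def)
    have "FArr G (FArr F f) \<cdot>\<^bsub>A\<^esub> \<eta> x = \<eta> y \<cdot>\<^bsub>A\<^esub> f"
      using eta_nat[of f] f by simp
    also have "\<dots> = FArr G g \<cdot>\<^bsub>A\<^esub> \<eta> x"
      using xy g by (simp add: f_def hom_def)
    finally have "FArr G (FArr F f) = FArr G g"
      using xy g f by (intro A.invertible_cancel_right[of "\<eta> x" "FArr G (FArr F f)" "FArr G g"]) (auto simp: hom_def)
    then have "FArr F f = g"
      using f g by (intro faithfulG) (auto simp: hom_def)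
    then show "\<exists>!f. f \<in> hom A x y \<and> FArr F f = g"
      using f faithfulF by (intro ex1I[of _ f]) (auto simp: hom_def)
  qed
  show "ess_surjective A B F"
    unfolding ess_surjective_def
  proof
    fix y assume y: "y \<in> Obj B"
    then show "\<exists>x \<in> Obj A. \<exists>g \<in> hom B y (FObj F x). invertible B g"
      by (intro bexI[of _ "FObj G y"] bexI[of _ "B.inv_of (\<epsilon> y)"]) (auto simp: hom_def)
  qed
qed

text \<open>Choose an isomorphism \<open>c y\<close> from each \<open>y\<close> to an object in the image. The inverse functor is
conjugation by \<open>c\<close> followed by taking preimages, the counit is the inverse of \<open>c\<close> and the unit at
\<open>x\<close> is the preimage of \<open>c (F x)\<close>. With these choices the first triangle identity holds by
construction, and the equations in \<open>A\<close> can be checked after applying the faithful functor \<open>F\<close>.\<close>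

lemma imp_adjoint_equivalence:
  assumes ff: "fully_faithful A B F" and es: "ess_surjective A B F"
  shows "adjoint_equivalence A B F"
proof -
  have "\<forall>y. \<exists>x g. y \<in> Obj B \<longrightarrow> x \<in> Obj A \<and> g \<in> hom B y (FObj F x) \<and> invertible B g"
    using es unfolding ess_surjective_def by blast
  then obtain go c where go_c: "\<And>y. y \<in> Obj B \<Longrightarrow> go y \<in> Obj A \<and> c y \<in> hom B y (FObj F (go y)) \<and> invertible B (c y)"
    by metis
  have c [simp]: "go y \<in> Obj A" "invertible B (c y)" "c y \<in> Arr B" "Dom B (c y) = y" "Cod B (c y) = FObj F (go y)"
    if "y \<in> Obj B" for y
    using go_c[OF that] by (auto simp: hom_def)
  define lift where "lift = (\<lambda>x y g. SOME f. f \<in> hom A x y \<and> FArr F f = g)"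
  have lift: "lift x y g \<in> Arr A" "Dom A (lift x y g) = x" "Cod A (lift x y g) = y" "FArr F (lift x y g) = g"
    if "x \<in> Obj A" "y \<in> Obj A" "g \<in> Arr B" "Dom B g = FObj F x" "Cod B g = FObj F y" for x y g
  proof -
    have "\<exists>f. f \<in> hom A x y \<and> FArr F f = g"
      using fully_faithful_full[OF ff that] by (auto simp: hom_def)
    then have "lift x y g \<in> hom A x y \<and> FArr F (lift x y g) = g"
      unfolding lift_def by (rule someI_ex)
    then show "lift x y g \<in> Arr A" "Dom A (lift x y g) = x" "Cod A (lift x y g) = y" "FArr F (lift x y g) = g"
      by (auto simp: hom_def)
  qed
  define ga where "ga = (\<lambda>g. lift (go (Dom B g)) (go (Cod B g)) (c (Cod B g) \<cdot>\<^bsub>B\<^esub> (g \<cdot>\<^bsub>B\<^esub> B.inv_of (c (Dom B g)))))"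
  define G where "G = \<lparr>FObj = go, FArr = ga\<rparr>"
  define \<eta> where "\<eta> = (\<lambda>x. lift x (go (FObj F x)) (c (FObj F x)))"
  define \<epsilon> where "\<epsilon> = (\<lambda>y. B.inv_of (c y))"
  have ga [simp]: "ga g \<in> Arr A" "Dom A (ga g) = go (Dom B g)" "Cod A (ga g) = go (Cod B g)"
    "FArr F (ga g) = c (Cod B g) \<cdot>\<^bsub>B\<^esub> (g \<cdot>\<^bsub>B\<^esub> B.inv_of (c (Dom B g)))" if "g \<in> Arr B" for g
    using that unfolding ga_def by (simp_all add: lift)
  have eta [simp]: "\<eta> x \<in> Arr A" "Dom A (\<eta> x) = x" "Cod A (\<eta> x) = go (FObj F x)"
    "FArr F (\<eta> x) = c (FObj F x)" if "x \<in> Obj A" for x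
    using that unfolding \<eta>_def by (simp_all add: lift)
  have eta_inv: "invertible A (\<eta> x)" if "x \<in> Obj A" for x
    using that by (intro fully_faithful_reflects_invertible[OF ff]) auto
  have G: "is_functor B A G"
    unfolding is_functor_def G_def
    by (auto simp: hom_def intro!: fully_faithful_eqI[OF ff])
  show ?thesis
    unfolding adjoint_equivalence_def
    using is_fun G eta_inv
    by (intro conjI exI[of _ G] exI[of _ \<eta>] exI[of _ \<epsilon>])
      (auto simp: nat_trans_def id_func_def comp_func_def G_def \<epsilon>_def hom_def
        intro!: fully_faithful_eqI[OF ff])
qed

theorem adjoint_equivalence_iff:
  "adjoint_equivalence A B F \<longleftrightarrow> fully_faithful A B F \<and> ess_surjective A B F"
  using adjoint_equivalence_imp imp_adjoint_equivalence by blast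

end

section \<open>2-categories and normal pseudo-functors\<close>

sublocale two_category \<subseteq> V: category "Vert A"
  by (rule vert)

context two_category
begin

lemma src_in [simp]: "f \<in> Mor A \<Longrightarrow> Src A f \<in> Ob A"
  by (rule src_ob)

lemma trg_in [simp]: "f \<in> Mor A \<Longrightarrow> Trg A f \<in> Ob A"
  by (rule trg_ob)

lemma src_cod [simp]: "\<alpha> \<in> Cell A \<Longrightarrow> Src A (Cod (Vert A) \<alpha>) = Src A (Dom (Vert A) \<alpha>)"
  using src_cell[of \<alpha> "Dom (Vert A) \<alpha>" "Cod (Vert A) \<alpha>"] by (simp add: hom_def)

lemma trg_cod [simp]: "\<alpha> \<in> Cell A \<Longrightarrow> Trg A (Cod (Vert A) \<alpha>) = Trg A (Dom (Vert A) \<alpha>)"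
  using trg_cell[of \<alpha> "Dom (Vert A) \<alpha>" "Cod (Vert A) \<alpha>"] by (simp add: hom_def)

lemma unit_type [simp]:
  assumes "x \<in> Ob A"
  shows "Unit A x \<in> Mor A" "Src A (Unit A x) = x" "Trg A (Unit A x) = x"
  using unit_hom[OF assms] by (auto simp: hom1_def)

lemma HC1_type [simp]:
  assumes "f \<in> Mor A" "g \<in> Mor A" "Trg A f = Src A g"
  shows "g \<odot> f \<in> Mor A" "Src A (g \<odot> f) = Src A f" "Trg A (g \<odot> f) = Trg A g"
  using HC1_hom[of f "Src A f" "Trg A f" g "Trg A g"] assms by (auto simp: hom1_def)

lemma HC1_unit_right [simp]: "f \<in> Mor A \<Longrightarrow> Src A f = x \<Longrightarrow> f \<odot> Unit A x = f"
  using HC1_unit[of f x "Trg A f"] by (simp add: hom1_def)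

lemma HC1_unit_left [simp]: "f \<in> Mor A \<Longrightarrow> Trg A f = x \<Longrightarrow> Unit A x \<odot> f = f"
  using unit_HC1[of f "Src A f" x] by (simp add: hom1_def)

lemma HC1_assoc_right [simp]:
  "f \<in> Mor A \<Longrightarrow> g \<in> Mor A \<Longrightarrow> h \<in> Mor A \<Longrightarrow> Trg A f = Src A g \<Longrightarrow> Trg A g = Src A h
    \<Longrightarrow> (h \<odot> g) \<odot> f = h \<odot> (g \<odot> f)"
  using HC1_assoc[of f "Src A f" "Trg A f" g "Trg A g" h "Trg A h"] by (simp add: hom1_def)

lemma HC2_type [simp]:
  assumes "\<alpha> \<in> Cell A" "\<beta> \<in> Cell A" "Trg A (Dom (Vert A) \<alpha>) = Src A (Dom (Vert A) \<beta>)"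
  shows "\<beta> \<star> \<alpha> \<in> Cell A" "Dom (Vert A) (\<beta> \<star> \<alpha>) = Dom (Vert A) \<beta> \<odot> Dom (Vert A) \<alpha>"
    "Cod (Vert A) (\<beta> \<star> \<alpha>) = Cod (Vert A) \<beta> \<odot> Cod (Vert A) \<alpha>"
  using HC2_hom[of "Dom (Vert A) \<alpha>" "Src A (Dom (Vert A) \<alpha>)" "Trg A (Dom (Vert A) \<alpha>)"
      "Dom (Vert A) \<beta>" "Trg A (Dom (Vert A) \<beta>)" \<alpha> "Cod (Vert A) \<alpha>" \<beta> "Cod (Vert A) \<beta>"] assms
  by (auto simp: hom1_def hom_def)

lemma HC2_unit_right [simp]:
  "\<alpha> \<in> Cell A \<Longrightarrow> Src A (Dom (Vert A) \<alpha>) = x \<Longrightarrow> \<alpha> \<star> id2 A (Unit A x) = \<alpha>"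
  using HC2_unit[of "Dom (Vert A) \<alpha>" x "Trg A (Dom (Vert A) \<alpha>)" \<alpha> "Cod (Vert A) \<alpha>"]
  by (simp add: hom1_def hom_def)

lemma HC2_unit_left [simp]:
  "\<alpha> \<in> Cell A \<Longrightarrow> Trg A (Dom (Vert A) \<alpha>) = x \<Longrightarrow> id2 A (Unit A x) \<star> \<alpha> = \<alpha>"
  using unit_HC2[of "Dom (Vert A) \<alpha>" "Src A (Dom (Vert A) \<alpha>)" x \<alpha> "Cod (Vert A) \<alpha>"]
  by (simp add: hom1_def hom_def)

lemma HC2_assoc_right [simp]:
  "\<alpha> \<in> Cell A \<Longrightarrow> \<beta> \<in> Cell A \<Longrightarrow> \<gamma> \<in> Cell A \<Longrightarrow> Trg A (Dom (Vert A) \<alpha>) = Src A (Dom (Vert A) \<beta>)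
    \<Longrightarrow> Trg A (Dom (Vert A) \<beta>) = Src A (Dom (Vert A) \<gamma>) \<Longrightarrow> (\<gamma> \<star> \<beta>) \<star> \<alpha> = \<gamma> \<star> (\<beta> \<star> \<alpha>)"
  using HC2_assoc[of "Dom (Vert A) \<alpha>" "Src A (Dom (Vert A) \<alpha>)" "Trg A (Dom (Vert A) \<alpha>)"
      "Dom (Vert A) \<beta>" "Trg A (Dom (Vert A) \<beta>)" "Dom (Vert A) \<gamma>" "Trg A (Dom (Vert A) \<gamma>)"
      \<alpha> "Cod (Vert A) \<alpha>" \<beta> "Cod (Vert A) \<beta>" \<gamma> "Cod (Vert A) \<gamma>"]
  by (simp add: hom1_def hom_def)

lemma HC2_ident [simp]:
  "f \<in> Mor A \<Longrightarrow> g \<in> Mor A \<Longrightarrow> Trg A f = Src A g \<Longrightarrow> id2 A g \<star> id2 A f = id2 A (g \<odot> f)"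
  using HC2_id[of f "Src A f" "Trg A f" g "Trg A g"] by (simp add: hom1_def)

lemma HC2_vcomp:
  assumes "\<alpha> \<in> Cell A" "\<alpha>' \<in> Cell A" "\<beta> \<in> Cell A" "\<beta>' \<in> Cell A"
    "Cod (Vert A) \<alpha> = Dom (Vert A) \<alpha>'" "Cod (Vert A) \<beta> = Dom (Vert A) \<beta>'"
    "Trg A (Dom (Vert A) \<alpha>) = Src A (Dom (Vert A) \<beta>)"
  shows "(\<beta>' \<bullet>\<^bsub>A\<^esub> \<beta>) \<star> (\<alpha>' \<bullet>\<^bsub>A\<^esub> \<alpha>) = (\<beta>' \<star> \<alpha>') \<bullet>\<^bsub>A\<^esub> (\<beta> \<star> \<alpha>)"
  by (rule interchange[of "Dom (Vert A) \<alpha>" "Src A (Dom (Vert A) \<alpha>)" "Trg A (Dom (Vert A) \<alpha>)"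
      "Dom (Vert A) \<beta>" "Trg A (Dom (Vert A) \<beta>)" _ "Cod (Vert A) \<alpha>" _ "Cod (Vert A) \<alpha>'"
      _ "Cod (Vert A) \<beta>" _ "Cod (Vert A) \<beta>'"])
    (use assms in \<open>simp_all add: hom1_def hom_def\<close>)

text \<open>Whiskering is functorial; together with the laws above the following rules bring every
  pasting composite into the form of a vertical composite of whiskered basic cells.\<close>

lemma whisker_left_comp [simp]:
  assumes "\<alpha> \<in> Cell A" "\<alpha>' \<in> Cell A" "g \<in> Mor A"
    "Cod (Vert A) \<alpha> = Dom (Vert A) \<alpha>'" "Trg A (Dom (Vert A) \<alpha>) = Src A g"
  shows "id2 A g \<star> (\<alpha>' \<bullet>\<^bsub>A\<^esub> \<alpha>) = (id2 A g \<star> \<alpha>') \<bullet>\<^bsub>A\<^esub> (id2 A g \<star> \<alpha>)"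
  using HC2_vcomp[of \<alpha> \<alpha>' "id2 A g" "id2 A g"] assms by simp

lemma whisker_right_comp [simp]:
  assumes "\<beta> \<in> Cell A" "\<beta>' \<in> Cell A" "f \<in> Mor A"
    "Cod (Vert A) \<beta> = Dom (Vert A) \<beta>'" "Trg A f = Src A (Dom (Vert A) \<beta>)"
  shows "(\<beta>' \<bullet>\<^bsub>A\<^esub> \<beta>) \<star> id2 A f = (\<beta>' \<star> id2 A f) \<bullet>\<^bsub>A\<^esub> (\<beta> \<star> id2 A f)"
  using HC2_vcomp[of "id2 A f" "id2 A f" \<beta> \<beta>'] assms by simp

lemma whisker_left_whisker [simp]:
  assumes "\<alpha> \<in> Cell A" "g \<in> Mor A" "h \<in> Mor A" "Trg A (Dom (Vert A) \<alpha>) = Src A g" "Trg A g = Src A h"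
  shows "id2 A h \<star> (id2 A g \<star> \<alpha>) = id2 A (h \<odot> g) \<star> \<alpha>"
  using HC2_assoc_right[of \<alpha> "id2 A g" "id2 A h"] assms by simp

text \<open>In particular, 2-morphisms on neighbouring 1-morphisms slide past each other.\<close>

lemma whisker_exchange:
  assumes "\<alpha> \<in> Cell A" "\<beta> \<in> Cell A" "Trg A (Dom (Vert A) \<alpha>) = Src A (Dom (Vert A) \<beta>)"
  shows "(\<beta> \<star> id2 A (Cod (Vert A) \<alpha>)) \<bullet>\<^bsub>A\<^esub> (id2 A (Dom (Vert A) \<beta>) \<star> \<alpha>) = \<beta> \<star> \<alpha>"
    "(id2 A (Cod (Vert A) \<beta>) \<star> \<alpha>) \<bullet>\<^bsub>A\<^esub> (\<beta> \<star> id2 A (Dom (Vert A) \<alpha>)) = \<beta> \<star> \<alpha>"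
  using HC2_vcomp[of \<alpha> "id2 A (Cod (Vert A) \<alpha>)" "id2 A (Dom (Vert A) \<beta>)" \<beta>]
    HC2_vcomp[of "id2 A (Dom (Vert A) \<alpha>)" \<alpha> \<beta> "id2 A (Cod (Vert A) \<beta>)"] assms by simp_all

lemma invertible_HC2 [simp]:
  assumes "invertible (Vert A) \<alpha>" "invertible (Vert A) \<beta>"
    "Trg A (Dom (Vert A) \<alpha>) = Src A (Dom (Vert A) \<beta>)"
  shows "invertible (Vert A) (\<beta> \<star> \<alpha>)"
proof -
  have "(V.inv_of \<beta> \<star> V.inv_of \<alpha>) \<bullet>\<^bsub>A\<^esub> (\<beta> \<star> \<alpha>) = id2 A (Dom (Vert A) \<beta> \<odot> Dom (Vert A) \<alpha>)"
    by (subst HC2_vcomp[symmetric]) (use assms in simp_all)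
  moreover have "(\<beta> \<star> \<alpha>) \<bullet>\<^bsub>A\<^esub> (V.inv_of \<beta> \<star> V.inv_of \<alpha>) = id2 A (Cod (Vert A) \<beta> \<odot> Cod (Vert A) \<alpha>)"
    by (subst HC2_vcomp[symmetric]) (use assms in simp_all)
  ultimately show ?thesis
    by (intro V.invertibleI[of "\<beta> \<star> \<alpha>" "V.inv_of \<beta> \<star> V.inv_of \<alpha>"]) (use assms in simp_all)
qed

lemma hom_cat_simps:
  "Obj (hom_cat A x y) = hom1 A x y"
  "Arr (hom_cat A x y) = {\<alpha> \<in> Cell A. Dom (Vert A) \<alpha> \<in> hom1 A x y}"
  "Dom (hom_cat A x y) = Dom (Vert A)" "Cod (hom_cat A x y) = Cod (Vert A)"
  "Ident (hom_cat A x y) = Ident (Vert A)" "Comp (hom_cat A x y) = Comp (Vert A)"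
  by (simp_all add: hom_cat_def)

lemma hom_hom_cat:
  assumes "f \<in> hom1 A x y"
  shows "hom (hom_cat A x y) f g = hom2 A f g"
  using assms by (auto simp: hom_def hom_cat_simps)

lemma category_hom_cat: "category (hom_cat A x y)"
  by unfold_locales (auto simp: hom_def hom_cat_simps hom1_def)

lemma invertible_hom_cat:
  "invertible (hom_cat A x y) \<alpha> \<longleftrightarrow> invertible (Vert A) \<alpha> \<and> Dom (Vert A) \<alpha> \<in> hom1 A x y"
proof
  assume "invertible (hom_cat A x y) \<alpha>"
  then show "invertible (Vert A) \<alpha> \<and> Dom (Vert A) \<alpha> \<in> hom1 A x y"
    unfolding invertible_def by (force simp: hom_def hom_cat_simps)
next
  assume inv: "invertible (Vert A) \<alpha> \<and> Dom (Vert A) \<alpha> \<in> hom1 A x y"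
  interpret h: category "hom_cat A x y"
    by (rule category_hom_cat)
  show "invertible (hom_cat A x y) \<alpha>"
    by (rule h.invertibleI[of _ "V.inv_of \<alpha>"]) (use inv in \<open>auto simp: hom_cat_simps hom1_def\<close>)
qed

end

locale pseudofunctor = A: two_category A + B: two_category B
  for A :: "('o, 'm, 'c) two_cat" and B :: "('p, 'n, 'd) two_cat" +
  fixes F :: "('o, 'm, 'c, 'p, 'n, 'd) psfun"
  assumes npf: "normal_pseudofunctor A B F"
begin

lemma po [simp]: "x \<in> Ob A \<Longrightarrow> PO F x \<in> Ob B"
  using npf by (simp add: normal_pseudofunctor_def)

lemma hom_functor:
  assumes "x \<in> Ob A" "y \<in> Ob A"
  shows "is_functor (hom_cat A x y) (hom_cat B (PO F x) (PO F y)) \<lparr>FObj = P1 F, FArr = P2 F\<rparr>"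
  using npf assms by (simp add: normal_pseudofunctor_def)

lemma p1 [simp]:
  assumes "f \<in> Mor A"
  shows "P1 F f \<in> Mor B" "Src B (P1 F f) = PO F (Src A f)" "Trg B (P1 F f) = PO F (Trg A f)"
  using hom_functor[of "Src A f" "Trg A f"] assms
  by (auto simp: is_functor_def A.hom_cat_simps B.hom_cat_simps hom1_def)

lemma p2 [simp]:
  assumes "\<alpha> \<in> Cell A"
  shows "P2 F \<alpha> \<in> Cell B" "Dom (Vert B) (P2 F \<alpha>) = P1 F (Dom (Vert A) \<alpha>)"
    "Cod (Vert B) (P2 F \<alpha>) = P1 F (Cod (Vert A) \<alpha>)"
  using hom_functor[of "Src A (Dom (Vert A) \<alpha>)" "Trg A (Dom (Vert A) \<alpha>)"] assms
  by (auto simp: is_functor_def A.hom_cat_simps B.hom_cat_simps hom1_def hom_def)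

lemma p2_ident [simp]: "f \<in> Mor A \<Longrightarrow> P2 F (id2 A f) = id2 B (P1 F f)"
  using hom_functor[of "Src A f" "Trg A f"]
  by (auto simp: is_functor_def A.hom_cat_simps B.hom_cat_simps hom1_def)

lemma p2_comp [simp]:
  assumes "\<alpha> \<in> Cell A" "\<beta> \<in> Cell A" "Cod (Vert A) \<alpha> = Dom (Vert A) \<beta>"
  shows "P2 F (\<beta> \<bullet>\<^bsub>A\<^esub> \<alpha>) = P2 F \<beta> \<bullet>\<^bsub>B\<^esub> P2 F \<alpha>"
proof -
  have "Src A (Dom (Vert A) \<beta>) = Src A (Dom (Vert A) \<alpha>)" "Trg A (Dom (Vert A) \<beta>) = Trg A (Dom (Vert A) \<alpha>)"
    using assms by (auto simp flip: assms(3))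
  then show ?thesis
    using hom_functor[of "Src A (Dom (Vert A) \<alpha>)" "Trg A (Dom (Vert A) \<alpha>)"] assms
    by (auto simp: is_functor_def A.hom_cat_simps B.hom_cat_simps hom1_def)
qed

lemma p1_unit [simp]: "x \<in> Ob A \<Longrightarrow> P1 F (Unit A x) = Unit B (PO F x)"
  using npf by (simp add: normal_pseudofunctor_def)

lemma pc [simp]:
  assumes "a \<in> Mor A" "b \<in> Mor A" "Trg A a = Src A b"
  shows "PC F b a \<in> Cell B" "Dom (Vert B) (PC F b a) = P1 F b \<odot>\<^bsub>B\<^esub> P1 F a"
    "Cod (Vert B) (PC F b a) = P1 F (b \<odot>\<^bsub>A\<^esub> a)" "invertible (Vert B) (PC F b a)"
  using npf assms by (auto simp: normal_pseudofunctor_def hom_def)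

lemma pc_natural:
  assumes "\<alpha> \<in> Cell A" "\<beta> \<in> Cell A" "Trg A (Dom (Vert A) \<alpha>) = Src A (Dom (Vert A) \<beta>)"
  shows "PC F (Cod (Vert A) \<beta>) (Cod (Vert A) \<alpha>) \<bullet>\<^bsub>B\<^esub> (P2 F \<beta> \<star>\<^bsub>B\<^esub> P2 F \<alpha>) =
    P2 F (\<beta> \<star>\<^bsub>A\<^esub> \<alpha>) \<bullet>\<^bsub>B\<^esub> PC F (Dom (Vert A) \<beta>) (Dom (Vert A) \<alpha>)"
  using npf assms by (auto simp: normal_pseudofunctor_def hom_def)

lemma pc_assoc:
  assumes "a \<in> Mor A" "b \<in> Mor A" "c \<in> Mor A" "Trg A a = Src A b" "Trg A b = Src A c"
  shows "PC F c (b \<odot>\<^bsub>A\<^esub> a) \<bullet>\<^bsub>B\<^esub> (id2 B (P1 F c) \<star>\<^bsub>B\<^esub> PC F b a) =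
    PC F (c \<odot>\<^bsub>A\<^esub> b) a \<bullet>\<^bsub>B\<^esub> (PC F c b \<star>\<^bsub>B\<^esub> id2 B (P1 F a))"
  using npf assms by (auto simp: normal_pseudofunctor_def)

lemma pc_unit [simp]:
  assumes "a \<in> Mor A"
  shows "Src A a = x \<Longrightarrow> PC F a (Unit A x) = id2 B (P1 F a)"
    "Trg A a = y \<Longrightarrow> PC F (Unit A y) a = id2 B (P1 F a)"
  using npf assms by (auto simp: normal_pseudofunctor_def)

lemma p2_invertible [simp]: "invertible (Vert A) \<alpha> \<Longrightarrow> invertible (Vert B) (P2 F \<alpha>)"
  by (rule B.V.invertibleI[of _ "P2 F (A.V.inv_of \<alpha>)"]) (simp_all flip: p2_comp)

end

lemma normal_pseudofunctorI:
  assumes A: "two_category A" and B: "two_category B"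
    and po: "\<And>x. x \<in> Ob A \<Longrightarrow> PO F x \<in> Ob B"
    and p1: "\<And>f. f \<in> Mor A \<Longrightarrow> P1 F f \<in> Mor B \<and> Src B (P1 F f) = PO F (Src A f) \<and> Trg B (P1 F f) = PO F (Trg A f)"
    and p2: "\<And>\<alpha>. \<alpha> \<in> Cell A \<Longrightarrow> P2 F \<alpha> \<in> Cell B \<and> Dom (Vert B) (P2 F \<alpha>) = P1 F (Dom (Vert A) \<alpha>) \<and>
      Cod (Vert B) (P2 F \<alpha>) = P1 F (Cod (Vert A) \<alpha>)"
    and p2_ident: "\<And>f. f \<in> Mor A \<Longrightarrow> P2 F (id2 A f) = id2 B (P1 F f)"
    and p2_comp: "\<And>\<alpha> \<beta>. \<alpha> \<in> Cell A \<Longrightarrow> \<beta> \<in> Cell A \<Longrightarrow> Cod (Vert A) \<alpha> = Dom (Vert A) \<beta>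
      \<Longrightarrow> P2 F (\<beta> \<bullet>\<^bsub>A\<^esub> \<alpha>) = P2 F \<beta> \<bullet>\<^bsub>B\<^esub> P2 F \<alpha>"
    and p1_unit: "\<And>x. x \<in> Ob A \<Longrightarrow> P1 F (Unit A x) = Unit B (PO F x)"
    and pc: "\<And>a b. a \<in> Mor A \<Longrightarrow> b \<in> Mor A \<Longrightarrow> Trg A a = Src A b
      \<Longrightarrow> PC F b a \<in> Cell B \<and> Dom (Vert B) (PC F b a) = P1 F b \<odot>\<^bsub>B\<^esub> P1 F a \<and>
        Cod (Vert B) (PC F b a) = P1 F (b \<odot>\<^bsub>A\<^esub> a) \<and> invertible (Vert B) (PC F b a)"
    and pc_natural: "\<And>\<alpha> \<beta>. \<alpha> \<in> Cell A \<Longrightarrow> \<beta> \<in> Cell A \<Longrightarrow> Trg A (Dom (Vert A) \<alpha>) = Src A (Dom (Vert A) \<beta>)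
      \<Longrightarrow> PC F (Cod (Vert A) \<beta>) (Cod (Vert A) \<alpha>) \<bullet>\<^bsub>B\<^esub> (P2 F \<beta> \<star>\<^bsub>B\<^esub> P2 F \<alpha>) =
        P2 F (\<beta> \<star>\<^bsub>A\<^esub> \<alpha>) \<bullet>\<^bsub>B\<^esub> PC F (Dom (Vert A) \<beta>) (Dom (Vert A) \<alpha>)"
    and pc_assoc: "\<And>a b c. a \<in> Mor A \<Longrightarrow> b \<in> Mor A \<Longrightarrow> c \<in> Mor A \<Longrightarrow> Trg A a = Src A b \<Longrightarrow> Trg A b = Src A c
      \<Longrightarrow> PC F c (b \<odot>\<^bsub>A\<^esub> a) \<bullet>\<^bsub>B\<^esub> (id2 B (P1 F c) \<star>\<^bsub>B\<^esub> PC F b a) =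
        PC F (c \<odot>\<^bsub>A\<^esub> b) a \<bullet>\<^bsub>B\<^esub> (PC F c b \<star>\<^bsub>B\<^esub> id2 B (P1 F a))"
    and pc_unit: "\<And>a. a \<in> Mor A \<Longrightarrow> PC F a (Unit A (Src A a)) = id2 B (P1 F a) \<and>
      PC F (Unit A (Trg A a)) a = id2 B (P1 F a)"
  shows "normal_pseudofunctor A B F"
proof -
  interpret A: two_category A by (rule A)
  interpret B: two_category B by (rule B)
  show ?thesis
    unfolding normal_pseudofunctor_def
    by (auto simp: is_functor_def A.hom_cat_simps B.hom_cat_simps hom1_def hom_def po p1 p2 p2_ident p2_comp
        p1_unit pc pc_natural pc_assoc pc_unit)
qed

section \<open>Arrow categories\<close>

definition arrow_functor :: "('a, 'b, 'p, 'q) func \<Rightarrow> ('b, ('b, 'b \<times> 'b) arrow, 'q, ('q, 'q \<times> 'q) arrow) func" where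
  "arrow_functor F = \<lparr>FObj = FArr F,
    FArr = (\<lambda>(\<alpha>, \<beta>, (s, t)). (FArr F \<alpha>, FArr F \<beta>, (FArr F s, FArr F t)))\<rparr>"

lemma arrow_cat_simps [simp]:
  "Obj (arrow_cat C) = Arr C"
  "Dom (arrow_cat C) = asrc" "Cod (arrow_cat C) = atrg"
  "Ident (arrow_cat C) \<alpha> = (\<alpha>, \<alpha>, (Ident C (Dom C \<alpha>), Ident C (Cod C \<alpha>)))"
  "Comp (arrow_cat C) (\<beta>, \<gamma>, (s', t')) (\<alpha>, \<beta>', (s, t)) = (\<alpha>, \<gamma>, (Comp C s' s, Comp C t' t))"
  by (simp_all add: arrow_cat_def)

lemma arrow_cat_Arr [simp]:
  "(\<alpha>, \<beta>, (s, t)) \<in> Arr (arrow_cat C) \<longleftrightarrow> \<alpha> \<in> Arr C \<and> \<beta> \<in> Arr C \<and> s \<in> Arr C \<and> t \<in> Arr C \<and>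
    Dom C s = Dom C \<alpha> \<and> Cod C s = Dom C \<beta> \<and> Dom C t = Cod C \<alpha> \<and> Cod C t = Cod C \<beta> \<and>
    t \<cdot>\<^bsub>C\<^esub> \<alpha> = \<beta> \<cdot>\<^bsub>C\<^esub> s"
  by (auto simp: arrow_cat_def hom_def)

lemma arrow_cat_cases:
  obtains \<alpha> \<beta> s t where "p = (\<alpha>, \<beta>, (s, t))"
  by (cases p) auto

context category
begin

lemma square_comp:
  assumes "t \<cdot> \<alpha> = \<beta> \<cdot> s" "t' \<cdot> \<beta> = \<gamma> \<cdot> s'"
    "\<alpha> \<in> Arr C" "\<beta> \<in> Arr C" "\<gamma> \<in> Arr C" "s \<in> Arr C" "t \<in> Arr C" "s' \<in> Arr C" "t' \<in> Arr C"
    "Dom C s = Dom C \<alpha>" "Cod C s = Dom C \<beta>" "Dom C t = Cod C \<alpha>" "Cod C t = Cod C \<beta>"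
    "Dom C s' = Dom C \<beta>" "Cod C s' = Dom C \<gamma>" "Dom C t' = Cod C \<beta>" "Cod C t' = Cod C \<gamma>"
  shows "(t' \<cdot> t) \<cdot> \<alpha> = \<gamma> \<cdot> (s' \<cdot> s)"
proof -
  have "(t' \<cdot> t) \<cdot> \<alpha> = t' \<cdot> (\<beta> \<cdot> s)"
    using assms by simp
  also have "\<dots> = (t' \<cdot> \<beta>) \<cdot> s"
    using assms(3-) by simp
  also have "\<dots> = \<gamma> \<cdot> (s' \<cdot> s)"
    unfolding assms(2) using assms(3-) by simp
  finally show ?thesis .
qed

lemma category_arrow_cat: "category (arrow_cat C)"
proof
  fix f x assume "f \<in> Arr (arrow_cat C)"
  then show "Dom (arrow_cat C) f \<in> Obj (arrow_cat C)" "Cod (arrow_cat C) f \<in> Obj (arrow_cat C)"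
    by (cases f rule: arrow_cat_cases; simp)+
next
  fix x assume "x \<in> Obj (arrow_cat C)"
  then show "Ident (arrow_cat C) x \<in> hom (arrow_cat C) x x"
    by (auto simp: hom_def)
next
  fix f g x y z assume "f \<in> hom (arrow_cat C) x y" "g \<in> hom (arrow_cat C) y z"
  then show "g \<cdot>\<^bsub>arrow_cat C\<^esub> f \<in> hom (arrow_cat C) x z"
    by (cases f rule: arrow_cat_cases; cases g rule: arrow_cat_cases)
      (auto simp: hom_def simp del: comp_assoc_right intro: square_comp)
next
  fix f x y assume "f \<in> hom (arrow_cat C) x y"
  then show "f \<cdot>\<^bsub>arrow_cat C\<^esub> Ident (arrow_cat C) x = f" "Ident (arrow_cat C) y \<cdot>\<^bsub>arrow_cat C\<^esub> f = f"
    by (cases f rule: arrow_cat_cases; auto simp: hom_def)+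
next
  fix f g h w x y z
  assume "f \<in> hom (arrow_cat C) w x" "g \<in> hom (arrow_cat C) x y" "h \<in> hom (arrow_cat C) y z"
  then show "(h \<cdot>\<^bsub>arrow_cat C\<^esub> g) \<cdot>\<^bsub>arrow_cat C\<^esub> f = h \<cdot>\<^bsub>arrow_cat C\<^esub> (g \<cdot>\<^bsub>arrow_cat C\<^esub> f)"
    by (cases f rule: arrow_cat_cases; cases g rule: arrow_cat_cases; cases h rule: arrow_cat_cases)
      (auto simp: hom_def)
qed

lemma invertible_arrow_cat:
  "invertible (arrow_cat C) (\<alpha>, \<beta>, (s, t)) \<longleftrightarrow>
    (\<alpha>, \<beta>, (s, t)) \<in> Arr (arrow_cat C) \<and> invertible C s \<and> invertible C t"
proof
  interpret a: category "arrow_cat C" by (rule category_arrow_cat)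
  assume inv: "invertible (arrow_cat C) (\<alpha>, \<beta>, (s, t))"
  obtain \<alpha>' \<beta>' s' t' where i: "a.inv_of (\<alpha>, \<beta>, (s, t)) = (\<alpha>', \<beta>', (s', t'))"
    by (rule arrow_cat_cases)
  show "(\<alpha>, \<beta>, (s, t)) \<in> Arr (arrow_cat C) \<and> invertible C s \<and> invertible C t"
    using a.inv_of[OF inv] a.invertible_arr[OF inv] unfolding i
    by (auto intro: invertibleI[of s s'] invertibleI[of t t'])
next
  interpret a: category "arrow_cat C" by (rule category_arrow_cat)
  assume p: "(\<alpha>, \<beta>, (s, t)) \<in> Arr (arrow_cat C) \<and> invertible C s \<and> invertible C t"
  then have *: "t \<cdot> \<alpha> = \<beta> \<cdot> s" and [simp]: "\<alpha> \<in> Arr C" "\<beta> \<in> Arr C"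
    "Dom C s = Dom C \<alpha>" "Cod C s = Dom C \<beta>" "Dom C t = Cod C \<alpha>" "Cod C t = Cod C \<beta>"
    and inv [simp]: "invertible C s" "invertible C t"
    by auto
  have "inv_of t \<cdot> \<beta> = inv_of t \<cdot> ((\<beta> \<cdot> s) \<cdot> inv_of s)"
    by simp
  also have "\<dots> = \<alpha> \<cdot> inv_of s"
    unfolding *[symmetric] by simp
  finally have "inv_of t \<cdot> \<beta> = \<alpha> \<cdot> inv_of s" .
  then show "invertible (arrow_cat C) (\<alpha>, \<beta>, (s, t))"
    using p by (intro a.invertibleI[of _ "(\<beta>, \<alpha>, (inv_of s, inv_of t))"]) auto
qed

end

lemma arrow_functor_simps [simp]:
  "FObj (arrow_functor F) = FArr F"
  "FArr (arrow_functor F) (\<alpha>, \<beta>, (s, t)) = (FArr F \<alpha>, FArr F \<beta>, (FArr F s, FArr F t))"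
  by (simp_all add: arrow_functor_def)

context cat_functor
begin

lemma arrow_functor: "cat_functor (arrow_cat A) (arrow_cat B) (arrow_functor F)"
proof (intro cat_functor.intro cat_functor_axioms.intro A.category_arrow_cat B.category_arrow_cat)
  show "is_functor (arrow_cat A) (arrow_cat B) (arrow_functor F)"
    unfolding is_functor_def by (auto simp: hom_def simp flip: fcomp)
qed

text \<open>The two sides of a square lift separately, and the lifted square commutes because its image
does.\<close>

lemma arrow_functor_fully_faithful:
  assumes ff: "fully_faithful A B F"
  shows "fully_faithful (arrow_cat A) (arrow_cat B) (arrow_functor F)"
  unfolding fully_faithful_def
proof (intro ballI)
  fix \<alpha> \<beta> g
  assume "\<alpha> \<in> Obj (arrow_cat A)" "\<beta> \<in> Obj (arrow_cat A)"
    and g: "g \<in> hom (arrow_cat B) (FObj (arrow_functor F) \<alpha>) (FObj (arrow_functor F) \<beta>)"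
  then have ab [simp]: "\<alpha> \<in> Arr A" "\<beta> \<in> Arr A" by auto
  obtain p q where gpq: "g = (FArr F \<alpha>, FArr F \<beta>, (p, q))"
    using g by (cases g rule: arrow_cat_cases) (auto simp: hom_def)
  have pq: "p \<in> Arr B" "q \<in> Arr B" "q \<cdot>\<^bsub>B\<^esub> FArr F \<alpha> = FArr F \<beta> \<cdot>\<^bsub>B\<^esub> p"
    "Dom B p = FObj F (Dom A \<alpha>)" "Cod B p = FObj F (Dom A \<beta>)"
    "Dom B q = FObj F (Cod A \<alpha>)" "Cod B q = FObj F (Cod A \<beta>)"
    using g unfolding gpq by (auto simp: hom_def)
  obtain s where s: "s \<in> Arr A" "Dom A s = Dom A \<alpha>" "Cod A s = Dom A \<beta>" "FArr F s = p"
    by (rule fully_faithful_full[OF ff, of "Dom A \<alpha>" "Dom A \<beta>" p]) (use pq in auto)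
  obtain t where t: "t \<in> Arr A" "Dom A t = Cod A \<alpha>" "Cod A t = Cod A \<beta>" "FArr F t = q"
    by (rule fully_faithful_full[OF ff, of "Cod A \<alpha>" "Cod A \<beta>" q]) (use pq in auto)
  have sq: "t \<cdot>\<^bsub>A\<^esub> \<alpha> = \<beta> \<cdot>\<^bsub>A\<^esub> s"
    by (rule fully_faithful_eqI[OF ff]) (use pq s t in auto)
  show "\<exists>!f. f \<in> hom (arrow_cat A) \<alpha> \<beta> \<and> FArr (arrow_functor F) f = g"
  proof (rule ex1I[of _ "(\<alpha>, \<beta>, (s, t))"])
    show "(\<alpha>, \<beta>, (s, t)) \<in> hom (arrow_cat A) \<alpha> \<beta> \<and> FArr (arrow_functor F) (\<alpha>, \<beta>, (s, t)) = g"
      using s t sq by (auto simp: hom_def gpq)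
  next
    fix f assume f: "f \<in> hom (arrow_cat A) \<alpha> \<beta> \<and> FArr (arrow_functor F) f = g"
    then show "f = (\<alpha>, \<beta>, (s, t))"
      using s t by (cases f rule: arrow_cat_cases)
        (auto simp: hom_def gpq intro!: fully_faithful_eqI[OF ff])
  qed
qed

lemma arrow_functor_ess_surjective:
  assumes ff: "fully_faithful A B F" and es: "ess_surjective A B F"
  shows "ess_surjective (arrow_cat A) (arrow_cat B) (arrow_functor F)"
  unfolding ess_surjective_def
proof
  fix g assume "g \<in> Obj (arrow_cat B)"
  then have g [simp]: "g \<in> Arr B" by simp
  obtain x c where x [simp]: "x \<in> Obj A" and c: "c \<in> hom B (Dom B g) (FObj F x)" "invertible B c"
    using es g unfolding ess_surjective_def by (metis B.dom_in)
  obtain y d where y [simp]: "y \<in> Obj A" and d: "d \<in> hom B (Cod B g) (FObj F y)" "invertible B d"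
    using es g unfolding ess_surjective_def by (metis B.cod_in)
  have [simp]: "Dom B c = Dom B g" "Cod B c = FObj F x" "Dom B d = Cod B g" "Cod B d = FObj F y"
    "invertible B c" "invertible B d"
    using c d by (auto simp: hom_def)
  obtain f where f: "f \<in> Arr A" "Dom A f = x" "Cod A f = y" "FArr F f = d \<cdot>\<^bsub>B\<^esub> (g \<cdot>\<^bsub>B\<^esub> B.inv_of c)"
    by (rule fully_faithful_full[OF ff, of x y "d \<cdot>\<^bsub>B\<^esub> (g \<cdot>\<^bsub>B\<^esub> B.inv_of c)"]) auto
  show "\<exists>x \<in> Obj (arrow_cat A). \<exists>k \<in> hom (arrow_cat B) g (FObj (arrow_functor F) x). invertible (arrow_cat B) k"
    using f by (intro bexI[of _ f] bexI[of _ "(g, FArr F f, (c, d))"])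
      (auto simp: hom_def B.invertible_arrow_cat)
qed

lemma iso_lifting_unique:
  assumes "iso_lifting A B F" "f \<in> Arr A" "g \<in> Arr A" "Dom A f = Dom A g" "Cod A f = Cod A g"
    "FArr F f = FArr F g" "invertible B (FArr F g)"
  shows "f = g"
proof -
  have "FArr F g \<in> hom B (FObj F (Dom A g)) (FObj F (Cod A g))"
    using assms(3) by (simp add: hom_def)
  then obtain h where "\<forall>f' \<in> hom A (Dom A g) (Cod A g). FArr F f' = FArr F g \<longrightarrow> f' = h"
    using assms unfolding iso_lifting_def by (meson A.dom_in A.cod_in)
  then show ?thesis
    using assms by (auto simp: hom_def)
qed

lemma iso_lifting_lift:
  assumes "iso_lifting A B F" "x \<in> Obj A" "y \<in> Obj A" "invertible B g"
    "Dom B g = FObj F x" "Cod B g = FObj F y"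
  obtains f where "invertible A f" "Dom A f = x" "Cod A f = y" "FArr F f = g"
proof -
  have "g \<in> hom B (FObj F x) (FObj F y)"
    using assms by (simp add: hom_def)
  then show thesis
    using assms that unfolding iso_lifting_def by (metis (mono_tags, lifting) hom_def mem_Collect_eq)
qed

text \<open>A square from an identity to an identity is a pair of equal arrows. Hence the arrow category
contains the original category, and the lifting of isomorphisms restricts to it.\<close>

lemma iso_lifting_arrow_functor:
  assumes il: "iso_lifting (arrow_cat A) (arrow_cat B) (arrow_functor F)"
  shows "iso_lifting A B F"
  unfolding iso_lifting_def
proof (intro ballI impI)
  interpret R: cat_functor "arrow_cat A" "arrow_cat B" "arrow_functor F" by (rule arrow_functor)
  fix x y g
  assume xy [simp]: "x \<in> Obj A" "y \<in> Obj A" and g: "g \<in> hom B (FObj F x) (FObj F y)" and inv: "invertible B g"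
  have "invertible (arrow_cat B) (FArr F (Ident A x), FArr F (Ident A y), (g, g))"
    unfolding B.invertible_arrow_cat using g inv by (auto simp: hom_def)
  then obtain k where k: "invertible (arrow_cat A) k"
      "Dom (arrow_cat A) k = Ident A x" "Cod (arrow_cat A) k = Ident A y"
      "FArr (arrow_functor F) k = (FArr F (Ident A x), FArr F (Ident A y), (g, g))"
    by (rule R.iso_lifting_lift[OF il, of "Ident A x" "Ident A y", rotated 2]) simp_all
  obtain s t where kst: "k = (Ident A x, Ident A y, (s, t))"
    using k by (cases k rule: arrow_cat_cases) auto
  have st: "invertible A s" "Dom A s = x" "Cod A s = y" "FArr F s = g" "t = s"
    using k unfolding kst A.invertible_arrow_cat by auto
  show "\<exists>f \<in> hom A x y. invertible A f \<and> FArr F f = g \<and> (\<forall>f' \<in> hom A x y. FArr F f' = g \<longrightarrow> f' = f)"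
  proof (intro bexI[of _ s] conjI ballI impI)
    fix f' assume f': "f' \<in> hom A x y" "FArr F f' = g"
    have "(Ident A x, Ident A y, (f', f')) = (Ident A x, Ident A y, (s, s))"
      by (rule R.iso_lifting_unique[OF il])
        (use f' st inv in \<open>auto simp: hom_def B.invertible_arrow_cat\<close>)
    then show "f' = s" by simp
  qed (use st in \<open>auto simp: hom_def\<close>)
qed

text \<open>Essential surjectivity on arrows presents each arrow \<open>g\<close> between objects \<open>F x\<close> and \<open>F y\<close>, up
to an isomorphic square, as the image of some arrow. Lifting the two isomorphisms of that square to
\<open>x\<close> and \<open>y\<close> transports the preimage to the prescribed objects, which gives fullness. For
faithfulness, two arrows with the same image are joined by a square of identities over them; the sides of its
lift are lifts of identities, hence identities, and the arrows are equal.\<close>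

lemma arrow_functor_imp_equivalence:
  assumes il: "iso_lifting (arrow_cat A) (arrow_cat B) (arrow_functor F)"
    and es: "ess_surjective (arrow_cat A) (arrow_cat B) (arrow_functor F)"
  shows "fully_faithful A B F" "ess_surjective A B F"
proof -
  interpret R: cat_functor "arrow_cat A" "arrow_cat B" "arrow_functor F" by (rule arrow_functor)
  have il': "iso_lifting A B F"
    by (rule iso_lifting_arrow_functor[OF il])
  have cover: "\<exists>f c d. f \<in> Arr A \<and> invertible B c \<and> invertible B d \<and> Dom B c = Dom B g \<and> Dom B d = Cod B g \<and>
      Cod B c = FObj F (Dom A f) \<and> Cod B d = FObj F (Cod A f) \<and> d \<cdot>\<^bsub>B\<^esub> g = FArr F f \<cdot>\<^bsub>B\<^esub> c"
    if g: "g \<in> Arr B" for g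
  proof -
    obtain f k where f: "f \<in> Arr A" and k: "k \<in> hom (arrow_cat B) g (FArr F f)" "invertible (arrow_cat B) k"
      using es g unfolding ess_surjective_def by auto
    obtain c d where "k = (g, FArr F f, (c, d))"
      using k by (cases k rule: arrow_cat_cases) (auto simp: hom_def)
    then show ?thesis
      using f k by (intro exI[of _ f] exI[of _ c] exI[of _ d]) (auto simp: B.invertible_arrow_cat)
  qed
  show "ess_surjective A B F"
    unfolding ess_surjective_def
  proof
    fix y assume y: "y \<in> Obj B"
    then obtain f c where "f \<in> Arr A" "invertible B c" "Dom B c = y" "Cod B c = FObj F (Dom A f)"
      using cover[of "Ident B y"] by auto
    then show "\<exists>x \<in> Obj A. \<exists>g \<in> hom B y (FObj F x). invertible B g"
      by (intro bexI[of _ "Dom A f"] bexI[of _ c]) (auto simp: hom_def)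
  qed
  have faithful: "f = g" if fg: "f \<in> Arr A" "g \<in> Arr A" "Dom A f = Dom A g" "Cod A f = Cod A g"
    "FArr F f = FArr F g" for f g
  proof -
    let ?k = "(FArr F f, FArr F g, (Ident B (FObj F (Dom A g)), Ident B (FObj F (Cod A g))))"
    have "invertible (arrow_cat B) ?k"
      unfolding B.invertible_arrow_cat using fg by auto
    then obtain k where k: "invertible (arrow_cat A) k" "Dom (arrow_cat A) k = f" "Cod (arrow_cat A) k = g"
        "FArr (arrow_functor F) k = ?k"
      by (rule R.iso_lifting_lift[OF il, of f g, rotated 2]) (use fg in simp_all)
    obtain s t where kst: "k = (f, g, (s, t))"
      using k by (cases k rule: arrow_cat_cases) auto
    have st: "s \<in> Arr A" "t \<in> Arr A" "Dom A s = Dom A g" "Cod A s = Dom A g" "Dom A t = Cod A g"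
      "Cod A t = Cod A g" "t \<cdot>\<^bsub>A\<^esub> f = g \<cdot>\<^bsub>A\<^esub> s" "FArr F s = Ident B (FObj F (Dom A g))"
      "FArr F t = Ident B (FObj F (Cod A g))"
      using k fg unfolding kst A.invertible_arrow_cat by auto
    have "s = Ident A (Dom A g)" "t = Ident A (Cod A g)"
      using st fg by (auto intro!: iso_lifting_unique[OF il'])
    then show "f = g"
      using st(7) fg by simp
  qed
  show "fully_faithful A B F"
    unfolding fully_faithful_def
  proof (intro ballI)
    fix x y g
    assume xy [simp]: "x \<in> Obj A" "y \<in> Obj A" and "g \<in> hom B (FObj F x) (FObj F y)"
    then have g [simp]: "g \<in> Arr B" "Dom B g = FObj F x" "Cod B g = FObj F y"
      by (auto simp: hom_def)
    obtain f c d where f [simp]: "f \<in> Arr A" and cd [simp]: "invertible B c" "invertible B d" "Dom B c = FObj F x"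
      "Dom B d = FObj F y" "Cod B c = FObj F (Dom A f)" "Cod B d = FObj F (Cod A f)"
      and sq: "d \<cdot>\<^bsub>B\<^esub> g = FArr F f \<cdot>\<^bsub>B\<^esub> c"
      using cover[OF g(1)] by auto
    obtain s where s: "invertible A s" "Dom A s = x" "Cod A s = Dom A f" "FArr F s = c"
      by (rule iso_lifting_lift[OF il', of x "Dom A f" c]) auto
    obtain t where t: "invertible A t" "Dom A t = y" "Cod A t = Cod A f" "FArr F t = d"
      by (rule iso_lifting_lift[OF il', of y "Cod A f" d]) auto
    define h where "h = A.inv_of t \<cdot>\<^bsub>A\<^esub> (f \<cdot>\<^bsub>A\<^esub> s)"
    have h: "h \<in> Arr A" "Dom A h = x" "Cod A h = y"
      using s t by (auto simp: h_def)
    have "d \<cdot>\<^bsub>B\<^esub> FArr F h = FArr F (t \<cdot>\<^bsub>A\<^esub> h)"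
      using h t by simp
    also have "t \<cdot>\<^bsub>A\<^esub> h = f \<cdot>\<^bsub>A\<^esub> s"
      using s t by (simp add: h_def)
    finally have "d \<cdot>\<^bsub>B\<^esub> FArr F h = d \<cdot>\<^bsub>B\<^esub> g"
      using s sq by simp
    then have "FArr F h = g"
      using h by (intro B.invertible_cancel_left[of d "FArr F h" g]) auto
    then show "\<exists>!f. f \<in> hom A x y \<and> FArr F f = g"
      using h faithful by (intro ex1I[of _ h]) (auto simp: hom_def)
  qed
qed

text \<open>Isomorphisms see only the groupoid of a category, but the isomorphisms of the arrow category
also see all arrows. This is why bi-initiality over the 2-category of arrows suffices for an
equivalence, whereas bi-initiality in the plain pseudo-slice does not.\<close>

theorem arrow_functor_equivalence_iff:
  "iso_lifting (arrow_cat A) (arrow_cat B) (arrow_functor F) \<and>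
    ess_surjective (arrow_cat A) (arrow_cat B) (arrow_functor F) \<longleftrightarrow>
   fully_faithful A B F \<and> ess_surjective A B F"
  using arrow_functor_imp_equivalence arrow_functor_ess_surjective
    cat_functor.fully_faithful_imp_iso_lifting[OF arrow_functor arrow_functor_fully_faithful] by blast

end

section \<open>Bi-initial objects of pseudo-slices\<close>

lemma slice_simps [simp]:
  "Ob (slice B A G I) = slice_obs B A G I"
  "Obj (Vert (slice B A G I)) = slice_mors B A G I"
  "Arr (Vert (slice B A G I)) = slice_cells B A G I"
  "Dom (Vert (slice B A G I)) = asrc" "Cod (Vert (slice B A G I)) = atrg"
  "Ident (Vert (slice B A G I)) p = (p, p, id2 B (fst (adat p)))"
  "Comp (Vert (slice B A G I)) (q, r, \<gamma>) (p, q', \<beta>) = (p, r, \<gamma> \<bullet>\<^bsub>B\<^esub> \<beta>)"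
  "Src (slice B A G I) = asrc" "Trg (slice B A G I) = atrg"
  "Unit (slice B A G I) = slice_unit B A"
  "HC1 (slice B A G I) = slice_comp B A G"
  "HC2 (slice B A G I) (q, q', \<gamma>) (p, p', \<beta>) = (slice_comp B A G q p, slice_comp B A G q' p', \<gamma> \<star>\<^bsub>B\<^esub> \<beta>)"
  by (simp_all add: slice_def)

lemma slice_obs_iff [simp]: "(x, f) \<in> slice_obs B A G I \<longleftrightarrow> x \<in> Ob B \<and> f \<in> hom1 A I (PO G x)"
  by (simp add: slice_obs_def)

lemma slice_hom1_iff:
  "m \<in> hom1 (slice B A G I) (x, f) (y, g) \<longleftrightarrow>
    (x, f) \<in> slice_obs B A G I \<and> (y, g) \<in> slice_obs B A G I \<and>
    (\<exists>b \<psi>. m = ((x, f), (y, g), (b, \<psi>)) \<and> b \<in> hom1 B x y \<and>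
      \<psi> \<in> hom2 A g (P1 G b \<odot>\<^bsub>A\<^esub> f) \<and> invertible (Vert A) \<psi>)"
  by (cases m) (auto simp: hom1_def slice_mors_def)

lemma slice_hom2_iff:
  assumes "((x, f), (y, g), (b, \<psi>)) \<in> hom1 (slice B A G I) (x, f) (y, g)"
    "((x, f), (y, g), (c, \<phi>)) \<in> hom1 (slice B A G I) (x, f) (y, g)"
  shows "\<mu> \<in> hom2 (slice B A G I) ((x, f), (y, g), (b, \<psi>)) ((x, f), (y, g), (c, \<phi>)) \<longleftrightarrow>
    (\<exists>\<beta>. \<mu> = (((x, f), (y, g), (b, \<psi>)), ((x, f), (y, g), (c, \<phi>)), \<beta>) \<and>
      \<beta> \<in> hom2 B b c \<and> (P2 G \<beta> \<star>\<^bsub>A\<^esub> id2 A f) \<bullet>\<^bsub>A\<^esub> \<psi> = \<phi>)"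
  using assms by (cases \<mu>) (auto simp: hom_def slice_cells_def hom1_def)

lemma slice_hom1_cases:
  assumes "m \<in> hom1 (slice B A G I) (x, f) (y, g)"
  obtains b \<psi> where "m = ((x, f), (y, g), (b, \<psi>))" "b \<in> hom1 B x y"
    "\<psi> \<in> hom2 A g (P1 G b \<odot>\<^bsub>A\<^esub> f)" "invertible (Vert A) \<psi>"
  using assms unfolding slice_hom1_iff by blast

text \<open>The projection from \<open>J \<down> K\<close> is bijective on cells between given 1-morphisms as soon as each
cell of \<open>K\<close> satisfies the pasting condition, because a cell of \<open>J \<down> K\<close> is determined by its
projection. So the last clause of a trivial fibration becomes an equation that holds for all data.\<close>

lemma bi_initial_iff:
  "bi_initial K J \<longleftrightarrow> J \<in> Ob K \<and>
    (\<forall>P \<in> Ob K. \<exists>p. p \<in> hom1 K J P) \<and>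
    (\<forall>P \<in> Ob K. \<forall>Q \<in> Ob K. \<forall>p \<in> hom1 K J P. \<forall>q \<in> hom1 K J Q. \<forall>m \<in> hom1 K P Q.
      \<exists>\<chi> \<in> hom2 K q (m \<odot>\<^bsub>K\<^esub> p). invertible (Vert K) \<chi>) \<and>
    (\<forall>P \<in> Ob K. \<forall>Q \<in> Ob K. \<forall>p \<in> hom1 K J P. \<forall>q \<in> hom1 K J Q.
      \<forall>m \<in> hom1 K P Q. \<forall>m' \<in> hom1 K P Q.
      \<forall>\<chi> \<in> hom2 K q (m \<odot>\<^bsub>K\<^esub> p). invertible (Vert K) \<chi> \<longrightarrow>
      (\<forall>\<chi>' \<in> hom2 K q (m' \<odot>\<^bsub>K\<^esub> p). invertible (Vert K) \<chi>' \<longrightarrow>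
      (\<forall>\<mu> \<in> hom2 K m m'. (\<mu> \<star>\<^bsub>K\<^esub> id2 K p) \<bullet>\<^bsub>K\<^esub> \<chi> = \<chi>')))"
  (is "_ \<longleftrightarrow> ?J \<and> ?E \<and> ?F \<and> ?U")
proof -
  let ?S = "slice K K (id_psfun K) J"
  have P [simp]: "PO (slice_proj K) = fst" "P1 (slice_proj K) = (\<lambda>p. fst (adat p))" "P2 (slice_proj K) = adat"
    "PO (id_psfun K) = (\<lambda>x. x)" "P1 (id_psfun K) = (\<lambda>x. x)" "P2 (id_psfun K) = (\<lambda>x. x)"
    by (simp_all add: slice_proj_def id_psfun_def)
  have E: "(\<forall>y \<in> Ob K. \<exists>x \<in> Ob ?S. PO (slice_proj K) x = y) \<longleftrightarrow> ?E"
    unfolding slice_simps P by (rule ball_cong[OF refl]) (auto simp: slice_obs_def)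
  have F: "(\<forall>x \<in> Ob ?S. \<forall>x' \<in> Ob ?S. \<forall>g \<in> hom1 K (PO (slice_proj K) x) (PO (slice_proj K) x').
      \<exists>f \<in> hom1 ?S x x'. P1 (slice_proj K) f = g) \<longleftrightarrow> ?F"
    by (simp add: slice_hom1_iff split_paired_Ball_Sigma slice_obs_def Ball_def Bex_def) blast
  have U: "(\<forall>x \<in> Ob ?S. \<forall>x' \<in> Ob ?S. \<forall>f \<in> hom1 ?S x x'. \<forall>f' \<in> hom1 ?S x x'.
      \<forall>\<beta> \<in> hom2 K (P1 (slice_proj K) f) (P1 (slice_proj K) f').
      \<exists>!\<alpha>. \<alpha> \<in> hom2 ?S f f' \<and> P2 (slice_proj K) \<alpha> = \<beta>) \<longleftrightarrow> ?U"
    (is "?L \<longleftrightarrow> _")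
  proof
    assume L: ?L
    show ?U
    proof (intro ballI impI)
      fix P Q p q m m' \<chi> \<chi>' \<mu>
      assume *: "P \<in> Ob K" "Q \<in> Ob K" "p \<in> hom1 K J P" "q \<in> hom1 K J Q" "m \<in> hom1 K P Q" "m' \<in> hom1 K P Q"
        "\<chi> \<in> hom2 K q (m \<odot>\<^bsub>K\<^esub> p)" "invertible (Vert K) \<chi>" "\<chi>' \<in> hom2 K q (m' \<odot>\<^bsub>K\<^esub> p)"
        "invertible (Vert K) \<chi>'" "\<mu> \<in> hom2 K m m'"
      let ?f = "((P, p), (Q, q), (m, \<chi>))" and ?f' = "((P, p), (Q, q), (m', \<chi>'))"
      have f: "?f \<in> hom1 ?S (P, p) (Q, q)" "?f' \<in> hom1 ?S (P, p) (Q, q)"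
        using * by (auto simp: slice_hom1_iff)
      have "\<exists>!\<alpha>. \<alpha> \<in> hom2 ?S ?f ?f' \<and> adat \<alpha> = \<mu>"
        by (rule L[rule_format, unfolded P, of "(P, p)" "(Q, q)" ?f ?f' \<mu>]) (use * f in simp_all)
      then show "(\<mu> \<star>\<^bsub>K\<^esub> id2 K p) \<bullet>\<^bsub>K\<^esub> \<chi> = \<chi>'"
        unfolding slice_hom2_iff[OF f] P by (elim ex1E conjE exE) simp
    qed
  next
    assume U: ?U
    show ?L
    proof (intro ballI)
      fix x x' f f' \<beta>
      assume *: "x \<in> Ob ?S" "x' \<in> Ob ?S" "f \<in> hom1 ?S x x'" "f' \<in> hom1 ?S x x'"
        "\<beta> \<in> hom2 K (P1 (slice_proj K) f) (P1 (slice_proj K) f')"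
      obtain P p Q q where xx: "x = (P, p)" "x' = (Q, q)"
        by (metis surj_pair)
      obtain m \<chi> where f: "f = ((P, p), (Q, q), (m, \<chi>))" "m \<in> hom1 K P Q"
        "\<chi> \<in> hom2 K q (m \<odot>\<^bsub>K\<^esub> p)" "invertible (Vert K) \<chi>"
        using *(3) unfolding xx by (rule slice_hom1_cases) auto
      obtain m' \<chi>' where f': "f' = ((P, p), (Q, q), (m', \<chi>'))" "m' \<in> hom1 K P Q"
        "\<chi>' \<in> hom2 K q (m' \<odot>\<^bsub>K\<^esub> p)" "invertible (Vert K) \<chi>'"
        using *(4) unfolding xx by (rule slice_hom1_cases) auto
      have "(\<beta> \<star>\<^bsub>K\<^esub> id2 K p) \<bullet>\<^bsub>K\<^esub> \<chi> = \<chi>'"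
        by (rule U[rule_format, of P Q p q m m']) (use * f f' xx in auto)
      then show "\<exists>!\<alpha>. \<alpha> \<in> hom2 ?S f f' \<and> P2 (slice_proj K) \<alpha> = \<beta>"
        unfolding f(1) f'(1) slice_hom2_iff[OF *(3,4)[unfolded xx f(1) f'(1)]]
        using *(5)[unfolded P f(1) f'(1) fst_conv snd_conv]
        by (intro ex1I[of _ "(((P, p), (Q, q), (m, \<chi>)), ((P, p), (Q, q), (m', \<chi>')), \<beta>)"])
          (simp, elim conjE exE, simp)
    qed
  qed
  show ?thesis
    unfolding bi_initial_def trivial_fibration_def E F U ..
qed

text \<open>For \<open>C(-,F)\<close> and \<open>l = \<lambda>\<close> this is the functor in the definition of a weighted bi-limit. In
general it is evaluation at \<open>l\<close>, from \<open>A(X,Y)\<close> to \<open>B(W,F Y)\<close>, as in the bicategorical Yoneda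
lemma.\<close>

definition eval_functor :: "('p, 'n, 'd) two_cat \<Rightarrow> ('o, 'm, 'c, 'p, 'n, 'd) psfun \<Rightarrow> 'n \<Rightarrow> ('m, 'c, 'n, 'd) func" where
  "eval_functor B F l = \<lparr>FObj = \<lambda>b. P1 F b \<odot>\<^bsub>B\<^esub> l, FArr = \<lambda>\<beta>. P2 F \<beta> \<star>\<^bsub>B\<^esub> id2 B l\<rparr>"

lemma eval_functor_simps [simp]:
  "FObj (eval_functor B F l) b = P1 F b \<odot>\<^bsub>B\<^esub> l"
  "FArr (eval_functor B F l) \<beta> = P2 F \<beta> \<star>\<^bsub>B\<^esub> id2 B l"
  by (simp_all add: eval_functor_def)

context pseudofunctor
begin

lemma eval_functor:
  assumes "X \<in> Ob A" "Y \<in> Ob A" "l \<in> hom1 B W (PO F X)"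
  shows "cat_functor (hom_cat A X Y) (hom_cat B W (PO F Y)) (eval_functor B F l)"
  by (intro cat_functor.intro cat_functor_axioms.intro A.category_hom_cat B.category_hom_cat)
    (use assms in \<open>auto simp: is_functor_def A.hom_cat_simps B.hom_cat_simps hom1_def hom_def\<close>)

lemma slice_comp_in:
  assumes "((x, f), (y, g), (b, \<psi>)) \<in> hom1 (slice A B F W) (x, f) (y, g)"
    "((y, g), (z, h), (c, \<chi>)) \<in> hom1 (slice A B F W) (y, g) (z, h)"
  shows "((x, f), (z, h), (c \<odot>\<^bsub>A\<^esub> b, (PC F c b \<star>\<^bsub>B\<^esub> id2 B f) \<bullet>\<^bsub>B\<^esub> (id2 B (P1 F c) \<star>\<^bsub>B\<^esub> \<psi>) \<bullet>\<^bsub>B\<^esub> \<chi>))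
    \<in> hom1 (slice A B F W) (x, f) (z, h)"
  using assms unfolding slice_hom1_iff by (auto simp: hom1_def hom_def)

text \<open>The inverse of an invertible 2-morphism inherits the pasting condition.\<close>

lemma slice_cell_invertible:
  assumes m: "((x, f), (y, g), (b, \<psi>)) \<in> hom1 (slice A B F W) (x, f) (y, g)"
    and m': "((x, f), (y, g), (c, \<phi>)) \<in> hom1 (slice A B F W) (x, f) (y, g)"
    and \<mu>: "(((x, f), (y, g), (b, \<psi>)), ((x, f), (y, g), (c, \<phi>)), \<beta>)
      \<in> hom2 (slice A B F W) ((x, f), (y, g), (b, \<psi>)) ((x, f), (y, g), (c, \<phi>))" (is "?\<mu> \<in> _")
  shows "invertible (Vert (slice A B F W)) ?\<mu> \<longleftrightarrow> invertible (Vert A) \<beta>"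
proof
  assume "invertible (Vert (slice A B F W)) ?\<mu>"
  then obtain \<nu> where \<nu>: "\<nu> \<in> hom2 (slice A B F W) ((x, f), (y, g), (c, \<phi>)) ((x, f), (y, g), (b, \<psi>))"
    "Comp (Vert (slice A B F W)) \<nu> ?\<mu> = Ident (Vert (slice A B F W)) ((x, f), (y, g), (b, \<psi>))"
    "Comp (Vert (slice A B F W)) ?\<mu> \<nu> = Ident (Vert (slice A B F W)) ((x, f), (y, g), (c, \<phi>))"
    unfolding invertible_def by (auto simp del: slice_simps(6,7))
  then obtain \<gamma> where \<gamma>: "\<nu> = (((x, f), (y, g), (c, \<phi>)), ((x, f), (y, g), (b, \<psi>)), \<gamma>)" "\<gamma> \<in> hom2 A c b"
    unfolding slice_hom2_iff[OF m' m] by blast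
  have "\<beta> \<in> hom2 A b c"
    using \<mu> unfolding slice_hom2_iff[OF m m'] by blast
  then show "invertible (Vert A) \<beta>"
    by (intro A.V.invertibleI[of _ \<gamma>]) (use \<nu> \<gamma> in \<open>auto simp: hom_def\<close>)
next
  assume inv [simp]: "invertible (Vert A) \<beta>"
  have \<beta>: "Dom (Vert A) \<beta> = b" "Cod (Vert A) \<beta> = c" "(P2 F \<beta> \<star>\<^bsub>B\<^esub> id2 B f) \<bullet>\<^bsub>B\<^esub> \<psi> = \<phi>"
    using \<mu> unfolding slice_hom2_iff[OF m m'] by (auto simp: hom_def)
  have c: "c \<in> Mor A" "Src A c = x"
    using m' unfolding slice_hom1_iff by (auto simp: hom1_def)
  have \<psi>: "b \<in> Mor A" "Src A b = x" "f \<in> Mor B" "Trg B f = PO F x" "\<psi> \<in> Cell B" "Cod (Vert B) \<psi> = P1 F b \<odot>\<^bsub>B\<^esub> f"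
    using m unfolding slice_hom1_iff by (auto simp: hom1_def hom_def)
  have "(P2 F (A.V.inv_of \<beta>) \<star>\<^bsub>B\<^esub> id2 B f) \<bullet>\<^bsub>B\<^esub> (P2 F \<beta> \<star>\<^bsub>B\<^esub> id2 B f) \<bullet>\<^bsub>B\<^esub> \<psi> =
      ((P2 F (A.V.inv_of \<beta>) \<star>\<^bsub>B\<^esub> id2 B f) \<bullet>\<^bsub>B\<^esub> (P2 F \<beta> \<star>\<^bsub>B\<^esub> id2 B f)) \<bullet>\<^bsub>B\<^esub> \<psi>"
    using \<beta>(1,2) \<psi> c by simp
  also have "\<dots> = (P2 F (A.V.inv_of \<beta> \<bullet>\<^bsub>A\<^esub> \<beta>) \<star>\<^bsub>B\<^esub> id2 B f) \<bullet>\<^bsub>B\<^esub> \<psi>"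
    using \<beta>(1,2) \<psi> c by (simp del: A.V.inv_of(4,5) B.V.comp_assoc_right)
  also have "\<dots> = \<psi>"
    using \<beta>(1,2) \<psi> c by simp
  finally have "(P2 F (A.V.inv_of \<beta>) \<star>\<^bsub>B\<^esub> id2 B f) \<bullet>\<^bsub>B\<^esub> \<phi> = \<psi>"
    unfolding \<beta>(3) .
  then have \<nu>: "(((x, f), (y, g), (c, \<phi>)), ((x, f), (y, g), (b, \<psi>)), A.V.inv_of \<beta>)
      \<in> hom2 (slice A B F W) ((x, f), (y, g), (c, \<phi>)) ((x, f), (y, g), (b, \<psi>))" (is "?\<nu> \<in> _")
    unfolding slice_hom2_iff[OF m' m] using \<beta> by (auto simp: hom_def)
  show "invertible (Vert (slice A B F W)) ?\<mu>"
    unfolding invertible_def using \<mu> \<nu> \<beta>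
    by (intro conjI bexI[of _ ?\<nu>]) (auto simp: hom_def)
qed

text \<open>A 1-morphism \<open>(X, l) \<rightarrow> (Y, k)\<close> is an object \<open>b\<close> together with an isomorphism from \<open>k\<close> to the
image of \<open>b\<close> under evaluation, so the existence of these morphisms is essential surjectivity. Given
two such morphisms to the same object, an invertible cell between them is a lift of the isomorphism
that compares their targets; this is fullness of the projection over the identity of \<open>(Y, k)\<close>, and
fullness over an arbitrary \<open>m\<close> reduces to it by composing with \<open>m\<close>. Full faithfulness on cells says
that a cell is determined by its image when that image is invertible.\<close>

theorem bi_initial_slice_iff:
  "bi_initial (slice A B F W) (X, l) \<longleftrightarrow> X \<in> Ob A \<and> l \<in> hom1 B W (PO F X) \<and>
    (\<forall>Y \<in> Ob A. ess_surjective (hom_cat A X Y) (hom_cat B W (PO F Y)) (eval_functor B F l) \<and>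
      iso_lifting (hom_cat A X Y) (hom_cat B W (PO F Y)) (eval_functor B F l))"
  (is "_ \<longleftrightarrow> _ \<and> _ \<and> (\<forall>Y \<in> _. ?E Y \<and> ?L Y)")
proof (intro iffI conjI ballI; (elim conjE)?)
  let ?K = "slice A B F W"
  assume bi: "bi_initial ?K (X, l)"
  note bi' = bi[unfolded bi_initial_iff]
  show X: "X \<in> Ob A" and l: "l \<in> hom1 B W (PO F X)"
    using bi' by simp_all
  fix Y assume Y: "Y \<in> Ob A"
  show "?E Y"
    unfolding ess_surjective_def
  proof
    fix k assume "k \<in> Obj (hom_cat B W (PO F Y))"
    then have k: "k \<in> hom1 B W (PO F Y)"
      by (simp add: B.hom_cat_simps)
    then obtain p where "p \<in> hom1 ?K (X, l) (Y, k)"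
      using bi'[THEN conjunct2, THEN conjunct1, rule_format, of "(Y, k)"] Y by (auto simp del: split_paired_Ex)
    then obtain b \<psi> where "b \<in> hom1 A X Y" "\<psi> \<in> hom2 B k (P1 F b \<odot>\<^bsub>B\<^esub> l)" "invertible (Vert B) \<psi>"
      by (rule slice_hom1_cases)
    with k show "\<exists>x \<in> Obj (hom_cat A X Y). \<exists>g \<in> hom (hom_cat B W (PO F Y)) k (FObj (eval_functor B F l) x).
        invertible (hom_cat B W (PO F Y)) g"
      by (intro bexI[of _ b] bexI[of _ \<psi>])
        (auto simp: A.hom_cat_simps B.hom_cat_simps B.invertible_hom_cat hom_def)
  qed
  show "?L Y"
    unfolding iso_lifting_def
  proof (intro ballI impI)
    fix b b' g
    assume "b \<in> Obj (hom_cat A X Y)" "b' \<in> Obj (hom_cat A X Y)"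
      and g: "g \<in> hom (hom_cat B W (PO F Y)) (FObj (eval_functor B F l) b) (FObj (eval_functor B F l) b')"
        "invertible (hom_cat B W (PO F Y)) g"
    then have b: "b \<in> hom1 A X Y" "b' \<in> hom1 A X Y"
      by (simp_all add: A.hom_cat_simps)
    have Fl: "P1 F b \<odot>\<^bsub>B\<^esub> l \<in> hom1 B W (PO F Y)"
      using b l by (auto simp: hom1_def)
    have g: "g \<in> hom2 B (P1 F b \<odot>\<^bsub>B\<^esub> l) (P1 F b' \<odot>\<^bsub>B\<^esub> l)" "invertible (Vert B) g"
      using g Fl by (simp_all add: B.hom_hom_cat B.invertible_hom_cat)
    \<comment> \<open>Over the object \<open>(Y, F b l)\<close>, the identity makes \<open>b\<close> and the isomorphism \<open>g\<close> makes \<open>b'\<close> a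
      morphism from \<open>(X, l)\<close>.\<close>
    let ?Q = "(Y, P1 F b \<odot>\<^bsub>B\<^esub> l)" and ?J = "(X, l)"
    let ?p = "(?J, ?Q, (b, id2 B (P1 F b \<odot>\<^bsub>B\<^esub> l)))" and ?q = "(?J, ?Q, (b', g))"
    have p: "?p \<in> hom1 ?K ?J ?Q" and q: "?q \<in> hom1 ?K ?J ?Q"
      and u: "slice_unit A B ?Q \<in> hom1 ?K ?Q ?Q" and v: "slice_unit A B ?J \<in> hom1 ?K ?J ?J"
      using X Y l b g Fl unfolding slice_unit_def prod.case slice_hom1_iff
      by (auto simp: hom1_def hom_def)
    have uq: "slice_comp A B F (slice_unit A B ?Q) ?q = ?q"
      and pv: "slice_comp A B F ?p (slice_unit A B ?J) = ?p"
      and qv: "slice_comp A B F ?q (slice_unit A B ?J) = ?q"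
      using X Y l b g by (auto simp: slice_comp_def slice_unit_def hom1_def hom_def)
    have Q: "?Q \<in> Ob ?K" and J: "?J \<in> Ob ?K"
      using X Y l Fl by auto
    have "\<exists>\<chi> \<in> hom2 ?K ?p ?q. invertible (Vert ?K) \<chi>"
      using bi'[THEN conjunct2, THEN conjunct2, THEN conjunct1, rule_format, OF Q Q q p u]
      unfolding slice_simps uq .
    then obtain \<chi> where \<chi>: "\<chi> \<in> hom2 ?K ?p ?q" "invertible (Vert ?K) \<chi>"
      by blast
    then obtain f where f: "\<chi> = (?p, ?q, f)" "f \<in> hom2 A b b'" "(P2 F f \<star>\<^bsub>B\<^esub> id2 B l) \<bullet>\<^bsub>B\<^esub> id2 B (P1 F b \<odot>\<^bsub>B\<^esub> l) = g"
      unfolding slice_hom2_iff[OF p q] by blast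
    have f_inv: "invertible (Vert A) f"
      using \<chi> slice_cell_invertible[OF p q] unfolding f(1) by blast
    have unit_right: "(P2 F h \<star>\<^bsub>B\<^esub> id2 B l) \<bullet>\<^bsub>B\<^esub> id2 B (P1 F b \<odot>\<^bsub>B\<^esub> l) = P2 F h \<star>\<^bsub>B\<^esub> id2 B l"
      if "h \<in> hom2 A b b'" for h
      using that b l by (auto simp: hom1_def hom_def)
    have unique: "f' = f" if f': "f' \<in> hom2 A b b'" "P2 F f' \<star>\<^bsub>B\<^esub> id2 B l = g" for f'
    proof -
      \<comment> \<open>Both \<open>?p\<close> and \<open>?q\<close> are morphisms of \<open>J \<down> K\<close> from the identity of \<open>(X, l)\<close> to \<open>?p\<close>, with
        the identity and \<open>\<chi>\<close> as their isomorphisms. The pasting condition for \<open>f'\<close> as a cell between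
        them is \<open>f' = f\<close>.\<close>
      have \<mu>: "(?p, ?q, f') \<in> hom2 ?K ?p ?q"
        using f' unit_right[OF f'(1)] by (simp add: slice_hom2_iff[OF p q])
      have i: "(?p, ?p, id2 A b) \<in> hom2 ?K ?p ?p"
        unfolding slice_hom2_iff[OF p p] using b l by (auto simp: hom1_def hom_def)
      have "invertible (Vert ?K) (?p, ?p, id2 A b)"
        using slice_cell_invertible[OF p p i] b by (simp add: hom1_def)
      then have "((?p, ?q, f') \<star>\<^bsub>?K\<^esub> id2 ?K (slice_unit A B ?J)) \<bullet>\<^bsub>?K\<^esub> (?p, ?p, id2 A b) = \<chi>"
        using i \<chi> by (intro bi'[THEN conjunct2, THEN conjunct2, THEN conjunct2, rule_format, OF J Q v p p q _ _ _ _ \<mu>])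
          (simp_all only: slice_simps pv qv)
      then show "f' = f"
        using f'(1) b X by (auto simp: slice_unit_def f(1) hom1_def hom_def)
    qed
    show "\<exists>f \<in> hom (hom_cat A X Y) b b'. invertible (hom_cat A X Y) f \<and> FArr (eval_functor B F l) f = g \<and>
        (\<forall>f' \<in> hom (hom_cat A X Y) b b'. FArr (eval_functor B F l) f' = g \<longrightarrow> f' = f)"
      unfolding A.hom_hom_cat[OF b(1)] A.invertible_hom_cat
      using f f_inv unit_right[OF f(2)] unique b
      by (intro bexI[of _ f]) (auto simp: hom_def)
  qed
next
  let ?K = "slice A B F W" and ?J = "(X, l)"
  assume X: "X \<in> Ob A" and l: "l \<in> hom1 B W (PO F X)" and EL: "\<forall>Y \<in> Ob A. ?E Y \<and> ?L Y"
  have lift: "\<exists>f \<in> hom2 A b b'. invertible (Vert A) f \<and> P2 F f \<star>\<^bsub>B\<^esub> id2 B l = g \<and>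
      (\<forall>f' \<in> hom2 A b b'. P2 F f' \<star>\<^bsub>B\<^esub> id2 B l = g \<longrightarrow> f' = f)"
    if b: "b \<in> hom1 A X Y" "b' \<in> hom1 A X Y"
      and g: "g \<in> hom2 B (P1 F b \<odot>\<^bsub>B\<^esub> l) (P1 F b' \<odot>\<^bsub>B\<^esub> l)" "invertible (Vert B) g" for b b' g Y
  proof -
    have Y: "Y \<in> Ob A" and Fl: "P1 F b \<odot>\<^bsub>B\<^esub> l \<in> hom1 B W (PO F Y)"
      using b l by (auto simp: hom1_def)
    have "invertible (hom_cat B W (PO F Y)) g" "g \<in> hom (hom_cat B W (PO F Y)) (P1 F b \<odot>\<^bsub>B\<^esub> l) (P1 F b' \<odot>\<^bsub>B\<^esub> l)"
      using g Fl by (auto simp: B.hom_cat_simps B.invertible_hom_cat hom_def)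
    moreover have "?L Y"
      using EL Y by simp
    ultimately show ?thesis
      using b unfolding iso_lifting_def
      by (fastforce simp: A.hom_cat_simps A.hom_hom_cat A.invertible_hom_cat)
  qed
  show "bi_initial ?K ?J"
    unfolding bi_initial_iff
  proof (intro conjI ballI impI)
    show J: "?J \<in> Ob ?K"
      using X l by simp
    {
      fix P assume "P \<in> Ob ?K"
      moreover obtain Y k where P: "P = (Y, k)"
        by (rule prod.exhaust)
      ultimately have Yk: "Y \<in> Ob A" "k \<in> hom1 B W (PO F Y)"
        by auto
      then have "?E Y" "k \<in> Obj (hom_cat B W (PO F Y))"
        using EL by (auto simp: B.hom_cat_simps)
      then obtain b g where "b \<in> Obj (hom_cat A X Y)" "g \<in> hom (hom_cat B W (PO F Y)) k (FObj (eval_functor B F l) b)"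
        "invertible (hom_cat B W (PO F Y)) g"
        unfolding ess_surjective_def by blast
      then have "(?J, P, (b, g)) \<in> hom1 ?K ?J P"
        using X l Yk unfolding P by (auto simp: slice_hom1_iff A.hom_cat_simps B.hom_hom_cat B.invertible_hom_cat)
      then show "\<exists>p. p \<in> hom1 ?K ?J P" ..
    }
    fix P Q p q m
    assume pqm: "p \<in> hom1 ?K ?J P" "q \<in> hom1 ?K ?J Q" "m \<in> hom1 ?K P Q"
    obtain Y k Z h where PQ: "P = (Y, k)" "Q = (Z, h)"
      by (metis surj_pair)
    obtain b \<psi> where p: "p = (?J, (Y, k), (b, \<psi>))" and b: "b \<in> hom1 A X Y"
      and \<psi>: "\<psi> \<in> hom2 B k (P1 F b \<odot>\<^bsub>B\<^esub> l)" "invertible (Vert B) \<psi>"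
      using pqm(1) unfolding PQ by (rule slice_hom1_cases)
    obtain d \<phi> where q: "q = (?J, (Z, h), (d, \<phi>))" and d: "d \<in> hom1 A X Z"
      and \<phi>: "\<phi> \<in> hom2 B h (P1 F d \<odot>\<^bsub>B\<^esub> l)" "invertible (Vert B) \<phi>"
      using pqm(2) unfolding PQ by (rule slice_hom1_cases)
    note pqm' = pqm[unfolded PQ p q]
    obtain c \<omega> where m: "m = ((Y, k), (Z, h), (c, \<omega>))" and c: "c \<in> hom1 A Y Z"
      and \<omega>: "\<omega> \<in> hom2 B h (P1 F c \<odot>\<^bsub>B\<^esub> k)" "invertible (Vert B) \<omega>"
      using pqm(3) unfolding PQ by (rule slice_hom1_cases)
    define \<xi> where "\<xi> = (PC F c b \<star>\<^bsub>B\<^esub> id2 B l) \<bullet>\<^bsub>B\<^esub> (id2 B (P1 F c) \<star>\<^bsub>B\<^esub> \<psi>) \<bullet>\<^bsub>B\<^esub> \<omega>"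
    have mp: "slice_comp A B F m p = (?J, (Z, h), (c \<odot>\<^bsub>A\<^esub> b, \<xi>))"
      by (simp add: m p \<xi>_def slice_comp_def)
    have mp_in: "(?J, (Z, h), (c \<odot>\<^bsub>A\<^esub> b, \<xi>)) \<in> hom1 ?K ?J (Z, h)"
      unfolding \<xi>_def using slice_comp_in[OF pqm'(1)] pqm'(3)[unfolded m] by blast
    then have cb: "c \<odot>\<^bsub>A\<^esub> b \<in> hom1 A X Z" and \<xi>: "\<xi> \<in> hom2 B h (P1 F (c \<odot>\<^bsub>A\<^esub> b) \<odot>\<^bsub>B\<^esub> l)" "invertible (Vert B) \<xi>"
      by (auto simp: slice_hom1_iff)
    have "\<xi> \<bullet>\<^bsub>B\<^esub> B.V.inv_of \<phi> \<in> hom2 B (P1 F d \<odot>\<^bsub>B\<^esub> l) (P1 F (c \<odot>\<^bsub>A\<^esub> b) \<odot>\<^bsub>B\<^esub> l)" "invertible (Vert B) (\<xi> \<bullet>\<^bsub>B\<^esub> B.V.inv_of \<phi>)"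
      using \<xi> \<phi> by (auto simp: hom_def)
    from lift[OF d cb this] obtain f where f: "f \<in> hom2 A d (c \<odot>\<^bsub>A\<^esub> b)" "invertible (Vert A) f"
      "P2 F f \<star>\<^bsub>B\<^esub> id2 B l = \<xi> \<bullet>\<^bsub>B\<^esub> B.V.inv_of \<phi>" by blast
    have fcell: "(q, slice_comp A B F m p, f) \<in> hom2 ?K q (slice_comp A B F m p)"
      unfolding mp q slice_hom2_iff[OF pqm'(2) mp_in] using f \<xi> \<phi> by (auto simp: hom_def)
    then have "invertible (Vert ?K) (q, slice_comp A B F m p, f)"
      using slice_cell_invertible[OF pqm'(2) mp_in] f(2) unfolding mp q by blast
    then show "\<exists>\<chi> \<in> hom2 ?K q (m \<odot>\<^bsub>?K\<^esub> p). invertible (Vert ?K) \<chi>"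
      using fcell by auto
    fix m' \<chi> \<chi>' \<mu>
    assume m'_in: "m' \<in> hom1 ?K P Q" and \<chi>: "\<chi> \<in> hom2 ?K q (m \<odot>\<^bsub>?K\<^esub> p)" "invertible (Vert ?K) \<chi>"
      and \<chi>': "\<chi>' \<in> hom2 ?K q (m' \<odot>\<^bsub>?K\<^esub> p)" "invertible (Vert ?K) \<chi>'" and \<mu>: "\<mu> \<in> hom2 ?K m m'"
    obtain c' \<omega>' where m': "m' = ((Y, k), (Z, h), (c', \<omega>'))" and c': "c' \<in> hom1 A Y Z"
      and \<omega>': "\<omega>' \<in> hom2 B h (P1 F c' \<odot>\<^bsub>B\<^esub> k)" "invertible (Vert B) \<omega>'"
      using m'_in unfolding PQ by (rule slice_hom1_cases)
    define \<xi>' where "\<xi>' = (PC F c' b \<star>\<^bsub>B\<^esub> id2 B l) \<bullet>\<^bsub>B\<^esub> (id2 B (P1 F c') \<star>\<^bsub>B\<^esub> \<psi>) \<bullet>\<^bsub>B\<^esub> \<omega>'"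
    have mp': "slice_comp A B F m' p = (?J, (Z, h), (c' \<odot>\<^bsub>A\<^esub> b, \<xi>'))"
      by (simp add: m' p \<xi>'_def slice_comp_def)
    have mp'_in: "(?J, (Z, h), (c' \<odot>\<^bsub>A\<^esub> b, \<xi>')) \<in> hom1 ?K ?J (Z, h)"
      unfolding \<xi>'_def using slice_comp_in[OF pqm'(1)] m'_in[unfolded PQ m'] by blast
    then have cb': "c' \<odot>\<^bsub>A\<^esub> b \<in> hom1 A X Z" and \<xi>': "\<xi>' \<in> hom2 B h (P1 F (c' \<odot>\<^bsub>A\<^esub> b) \<odot>\<^bsub>B\<^esub> l)" "invertible (Vert B) \<xi>'"
      by (auto simp: slice_hom1_iff)
    obtain x where x: "\<chi> = (q, slice_comp A B F m p, x)" "x \<in> hom2 A d (c \<odot>\<^bsub>A\<^esub> b)"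
      "(P2 F x \<star>\<^bsub>B\<^esub> id2 B l) \<bullet>\<^bsub>B\<^esub> \<phi> = \<xi>"
      using \<chi>(1) unfolding slice_simps mp q slice_hom2_iff[OF pqm'(2) mp_in] by auto
    obtain x' where x': "\<chi>' = (q, slice_comp A B F m' p, x')" "x' \<in> hom2 A d (c' \<odot>\<^bsub>A\<^esub> b)"
      "(P2 F x' \<star>\<^bsub>B\<^esub> id2 B l) \<bullet>\<^bsub>B\<^esub> \<phi> = \<xi>'"
      using \<chi>'(1) unfolding slice_simps mp' q slice_hom2_iff[OF pqm'(2) mp'_in] by auto
    obtain \<beta> where \<beta>: "\<mu> = (m, m', \<beta>)" "\<beta> \<in> hom2 A c c'" "(P2 F \<beta> \<star>\<^bsub>B\<^esub> id2 B k) \<bullet>\<^bsub>B\<^esub> \<omega> = \<omega>'"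
      using \<mu> unfolding m m' slice_hom2_iff[OF pqm'(3)[unfolded m] m'_in[unfolded PQ m']] by auto
    have mor [simp]: "b \<in> Mor A" "Src A b = X" "Trg A b = Y" "l \<in> Mor B" "Trg B l = PO F X" "Src B l = W"
      "c \<in> Mor A" "Src A c = Y" "Trg A c = Z" "c' \<in> Mor A" "Src A c' = Y" "Trg A c' = Z"
      "d \<in> Mor A" "Src A d = X" "Trg A d = Z"
      using b c c' d l by (auto simp: hom1_def)
    have cell [simp]: "\<beta> \<in> Cell A" "Dom (Vert A) \<beta> = c" "Cod (Vert A) \<beta> = c'"
      "x \<in> Cell A" "Dom (Vert A) x = d" "Cod (Vert A) x = c \<odot>\<^bsub>A\<^esub> b"
      "x' \<in> Cell A" "Dom (Vert A) x' = d" "Cod (Vert A) x' = c' \<odot>\<^bsub>A\<^esub> b"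
      "\<psi> \<in> Cell B" "Dom (Vert B) \<psi> = k" "Cod (Vert B) \<psi> = P1 F b \<odot>\<^bsub>B\<^esub> l"
      "\<omega> \<in> Cell B" "Dom (Vert B) \<omega> = h" "Cod (Vert B) \<omega> = P1 F c \<odot>\<^bsub>B\<^esub> k"
      "\<phi> \<in> Cell B" "Dom (Vert B) \<phi> = h" "Cod (Vert B) \<phi> = P1 F d \<odot>\<^bsub>B\<^esub> l"
      "\<xi> \<in> Cell B" "Dom (Vert B) \<xi> = h" "Cod (Vert B) \<xi> = P1 F (c \<odot>\<^bsub>A\<^esub> b) \<odot>\<^bsub>B\<^esub> l"
      "\<xi>' \<in> Cell B" "Dom (Vert B) \<xi>' = h" "Cod (Vert B) \<xi>' = P1 F (c' \<odot>\<^bsub>A\<^esub> b) \<odot>\<^bsub>B\<^esub> l"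
      using \<beta>(2) x(2) x'(2) \<psi> \<omega> \<phi> \<xi> \<xi>' by (simp_all add: hom_def)
    have km [simp]: "k \<in> Mor B" "Src B k = W" "Trg B k = PO F Y"
      using pqm'(1) unfolding slice_hom1_iff by (auto simp: hom1_def)
    have e1: "(P2 F (\<beta> \<star>\<^bsub>A\<^esub> id2 A b) \<star>\<^bsub>B\<^esub> id2 B l) \<bullet>\<^bsub>B\<^esub> (PC F c b \<star>\<^bsub>B\<^esub> id2 B l) =
        (PC F c' b \<star>\<^bsub>B\<^esub> id2 B l) \<bullet>\<^bsub>B\<^esub> (P2 F \<beta> \<star>\<^bsub>B\<^esub> id2 B (P1 F b \<odot>\<^bsub>B\<^esub> l))"
    proof -
      have "(P2 F (\<beta> \<star>\<^bsub>A\<^esub> id2 A b) \<star>\<^bsub>B\<^esub> id2 B l) \<bullet>\<^bsub>B\<^esub> (PC F c b \<star>\<^bsub>B\<^esub> id2 B l) =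
          (P2 F (\<beta> \<star>\<^bsub>A\<^esub> id2 A b) \<bullet>\<^bsub>B\<^esub> PC F c b) \<star>\<^bsub>B\<^esub> id2 B l"
        by simp
      also have "\<dots> = (PC F c' b \<bullet>\<^bsub>B\<^esub> (P2 F \<beta> \<star>\<^bsub>B\<^esub> id2 B (P1 F b))) \<star>\<^bsub>B\<^esub> id2 B l"
        using pc_natural[of "id2 A b" \<beta>] by simp
      finally show ?thesis by simp
    qed
    have e2: "(P2 F \<beta> \<star>\<^bsub>B\<^esub> id2 B (P1 F b \<odot>\<^bsub>B\<^esub> l)) \<bullet>\<^bsub>B\<^esub> (id2 B (P1 F c) \<star>\<^bsub>B\<^esub> \<psi>) =
        (id2 B (P1 F c') \<star>\<^bsub>B\<^esub> \<psi>) \<bullet>\<^bsub>B\<^esub> (P2 F \<beta> \<star>\<^bsub>B\<^esub> id2 B k)"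
      using B.whisker_exchange[of \<psi> "P2 F \<beta>"] by simp
    have "(P2 F (\<beta> \<star>\<^bsub>A\<^esub> id2 A b) \<star>\<^bsub>B\<^esub> id2 B l) \<bullet>\<^bsub>B\<^esub> \<xi> =
        ((P2 F (\<beta> \<star>\<^bsub>A\<^esub> id2 A b) \<star>\<^bsub>B\<^esub> id2 B l) \<bullet>\<^bsub>B\<^esub> (PC F c b \<star>\<^bsub>B\<^esub> id2 B l)) \<bullet>\<^bsub>B\<^esub> (id2 B (P1 F c) \<star>\<^bsub>B\<^esub> \<psi>) \<bullet>\<^bsub>B\<^esub> \<omega>"
      by (simp add: \<xi>_def)
    also have "\<dots> = (PC F c' b \<star>\<^bsub>B\<^esub> id2 B l) \<bullet>\<^bsub>B\<^esub> ((P2 F \<beta> \<star>\<^bsub>B\<^esub> id2 B (P1 F b \<odot>\<^bsub>B\<^esub> l)) \<bullet>\<^bsub>B\<^esub> (id2 B (P1 F c) \<star>\<^bsub>B\<^esub> \<psi>)) \<bullet>\<^bsub>B\<^esub> \<omega>"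
      unfolding e1 by simp
    also have "\<dots> = (PC F c' b \<star>\<^bsub>B\<^esub> id2 B l) \<bullet>\<^bsub>B\<^esub> (id2 B (P1 F c') \<star>\<^bsub>B\<^esub> \<psi>) \<bullet>\<^bsub>B\<^esub> (P2 F \<beta> \<star>\<^bsub>B\<^esub> id2 B k) \<bullet>\<^bsub>B\<^esub> \<omega>"
      unfolding e2 by simp
    also have "\<dots> = \<xi>'"
      by (simp add: \<xi>'_def \<beta>(3))
    finally have transport: "(P2 F (\<beta> \<star>\<^bsub>A\<^esub> id2 A b) \<star>\<^bsub>B\<^esub> id2 B l) \<bullet>\<^bsub>B\<^esub> \<xi> = \<xi>'" .
    \<comment> \<open>Both sides of the pasting condition have the same invertible image, so they are equal.\<close>
    let ?y = "(\<beta> \<star>\<^bsub>A\<^esub> id2 A b) \<bullet>\<^bsub>A\<^esub> x"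
    have "(P2 F ?y \<star>\<^bsub>B\<^esub> id2 B l) \<bullet>\<^bsub>B\<^esub> \<phi> = (P2 F x' \<star>\<^bsub>B\<^esub> id2 B l) \<bullet>\<^bsub>B\<^esub> \<phi>"
      using transport x(3) x'(3) by simp
    then have same: "P2 F ?y \<star>\<^bsub>B\<^esub> id2 B l = P2 F x' \<star>\<^bsub>B\<^esub> id2 B l"
      using \<phi>(2) by (intro B.V.invertible_cancel_right[of \<phi> "P2 F ?y \<star>\<^bsub>B\<^esub> id2 B l" "P2 F x' \<star>\<^bsub>B\<^esub> id2 B l"]) auto
    have "P2 F x' \<star>\<^bsub>B\<^esub> id2 B l = ((P2 F x' \<star>\<^bsub>B\<^esub> id2 B l) \<bullet>\<^bsub>B\<^esub> \<phi>) \<bullet>\<^bsub>B\<^esub> B.V.inv_of \<phi>"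
      using \<phi>(2) by simp
    then have "invertible (Vert B) (P2 F x' \<star>\<^bsub>B\<^esub> id2 B l)"
      unfolding x'(3) using \<phi>(2) \<xi>'(2) by simp
    moreover have "P2 F x' \<star>\<^bsub>B\<^esub> id2 B l \<in> hom2 B (P1 F d \<odot>\<^bsub>B\<^esub> l) (P1 F (c' \<odot>\<^bsub>A\<^esub> b) \<odot>\<^bsub>B\<^esub> l)"
      by (simp add: hom_def)
    ultimately obtain z where
      z: "\<forall>f' \<in> hom2 A d (c' \<odot>\<^bsub>A\<^esub> b). P2 F f' \<star>\<^bsub>B\<^esub> id2 B l = P2 F x' \<star>\<^bsub>B\<^esub> id2 B l \<longrightarrow> f' = z"
      using lift[OF d cb'] by blast
    have "?y \<in> hom2 A d (c' \<odot>\<^bsub>A\<^esub> b)"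
      by (simp add: hom_def)
    then have "?y = x'"
      using z same x'(2) by blast
    then show "(\<mu> \<star>\<^bsub>?K\<^esub> id2 ?K p) \<bullet>\<^bsub>?K\<^esub> \<chi> = \<chi>'"
      by (simp add: \<beta>(1) x(1) x'(1)) (simp add: p)
  qed
qed

end

section \<open>The 2-category of arrows\<close>

lemma Ar2_simps [simp]:
  "Ob (Ar2 A) = Ob A" "Vert (Ar2 A) = arrow_cat (Vert A)"
  "Src (Ar2 A) \<alpha> = Src A (Dom (Vert A) \<alpha>)" "Trg (Ar2 A) \<alpha> = Trg A (Dom (Vert A) \<alpha>)"
  "Unit (Ar2 A) x = id2 A (Unit A x)" "HC1 (Ar2 A) = HC2 A"
  "HC2 (Ar2 A) (\<beta>, \<beta>', (u, v)) (\<alpha>, \<alpha>', (s, t)) =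
    (HC2 A \<beta> \<alpha>, HC2 A \<beta>' \<alpha>', (HC2 A u s, HC2 A v t))"
  by (simp_all add: Ar2_def)

context two_category
begin

text \<open>The sides of a square are 2-morphisms and hence preserve source and target; this lets the
source and target of a 1-morphism of \<open>Ar2 A\<close> be read off from any corner.\<close>

lemma square_boundaries:
  assumes "(\<alpha>, \<beta>, (s, t)) \<in> Arr (arrow_cat (Vert A))"
  shows "Src A (Dom (Vert A) \<beta>) = Src A (Dom (Vert A) \<alpha>)" "Trg A (Dom (Vert A) \<beta>) = Trg A (Dom (Vert A) \<alpha>)"
  using assms src_cod[of s] trg_cod[of s] by simp_all

lemma square_HC2:
  assumes p: "(\<alpha>, \<alpha>', (s, t)) \<in> Arr (arrow_cat (Vert A))" and q: "(\<beta>, \<beta>', (u, v)) \<in> Arr (arrow_cat (Vert A))"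
    and "Trg A (Dom (Vert A) \<alpha>) = Src A (Dom (Vert A) \<beta>)"
  shows "(\<beta> \<star> \<alpha>, \<beta>' \<star> \<alpha>', (u \<star> s, v \<star> t)) \<in> Arr (arrow_cat (Vert A))"
proof -
  note b = square_boundaries[OF p] square_boundaries[OF q]
  have "(v \<star> t) \<bullet>\<^bsub>A\<^esub> (\<beta> \<star> \<alpha>) = (v \<bullet>\<^bsub>A\<^esub> \<beta>) \<star> (t \<bullet>\<^bsub>A\<^esub> \<alpha>)"
    by (rule HC2_vcomp[symmetric]) (use assms b in simp_all)
  also have "\<dots> = (\<beta>' \<bullet>\<^bsub>A\<^esub> u) \<star> (\<alpha>' \<bullet>\<^bsub>A\<^esub> s)"
    using p q by simp
  also have "\<dots> = (\<beta>' \<star> \<alpha>') \<bullet>\<^bsub>A\<^esub> (u \<star> s)"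
    by (rule HC2_vcomp) (use assms b in simp_all)
  finally show ?thesis
    using assms b by simp
qed

lemma two_category_Ar2: "two_category (Ar2 A)"
proof (rule two_category.intro)
  have hom2E: thesis if "p \<in> hom (arrow_cat (Vert A)) \<alpha> \<beta>" "\<And>s t. p = (\<alpha>, \<beta>, (s, t)) \<Longrightarrow>
      (\<alpha>, \<beta>, (s, t)) \<in> Arr (arrow_cat (Vert A)) \<Longrightarrow> thesis" for p \<alpha> \<beta> thesis
    using that by (cases p rule: arrow_cat_cases) (auto simp: hom_def)
  show "category (Vert (Ar2 A))"
    by (simp add: V.category_arrow_cat)
  show "Src (Ar2 A) f \<in> Ob (Ar2 A)" "Trg (Ar2 A) f \<in> Ob (Ar2 A)" if "f \<in> Mor (Ar2 A)" for f
    using that by simp_all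
  show "Src (Ar2 A) f = Src (Ar2 A) g" "Trg (Ar2 A) f = Trg (Ar2 A) g" if "\<alpha> \<in> hom2 (Ar2 A) f g" for \<alpha> f g
    using that unfolding Ar2_simps by (metis hom2E square_boundaries)+
  show "Unit (Ar2 A) x \<in> hom1 (Ar2 A) x x" if "x \<in> Ob (Ar2 A)" for x
    using that by (auto simp: hom1_def)
  show "g \<odot>\<^bsub>Ar2 A\<^esub> f \<in> hom1 (Ar2 A) x z" if "f \<in> hom1 (Ar2 A) x y" "g \<in> hom1 (Ar2 A) y z" for f g x y z
    using that by (auto simp: hom1_def)
  show "\<beta> \<star>\<^bsub>Ar2 A\<^esub> \<alpha> \<in> hom2 (Ar2 A) (g \<odot>\<^bsub>Ar2 A\<^esub> f) (g' \<odot>\<^bsub>Ar2 A\<^esub> f')"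
    if f: "f \<in> hom1 (Ar2 A) x y" "g \<in> hom1 (Ar2 A) y z" and cells: "\<alpha> \<in> hom2 (Ar2 A) f f'" "\<beta> \<in> hom2 (Ar2 A) g g'"
    for f g f' g' \<alpha> \<beta> x y z
  proof -
    obtain a1 a2 b1 b2 where
      ab: "\<alpha> = (f, f', (a1, a2))" "\<beta> = (g, g', (b1, b2))"
      and sq: "(f, f', (a1, a2)) \<in> Arr (arrow_cat (Vert A))" "(g, g', (b1, b2)) \<in> Arr (arrow_cat (Vert A))"
      using cells[unfolded Ar2_simps] by (metis hom2E)
    show ?thesis
      using square_HC2[OF sq] f by (simp add: ab hom_def hom1_def del: arrow_cat_Arr)
  qed
  show "f \<odot>\<^bsub>Ar2 A\<^esub> Unit (Ar2 A) x = f" "Unit (Ar2 A) y \<odot>\<^bsub>Ar2 A\<^esub> f = f"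
    if "f \<in> hom1 (Ar2 A) x y" for f x y
    using that by (auto simp: hom1_def)
  show "(h \<odot>\<^bsub>Ar2 A\<^esub> g) \<odot>\<^bsub>Ar2 A\<^esub> f = h \<odot>\<^bsub>Ar2 A\<^esub> (g \<odot>\<^bsub>Ar2 A\<^esub> f)"
    if "f \<in> hom1 (Ar2 A) w x" "g \<in> hom1 (Ar2 A) x y" "h \<in> hom1 (Ar2 A) y z" for f g h w x y z
    using that by (auto simp: hom1_def)
  show "\<alpha> \<star>\<^bsub>Ar2 A\<^esub> id2 (Ar2 A) (Unit (Ar2 A) x) = \<alpha>" "id2 (Ar2 A) (Unit (Ar2 A) y) \<star>\<^bsub>Ar2 A\<^esub> \<alpha> = \<alpha>"
    if f: "f \<in> hom1 (Ar2 A) x y" and cell: "\<alpha> \<in> hom2 (Ar2 A) f f'" for f f' \<alpha> x y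
  proof -
    obtain s t where st: "\<alpha> = (f, f', (s, t))" and sq: "(f, f', (s, t)) \<in> Arr (arrow_cat (Vert A))"
      using cell[unfolded Ar2_simps] by (metis hom2E)
    show "\<alpha> \<star>\<^bsub>Ar2 A\<^esub> id2 (Ar2 A) (Unit (Ar2 A) x) = \<alpha>" "id2 (Ar2 A) (Unit (Ar2 A) y) \<star>\<^bsub>Ar2 A\<^esub> \<alpha> = \<alpha>"
      using f sq square_boundaries[OF sq] by (auto simp: st hom1_def)
  qed
  show "(\<gamma> \<star>\<^bsub>Ar2 A\<^esub> \<beta>) \<star>\<^bsub>Ar2 A\<^esub> \<alpha> = \<gamma> \<star>\<^bsub>Ar2 A\<^esub> (\<beta> \<star>\<^bsub>Ar2 A\<^esub> \<alpha>)"
    if f: "f \<in> hom1 (Ar2 A) w x" "g \<in> hom1 (Ar2 A) x y" "h \<in> hom1 (Ar2 A) y z"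
    and cells: "\<alpha> \<in> hom2 (Ar2 A) f f'" "\<beta> \<in> hom2 (Ar2 A) g g'" "\<gamma> \<in> hom2 (Ar2 A) h h'"
    for f g h f' g' h' \<alpha> \<beta> \<gamma> w x y z
  proof -
    obtain a1 a2 b1 b2 c1 c2 where
      abc: "\<alpha> = (f, f', (a1, a2))" "\<beta> = (g, g', (b1, b2))" "\<gamma> = (h, h', (c1, c2))"
      and sq: "(f, f', (a1, a2)) \<in> Arr (arrow_cat (Vert A))" "(g, g', (b1, b2)) \<in> Arr (arrow_cat (Vert A))"
        "(h, h', (c1, c2)) \<in> Arr (arrow_cat (Vert A))"
      using cells[unfolded Ar2_simps] by (metis hom2E)
    show ?thesis
      using f sq sq[THEN square_boundaries(1)] sq[THEN square_boundaries(2)] by (simp add: abc hom1_def)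
  qed
  show "id2 (Ar2 A) g \<star>\<^bsub>Ar2 A\<^esub> id2 (Ar2 A) f = id2 (Ar2 A) (g \<odot>\<^bsub>Ar2 A\<^esub> f)"
    if "f \<in> hom1 (Ar2 A) x y" "g \<in> hom1 (Ar2 A) y z" for f g x y z
    using that by (auto simp: hom1_def)
  show "(\<beta>' \<bullet>\<^bsub>Ar2 A\<^esub> \<beta>) \<star>\<^bsub>Ar2 A\<^esub> (\<alpha>' \<bullet>\<^bsub>Ar2 A\<^esub> \<alpha>) = (\<beta>' \<star>\<^bsub>Ar2 A\<^esub> \<alpha>') \<bullet>\<^bsub>Ar2 A\<^esub> (\<beta> \<star>\<^bsub>Ar2 A\<^esub> \<alpha>)"
    if f: "f \<in> hom1 (Ar2 A) x y" "g \<in> hom1 (Ar2 A) y z"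
    and cells: "\<alpha> \<in> hom2 (Ar2 A) f f'" "\<alpha>' \<in> hom2 (Ar2 A) f' f''" "\<beta> \<in> hom2 (Ar2 A) g g'" "\<beta>' \<in> hom2 (Ar2 A) g' g''"
    for f g f' g' f'' g'' \<alpha> \<alpha>' \<beta> \<beta>' x y z
  proof -
    obtain a1 a2 a1' a2' b1 b2 b1' b2' where
      abc: "\<alpha> = (f, f', (a1, a2))" "\<alpha>' = (f', f'', (a1', a2'))" "\<beta> = (g, g', (b1, b2))" "\<beta>' = (g', g'', (b1', b2'))"
      and sq: "(f, f', (a1, a2)) \<in> Arr (arrow_cat (Vert A))" "(f', f'', (a1', a2')) \<in> Arr (arrow_cat (Vert A))"
        "(g, g', (b1, b2)) \<in> Arr (arrow_cat (Vert A))" "(g', g'', (b1', b2')) \<in> Arr (arrow_cat (Vert A))"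
      using cells[unfolded Ar2_simps] by (metis hom2E)
    show ?thesis
      using f sq sq[THEN square_boundaries(1)] sq[THEN square_boundaries(2)] by (simp add: abc hom1_def HC2_vcomp)
  qed
qed

text \<open>This equality makes the results on arrow categories applicable to \<open>Ar2\<close>.\<close>

lemma hom_cat_Ar2: "hom_cat (Ar2 A) x y = arrow_cat (hom_cat A x y)"
proof -
  have "{p \<in> Arr (arrow_cat (Vert A)). asrc p \<in> hom1 (Ar2 A) x y} = Arr (arrow_cat (hom_cat A x y))"
  proof (intro set_eqI)
    fix p
    show "p \<in> {p \<in> Arr (arrow_cat (Vert A)). asrc p \<in> hom1 (Ar2 A) x y} \<longleftrightarrow> p \<in> Arr (arrow_cat (hom_cat A x y))"
    proof (cases p rule: arrow_cat_cases)
      fix \<alpha> \<beta> s t assume p: "p = (\<alpha>, \<beta>, (s, t))"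
      show ?thesis
      proof
        assume *: "p \<in> {p \<in> Arr (arrow_cat (Vert A)). asrc p \<in> hom1 (Ar2 A) x y}"
        then have "(\<alpha>, \<beta>, (s, t)) \<in> Arr (arrow_cat (Vert A))"
          by (simp add: p)
        from square_boundaries[OF this] * show "p \<in> Arr (arrow_cat (hom_cat A x y))"
          by (simp add: p hom_cat_simps hom1_def)
      next
        assume "p \<in> Arr (arrow_cat (hom_cat A x y))"
        then show "p \<in> {p \<in> Arr (arrow_cat (Vert A)). asrc p \<in> hom1 (Ar2 A) x y}"
          by (simp add: p hom_cat_simps hom1_def)
      qed
    qed
  qed
  then show ?thesis
    by (auto simp: hom_cat_def arrow_cat_def hom1_def)
qed

end

context pseudofunctor
begin

text \<open>A pair of compositors is a square by naturality of the compositor; all axioms then hold in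
each component.\<close>

lemma normal_pseudofunctor_Ar2: "normal_pseudofunctor (Ar2 A) (Ar2 B) (Ar2_psfun A B F)"
proof -
  have [simp]: "PO (Ar2_psfun A B F) = PO F" "P1 (Ar2_psfun A B F) = P2 F"
    "P2 (Ar2_psfun A B F) (\<alpha>, \<beta>, (s, t)) = (P2 F \<alpha>, P2 F \<beta>, (P2 F s, P2 F t))"
    "PC (Ar2_psfun A B F) \<beta> \<alpha> = (P2 F \<beta> \<star>\<^bsub>B\<^esub> P2 F \<alpha>, P2 F (\<beta> \<star>\<^bsub>A\<^esub> \<alpha>),
      (PC F (Dom (Vert A) \<beta>) (Dom (Vert A) \<alpha>), PC F (Cod (Vert A) \<beta>) (Cod (Vert A) \<alpha>)))" for \<alpha> \<beta> s t
    by (simp_all add: Ar2_psfun_def)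
  show ?thesis
  proof (rule normal_pseudofunctorI[OF A.two_category_Ar2 B.two_category_Ar2])
    fix \<alpha> assume "\<alpha> \<in> Cell (Ar2 A)"
    then show "P2 (Ar2_psfun A B F) \<alpha> \<in> Cell (Ar2 B) \<and>
        Dom (Vert (Ar2 B)) (P2 (Ar2_psfun A B F) \<alpha>) = P1 (Ar2_psfun A B F) (Dom (Vert (Ar2 A)) \<alpha>) \<and>
        Cod (Vert (Ar2 B)) (P2 (Ar2_psfun A B F) \<alpha>) = P1 (Ar2_psfun A B F) (Cod (Vert (Ar2 A)) \<alpha>)"
      by (cases \<alpha> rule: arrow_cat_cases) (auto simp flip: p2_comp)
  next
    fix \<alpha> \<beta> assume "\<alpha> \<in> Cell (Ar2 A)" "\<beta> \<in> Cell (Ar2 A)" "Cod (Vert (Ar2 A)) \<alpha> = Dom (Vert (Ar2 A)) \<beta>"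
    then show "P2 (Ar2_psfun A B F) (\<beta> \<bullet>\<^bsub>Ar2 A\<^esub> \<alpha>) = P2 (Ar2_psfun A B F) \<beta> \<bullet>\<^bsub>Ar2 B\<^esub> P2 (Ar2_psfun A B F) \<alpha>"
      by (cases \<alpha> rule: arrow_cat_cases; cases \<beta> rule: arrow_cat_cases) auto
  next
    fix \<alpha> \<beta> assume \<alpha>\<beta>: "\<alpha> \<in> Mor (Ar2 A)" "\<beta> \<in> Mor (Ar2 A)" "Trg (Ar2 A) \<alpha> = Src (Ar2 A) \<beta>"
    then show "PC (Ar2_psfun A B F) \<beta> \<alpha> \<in> Cell (Ar2 B) \<and>
        Dom (Vert (Ar2 B)) (PC (Ar2_psfun A B F) \<beta> \<alpha>) = P1 (Ar2_psfun A B F) \<beta> \<odot>\<^bsub>Ar2 B\<^esub> P1 (Ar2_psfun A B F) \<alpha> \<and>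
        Cod (Vert (Ar2 B)) (PC (Ar2_psfun A B F) \<beta> \<alpha>) = P1 (Ar2_psfun A B F) (\<beta> \<odot>\<^bsub>Ar2 A\<^esub> \<alpha>) \<and>
        invertible (Vert (Ar2 B)) (PC (Ar2_psfun A B F) \<beta> \<alpha>)"
      by (simp add: B.V.invertible_arrow_cat pc_natural)
  next
    fix \<alpha> \<beta> assume "\<alpha> \<in> Cell (Ar2 A)" "\<beta> \<in> Cell (Ar2 A)"
      and t: "Trg (Ar2 A) (Dom (Vert (Ar2 A)) \<alpha>) = Src (Ar2 A) (Dom (Vert (Ar2 A)) \<beta>)"
    moreover obtain a a' a1 a2 b b' b1 b2 where ab: "\<alpha> = (a, a', (a1, a2))" "\<beta> = (b, b', (b1, b2))"
      by (metis arrow_cat_cases)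
    ultimately have sq: "(a, a', (a1, a2)) \<in> Arr (arrow_cat (Vert A))" "(b, b', (b1, b2)) \<in> Arr (arrow_cat (Vert A))"
      by auto
    show "PC (Ar2_psfun A B F) (Cod (Vert (Ar2 A)) \<beta>) (Cod (Vert (Ar2 A)) \<alpha>) \<bullet>\<^bsub>Ar2 B\<^esub>
        (P2 (Ar2_psfun A B F) \<beta> \<star>\<^bsub>Ar2 B\<^esub> P2 (Ar2_psfun A B F) \<alpha>) =
        P2 (Ar2_psfun A B F) (\<beta> \<star>\<^bsub>Ar2 A\<^esub> \<alpha>) \<bullet>\<^bsub>Ar2 B\<^esub>
        PC (Ar2_psfun A B F) (Dom (Vert (Ar2 A)) \<beta>) (Dom (Vert (Ar2 A)) \<alpha>)"
      using t sq pc_natural[of a1 b1] pc_natural[of a2 b2] by (simp add: ab)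
  next
    fix a b c assume "a \<in> Mor (Ar2 A)" "b \<in> Mor (Ar2 A)" "c \<in> Mor (Ar2 A)"
      "Trg (Ar2 A) a = Src (Ar2 A) b" "Trg (Ar2 A) b = Src (Ar2 A) c"
    then show "PC (Ar2_psfun A B F) c (b \<odot>\<^bsub>Ar2 A\<^esub> a) \<bullet>\<^bsub>Ar2 B\<^esub>
        (id2 (Ar2 B) (P1 (Ar2_psfun A B F) c) \<star>\<^bsub>Ar2 B\<^esub> PC (Ar2_psfun A B F) b a) =
        PC (Ar2_psfun A B F) (c \<odot>\<^bsub>Ar2 A\<^esub> b) a \<bullet>\<^bsub>Ar2 B\<^esub>
        (PC (Ar2_psfun A B F) c b \<star>\<^bsub>Ar2 B\<^esub> id2 (Ar2 B) (P1 (Ar2_psfun A B F) a))"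
      by (simp add: pc_assoc)
  qed auto
qed

lemma eval_functor_Ar2:
  assumes "l \<in> Mor B"
  shows "eval_functor (Ar2 B) (Ar2_psfun A B F) (id2 B l) = arrow_functor (eval_functor B F l)"
  using assms unfolding eval_functor_def arrow_functor_def
  by (auto simp: Ar2_psfun_def fun_eq_iff)

text \<open>Evaluation at \<open>id2 B l\<close> is the functor induced on arrow categories by evaluation at \<open>l\<close>. So
the characterisation of bi-initial objects of pseudo-slices, applied to \<open>Ar2_psfun\<close>, asks exactly for what
makes the latter an equivalence.\<close>

theorem bi_initial_slice_Ar2_iff:
  assumes l: "l \<in> hom1 B W (PO F X)"
  shows "bi_initial (slice (Ar2 A) (Ar2 B) (Ar2_psfun A B F) W) (X, id2 B l) \<longleftrightarrow> X \<in> Ob A \<and>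
    (\<forall>Y \<in> Ob A. fully_faithful (hom_cat A X Y) (hom_cat B W (PO F Y)) (eval_functor B F l) \<and>
      ess_surjective (hom_cat A X Y) (hom_cat B W (PO F Y)) (eval_functor B F l))"
proof -
  interpret R: pseudofunctor "Ar2 A" "Ar2 B" "Ar2_psfun A B F"
    by (intro pseudofunctor.intro pseudofunctor_axioms.intro A.two_category_Ar2 B.two_category_Ar2
        normal_pseudofunctor_Ar2)
  have [simp]: "PO (Ar2_psfun A B F) = PO F"
    by (simp add: Ar2_psfun_def)
  have "l \<in> Mor B" "id2 B l \<in> hom1 (Ar2 B) W (PO F X)"
    using l by (auto simp: hom1_def)
  moreover have "iso_lifting (hom_cat (Ar2 A) X Y) (hom_cat (Ar2 B) W (PO F Y)) (arrow_functor (eval_functor B F l)) \<and>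
      ess_surjective (hom_cat (Ar2 A) X Y) (hom_cat (Ar2 B) W (PO F Y)) (arrow_functor (eval_functor B F l)) \<longleftrightarrow>
      fully_faithful (hom_cat A X Y) (hom_cat B W (PO F Y)) (eval_functor B F l) \<and>
      ess_surjective (hom_cat A X Y) (hom_cat B W (PO F Y)) (eval_functor B F l)"
    if "X \<in> Ob A" "Y \<in> Ob A" for Y
    unfolding A.hom_cat_Ar2 B.hom_cat_Ar2
    by (rule cat_functor.arrow_functor_equivalence_iff[OF eval_functor[OF that l]])
  ultimately show ?thesis
    unfolding R.bi_initial_slice_iff by (simp add: eval_functor_Ar2) blast
qed

theorem bi_initial_slice_if_Ar2:
  assumes l: "l \<in> hom1 B W (PO F X)"
    and bi: "bi_initial (slice (Ar2 A) (Ar2 B) (Ar2_psfun A B F) W) (X, id2 B l)"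
  shows "bi_initial (slice A B F W) (X, l)"
  using bi l cat_functor.fully_faithful_imp_iso_lifting[OF eval_functor]
  unfolding bi_initial_slice_Ar2_iff[OF l] bi_initial_slice_iff by blast

end

section \<open>Double bi-initial objects\<close>

text \<open>As for bi-initial objects, a square of \<open>J \<down>\<down> D\<close> is determined by its projection, and full
faithfulness on squares becomes the condition that every square of \<open>D\<close> satisfies the pasting
equation.\<close>

lemma double_bi_initial_iff:
  "double_bi_initial D J \<longleftrightarrow> J \<in> Obj (Hor D) \<and>
    (\<forall>P \<in> Obj (Hor D). \<exists>p. p \<in> hom (Hor D) J P) \<and>
    (\<forall>P \<in> Obj (Hor D). \<forall>Q \<in> Obj (Hor D). \<forall>p \<in> hom (Hor D) J P. \<forall>q \<in> hom (Hor D) J Q. \<forall>m \<in> hom (Hor D) P Q.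
      \<exists>\<psi> \<in> squares D q (m \<cdot>\<^bsub>Hor D\<^esub> p) (Ident (Ver D) J) (Ident (Ver D) Q). invertible (VSq D) \<psi>) \<and>
    (\<forall>v \<in> Arr (Ver D). \<exists>p \<in> hom (Hor D) J (Dom (Ver D) v). \<exists>q \<in> hom (Hor D) J (Cod (Ver D) v).
      \<exists>\<gamma>. \<gamma> \<in> squares D p q (Ident (Ver D) J) v) \<and>
    (\<forall>P P' Q Q'. \<forall>p \<in> hom (Hor D) J P. \<forall>p' \<in> hom (Hor D) J P'. \<forall>q \<in> hom (Hor D) J Q. \<forall>q' \<in> hom (Hor D) J Q'.
      \<forall>a \<in> hom (Hor D) P P'. \<forall>b \<in> hom (Hor D) Q Q'. \<forall>u \<in> hom (Ver D) P Q. \<forall>u' \<in> hom (Ver D) P' Q'.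
      \<forall>\<psi> \<in> squares D p' (a \<cdot>\<^bsub>Hor D\<^esub> p) (Ident (Ver D) J) (Ident (Ver D) P'). invertible (VSq D) \<psi> \<longrightarrow>
      (\<forall>\<phi> \<in> squares D q' (b \<cdot>\<^bsub>Hor D\<^esub> q) (Ident (Ver D) J) (Ident (Ver D) Q'). invertible (VSq D) \<phi> \<longrightarrow>
      (\<forall>\<gamma> \<in> squares D p q (Ident (Ver D) J) u. \<forall>\<gamma>' \<in> squares D p' q' (Ident (Ver D) J) u'.
      \<forall>\<alpha> \<in> squares D a b u u'. (\<alpha> \<cdot>\<^bsub>HSq D\<^esub> \<gamma>) \<cdot>\<^bsub>VSq D\<^esub> \<psi> = \<phi> \<cdot>\<^bsub>VSq D\<^esub> \<gamma>')))"
  (is "_ \<longleftrightarrow> ?J \<and> ?E \<and> ?F \<and> ?V \<and> ?U")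
proof -
  let ?S = "dbl_slice D J"
  have P [simp]: "DO dbl_slice_proj = fst" "DH dbl_slice_proj = (\<lambda>p. fst (adat p))"
    "DV dbl_slice_proj = (\<lambda>p. fst (adat p))" "DS dbl_slice_proj = sdat"
    by (simp_all add: dbl_slice_proj_def)
  have S: "Hor ?S = dbl_slice_Hor D J" "Ver ?S = dbl_slice_Ver D J"
    by (simp_all add: dbl_slice_def Let_def)
  have H: "Obj (dbl_slice_Hor D J) = {(x, f). x \<in> Obj (Hor D) \<and> f \<in> hom (Hor D) J x}"
    "Dom (dbl_slice_Hor D J) = asrc" "Cod (dbl_slice_Hor D J) = atrg"
    by (simp_all add: dbl_slice_Hor_def)
  have HA: "((x, f), (y, g), (a, \<psi>)) \<in> Arr (dbl_slice_Hor D J) \<longleftrightarrow>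
      f \<in> hom (Hor D) J x \<and> g \<in> hom (Hor D) J y \<and> a \<in> hom (Hor D) x y \<and>
      \<psi> \<in> squares D g (a \<cdot>\<^bsub>Hor D\<^esub> f) (Ident (Ver D) J) (Ident (Ver D) y) \<and> invertible (VSq D) \<psi>"
    for x f y g a \<psi> by (simp add: dbl_slice_Hor_def)
  have V: "Dom (dbl_slice_Ver D J) = asrc" "Cod (dbl_slice_Ver D J) = atrg"
    by (simp_all add: dbl_slice_Ver_def)
  have VA: "((x, f), (y, g), (u, \<gamma>)) \<in> Arr (dbl_slice_Ver D J) \<longleftrightarrow>
      f \<in> hom (Hor D) J x \<and> g \<in> hom (Hor D) J y \<and> u \<in> hom (Ver D) x y \<and> \<gamma> \<in> squares D f g (Ident (Ver D) J) u"
    for x f y g u \<gamma> by (simp add: dbl_slice_Ver_def)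
  have SD: "Dom (VSq ?S) = stop" "Cod (VSq ?S) = sbot" "Dom (HSq ?S) = sleft" "Cod (HSq ?S) = sright"
    "Arr (HSq ?S) = Arr (VSq ?S)"
    by (simp_all add: dbl_slice_def Let_def)
  have SA: "(((P, p), (P', p'), (a, \<psi>)), ((Q, q), (Q', q'), (b, \<phi>)), ((P, p), (Q, q), (u, \<gamma>)), ((P', p'), (Q', q'), (u', \<gamma>')), \<alpha>)
      \<in> Arr (VSq ?S) \<longleftrightarrow> ((P, p), (P', p'), (a, \<psi>)) \<in> Arr (dbl_slice_Hor D J) \<and> ((Q, q), (Q', q'), (b, \<phi>)) \<in> Arr (dbl_slice_Hor D J) \<and>
      ((P, p), (Q, q), (u, \<gamma>)) \<in> Arr (dbl_slice_Ver D J) \<and> ((P', p'), (Q', q'), (u', \<gamma>')) \<in> Arr (dbl_slice_Ver D J) \<and>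
      \<alpha> \<in> squares D a b u u' \<and> (\<alpha> \<cdot>\<^bsub>HSq D\<^esub> \<gamma>) \<cdot>\<^bsub>VSq D\<^esub> \<psi> = \<phi> \<cdot>\<^bsub>VSq D\<^esub> \<gamma>'"
    for P p P' p' a \<psi> Q q Q' q' b \<phi> u \<gamma> u' \<gamma>' \<alpha>
    by (simp add: dbl_slice_def Let_def)
  have Sq: "w \<in> squares ?S ((P, p), (P', p'), (a, \<psi>)) ((Q, q), (Q', q'), (b, \<phi>)) ((P, p), (Q, q), (u, \<gamma>)) ((P', p'), (Q', q'), (u', \<gamma>')) \<longleftrightarrow>
      (\<exists>\<alpha>. w = (((P, p), (P', p'), (a, \<psi>)), ((Q, q), (Q', q'), (b, \<phi>)), ((P, p), (Q, q), (u, \<gamma>)), ((P', p'), (Q', q'), (u', \<gamma>')), \<alpha>) \<and>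
        \<alpha> \<in> squares D a b u u' \<and> (\<alpha> \<cdot>\<^bsub>HSq D\<^esub> \<gamma>) \<cdot>\<^bsub>VSq D\<^esub> \<psi> = \<phi> \<cdot>\<^bsub>VSq D\<^esub> \<gamma>')"
    if "((P, p), (P', p'), (a, \<psi>)) \<in> Arr (dbl_slice_Hor D J)" "((Q, q), (Q', q'), (b, \<phi>)) \<in> Arr (dbl_slice_Hor D J)"
      "((P, p), (Q, q), (u, \<gamma>)) \<in> Arr (dbl_slice_Ver D J)" "((P', p'), (Q', q'), (u', \<gamma>')) \<in> Arr (dbl_slice_Ver D J)"
    for w P p P' p' a \<psi> Q q Q' q' b \<phi> u \<gamma> u' \<gamma>'
  proof -
    let ?t = "((P, p), (P', p'), (a, \<psi>))" and ?b = "((Q, q), (Q', q'), (b, \<phi>))"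
      and ?l = "((P, p), (Q, q), (u, \<gamma>))" and ?r = "((P', p'), (Q', q'), (u', \<gamma>'))"
    have "w \<in> squares ?S ?t ?b ?l ?r \<longleftrightarrow> (\<exists>\<alpha>. w = (?t, ?b, ?l, ?r, \<alpha>) \<and> (?t, ?b, ?l, ?r, \<alpha>) \<in> Arr (VSq ?S))"
      unfolding squares_def[of ?S] hom_def[of "HSq ?S"] hom_def[of "VSq ?S"] SD
      by (cases w) auto
    then show ?thesis
      unfolding SA using that by simp
  qed
  have E: "(\<forall>y \<in> Obj (Hor D). \<exists>x \<in> Obj (Hor ?S). DO dbl_slice_proj x = y) \<longleftrightarrow> ?E"
    unfolding S H P by (rule ball_cong[OF refl]) auto
  have F: "(\<forall>x \<in> Obj (Hor ?S). \<forall>x' \<in> Obj (Hor ?S). \<forall>g \<in> hom (Hor D) (DO dbl_slice_proj x) (DO dbl_slice_proj x').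
      \<exists>f \<in> hom (Hor ?S) x x'. DH dbl_slice_proj f = g) \<longleftrightarrow> ?F" (is "?L \<longleftrightarrow> _")
  proof
    assume L: ?L
    show ?F
    proof (intro ballI)
      fix P Q p q m
      assume *: "P \<in> Obj (Hor D)" "Q \<in> Obj (Hor D)" "p \<in> hom (Hor D) J P" "q \<in> hom (Hor D) J Q" "m \<in> hom (Hor D) P Q"
      then have "\<exists>f \<in> hom (dbl_slice_Hor D J) (P, p) (Q, q). fst (adat f) = m"
        by (intro L[unfolded S P, rule_format]) (auto simp: H)
      then obtain f where f: "f \<in> Arr (dbl_slice_Hor D J)" "asrc f = (P, p)" "atrg f = (Q, q)" "fst (adat f) = m"
        by (auto simp: hom_def[of "dbl_slice_Hor D J"] H simp del: split_paired_All split_paired_Ex)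
      obtain \<psi> where "f = ((P, p), (Q, q), (m, \<psi>))"
        using f by (metis prod.collapse)
      then show "\<exists>\<psi> \<in> squares D q (m \<cdot>\<^bsub>Hor D\<^esub> p) (Ident (Ver D) J) (Ident (Ver D) Q). invertible (VSq D) \<psi>"
        using f(1) HA by blast
    qed
  next
    assume F: ?F
    show ?L
      unfolding S P
    proof (intro ballI)
      fix x x' m assume x: "x \<in> Obj (dbl_slice_Hor D J)" "x' \<in> Obj (dbl_slice_Hor D J)" and m: "m \<in> hom (Hor D) (fst x) (fst x')"
      obtain P p Q q where xx: "x = (P, p)" "x' = (Q, q)"
        by (metis surj_pair)
      have *: "P \<in> Obj (Hor D)" "Q \<in> Obj (Hor D)" "p \<in> hom (Hor D) J P" "q \<in> hom (Hor D) J Q" "m \<in> hom (Hor D) P Q"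
        using x m by (auto simp: xx H)
      then obtain \<psi> where "\<psi> \<in> squares D q (m \<cdot>\<^bsub>Hor D\<^esub> p) (Ident (Ver D) J) (Ident (Ver D) Q)" "invertible (VSq D) \<psi>"
        using F by blast
      then have "((P, p), (Q, q), (m, \<psi>)) \<in> Arr (dbl_slice_Hor D J)"
        using * HA by blast
      then show "\<exists>f \<in> hom (dbl_slice_Hor D J) x x'. fst (adat f) = m"
        by (intro bexI[of _ "((P, p), (Q, q), (m, \<psi>))"]) (auto intro!: homI simp: H xx)
    qed
  qed
  have V': "(\<forall>v \<in> Arr (Ver D). \<exists>u \<in> Arr (Ver ?S). DV dbl_slice_proj u = v) \<longleftrightarrow> ?V"
    unfolding S P
  proof (rule ball_cong[OF refl])
    fix v assume v: "v \<in> Arr (Ver D)"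
    show "(\<exists>u \<in> Arr (dbl_slice_Ver D J). fst (adat u) = v) \<longleftrightarrow>
      (\<exists>p \<in> hom (Hor D) J (Dom (Ver D) v). \<exists>q \<in> hom (Hor D) J (Cod (Ver D) v). \<exists>\<gamma>. \<gamma> \<in> squares D p q (Ident (Ver D) J) v)"
    proof
      assume "\<exists>u \<in> Arr (dbl_slice_Ver D J). fst (adat u) = v"
      then obtain u where u: "u \<in> Arr (dbl_slice_Ver D J)" "fst (adat u) = v"
        by blast
      obtain P p Q q \<gamma> where "u = ((P, p), (Q, q), (v, \<gamma>))"
        using u(2) by (metis prod.collapse)
      then have "((P, p), (Q, q), (v, \<gamma>)) \<in> Arr (dbl_slice_Ver D J)"
        using u by simp
      then show "\<exists>p \<in> hom (Hor D) J (Dom (Ver D) v). \<exists>q \<in> hom (Hor D) J (Cod (Ver D) v). \<exists>\<gamma>. \<gamma> \<in> squares D p q (Ident (Ver D) J) v"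
        unfolding VA hom_def[of "Ver D"] by blast
    next
      assume "\<exists>p \<in> hom (Hor D) J (Dom (Ver D) v). \<exists>q \<in> hom (Hor D) J (Cod (Ver D) v). \<exists>\<gamma>. \<gamma> \<in> squares D p q (Ident (Ver D) J) v"
      then obtain p q \<gamma> where "((Dom (Ver D) v, p), (Cod (Ver D) v, q), (v, \<gamma>)) \<in> Arr (dbl_slice_Ver D J)"
        unfolding VA using v homI[of v "Ver D"] by blast
      then show "\<exists>u \<in> Arr (dbl_slice_Ver D J). fst (adat u) = v"
        by (rule bexI[rotated]) simp
    qed
  qed
  have U: "(\<forall>t b l r. square_boundary ?S t b l r \<longrightarrow>
      (\<forall>s \<in> squares D (DH dbl_slice_proj t) (DH dbl_slice_proj b) (DV dbl_slice_proj l) (DV dbl_slice_proj r).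
        \<exists>!w. w \<in> squares ?S t b l r \<and> DS dbl_slice_proj w = s)) \<longleftrightarrow> ?U" (is "?L \<longleftrightarrow> _")
  proof
    assume L: ?L
    show ?U
    proof (intro allI ballI impI)
      fix P P' Q Q' p p' q q' a b u u' \<psi> \<phi> \<gamma> \<gamma>' \<alpha>
      assume *: "p \<in> hom (Hor D) J P" "p' \<in> hom (Hor D) J P'" "q \<in> hom (Hor D) J Q" "q' \<in> hom (Hor D) J Q'"
        "a \<in> hom (Hor D) P P'" "b \<in> hom (Hor D) Q Q'" "u \<in> hom (Ver D) P Q" "u' \<in> hom (Ver D) P' Q'"
        "\<psi> \<in> squares D p' (a \<cdot>\<^bsub>Hor D\<^esub> p) (Ident (Ver D) J) (Ident (Ver D) P')" "invertible (VSq D) \<psi>"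
        "\<phi> \<in> squares D q' (b \<cdot>\<^bsub>Hor D\<^esub> q) (Ident (Ver D) J) (Ident (Ver D) Q')" "invertible (VSq D) \<phi>"
        "\<gamma> \<in> squares D p q (Ident (Ver D) J) u" "\<gamma>' \<in> squares D p' q' (Ident (Ver D) J) u'"
        "\<alpha> \<in> squares D a b u u'"
      let ?t = "((P, p), (P', p'), (a, \<psi>))" and ?b = "((Q, q), (Q', q'), (b, \<phi>))"
        and ?l = "((P, p), (Q, q), (u, \<gamma>))" and ?r = "((P', p'), (Q', q'), (u', \<gamma>'))"
      have t: "?t \<in> Arr (dbl_slice_Hor D J)" "?b \<in> Arr (dbl_slice_Hor D J)"
        "?l \<in> Arr (dbl_slice_Ver D J)" "?r \<in> Arr (dbl_slice_Ver D J)"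
        using * unfolding HA VA by blast+
      have "square_boundary ?S ?t ?b ?l ?r"
        unfolding square_boundary_def S H V using t by simp
      then have "\<exists>!w. w \<in> squares ?S ?t ?b ?l ?r \<and> DS dbl_slice_proj w = \<alpha>"
        using L[rule_format, of ?t ?b ?l ?r \<alpha>] *(15) by simp
      then show "(\<alpha> \<cdot>\<^bsub>HSq D\<^esub> \<gamma>) \<cdot>\<^bsub>VSq D\<^esub> \<psi> = \<phi> \<cdot>\<^bsub>VSq D\<^esub> \<gamma>'"
        unfolding Sq[OF t] P by (elim ex1E conjE exE) simp
    qed
  next
    assume U: ?U
    show ?L
    proof (intro allI impI ballI)
      fix t b l r s
      assume bd: "square_boundary ?S t b l r"
        and s: "s \<in> squares D (DH dbl_slice_proj t) (DH dbl_slice_proj b) (DV dbl_slice_proj l) (DV dbl_slice_proj r)"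
      obtain P p P' p' a \<psi> where t: "t = ((P, p), (P', p'), (a, \<psi>))" by (metis surj_pair)
      obtain Q q Q' q' b' \<phi> where b: "b = ((Q, q), (Q', q'), (b', \<phi>))" by (metis surj_pair)
      obtain u \<gamma> where l: "l = ((P, p), (Q, q), (u, \<gamma>))"
        using bd unfolding square_boundary_def S H V t b by (metis fst_conv snd_conv surj_pair)
      obtain u' \<gamma>' where r: "r = ((P', p'), (Q', q'), (u', \<gamma>'))"
        using bd unfolding square_boundary_def S H V t b by (metis fst_conv snd_conv surj_pair)
      have A: "((P, p), (P', p'), (a, \<psi>)) \<in> Arr (dbl_slice_Hor D J)" "((Q, q), (Q', q'), (b', \<phi>)) \<in> Arr (dbl_slice_Hor D J)"
        "((P, p), (Q, q), (u, \<gamma>)) \<in> Arr (dbl_slice_Ver D J)" "((P', p'), (Q', q'), (u', \<gamma>')) \<in> Arr (dbl_slice_Ver D J)"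
        using bd unfolding square_boundary_def S t b l r by blast+
      have s': "s \<in> squares D a b' u u'"
        using s by (simp add: t b l r)
      have "(s \<cdot>\<^bsub>HSq D\<^esub> \<gamma>) \<cdot>\<^bsub>VSq D\<^esub> \<psi> = \<phi> \<cdot>\<^bsub>VSq D\<^esub> \<gamma>'"
        by (rule U[rule_format, of p P p' P' q Q q' Q' a b' u u']) (use A s' in \<open>unfold HA VA, blast+\<close>)
      then show "\<exists>!w. w \<in> squares ?S t b l r \<and> DS dbl_slice_proj w = s"
        unfolding t b l r Sq[OF A] P using s'
        by (intro ex1I[of _ "(((P, p), (P', p'), (a, \<psi>)), ((Q, q), (Q', q'), (b', \<phi>)), ((P, p), (Q, q), (u, \<gamma>)),
            ((P', p'), (Q', q'), (u', \<gamma>')), s)"]) (simp, elim conjE exE, simp)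
    qed
  qed
  show ?thesis
    unfolding double_bi_initial_def double_trivial_fibration_def E F V' U ..
qed

lemma Hslice_simps:
  "Obj (Hor (Hslice B A G I)) = slice_obs B A G I"
  "hom (Hor (Hslice B A G I)) P Q = hom1 (slice B A G I) P Q"
  "Ident (Hor (Hslice B A G I)) = slice_unit B A"
  "Comp (Hor (Hslice B A G I)) = slice_comp B A G"
  "Dom (Ver (Hslice B A G I)) = asrc" "Cod (Ver (Hslice B A G I)) = atrg"
  "Ident (Ver (Hslice B A G I)) (x, f) = ((x, f), (x, f), id2 A f)"
  "Comp (Ver (Hslice B A G I)) (Q, R, \<theta>') (P, Q', \<theta>) = (P, R, \<theta>' \<bullet>\<^bsub>A\<^esub> \<theta>)"
  "Comp (HSq (Hslice B A G I)) (t', b', l', r', \<gamma>') (t, b, l, r, \<gamma>) =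
    (slice_comp B A G t' t, slice_comp B A G b' b, l, r', \<gamma>' \<star>\<^bsub>B\<^esub> \<gamma>)"
  "Dom (VSq (Hslice B A G I)) = stop" "Cod (VSq (Hslice B A G I)) = sbot"
  "Ident (VSq (Hslice B A G I)) (p, p', (c, \<psi>)) = ((p, p', (c, \<psi>)), (p, p', (c, \<psi>)),
    Ident (Ver (Hslice B A G I)) p, Ident (Ver (Hslice B A G I)) p', id2 B c)"
  by (simp_all add: Hslice_def Let_def hom_def hom1_def)

lemma Hslice_VSq_Comp:
  "Comp (VSq (Hslice B A G I)) (t', b', l', r', \<gamma>') (t, b, l, r, \<gamma>) =
    (t, b', Comp (Ver (Hslice B A G I)) l' l, Comp (Ver (Hslice B A G I)) r' r, \<gamma>' \<bullet>\<^bsub>B\<^esub> \<gamma>)"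
  by (simp add: Hslice_def Let_def)

lemma Hslice_Arr_Ver:
  "((x, f), (y, g), \<theta>) \<in> Arr (Ver (Hslice B A G I)) \<longleftrightarrow>
    (x, f) \<in> slice_obs B A G I \<and> (y, g) \<in> slice_obs B A G I \<and> x = y \<and> \<theta> \<in> hom2 A f g"
  by (auto simp: Hslice_def Let_def)

lemma Hslice_squares_iff:
  assumes "(p, p', (c, \<psi>)) \<in> hom1 (slice B A G I) p p'" "(q, q', (d, \<phi>)) \<in> hom1 (slice B A G I) q q'"
    "(p, q, \<theta>) \<in> Arr (Ver (Hslice B A G I))" "(p', q', \<theta>') \<in> Arr (Ver (Hslice B A G I))"
  shows "s \<in> squares (Hslice B A G I) (p, p', (c, \<psi>)) (q, q', (d, \<phi>)) (p, q, \<theta>) (p', q', \<theta>') \<longleftrightarrow>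
    (\<exists>\<gamma>. s = ((p, p', (c, \<psi>)), (q, q', (d, \<phi>)), (p, q, \<theta>), (p', q', \<theta>'), \<gamma>) \<and>
      \<gamma> \<in> hom2 B c d \<and> \<phi> \<bullet>\<^bsub>A\<^esub> \<theta>' = (P2 G \<gamma> \<star>\<^bsub>A\<^esub> \<theta>) \<bullet>\<^bsub>A\<^esub> \<psi>)"
proof -
  let ?D = "Hslice B A G I"
  let ?t = "(p, p', (c, \<psi>))" and ?b = "(q, q', (d, \<phi>))" and ?l = "(p, q, \<theta>)" and ?r = "(p', q', \<theta>')"
  have D: "Dom (VSq ?D) = stop" "Cod (VSq ?D) = sbot" "Dom (HSq ?D) = sleft" "Cod (HSq ?D) = sright"
    "Arr (HSq ?D) = Arr (VSq ?D)"
    by (simp_all add: Hslice_def Let_def)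
  have A: "(?t, ?b, ?l, ?r, \<gamma>) \<in> Arr (VSq ?D) \<longleftrightarrow> ?t \<in> slice_mors B A G I \<and> ?b \<in> slice_mors B A G I \<and>
      ?l \<in> Arr (Ver ?D) \<and> ?r \<in> Arr (Ver ?D) \<and> \<gamma> \<in> hom2 B c d \<and> \<phi> \<bullet>\<^bsub>A\<^esub> \<theta>' = (P2 G \<gamma> \<star>\<^bsub>A\<^esub> \<theta>) \<bullet>\<^bsub>A\<^esub> \<psi>" for \<gamma>
    by (simp add: Hslice_def Let_def)
  have "s \<in> squares ?D ?t ?b ?l ?r \<longleftrightarrow> (\<exists>\<gamma>. s = (?t, ?b, ?l, ?r, \<gamma>) \<and> (?t, ?b, ?l, ?r, \<gamma>) \<in> Arr (VSq ?D))"
    unfolding squares_def[of ?D] hom_def[of "HSq ?D"] hom_def[of "VSq ?D"] D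
    by (cases s) auto
  then show ?thesis
    unfolding A using assms by (auto simp: hom1_def)
qed

context pseudofunctor
begin

text \<open>A square between vertical identities is a cell of the pseudo-slice 2-category. This connects
the horizontal fullness of the double projection with the fullness of the projection of
2-categories.\<close>

lemma Hslice_identity_square_iff:
  assumes m: "((x, f), (y, g), (c, \<psi>)) \<in> hom1 (slice A B F W) (x, f) (y, g)"
    and m': "((x, f), (y, g), (d, \<phi>)) \<in> hom1 (slice A B F W) (x, f) (y, g)"
  shows "s \<in> squares (Hslice A B F W) ((x, f), (y, g), (c, \<psi>)) ((x, f), (y, g), (d, \<phi>))
      (Ident (Ver (Hslice A B F W)) (x, f)) (Ident (Ver (Hslice A B F W)) (y, g)) \<longleftrightarrow>
    (\<exists>\<gamma>. s = (((x, f), (y, g), (c, \<psi>)), ((x, f), (y, g), (d, \<phi>)), ((x, f), (x, f), id2 B f), ((y, g), (y, g), id2 B g), \<gamma>) \<and>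
      \<gamma> \<in> hom2 A c d \<and> (P2 F \<gamma> \<star>\<^bsub>B\<^esub> id2 B f) \<bullet>\<^bsub>B\<^esub> \<psi> = \<phi>)"
proof -
  have bounds: "f \<in> hom1 B W (PO F x)" "g \<in> hom1 B W (PO F y)" "x \<in> Ob A" "y \<in> Ob A"
    "\<phi> \<in> Cell B" "Dom (Vert B) \<phi> = g"
    using m m' unfolding slice_hom1_iff by (auto simp: hom_def)
  have "((x, f), (x, f), id2 B f) \<in> Arr (Ver (Hslice A B F W))" "((y, g), (y, g), id2 B g) \<in> Arr (Ver (Hslice A B F W))"
    unfolding Hslice_Arr_Ver using bounds by (auto simp: hom_def hom1_def)
  from Hslice_squares_iff[OF m m' this] bounds show ?thesis
    unfolding Hslice_simps by auto
qed

lemma Hslice_identity_square_invertible: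
  assumes m: "((x, f), (y, g), (c, \<psi>)) \<in> hom1 (slice A B F W) (x, f) (y, g)" (is "?m \<in> _")
    and m': "((x, f), (y, g), (d, \<phi>)) \<in> hom1 (slice A B F W) (x, f) (y, g)" (is "?m' \<in> _")
    and s: "(((x, f), (y, g), (c, \<psi>)), ((x, f), (y, g), (d, \<phi>)), ((x, f), (x, f), id2 B f), ((y, g), (y, g), id2 B g), \<gamma>)
      \<in> squares (Hslice A B F W) ((x, f), (y, g), (c, \<psi>)) ((x, f), (y, g), (d, \<phi>))
      (Ident (Ver (Hslice A B F W)) (x, f)) (Ident (Ver (Hslice A B F W)) (y, g))" (is "?s \<in> _")
  shows "invertible (VSq (Hslice A B F W)) ?s \<longleftrightarrow> invertible (Vert A) \<gamma>"
proof
  let ?D = "Hslice A B F W"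
  have \<gamma>: "\<gamma> \<in> hom2 A c d" "(P2 F \<gamma> \<star>\<^bsub>B\<^esub> id2 B f) \<bullet>\<^bsub>B\<^esub> \<psi> = \<phi>"
    using s unfolding Hslice_identity_square_iff[OF m m'] by simp_all
  {
    assume "invertible (VSq ?D) ?s"
    then obtain k where k: "k \<in> hom (VSq ?D) ?m' ?m"
      "k \<cdot>\<^bsub>VSq ?D\<^esub> ?s = Ident (VSq ?D) ?m" "?s \<cdot>\<^bsub>VSq ?D\<^esub> k = Ident (VSq ?D) ?m'"
      unfolding invertible_def Hslice_simps(10,11) fst_conv snd_conv by blast
    obtain t b l r \<delta> where k': "k = (t, b, l, r, \<delta>)"
      by (metis surj_pair)
    have tb: "t = ?m'" "b = ?m"
      using k(1) by (simp_all add: hom_def[of "VSq ?D"] Hslice_simps k')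
    have "(?m', ?m, l, r, \<delta>) \<in> Arr (VSq ?D)"
      using k(1) by (simp add: hom_def[of "VSq ?D"] k' tb)
    then have "\<delta> \<in> hom2 A d c"
      by (cases l; cases r) (simp add: Hslice_def Let_def)
    then show "invertible (Vert A) \<gamma>"
      using k(2,3) \<gamma>(1) unfolding k'
      by (intro A.V.invertibleI[of \<gamma> \<delta>]) (auto simp: Hslice_simps Hslice_VSq_Comp hom_def)
  next
    assume inv: "invertible (Vert A) \<gamma>"
    have "(?m, ?m', \<gamma>) \<in> hom2 (slice A B F W) ?m ?m'"
      unfolding slice_hom2_iff[OF m m'] using \<gamma> by simp
    moreover from this have "invertible (Vert (slice A B F W)) (?m, ?m', \<gamma>)"
      using slice_cell_invertible[OF m m'] inv by blast
    ultimately obtain \<nu> where "\<nu> \<in> hom2 (slice A B F W) ?m' ?m"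
      "\<nu> \<bullet>\<^bsub>slice A B F W\<^esub> (?m, ?m', \<gamma>) = id2 (slice A B F W) ?m" "(?m, ?m', \<gamma>) \<bullet>\<^bsub>slice A B F W\<^esub> \<nu> = id2 (slice A B F W) ?m'"
      unfolding invertible_def slice_simps(4,5) fst_conv snd_conv by blast
    then obtain \<delta> where \<delta>: "\<delta> \<in> hom2 A d c" "(P2 F \<delta> \<star>\<^bsub>B\<^esub> id2 B f) \<bullet>\<^bsub>B\<^esub> \<phi> = \<psi>"
      "\<delta> \<bullet>\<^bsub>A\<^esub> \<gamma> = id2 A c" "\<gamma> \<bullet>\<^bsub>A\<^esub> \<delta> = id2 A d"
      unfolding slice_hom2_iff[OF m' m] by auto
    let ?k = "(?m', ?m, ((x, f), (x, f), id2 B f), ((y, g), (y, g), id2 B g), \<delta>)"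
    have "?k \<in> squares ?D ?m' ?m (Ident (Ver ?D) (x, f)) (Ident (Ver ?D) (y, g))"
      unfolding Hslice_identity_square_iff[OF m' m] using \<delta> by simp
    then have "?k \<in> hom (VSq ?D) ?m' ?m"
      by (simp add: squares_def[of ?D])
    moreover have "?s \<in> Arr (VSq ?D)"
      using s by (simp add: squares_def[of ?D] hom_def)
    moreover have "f \<in> Mor B" "g \<in> Mor B"
      using m unfolding slice_hom1_iff by (auto simp: hom1_def)
    ultimately show "invertible (VSq ?D) ?s"
      unfolding invertible_def using \<delta>
      by (intro conjI bexI[of _ ?k]) (simp_all add: Hslice_simps Hslice_VSq_Comp)
  }
qed

lemma slice_obj_unit: "P \<in> slice_obs A B F W \<Longrightarrow> slice_unit A B P \<in> hom1 (slice A B F W) P P"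
  by (cases P) (simp add: slice_unit_def slice_hom1_iff, auto simp: hom1_def hom_def)

lemma slice_comp_unit_left:
  assumes "p \<in> hom1 (slice A B F W) J P"
  shows "slice_comp A B F (slice_unit A B P) p = p"
proof -
  obtain x f y g where JP: "J = (x, f)" "P = (y, g)"
    by (metis surj_pair)
  obtain b \<psi> where "p = ((x, f), (y, g), (b, \<psi>))" "b \<in> hom1 A x y" "f \<in> hom1 B W (PO F x)" "g \<in> hom1 B W (PO F y)"
    "\<psi> \<in> hom2 B g (P1 F b \<odot>\<^bsub>B\<^esub> f)"
    using assms unfolding JP slice_hom1_iff by auto
  then show ?thesis
    by (auto simp: JP slice_comp_def slice_unit_def hom1_def hom_def)
qed

text \<open>Essential surjectivity is surjectivity on objects. A vertical morphism with first component
\<open>Y\<close> is an arrow of \<open>B(W,F Y)\<close>, and surjectivity on vertical morphisms presents it, up to isomorphism,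
as the image of a cell of \<open>A\<close>; horizontal fullness over an identity moves this cell to the prescribed
objects, which gives fullness. For faithfulness, two cells with the same image \<open>\<alpha>\<close> give two vertical
morphisms of the double slice over \<open>\<alpha>\<close>, and the pasting condition for the horizontal identity square
on \<open>\<alpha>\<close> is their equality.\<close>

theorem double_bi_initial_imp:
  assumes bi: "double_bi_initial (Hslice A B F W) (X, l)" and Y: "Y \<in> Ob A"
  shows "fully_faithful (hom_cat A X Y) (hom_cat B W (PO F Y)) (eval_functor B F l)"
    "ess_surjective (hom_cat A X Y) (hom_cat B W (PO F Y)) (eval_functor B F l)"
proof -
  let ?D = "Hslice A B F W" and ?K = "slice A B F W" and ?J = "(X, l)"
  note bi' = bi[unfolded double_bi_initial_iff Hslice_simps(1-6)]
  note full = bi'[THEN conjunct2, THEN conjunct2, THEN conjunct1, rule_format]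
    and vert = bi'[THEN conjunct2, THEN conjunct2, THEN conjunct2, THEN conjunct1, rule_format]
    and uniq = bi'[THEN conjunct2, THEN conjunct2, THEN conjunct2, THEN conjunct2, rule_format]
  have X: "X \<in> Ob A" and l: "l \<in> hom1 B W (PO F X)"
    using bi' by simp_all
  have [simp]: "l \<in> Mor B" "Src B l = W" "Trg B l = PO F X"
    using l by (simp_all add: hom1_def)
  show "ess_surjective (hom_cat A X Y) (hom_cat B W (PO F Y)) (eval_functor B F l)"
    unfolding ess_surjective_def
  proof
    fix k assume "k \<in> Obj (hom_cat B W (PO F Y))"
    then have k: "k \<in> hom1 B W (PO F Y)"
      by (simp add: B.hom_cat_simps)
    then obtain p where "p \<in> hom1 ?K ?J (Y, k)"
      using bi'[THEN conjunct2, THEN conjunct1, rule_format, of "(Y, k)"] Y by (auto simp del: split_paired_Ex)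
    then obtain b \<psi> where "b \<in> hom1 A X Y" "\<psi> \<in> hom2 B k (P1 F b \<odot>\<^bsub>B\<^esub> l)" "invertible (Vert B) \<psi>"
      by (rule slice_hom1_cases)
    with k show "\<exists>x \<in> Obj (hom_cat A X Y). \<exists>g \<in> hom (hom_cat B W (PO F Y)) k (FObj (eval_functor B F l) x).
        invertible (hom_cat B W (PO F Y)) g"
      by (intro bexI[of _ b] bexI[of _ \<psi>])
        (auto simp: A.hom_cat_simps B.hom_cat_simps B.invertible_hom_cat hom_def)
  qed
  \<comment> \<open>Horizontal fullness over an identity compares any two morphisms into the same object.\<close>
  have compare: "\<exists>s \<in> hom2 A b c. invertible (Vert A) s \<and> P2 F s \<star>\<^bsub>B\<^esub> id2 B l = \<psi>"
    if b: "b \<in> hom1 A X Y" and c: "c \<in> hom1 A X Y"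
      and \<psi>: "\<psi> \<in> hom2 B (P1 F b \<odot>\<^bsub>B\<^esub> l) (P1 F c \<odot>\<^bsub>B\<^esub> l)" "invertible (Vert B) \<psi>" for b c \<psi>
  proof -
    let ?P = "(Y, P1 F b \<odot>\<^bsub>B\<^esub> l)"
    let ?p = "(?J, ?P, (b, id2 B (P1 F b \<odot>\<^bsub>B\<^esub> l)))" and ?q = "(?J, ?P, (c, \<psi>))"
    have p: "?p \<in> hom1 ?K ?J ?P" and q: "?q \<in> hom1 ?K ?J ?P"
      using X Y l b c \<psi> unfolding slice_hom1_iff by (auto simp: hom1_def hom_def)
    have P: "?P \<in> slice_obs A B F W"
      using b Y by (simp add: hom1_def)
    obtain s where s: "s \<in> squares ?D ?p ?q (Ident (Ver ?D) ?J) (Ident (Ver ?D) ?P)" "invertible (VSq ?D) s"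
      using full[OF P P q p slice_obj_unit[OF P]] unfolding slice_comp_unit_left[OF q] by blast
    then obtain \<gamma> where \<gamma>: "s = (?p, ?q, (?J, ?J, id2 B l), (?P, ?P, id2 B (P1 F b \<odot>\<^bsub>B\<^esub> l)), \<gamma>)"
      "\<gamma> \<in> hom2 A b c" "(P2 F \<gamma> \<star>\<^bsub>B\<^esub> id2 B l) \<bullet>\<^bsub>B\<^esub> id2 B (P1 F b \<odot>\<^bsub>B\<^esub> l) = \<psi>"
      unfolding Hslice_identity_square_iff[OF p q] by blast
    have "invertible (Vert A) \<gamma>"
      using s unfolding \<gamma>(1) Hslice_identity_square_invertible[OF p q s(1)[unfolded \<gamma>(1)]] by blast
    moreover have "P2 F \<gamma> \<star>\<^bsub>B\<^esub> id2 B l = \<psi>"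
      using \<gamma>(2,3) b by (auto simp: hom_def hom1_def)
    ultimately show ?thesis
      using \<gamma>(2) by blast
  qed
  show "fully_faithful (hom_cat A X Y) (hom_cat B W (PO F Y)) (eval_functor B F l)"
    unfolding fully_faithful_def
  proof (intro ballI)
    fix b b' \<alpha>
    assume "b \<in> Obj (hom_cat A X Y)" "b' \<in> Obj (hom_cat A X Y)"
      and \<alpha>: "\<alpha> \<in> hom (hom_cat B W (PO F Y)) (FObj (eval_functor B F l) b) (FObj (eval_functor B F l) b')"
    then have b: "b \<in> hom1 A X Y" "b' \<in> hom1 A X Y"
      by (simp_all add: A.hom_cat_simps)
    have bm [simp]: "b \<in> Mor A" "Src A b = X" "Trg A b = Y" "b' \<in> Mor A" "Src A b' = X" "Trg A b' = Y"
      using b by (simp_all add: hom1_def)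
    have \<alpha>: "\<alpha> \<in> hom2 B (P1 F b \<odot>\<^bsub>B\<^esub> l) (P1 F b' \<odot>\<^bsub>B\<^esub> l)"
      using \<alpha> by (simp add: hom_def B.hom_cat_simps)
    then have [simp]: "\<alpha> \<in> Cell B" "Dom (Vert B) \<alpha> = P1 F b \<odot>\<^bsub>B\<^esub> l" "Cod (Vert B) \<alpha> = P1 F b' \<odot>\<^bsub>B\<^esub> l"
      by (simp_all add: hom_def)
    let ?P = "(Y, P1 F b \<odot>\<^bsub>B\<^esub> l)" and ?Q = "(Y, P1 F b' \<odot>\<^bsub>B\<^esub> l)"
    let ?v = "(?P, ?Q, \<alpha>)"
    have v: "?v \<in> Arr (Ver ?D)" and i: "(?J, ?J, id2 B l) \<in> Arr (Ver ?D)"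
      unfolding Hslice_Arr_Ver using X Y by (auto simp: hom1_def hom_def)
    have PQ: "?P \<in> slice_obs A B F W" "?Q \<in> slice_obs A B F W"
      using Y by (simp_all add: hom1_def)
    \<comment> \<open>Fullness: conjugate a preimage of the vertical morphism \<open>\<alpha>\<close> by the comparison cells.\<close>
    have "\<exists>f \<in> hom2 A b b'. P2 F f \<star>\<^bsub>B\<^esub> id2 B l = \<alpha>"
    proof -
      obtain p q \<Gamma> where pq: "p \<in> hom1 ?K ?J ?P" "q \<in> hom1 ?K ?J ?Q" "\<Gamma> \<in> squares ?D p q (?J, ?J, id2 B l) ?v"
        using vert[OF v] unfolding fst_conv snd_conv Hslice_simps(7) by blast
      obtain c \<psi> where p: "p = (?J, ?P, (c, \<psi>))" and c: "c \<in> hom1 A X Y"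
        and \<psi>: "\<psi> \<in> hom2 B (P1 F b \<odot>\<^bsub>B\<^esub> l) (P1 F c \<odot>\<^bsub>B\<^esub> l)" "invertible (Vert B) \<psi>"
        using pq(1) by (rule slice_hom1_cases)
      obtain c' \<psi>' where q: "q = (?J, ?Q, (c', \<psi>'))" and c': "c' \<in> hom1 A X Y"
        and \<psi>': "\<psi>' \<in> hom2 B (P1 F b' \<odot>\<^bsub>B\<^esub> l) (P1 F c' \<odot>\<^bsub>B\<^esub> l)" "invertible (Vert B) \<psi>'"
        using pq(2) by (rule slice_hom1_cases)
      obtain \<gamma> where \<gamma>: "\<gamma> \<in> hom2 A c c'" "\<psi>' \<bullet>\<^bsub>B\<^esub> \<alpha> = (P2 F \<gamma> \<star>\<^bsub>B\<^esub> id2 B l) \<bullet>\<^bsub>B\<^esub> \<psi>"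
        using pq(3) Hslice_squares_iff[OF pq(1,2)[unfolded p q] i v] unfolding p q by blast
      obtain s where s: "s \<in> hom2 A b c" "invertible (Vert A) s" "P2 F s \<star>\<^bsub>B\<^esub> id2 B l = \<psi>"
        using compare[OF b(1) c \<psi>] by blast
      obtain t where t: "t \<in> hom2 A b' c'" "invertible (Vert A) t" "P2 F t \<star>\<^bsub>B\<^esub> id2 B l = \<psi>'"
        using compare[OF b(2) c' \<psi>'] by blast
      have [simp]: "c \<in> Mor A" "Src A c = X" "Trg A c = Y" "c' \<in> Mor A" "Src A c' = X" "Trg A c' = Y"
        "s \<in> Cell A" "Dom (Vert A) s = b" "Cod (Vert A) s = c" "t \<in> Cell A" "Dom (Vert A) t = b'" "Cod (Vert A) t = c'"
        "\<gamma> \<in> Cell A" "Dom (Vert A) \<gamma> = c" "Cod (Vert A) \<gamma> = c'"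
        using c c' s t \<gamma> by (simp_all add: hom1_def hom_def)
      define f where "f = A.V.inv_of t \<bullet>\<^bsub>A\<^esub> \<gamma> \<bullet>\<^bsub>A\<^esub> s"
      have f: "f \<in> hom2 A b b'" and [simp]: "f \<in> Cell A" "Dom (Vert A) f = b" "Cod (Vert A) f = b'"
        using t(2) by (simp_all add: f_def hom_def)
      have "\<psi>' \<bullet>\<^bsub>B\<^esub> (P2 F f \<star>\<^bsub>B\<^esub> id2 B l) = P2 F (t \<bullet>\<^bsub>A\<^esub> f) \<star>\<^bsub>B\<^esub> id2 B l"
        by (simp flip: t(3))
      also have "t \<bullet>\<^bsub>A\<^esub> f = \<gamma> \<bullet>\<^bsub>A\<^esub> s"
        using t(2) by (simp add: f_def)
      also have "P2 F (\<gamma> \<bullet>\<^bsub>A\<^esub> s) \<star>\<^bsub>B\<^esub> id2 B l = \<psi>' \<bullet>\<^bsub>B\<^esub> \<alpha>"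
        by (simp add: \<gamma>(2) s(3))
      finally have "P2 F f \<star>\<^bsub>B\<^esub> id2 B l = \<alpha>"
        using \<psi>' by (intro B.V.invertible_cancel_left[of \<psi>' "P2 F f \<star>\<^bsub>B\<^esub> id2 B l" \<alpha>]) (auto simp: hom_def)
      then show ?thesis
        using f by blast
    qed
    moreover have "f = f'" if f: "f \<in> hom2 A b b'" "P2 F f \<star>\<^bsub>B\<^esub> id2 B l = \<alpha>"
      and f': "f' \<in> hom2 A b b'" "P2 F f' \<star>\<^bsub>B\<^esub> id2 B l = \<alpha>" for f f'
    proof -
      let ?p = "(?J, ?P, (b, id2 B (P1 F b \<odot>\<^bsub>B\<^esub> l)))" and ?q = "(?J, ?Q, (b', id2 B (P1 F b' \<odot>\<^bsub>B\<^esub> l)))"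
      have p: "?p \<in> hom1 ?K ?J ?P" and q: "?q \<in> hom1 ?K ?J ?Q"
        using X Y l unfolding slice_hom1_iff by (auto simp: hom1_def hom_def)
      have v_hom: "?v \<in> hom (Ver ?D) ?P ?Q"
        using v by (simp add: hom_def Hslice_simps)
      let ?ip = "(?p, ?p, (?J, ?J, id2 B l), (?P, ?P, id2 B (P1 F b \<odot>\<^bsub>B\<^esub> l)), id2 A b)"
      let ?iq = "(?q, ?q, (?J, ?J, id2 B l), (?Q, ?Q, id2 B (P1 F b' \<odot>\<^bsub>B\<^esub> l)), id2 A b')"
      have ip: "?ip \<in> squares ?D ?p ?p (Ident (Ver ?D) ?J) (Ident (Ver ?D) ?P)"
        unfolding Hslice_identity_square_iff[OF p p] by (auto simp: hom_def)
      have iq: "?iq \<in> squares ?D ?q ?q (Ident (Ver ?D) ?J) (Ident (Ver ?D) ?Q)"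
        unfolding Hslice_identity_square_iff[OF q q] by (auto simp: hom_def)
      have inv: "invertible (VSq ?D) ?ip" "invertible (VSq ?D) ?iq"
        using Hslice_identity_square_invertible[OF p p ip] Hslice_identity_square_invertible[OF q q iq] by simp_all
      have sq: "(?p, ?q, (?J, ?J, id2 B l), ?v, h) \<in> squares ?D ?p ?q (?J, ?J, id2 B l) ?v"
        if "h \<in> hom2 A b b'" "P2 F h \<star>\<^bsub>B\<^esub> id2 B l = \<alpha>" for h
        unfolding Hslice_squares_iff[OF p q i v] using that by (auto simp: hom_def)
      let ?uP = "slice_unit A B ?P" and ?uQ = "slice_unit A B ?Q"
      have u: "(?uP, ?uQ, ?v, ?v, id2 A (Unit A Y)) \<in> squares ?D ?uP ?uQ ?v ?v"
        using Hslice_squares_iff[OF slice_obj_unit[OF PQ(1), unfolded slice_unit_def prod.case]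
            slice_obj_unit[OF PQ(2), unfolded slice_unit_def prod.case] v v] Y
        unfolding slice_unit_def prod.case by (auto simp: hom_def)
      have "((?uP, ?uQ, ?v, ?v, id2 A (Unit A Y)) \<cdot>\<^bsub>HSq ?D\<^esub> (?p, ?q, (?J, ?J, id2 B l), ?v, f)) \<cdot>\<^bsub>VSq ?D\<^esub> ?ip =
          ?iq \<cdot>\<^bsub>VSq ?D\<^esub> (?p, ?q, (?J, ?J, id2 B l), ?v, f')"
        by (rule uniq[OF p p q q slice_obj_unit[OF PQ(1)] slice_obj_unit[OF PQ(2)] v_hom v_hom])
          (use ip iq inv sq[OF f] sq[OF f'] u in \<open>simp_all only: slice_comp_unit_left[OF p] slice_comp_unit_left[OF q] Hslice_simps\<close>)
      then show "f = f'"
        using f f' Y by (simp add: Hslice_simps Hslice_VSq_Comp hom_def)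
    qed
    ultimately show "\<exists>!f. f \<in> hom (hom_cat A X Y) b b' \<and> FArr (eval_functor B F l) f = \<alpha>"
      unfolding A.hom_hom_cat[OF b(1)] eval_functor_simps by blast
  qed
qed

text \<open>Horizontal fullness is inherited from the pseudo-slice 2-category, where \<open>(X, l)\<close> is
bi-initial. A vertical morphism \<open>\<theta>\<close> becomes, after conjugation by chosen isomorphisms, an arrow
between objects in the image of evaluation, and lifts by fullness. The pasting equation for squares can be
checked after evaluation, since evaluation is faithful: there both sides, preceded by the
invertible \<open>\<pi>'\<close>, can be transformed into each other by the naturality of the compositor and the equations
that define the five squares.\<close>

theorem imp_double_bi_initial:
  assumes X: "X \<in> Ob A" and l: "l \<in> hom1 B W (PO F X)"
    and ff: "\<And>Y. Y \<in> Ob A \<Longrightarrow> fully_faithful (hom_cat A X Y) (hom_cat B W (PO F Y)) (eval_functor B F l)"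
    and es: "\<And>Y. Y \<in> Ob A \<Longrightarrow> ess_surjective (hom_cat A X Y) (hom_cat B W (PO F Y)) (eval_functor B F l)"
  shows "double_bi_initial (Hslice A B F W) (X, l)"
proof -
  let ?D = "Hslice A B F W" and ?K = "slice A B F W" and ?J = "(X, l)"
  have [simp]: "l \<in> Mor B" "Src B l = W" "Trg B l = PO F X"
    using l by (simp_all add: hom1_def)
  have "bi_initial ?K ?J"
    unfolding bi_initial_slice_iff
    using X l ff es cat_functor.fully_faithful_imp_iso_lifting[OF eval_functor] by blast
  note bi = this[unfolded bi_initial_iff slice_simps(1,11)]
  have lift: "\<exists>\<gamma> \<in> hom2 A b b'. P2 F \<gamma> \<star>\<^bsub>B\<^esub> id2 B l = \<alpha>"
    if b: "b \<in> hom1 A X Y" "b' \<in> hom1 A X Y" and \<alpha>: "\<alpha> \<in> hom2 B (P1 F b \<odot>\<^bsub>B\<^esub> l) (P1 F b' \<odot>\<^bsub>B\<^esub> l)" for b b' Y \<alpha>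
  proof -
    have Y: "Y \<in> Ob A"
      using b by (auto simp: hom1_def)
    show ?thesis
      by (rule cat_functor.fully_faithful_full[OF eval_functor[OF X Y l] ff[OF Y], of b b' \<alpha>])
        (use b \<alpha> in \<open>auto simp: A.hom_cat_simps B.hom_cat_simps hom1_def hom_def\<close>)
  qed
  have faithful: "\<gamma> = \<delta>"
    if "\<gamma> \<in> hom2 A b b'" "\<delta> \<in> hom2 A b b'" "b \<in> hom1 A X Y" "P2 F \<gamma> \<star>\<^bsub>B\<^esub> id2 B l = P2 F \<delta> \<star>\<^bsub>B\<^esub> id2 B l" for b b' \<gamma> \<delta> Y
  proof -
    have Y: "Y \<in> Ob A"
      using that by (auto simp: hom1_def)
    show ?thesis
      by (rule cat_functor.fully_faithful_eqI[OF eval_functor[OF X Y l] ff[OF Y], of \<gamma> \<delta>])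
        (use that in \<open>auto simp: A.hom_cat_simps hom_def\<close>)
  qed
  show ?thesis
    unfolding double_bi_initial_iff Hslice_simps(1-6)
  proof (intro conjI)
    show "?J \<in> slice_obs A B F W"
      using X l by simp
    show "\<forall>P \<in> slice_obs A B F W. \<exists>p. p \<in> hom1 ?K ?J P"
      using bi by blast
    show "\<forall>P \<in> slice_obs A B F W. \<forall>Q \<in> slice_obs A B F W. \<forall>p \<in> hom1 ?K ?J P. \<forall>q \<in> hom1 ?K ?J Q. \<forall>m \<in> hom1 ?K P Q.
      \<exists>\<psi> \<in> squares ?D q (slice_comp A B F m p) (Ident (Ver ?D) ?J) (Ident (Ver ?D) Q). invertible (VSq ?D) \<psi>"
    proof (intro ballI)
      fix P Q p q m
      assume *: "P \<in> slice_obs A B F W" "Q \<in> slice_obs A B F W" "p \<in> hom1 ?K ?J P" "q \<in> hom1 ?K ?J Q" "m \<in> hom1 ?K P Q"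
      obtain \<chi> where \<chi>: "\<chi> \<in> hom2 ?K q (slice_comp A B F m p)" "invertible (Vert ?K) \<chi>"
        using bi[THEN conjunct2, THEN conjunct2, THEN conjunct1, rule_format, OF *] by blast
      obtain Y k Z h where PQ: "P = (Y, k)" "Q = (Z, h)"
        by (metis surj_pair)
      obtain b \<psi> where p: "p = (?J, (Y, k), (b, \<psi>))"
        using *(3) unfolding PQ by (rule slice_hom1_cases)
      obtain d \<phi> where q: "q = (?J, (Z, h), (d, \<phi>))"
        using *(4) unfolding PQ by (rule slice_hom1_cases)
      obtain c \<omega> where m: "m = ((Y, k), (Z, h), (c, \<omega>))"
        using *(5) unfolding PQ by (rule slice_hom1_cases)
      obtain e \<xi> where mp: "slice_comp A B F m p = (?J, (Z, h), (e, \<xi>))"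
        by (simp add: m p slice_comp_def)
      have q_in: "(?J, (Z, h), (d, \<phi>)) \<in> hom1 ?K ?J (Z, h)" and mp_in: "(?J, (Z, h), (e, \<xi>)) \<in> hom1 ?K ?J (Z, h)"
        using *(3-5) slice_comp_in[of X l Y k b \<psi> W Z h c \<omega>] mp unfolding PQ p q m by (auto simp: slice_comp_def)
      obtain x where x: "\<chi> = (q, slice_comp A B F m p, x)" "x \<in> hom2 A d e" "(P2 F x \<star>\<^bsub>B\<^esub> id2 B l) \<bullet>\<^bsub>B\<^esub> \<phi> = \<xi>"
        using \<chi>(1) unfolding q mp slice_hom2_iff[OF q_in mp_in] by blast
      have s: "(q, slice_comp A B F m p, (?J, ?J, id2 B l), ((Z, h), (Z, h), id2 B h), x)
          \<in> squares ?D q (slice_comp A B F m p) (Ident (Ver ?D) ?J) (Ident (Ver ?D) Q)"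
        unfolding q mp PQ Hslice_identity_square_iff[OF q_in mp_in] using x by blast
      have "invertible (Vert A) x"
        using \<chi> slice_cell_invertible[OF q_in mp_in] unfolding x(1) q mp by blast
      then show "\<exists>\<psi> \<in> squares ?D q (slice_comp A B F m p) (Ident (Ver ?D) ?J) (Ident (Ver ?D) Q). invertible (VSq ?D) \<psi>"
        using s Hslice_identity_square_invertible[OF q_in mp_in] unfolding q mp PQ by blast
    qed
    show "\<forall>v \<in> Arr (Ver ?D). \<exists>p \<in> hom1 ?K ?J (asrc v). \<exists>q \<in> hom1 ?K ?J (atrg v). \<exists>\<gamma>. \<gamma> \<in> squares ?D p q (Ident (Ver ?D) ?J) v"
    proof
      fix v assume v: "v \<in> Arr (Ver ?D)"
      obtain Y k Z k' \<theta> where v_eq: "v = ((Y, k), (Z, k'), \<theta>)"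
        by (metis surj_pair)
      then have Z: "Z = Y" and obs: "(Y, k) \<in> slice_obs A B F W" "(Y, k') \<in> slice_obs A B F W" and \<theta>: "\<theta> \<in> hom2 B k k'"
        using v unfolding v_eq Hslice_Arr_Ver by auto
      obtain p where p_in: "p \<in> hom1 ?K ?J (Y, k)"
        using bi obs by blast
      then obtain b \<psi> where p: "p = (?J, (Y, k), (b, \<psi>))" and b: "b \<in> hom1 A X Y"
        and \<psi>: "\<psi> \<in> hom2 B k (P1 F b \<odot>\<^bsub>B\<^esub> l)" "invertible (Vert B) \<psi>"
        by (rule slice_hom1_cases)
      obtain q where q_in: "q \<in> hom1 ?K ?J (Y, k')"
        using bi obs by blast
      then obtain b' \<psi>' where q: "q = (?J, (Y, k'), (b', \<psi>'))" and b': "b' \<in> hom1 A X Y"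
        and \<psi>': "\<psi>' \<in> hom2 B k' (P1 F b' \<odot>\<^bsub>B\<^esub> l)" "invertible (Vert B) \<psi>'"
        by (rule slice_hom1_cases)
      obtain \<gamma> where \<gamma>: "\<gamma> \<in> hom2 A b b'" "P2 F \<gamma> \<star>\<^bsub>B\<^esub> id2 B l = \<psi>' \<bullet>\<^bsub>B\<^esub> \<theta> \<bullet>\<^bsub>B\<^esub> B.V.inv_of \<psi>"
        using lift[OF b b', of "\<psi>' \<bullet>\<^bsub>B\<^esub> \<theta> \<bullet>\<^bsub>B\<^esub> B.V.inv_of \<psi>"] \<psi> \<psi>' \<theta> by (auto simp: hom_def)
      have i: "(?J, ?J, id2 B l) \<in> Arr (Ver ?D)"
        unfolding Hslice_Arr_Ver using X l by (auto simp: hom_def)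
      have "(p, q, (?J, ?J, id2 B l), v, \<gamma>) \<in> squares ?D p q (?J, ?J, id2 B l) v"
        unfolding p q v_eq Z Hslice_squares_iff[OF p_in[unfolded p] q_in[unfolded q] i v[unfolded v_eq Z]]
        using \<gamma> \<psi> \<psi>' \<theta> by (auto simp: hom_def)
      then show "\<exists>p \<in> hom1 ?K ?J (asrc v). \<exists>q \<in> hom1 ?K ?J (atrg v). \<exists>\<gamma>. \<gamma> \<in> squares ?D p q (Ident (Ver ?D) ?J) v"
        using p_in q_in unfolding v_eq Z Hslice_simps(7) fst_conv snd_conv by blast
    qed
    show "\<forall>P P' Q Q'. \<forall>p \<in> hom1 ?K ?J P. \<forall>p' \<in> hom1 ?K ?J P'. \<forall>q \<in> hom1 ?K ?J Q. \<forall>q' \<in> hom1 ?K ?J Q'.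
      \<forall>a \<in> hom1 ?K P P'. \<forall>b \<in> hom1 ?K Q Q'. \<forall>u \<in> hom (Ver ?D) P Q. \<forall>u' \<in> hom (Ver ?D) P' Q'.
      \<forall>\<psi> \<in> squares ?D p' (slice_comp A B F a p) (Ident (Ver ?D) ?J) (Ident (Ver ?D) P'). invertible (VSq ?D) \<psi> \<longrightarrow>
      (\<forall>\<phi> \<in> squares ?D q' (slice_comp A B F b q) (Ident (Ver ?D) ?J) (Ident (Ver ?D) Q'). invertible (VSq ?D) \<phi> \<longrightarrow>
      (\<forall>\<gamma> \<in> squares ?D p q (Ident (Ver ?D) ?J) u. \<forall>\<gamma>' \<in> squares ?D p' q' (Ident (Ver ?D) ?J) u'.
      \<forall>\<alpha> \<in> squares ?D a b u u'. (\<alpha> \<cdot>\<^bsub>HSq ?D\<^esub> \<gamma>) \<cdot>\<^bsub>VSq ?D\<^esub> \<psi> = \<phi> \<cdot>\<^bsub>VSq ?D\<^esub> \<gamma>'))"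
    proof (intro allI ballI impI)
      fix P P' Q Q' p p' q q' a b u u' \<psi> \<phi> \<gamma> \<gamma>' \<alpha>
      assume p_in: "p \<in> hom1 ?K ?J P" and p'_in: "p' \<in> hom1 ?K ?J P'" and q_in: "q \<in> hom1 ?K ?J Q" and q'_in: "q' \<in> hom1 ?K ?J Q'"
        and a_in: "a \<in> hom1 ?K P P'" and b_in: "b \<in> hom1 ?K Q Q'" and u_in: "u \<in> hom (Ver ?D) P Q" and u'_in: "u' \<in> hom (Ver ?D) P' Q'"
        and \<psi>: "\<psi> \<in> squares ?D p' (slice_comp A B F a p) (Ident (Ver ?D) ?J) (Ident (Ver ?D) P')"
        and \<phi>: "\<phi> \<in> squares ?D q' (slice_comp A B F b q) (Ident (Ver ?D) ?J) (Ident (Ver ?D) Q')"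
        and \<gamma>: "\<gamma> \<in> squares ?D p q (Ident (Ver ?D) ?J) u" and \<gamma>': "\<gamma>' \<in> squares ?D p' q' (Ident (Ver ?D) ?J) u'"
        and \<alpha>: "\<alpha> \<in> squares ?D a b u u'"
      obtain Y k Y' k' where PP: "P = (Y, k)" "P' = (Y', k')"
        by (metis surj_pair)
      obtain Z h Z' h' where QQ: "Q = (Z, h)" "Q' = (Z', h')"
        by (metis surj_pair)
      obtain \<theta> where u: "u = ((Y, k), (Z, h), \<theta>)" and u_arr: "u \<in> Arr (Ver ?D)"
        using u_in unfolding hom_def mem_Collect_eq Hslice_simps PP QQ by (metis prod.collapse)
      obtain \<theta>' where u': "u' = ((Y', k'), (Z', h'), \<theta>')" and u'_arr: "u' \<in> Arr (Ver ?D)"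
        using u'_in unfolding hom_def mem_Collect_eq Hslice_simps PP QQ by (metis prod.collapse)
      have Z: "Z = Y" "Z' = Y'" and \<theta>: "\<theta> \<in> hom2 B k h" "\<theta>' \<in> hom2 B k' h'" 
        and obs: "Y \<in> Ob A" "k \<in> hom1 B W (PO F Y)" "h \<in> hom1 B W (PO F Y)" "Y' \<in> Ob A" "k' \<in> hom1 B W (PO F Y')" "h' \<in> hom1 B W (PO F Y')"
        using u_arr u'_arr unfolding u u' Hslice_Arr_Ver by auto
      note eqs = PP QQ[unfolded Z]
      obtain c0 \<pi> where p: "p = (?J, (Y, k), (c0, \<pi>))" and c0: "c0 \<in> hom1 A X Y"
        and \<pi>: "\<pi> \<in> hom2 B k (P1 F c0 \<odot>\<^bsub>B\<^esub> l)" "invertible (Vert B) \<pi>"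
        using p_in unfolding eqs by (rule slice_hom1_cases)
      obtain c0' \<pi>' where p': "p' = (?J, (Y', k'), (c0', \<pi>'))" and c0': "c0' \<in> hom1 A X Y'"
        and \<pi>': "\<pi>' \<in> hom2 B k' (P1 F c0' \<odot>\<^bsub>B\<^esub> l)" "invertible (Vert B) \<pi>'"
        using p'_in unfolding eqs by (rule slice_hom1_cases)
      obtain d0 \<rho> where q: "q = (?J, (Y, h), (d0, \<rho>))" and d0: "d0 \<in> hom1 A X Y"
        and \<rho>: "\<rho> \<in> hom2 B h (P1 F d0 \<odot>\<^bsub>B\<^esub> l)" "invertible (Vert B) \<rho>"
        using q_in unfolding eqs by (rule slice_hom1_cases)
      obtain d0' \<rho>' where q': "q' = (?J, (Y', h'), (d0', \<rho>'))" and d0': "d0' \<in> hom1 A X Y'"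
        and \<rho>': "\<rho>' \<in> hom2 B h' (P1 F d0' \<odot>\<^bsub>B\<^esub> l)" "invertible (Vert B) \<rho>'"
        using q'_in unfolding eqs by (rule slice_hom1_cases)
      obtain c \<omega> where a: "a = ((Y, k), (Y', k'), (c, \<omega>))" and c: "c \<in> hom1 A Y Y'"
        and \<omega>: "\<omega> \<in> hom2 B k' (P1 F c \<odot>\<^bsub>B\<^esub> k)" "invertible (Vert B) \<omega>"
        using a_in unfolding eqs by (rule slice_hom1_cases)
      obtain d \<omega>' where b: "b = ((Y, h), (Y', h'), (d, \<omega>'))" and d: "d \<in> hom1 A Y Y'"
        and \<omega>': "\<omega>' \<in> hom2 B h' (P1 F d \<odot>\<^bsub>B\<^esub> h)" "invertible (Vert B) \<omega>'"
        using b_in unfolding eqs by (rule slice_hom1_cases)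
      define \<xi> where "\<xi> = (PC F c c0 \<star>\<^bsub>B\<^esub> id2 B l) \<bullet>\<^bsub>B\<^esub> (id2 B (P1 F c) \<star>\<^bsub>B\<^esub> \<pi>) \<bullet>\<^bsub>B\<^esub> \<omega>"
      define \<eta> where "\<eta> = (PC F d d0 \<star>\<^bsub>B\<^esub> id2 B l) \<bullet>\<^bsub>B\<^esub> (id2 B (P1 F d) \<star>\<^bsub>B\<^esub> \<rho>) \<bullet>\<^bsub>B\<^esub> \<omega>'"
      have ap: "slice_comp A B F a p = (?J, (Y', k'), (c \<odot>\<^bsub>A\<^esub> c0, \<xi>))"
        by (simp add: a p \<xi>_def slice_comp_def)
      have bq: "slice_comp A B F b q = (?J, (Y', h'), (d \<odot>\<^bsub>A\<^esub> d0, \<eta>))"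
        by (simp add: b q \<eta>_def slice_comp_def)
      note in' = p_in[unfolded eqs p] p'_in[unfolded eqs p'] q_in[unfolded eqs q] q'_in[unfolded eqs q'] a_in[unfolded eqs a] b_in[unfolded eqs b]
      have ap_in: "(?J, (Y', k'), (c \<odot>\<^bsub>A\<^esub> c0, \<xi>)) \<in> hom1 ?K ?J (Y', k')"
        unfolding \<xi>_def by (rule slice_comp_in[OF in'(1,5)])
      have bq_in: "(?J, (Y', h'), (d \<odot>\<^bsub>A\<^esub> d0, \<eta>)) \<in> hom1 ?K ?J (Y', h')"
        unfolding \<eta>_def by (rule slice_comp_in[OF in'(3,6)])
      have i: "(?J, ?J, id2 B l) \<in> Arr (Ver ?D)"
        unfolding Hslice_Arr_Ver using X l by (auto simp: hom_def)
      note arr = u_arr[unfolded u Z] u'_arr[unfolded u' Z]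
      obtain x where x: "\<psi> = (p', slice_comp A B F a p, (?J, ?J, id2 B l), (P', P', id2 B k'), x)"
        "x \<in> hom2 A c0' (c \<odot>\<^bsub>A\<^esub> c0)" "(P2 F x \<star>\<^bsub>B\<^esub> id2 B l) \<bullet>\<^bsub>B\<^esub> \<pi>' = \<xi>"
        using \<psi> unfolding ap p' eqs Hslice_identity_square_iff[OF in'(2) ap_in] by blast
      obtain y where y: "\<phi> = (q', slice_comp A B F b q, (?J, ?J, id2 B l), (Q', Q', id2 B h'), y)"
        "y \<in> hom2 A d0' (d \<odot>\<^bsub>A\<^esub> d0)" "(P2 F y \<star>\<^bsub>B\<^esub> id2 B l) \<bullet>\<^bsub>B\<^esub> \<rho>' = \<eta>"
        using \<phi> unfolding bq q' eqs Hslice_identity_square_iff[OF in'(4) bq_in] by blast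
      obtain g where g: "\<gamma> = (p, q, (?J, ?J, id2 B l), u, g)" "g \<in> hom2 A c0 d0" "\<rho> \<bullet>\<^bsub>B\<^esub> \<theta> = (P2 F g \<star>\<^bsub>B\<^esub> id2 B l) \<bullet>\<^bsub>B\<^esub> \<pi>"
        using \<gamma> unfolding p q u Z Hslice_simps(7) Hslice_squares_iff[OF in'(1,3) i arr(1)] by blast
      obtain g' where g': "\<gamma>' = (p', q', (?J, ?J, id2 B l), u', g')" "g' \<in> hom2 A c0' d0'"
        "\<rho>' \<bullet>\<^bsub>B\<^esub> \<theta>' = (P2 F g' \<star>\<^bsub>B\<^esub> id2 B l) \<bullet>\<^bsub>B\<^esub> \<pi>'"
        using \<gamma>' unfolding p' q' u' Z Hslice_simps(7) Hslice_squares_iff[OF in'(2,4) i arr(2)] by blast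
      obtain e where e: "\<alpha> = (a, b, u, u', e)" "e \<in> hom2 A c d" "\<omega>' \<bullet>\<^bsub>B\<^esub> \<theta>' = (P2 F e \<star>\<^bsub>B\<^esub> \<theta>) \<bullet>\<^bsub>B\<^esub> \<omega>"
        using \<alpha> unfolding a b u u' Z Hslice_squares_iff[OF in'(5,6) arr] by blast
      have [simp]: "c0 \<in> Mor A" "Src A c0 = X" "Trg A c0 = Y" "c0' \<in> Mor A" "Src A c0' = X" "Trg A c0' = Y'"
        "d0 \<in> Mor A" "Src A d0 = X" "Trg A d0 = Y" "d0' \<in> Mor A" "Src A d0' = X" "Trg A d0' = Y'"
        "c \<in> Mor A" "Src A c = Y" "Trg A c = Y'" "d \<in> Mor A" "Src A d = Y" "Trg A d = Y'"
        "k \<in> Mor B" "Src B k = W" "Trg B k = PO F Y" "h \<in> Mor B" "Src B h = W" "Trg B h = PO F Y"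
        "k' \<in> Mor B" "Src B k' = W" "Trg B k' = PO F Y'" "h' \<in> Mor B" "Src B h' = W" "Trg B h' = PO F Y'"
        using c0 c0' d0 d0' c d obs by (simp_all add: hom1_def)
      have [simp]: "\<theta> \<in> Cell B" "Dom (Vert B) \<theta> = k" "Cod (Vert B) \<theta> = h" "\<theta>' \<in> Cell B" "Dom (Vert B) \<theta>' = k'" "Cod (Vert B) \<theta>' = h'"
        "\<pi> \<in> Cell B" "Dom (Vert B) \<pi> = k" "Cod (Vert B) \<pi> = P1 F c0 \<odot>\<^bsub>B\<^esub> l"
        "\<pi>' \<in> Cell B" "Dom (Vert B) \<pi>' = k'" "Cod (Vert B) \<pi>' = P1 F c0' \<odot>\<^bsub>B\<^esub> l"
        "\<rho> \<in> Cell B" "Dom (Vert B) \<rho> = h" "Cod (Vert B) \<rho> = P1 F d0 \<odot>\<^bsub>B\<^esub> l"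
        "\<rho>' \<in> Cell B" "Dom (Vert B) \<rho>' = h'" "Cod (Vert B) \<rho>' = P1 F d0' \<odot>\<^bsub>B\<^esub> l"
        "\<omega> \<in> Cell B" "Dom (Vert B) \<omega> = k'" "Cod (Vert B) \<omega> = P1 F c \<odot>\<^bsub>B\<^esub> k"
        "\<omega>' \<in> Cell B" "Dom (Vert B) \<omega>' = h'" "Cod (Vert B) \<omega>' = P1 F d \<odot>\<^bsub>B\<^esub> h"
        using \<theta> \<pi> \<pi>' \<rho> \<rho>' \<omega> \<omega>' by (simp_all add: hom_def)
      have [simp]: "x \<in> Cell A" "Dom (Vert A) x = c0'" "Cod (Vert A) x = c \<odot>\<^bsub>A\<^esub> c0"
        "y \<in> Cell A" "Dom (Vert A) y = d0'" "Cod (Vert A) y = d \<odot>\<^bsub>A\<^esub> d0"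
        "g \<in> Cell A" "Dom (Vert A) g = c0" "Cod (Vert A) g = d0"
        "g' \<in> Cell A" "Dom (Vert A) g' = c0'" "Cod (Vert A) g' = d0'"
        "e \<in> Cell A" "Dom (Vert A) e = c" "Cod (Vert A) e = d"
        using x(2) y(2) g(2) g'(2) e(2) by (simp_all add: hom_def)
      have natural: "(P2 F (e \<star>\<^bsub>A\<^esub> g) \<star>\<^bsub>B\<^esub> id2 B l) \<bullet>\<^bsub>B\<^esub> (PC F c c0 \<star>\<^bsub>B\<^esub> id2 B l) =
          (PC F d d0 \<star>\<^bsub>B\<^esub> id2 B l) \<bullet>\<^bsub>B\<^esub> (P2 F e \<star>\<^bsub>B\<^esub> P2 F g \<star>\<^bsub>B\<^esub> id2 B l)"
      proof -
        have "(P2 F (e \<star>\<^bsub>A\<^esub> g) \<star>\<^bsub>B\<^esub> id2 B l) \<bullet>\<^bsub>B\<^esub> (PC F c c0 \<star>\<^bsub>B\<^esub> id2 B l) =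
            (P2 F (e \<star>\<^bsub>A\<^esub> g) \<bullet>\<^bsub>B\<^esub> PC F c c0) \<star>\<^bsub>B\<^esub> id2 B l"
          by simp
        also have "\<dots> = (PC F d d0 \<bullet>\<^bsub>B\<^esub> (P2 F e \<star>\<^bsub>B\<^esub> P2 F g)) \<star>\<^bsub>B\<^esub> id2 B l"
          using pc_natural[of g e] by simp
        finally show ?thesis by simp
      qed
      have slide: "(P2 F e \<star>\<^bsub>B\<^esub> P2 F g \<star>\<^bsub>B\<^esub> id2 B l) \<bullet>\<^bsub>B\<^esub> (id2 B (P1 F c) \<star>\<^bsub>B\<^esub> \<pi>) =
          (id2 B (P1 F d) \<star>\<^bsub>B\<^esub> \<rho>) \<bullet>\<^bsub>B\<^esub> (P2 F e \<star>\<^bsub>B\<^esub> \<theta>)"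
      proof -
        have "(P2 F e \<star>\<^bsub>B\<^esub> P2 F g \<star>\<^bsub>B\<^esub> id2 B l) \<bullet>\<^bsub>B\<^esub> (id2 B (P1 F c) \<star>\<^bsub>B\<^esub> \<pi>) = P2 F e \<star>\<^bsub>B\<^esub> ((P2 F g \<star>\<^bsub>B\<^esub> id2 B l) \<bullet>\<^bsub>B\<^esub> \<pi>)"
          using B.HC2_vcomp[of \<pi> "P2 F g \<star>\<^bsub>B\<^esub> id2 B l" "id2 B (P1 F c)" "P2 F e"] by simp
        also have "\<dots> = P2 F e \<star>\<^bsub>B\<^esub> (\<rho> \<bullet>\<^bsub>B\<^esub> \<theta>)"
          unfolding g(3) ..
        also have "\<dots> = (id2 B (P1 F d) \<star>\<^bsub>B\<^esub> \<rho>) \<bullet>\<^bsub>B\<^esub> (P2 F e \<star>\<^bsub>B\<^esub> \<theta>)"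
          using B.HC2_vcomp[of \<theta> \<rho> "P2 F e" "id2 B (P1 F d)"] by simp
        finally show ?thesis .
      qed
      let ?L = "(e \<star>\<^bsub>A\<^esub> g) \<bullet>\<^bsub>A\<^esub> x" and ?R = "y \<bullet>\<^bsub>A\<^esub> g'"
      have "(P2 F ?L \<star>\<^bsub>B\<^esub> id2 B l) \<bullet>\<^bsub>B\<^esub> \<pi>' = (P2 F (e \<star>\<^bsub>A\<^esub> g) \<star>\<^bsub>B\<^esub> id2 B l) \<bullet>\<^bsub>B\<^esub> \<xi>"
        by (simp flip: x(3))
      also have "\<dots> = ((P2 F (e \<star>\<^bsub>A\<^esub> g) \<star>\<^bsub>B\<^esub> id2 B l) \<bullet>\<^bsub>B\<^esub> (PC F c c0 \<star>\<^bsub>B\<^esub> id2 B l)) \<bullet>\<^bsub>B\<^esub> (id2 B (P1 F c) \<star>\<^bsub>B\<^esub> \<pi>) \<bullet>\<^bsub>B\<^esub> \<omega>"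
        by (simp add: \<xi>_def)
      also have "\<dots> = (PC F d d0 \<star>\<^bsub>B\<^esub> id2 B l) \<bullet>\<^bsub>B\<^esub> ((P2 F e \<star>\<^bsub>B\<^esub> P2 F g \<star>\<^bsub>B\<^esub> id2 B l) \<bullet>\<^bsub>B\<^esub> (id2 B (P1 F c) \<star>\<^bsub>B\<^esub> \<pi>)) \<bullet>\<^bsub>B\<^esub> \<omega>"
        unfolding natural by simp
      also have "\<dots> = (PC F d d0 \<star>\<^bsub>B\<^esub> id2 B l) \<bullet>\<^bsub>B\<^esub> (id2 B (P1 F d) \<star>\<^bsub>B\<^esub> \<rho>) \<bullet>\<^bsub>B\<^esub> (P2 F e \<star>\<^bsub>B\<^esub> \<theta>) \<bullet>\<^bsub>B\<^esub> \<omega>"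
        unfolding slide by simp
      also have "\<dots> = \<eta> \<bullet>\<^bsub>B\<^esub> \<theta>'"
        by (simp add: \<eta>_def flip: e(3))
      also have "\<dots> = (P2 F y \<star>\<^bsub>B\<^esub> id2 B l) \<bullet>\<^bsub>B\<^esub> \<rho>' \<bullet>\<^bsub>B\<^esub> \<theta>'"
        by (simp flip: y(3))
      also have "\<dots> = (P2 F ?R \<star>\<^bsub>B\<^esub> id2 B l) \<bullet>\<^bsub>B\<^esub> \<pi>'"
        by (simp add: g'(3))
      finally have "P2 F ?L \<star>\<^bsub>B\<^esub> id2 B l = P2 F ?R \<star>\<^bsub>B\<^esub> id2 B l"
        using \<pi>'(2) by (intro B.V.invertible_cancel_right[of \<pi>' "P2 F ?L \<star>\<^bsub>B\<^esub> id2 B l" "P2 F ?R \<star>\<^bsub>B\<^esub> id2 B l"]) simp_all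
      then have "?L = ?R"
        by (intro faithful[of ?L c0' "d \<odot>\<^bsub>A\<^esub> d0" ?R Y']) (use c0' in \<open>simp_all add: hom_def\<close>)
      then show "(\<alpha> \<cdot>\<^bsub>HSq ?D\<^esub> \<gamma>) \<cdot>\<^bsub>VSq ?D\<^esub> \<psi> = \<phi> \<cdot>\<^bsub>VSq ?D\<^esub> \<gamma>'"
        unfolding e(1) g(1) g'(1) x(1) y(1) Hslice_simps Hslice_VSq_Comp u u' eqs Z by simp
    qed
  qed
qed

theorem double_bi_initial_Hslice_iff:
  "double_bi_initial (Hslice A B F W) (X, l) \<longleftrightarrow> X \<in> Ob A \<and> l \<in> hom1 B W (PO F X) \<and>
    (\<forall>Y \<in> Ob A. fully_faithful (hom_cat A X Y) (hom_cat B W (PO F Y)) (eval_functor B F l) \<and>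
      ess_surjective (hom_cat A X Y) (hom_cat B W (PO F Y)) (eval_functor B F l))"
proof -
  have "X \<in> Ob A \<and> l \<in> hom1 B W (PO F X)" if "double_bi_initial (Hslice A B F W) (X, l)"
    using that by (simp add: double_bi_initial_def Hslice_simps)
  then show ?thesis
    using double_bi_initial_imp imp_double_bi_initial by metis
qed

end

section \<open>Opposites and the 2-category of categories\<close>

lemma two_op_simps [simp]:
  "Ob (two_op A) = Ob A" "Vert (two_op A) = Vert A" "Src (two_op A) = Trg A" "Trg (two_op A) = Src A"
  "Unit (two_op A) = Unit A" "HC1 (two_op A) g f = HC1 A f g" "HC2 (two_op A) \<beta> \<alpha> = HC2 A \<alpha> \<beta>"
  by (simp_all add: two_op_def)

lemma two_op_hom1 [simp]: "hom1 (two_op A) x y = hom1 A y x"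
  by (auto simp: hom1_def)

lemma (in two_category) two_category_two_op: "two_category (two_op A)"
proof (rule two_category.intro)
  show "category (Vert (two_op A))"
    by (simp add: vert)
  fix \<alpha> f g assume "\<alpha> \<in> hom2 (two_op A) f g"
  then show "Src (two_op A) f = Src (two_op A) g" "Trg (two_op A) f = Trg (two_op A) g"
    by (auto simp: hom_def)
next
  fix f g f' g' f'' g'' \<alpha> \<alpha>' \<beta> \<beta>' x y z
  assume *: "f \<in> hom1 (two_op A) x y" "g \<in> hom1 (two_op A) y z" "\<alpha> \<in> hom2 (two_op A) f f'" "\<alpha>' \<in> hom2 (two_op A) f' f''"
    "\<beta> \<in> hom2 (two_op A) g g'" "\<beta>' \<in> hom2 (two_op A) g' g''"
  show "(\<beta>' \<bullet>\<^bsub>two_op A\<^esub> \<beta>) \<star>\<^bsub>two_op A\<^esub> (\<alpha>' \<bullet>\<^bsub>two_op A\<^esub> \<alpha>) = (\<beta>' \<star>\<^bsub>two_op A\<^esub> \<alpha>') \<bullet>\<^bsub>two_op A\<^esub> (\<beta> \<star>\<^bsub>two_op A\<^esub> \<alpha>)"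
    unfolding two_op_simps by (rule HC2_vcomp) (use * in \<open>auto simp: hom1_def hom_def\<close>)
qed (auto simp: hom1_def hom_def)

locale nat_transformation = F: cat_functor A B F + G: cat_functor A B G
  for A :: "('a, 'b) cat" and B :: "('p, 'q) cat" and F G +
  fixes \<eta> :: "'a \<Rightarrow> 'q"
  assumes nat_trans: "nat_trans A B F G \<eta>"
begin

lemma component [simp]:
  assumes "x \<in> Obj A"
  shows "\<eta> x \<in> Arr B" "Dom B (\<eta> x) = FObj F x" "Cod B (\<eta> x) = FObj G x"
  using nat_trans assms by (auto simp: nat_trans_def hom_def)

lemma natural: "f \<in> Arr A \<Longrightarrow> \<eta> (Cod A f) \<cdot>\<^bsub>B\<^esub> FArr F f = FArr G f \<cdot>\<^bsub>B\<^esub> \<eta> (Dom A f)"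
  using nat_trans by (simp add: nat_trans_def)

text \<open>The form of naturality that applies inside a composite associated to the right.\<close>

lemma natural_right:
  assumes "f \<in> Arr A" "h \<in> Arr B" "Cod B h = FObj F (Dom A f)"
  shows "\<eta> (Cod A f) \<cdot>\<^bsub>B\<^esub> (FArr F f \<cdot>\<^bsub>B\<^esub> h) = FArr G f \<cdot>\<^bsub>B\<^esub> (\<eta> (Dom A f) \<cdot>\<^bsub>B\<^esub> h)"
proof -
  have "\<eta> (Cod A f) \<cdot>\<^bsub>B\<^esub> (FArr F f \<cdot>\<^bsub>B\<^esub> h) = (\<eta> (Cod A f) \<cdot>\<^bsub>B\<^esub> FArr F f) \<cdot>\<^bsub>B\<^esub> h"
    using assms by simp
  also have "\<dots> = FArr G f \<cdot>\<^bsub>B\<^esub> (\<eta> (Dom A f) \<cdot>\<^bsub>B\<^esub> h)"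
    unfolding natural[OF assms(1)] using assms by simp
  finally show ?thesis .
qed

end

lemma nat_transI:
  assumes "category A" "category B"
    and "\<And>x. x \<in> Obj A \<Longrightarrow> \<eta> x \<in> Arr B \<and> Dom B (\<eta> x) = FObj F x \<and> Cod B (\<eta> x) = FObj G x"
    and "\<And>f. f \<in> Arr A \<Longrightarrow> \<eta> (Cod A f) \<cdot>\<^bsub>B\<^esub> FArr F f = FArr G f \<cdot>\<^bsub>B\<^esub> \<eta> (Dom A f)"
  shows "nat_trans A B F G \<eta>"
  using assms by (auto simp: nat_trans_def hom_def)

lemma func_comp_simps [simp]:
  "FObj (comp_func G F) x = FObj G (FObj F x)" "FArr (comp_func G F) f = FArr G (FArr F f)"
  "FObj id_func y = y" "FArr id_func g = g"
  by (simp_all add: comp_func_def id_func_def)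

lemma restrict_func_simps [simp]:
  "x \<in> Obj A \<Longrightarrow> FObj (restrict_func A F) x = FObj F x"
  "f \<in> Arr A \<Longrightarrow> FArr (restrict_func A F) f = FArr F f"
  "FObj (restrict_func A F) \<in> extensional (Obj A)" "FArr (restrict_func A F) \<in> extensional (Arr A)"
  by (simp_all add: restrict_func_def)

lemma func_eqI:
  assumes "\<And>x. x \<in> Obj A \<Longrightarrow> FObj F x = FObj G x" "\<And>f. f \<in> Arr A \<Longrightarrow> FArr F f = FArr G f"
    "FObj F \<in> extensional (Obj A)" "FArr F \<in> extensional (Arr A)"
    "FObj G \<in> extensional (Obj A)" "FArr G \<in> extensional (Arr A)"
  shows "F = (G :: ('a, 'b, 'p, 'q) func)"
  using assms by (intro func.equality extensionalityI[of _ "Obj A"] extensionalityI[of _ "Arr A"]) auto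

lemma CAT_simps [simp]:
  "Ob CAT = {A. category A}" "Mor CAT = cat_funcs" "Cell CAT = cat_nats"
  "Dom (Vert CAT) = asrc" "Cod (Vert CAT) = atrg" "Src CAT = asrc" "Trg CAT = atrg"
  "Unit CAT A = (A, A, restrict_func A id_func)"
  "id2 CAT (A, B, F) = ((A, B, F), (A, B, F), \<lambda>x \<in> Obj A. Ident B (FObj F x))"
  "(G', H, \<theta>) \<bullet>\<^bsub>CAT\<^esub> ((A, B, F), G, \<eta>) = ((A, B, F), H, \<lambda>x \<in> Obj A. \<theta> x \<cdot>\<^bsub>B\<^esub> \<eta> x)"
  "(B', C, K) \<odot>\<^bsub>CAT\<^esub> (A, B, F) = (A, C, restrict_func A (comp_func K F))"
  "((B', C, K), (B'', C', K'), \<kappa>) \<star>\<^bsub>CAT\<^esub> ((A, B, F), (A', B''', F'), \<eta>) =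
    ((A, C, restrict_func A (comp_func K F)), (A, C, restrict_func A (comp_func K' F')),
      \<lambda>x \<in> Obj A. \<kappa> (FObj F' x) \<cdot>\<^bsub>C\<^esub> FArr K (\<eta> x))"
  by (simp_all add: CAT_def)

lemma cat_funcs_iff: "(A, B, F) \<in> cat_funcs \<longleftrightarrow>
    cat_functor A B F \<and> FObj F \<in> extensional (Obj A) \<and> FArr F \<in> extensional (Arr A)"
  by (auto simp: cat_funcs_def cat_functor_def cat_functor_axioms_def)

lemma cat_funcs_cases:
  assumes "f \<in> cat_funcs"
  obtains A B F where "f = (A, B, F)" "cat_functor A B F" "FObj F \<in> extensional (Obj A)" "FArr F \<in> extensional (Arr A)"
  using assms by (cases f) (auto simp: cat_funcs_iff)

lemma cat_nats_iff: "((A, B, F), (A', B', G), \<eta>) \<in> cat_nats \<longleftrightarrow>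
    (A, B, F) \<in> cat_funcs \<and> (A, B, G) \<in> cat_funcs \<and> A' = A \<and> B' = B \<and>
    nat_transformation A B F G \<eta> \<and> \<eta> \<in> extensional (Obj A)"
  by (auto simp: cat_nats_def nat_transformation_def nat_transformation_axioms_def cat_funcs_iff)

lemma cat_nats_cases:
  assumes "\<alpha> \<in> cat_nats"
  obtains A B F G \<eta> where "\<alpha> = ((A, B, F), (A, B, G), \<eta>)" "(A, B, F) \<in> cat_funcs" "(A, B, G) \<in> cat_funcs"
    "nat_transformation A B F G \<eta>" "\<eta> \<in> extensional (Obj A)"
proof -
  obtain A B F A' B' G \<eta> where \<alpha>: "\<alpha> = ((A, B, F), (A', B', G), \<eta>)"
    by (metis surj_pair)
  show thesis
    using assms that unfolding \<alpha> cat_nats_iff by blast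
qed

lemma cat_functor_id: "category A \<Longrightarrow> cat_functor A A (restrict_func A id_func)"
proof -
  assume "category A"
  then interpret category A .
  show ?thesis
    by unfold_locales (auto simp: is_functor_def hom_def)
qed

lemma cat_functor_comp:
  assumes "cat_functor A B F" "cat_functor B C G"
  shows "cat_functor A C (restrict_func A (comp_func G F))"
proof -
  interpret F: cat_functor A B F by fact
  interpret G: cat_functor B C G by fact
  show ?thesis
    by unfold_locales (auto simp: is_functor_def hom_def)
qed

lemma category_CAT_Vert: "category (Vert CAT)"
proof
  fix f :: "('a, 'b) cat_nat" assume "f \<in> Cell CAT"
  then show "Dom (Vert CAT) f \<in> Mor CAT" "Cod (Vert CAT) f \<in> Mor CAT"
    by (auto elim: cat_nats_cases)
next
  fix x :: "('a, 'b) cat_func" assume "x \<in> Mor CAT"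
  then obtain A B F where x: "x = (A, B, F)" "(A, B, F) \<in> cat_funcs" "cat_functor A B F"
    by (auto elim!: cat_funcs_cases simp: cat_funcs_iff)
  interpret F: cat_functor A B F by (rule x(3))
  have "nat_transformation A B F F (\<lambda>x \<in> Obj A. Ident B (FObj F x))"
    by unfold_locales (auto simp: nat_trans_def hom_def)
  then show "id2 CAT x \<in> hom2 CAT x x"
    using x by (auto simp: hom_def cat_nats_iff)
next
  fix f g :: "('a, 'b) cat_nat" and x y z assume f: "f \<in> hom2 CAT x y" and g: "g \<in> hom2 CAT y z"
  obtain A B F G \<eta> where f': "f = ((A, B, F), (A, B, G), \<eta>)" "(A, B, F) \<in> cat_funcs"
    "nat_transformation A B F G \<eta>" "\<eta> \<in> extensional (Obj A)" "x = (A, B, F)" "y = (A, B, G)"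
    using f by (auto simp: hom_def elim!: cat_nats_cases)
  obtain H \<theta> where g': "g = ((A, B, G), (A, B, H), \<theta>)" "(A, B, H) \<in> cat_funcs"
    "nat_transformation A B G H \<theta>" "\<theta> \<in> extensional (Obj A)" "z = (A, B, H)"
    using g f'(6) by (auto simp: hom_def elim!: cat_nats_cases)
  interpret f: nat_transformation A B F G \<eta> by (rule f'(3))
  interpret g: nat_transformation A B G H \<theta> by (rule g'(3))
  have "nat_transformation A B F H (\<lambda>x \<in> Obj A. \<theta> x \<cdot>\<^bsub>B\<^esub> \<eta> x)"
    by unfold_locales (auto intro!: nat_transI f.F.A.category_axioms f.F.B.category_axioms simp: f.natural g.natural_right)
  then show "g \<bullet>\<^bsub>CAT\<^esub> f \<in> hom2 CAT x z"
    using f' g' by (simp add: hom_def cat_nats_iff)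
next
  fix f :: "('a, 'b) cat_nat" and x y assume f: "f \<in> hom2 CAT x y"
  obtain A B F G \<eta> where f': "f = ((A, B, F), (A, B, G), \<eta>)"
    "nat_transformation A B F G \<eta>" "\<eta> \<in> extensional (Obj A)" "x = (A, B, F)" "y = (A, B, G)"
    using f by (auto simp: hom_def elim!: cat_nats_cases)
  interpret f: nat_transformation A B F G \<eta> by (rule f'(2))
  show "f \<bullet>\<^bsub>CAT\<^esub> id2 CAT x = f" "id2 CAT y \<bullet>\<^bsub>CAT\<^esub> f = f"
    using f' by (auto intro!: extensionalityI[of _ "Obj A"])
next
  fix f g h :: "('a, 'b) cat_nat" and w x y z
  assume f: "f \<in> hom2 CAT w x" and g: "g \<in> hom2 CAT x y" and h: "h \<in> hom2 CAT y z"
  obtain A B F G \<eta> where f': "f = ((A, B, F), (A, B, G), \<eta>)" "nat_transformation A B F G \<eta>" "x = (A, B, G)"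
    using f by (auto simp: hom_def elim!: cat_nats_cases)
  obtain H \<theta> where g': "g = ((A, B, G), (A, B, H), \<theta>)" "nat_transformation A B G H \<theta>" "y = (A, B, H)"
    using g f'(3) by (auto simp: hom_def elim!: cat_nats_cases)
  obtain K \<kappa> where h': "h = ((A, B, H), (A, B, K), \<kappa>)" "nat_transformation A B H K \<kappa>"
    using h g'(3) by (auto simp: hom_def elim!: cat_nats_cases)
  interpret f: nat_transformation A B F G \<eta> by (rule f'(2))
  interpret g: nat_transformation A B G H \<theta> by (rule g'(2))
  interpret h: nat_transformation A B H K \<kappa> by (rule h'(2))
  show "(h \<bullet>\<^bsub>CAT\<^esub> g) \<bullet>\<^bsub>CAT\<^esub> f = h \<bullet>\<^bsub>CAT\<^esub> g \<bullet>\<^bsub>CAT\<^esub> f"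
    unfolding f' g' h' by (auto intro!: extensionalityI[of _ "Obj A"])
qed

lemma CAT_hom1_cases:
  assumes "f \<in> hom1 CAT A B"
  obtains F where "f = (A, B, F)" "(A, B, F) \<in> cat_funcs" "cat_functor A B F" "FObj F \<in> extensional (Obj A)" "FArr F \<in> extensional (Arr A)"
  using assms by (auto simp: hom1_def cat_funcs_iff elim!: cat_funcs_cases)

lemma CAT_hom2_cases:
  assumes "\<alpha> \<in> hom2 CAT (A, B, F) G'"
  obtains G \<eta> where "\<alpha> = ((A, B, F), (A, B, G), \<eta>)" "G' = (A, B, G)" "(A, B, F) \<in> cat_funcs" "(A, B, G) \<in> cat_funcs"
    "nat_transformation A B F G \<eta>" "\<eta> \<in> extensional (Obj A)"
  using assms by (auto simp: hom_def elim!: cat_nats_cases)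

theorem two_category_CAT: "two_category CAT"
proof (rule two_category.intro)
  show "category (Vert CAT)"
    by (rule category_CAT_Vert)
  fix f :: "('a, 'b) cat_func" assume "f \<in> Mor CAT"
  then show "Src CAT f \<in> Ob CAT" "Trg CAT f \<in> Ob CAT"
    by (auto elim!: cat_funcs_cases simp: cat_functor_def)
next
  fix \<alpha> :: "('a, 'b) cat_nat" and f g assume "\<alpha> \<in> hom2 CAT f g"
  then show "Src CAT f = Src CAT g" "Trg CAT f = Trg CAT g"
    by (auto simp: hom_def elim!: cat_nats_cases)
next
  fix A :: "('a, 'b) cat" assume "A \<in> Ob CAT"
  then show "Unit CAT A \<in> hom1 CAT A A"
    by (simp add: hom1_def cat_funcs_iff cat_functor_id)
next
  fix f g :: "('a, 'b) cat_func" and x y z assume f: "f \<in> hom1 CAT x y" and g: "g \<in> hom1 CAT y z"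
  obtain F where F: "f = (x, y, F)" "cat_functor x y F" using f by (rule CAT_hom1_cases)
  obtain G where G: "g = (y, z, G)" "cat_functor y z G" using g by (rule CAT_hom1_cases)
  show "g \<odot>\<^bsub>CAT\<^esub> f \<in> hom1 CAT x z"
    using cat_functor_comp[OF F(2) G(2)] by (simp add: F(1) G(1) hom1_def cat_funcs_iff)
next
  fix f g f' g' :: "('a, 'b) cat_func" and \<alpha> \<beta> x y z
  assume f: "f \<in> hom1 CAT x y" and g: "g \<in> hom1 CAT y z" and \<alpha>: "\<alpha> \<in> hom2 CAT f f'" and \<beta>: "\<beta> \<in> hom2 CAT g g'"
  obtain F where F: "f = (x, y, F)" using f by (rule CAT_hom1_cases)
  obtain G where G: "g = (y, z, G)" using g by (rule CAT_hom1_cases)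
  obtain F' \<eta> where F': "\<alpha> = ((x, y, F), (x, y, F'), \<eta>)" "f' = (x, y, F')" "nat_transformation x y F F' \<eta>"
    using \<alpha> unfolding F by (rule CAT_hom2_cases)
  obtain G' \<theta> where G': "\<beta> = ((y, z, G), (y, z, G'), \<theta>)" "g' = (y, z, G')" "nat_transformation y z G G' \<theta>"
    using \<beta> unfolding G by (rule CAT_hom2_cases)
  interpret f: nat_transformation x y F F' \<eta> by (rule F'(3))
  interpret g: nat_transformation y z G G' \<theta> by (rule G'(3))
  interpret GF: cat_functor x z "restrict_func x (comp_func G F)"
    by (rule cat_functor_comp) unfold_locales
  interpret GF': cat_functor x z "restrict_func x (comp_func G' F')"
    by (rule cat_functor_comp) unfold_locales
  have "nat_trans x z (restrict_func x (comp_func G F)) (restrict_func x (comp_func G' F'))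
      (\<lambda>x \<in> Obj x. \<theta> (FObj F' x) \<cdot>\<^bsub>z\<^esub> FArr G (\<eta> x))"
  proof (rule nat_transI[OF f.F.A.category_axioms g.F.B.category_axioms])
    fix h assume h [simp]: "h \<in> Arr x"
    have "\<theta> (FObj F' (Cod x h)) \<cdot>\<^bsub>z\<^esub> (FArr G (\<eta> (Cod x h)) \<cdot>\<^bsub>z\<^esub> FArr G (FArr F h)) =
        \<theta> (FObj F' (Cod x h)) \<cdot>\<^bsub>z\<^esub> FArr G (\<eta> (Cod x h) \<cdot>\<^bsub>y\<^esub> FArr F h)"
      by simp
    also have "\<dots> = \<theta> (Cod y (FArr F' h)) \<cdot>\<^bsub>z\<^esub> (FArr G (FArr F' h) \<cdot>\<^bsub>z\<^esub> FArr G (\<eta> (Dom x h)))"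
      by (simp add: f.natural)
    also have "\<dots> = FArr G' (FArr F' h) \<cdot>\<^bsub>z\<^esub> (\<theta> (FObj F' (Dom x h)) \<cdot>\<^bsub>z\<^esub> FArr G (\<eta> (Dom x h)))"
      by (subst g.natural_right) simp_all
    finally show "(\<lambda>x \<in> Obj x. \<theta> (FObj F' x) \<cdot>\<^bsub>z\<^esub> FArr G (\<eta> x)) (Cod x h) \<cdot>\<^bsub>z\<^esub> FArr (restrict_func x (comp_func G F)) h =
        FArr (restrict_func x (comp_func G' F')) h \<cdot>\<^bsub>z\<^esub> (\<lambda>x \<in> Obj x. \<theta> (FObj F' x) \<cdot>\<^bsub>z\<^esub> FArr G (\<eta> x)) (Dom x h)"
      by simp
  qed simp
  then have "nat_transformation x z (restrict_func x (comp_func G F)) (restrict_func x (comp_func G' F'))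
      (\<lambda>x \<in> Obj x. \<theta> (FObj F' x) \<cdot>\<^bsub>z\<^esub> FArr G (\<eta> x))"
    by unfold_locales
  then show "\<beta> \<star>\<^bsub>CAT\<^esub> \<alpha> \<in> hom2 CAT (g \<odot>\<^bsub>CAT\<^esub> f) (g' \<odot>\<^bsub>CAT\<^esub> f')"
    unfolding F F' G G'
    using GF.cat_functor_axioms GF'.cat_functor_axioms by (simp add: hom_def cat_nats_iff cat_funcs_iff)
next
  fix f :: "('a, 'b) cat_func" and x y assume f: "f \<in> hom1 CAT x y"
  obtain F where F: "f = (x, y, F)" "cat_functor x y F" "FObj F \<in> extensional (Obj x)" "FArr F \<in> extensional (Arr x)"
    using f by (rule CAT_hom1_cases)
  interpret cat_functor x y F by (rule F(2))
  show "f \<odot>\<^bsub>CAT\<^esub> Unit CAT x = f" "Unit CAT y \<odot>\<^bsub>CAT\<^esub> f = f"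
    using F by (auto intro!: func_eqI[of x])
next
  fix f g h :: "('a, 'b) cat_func" and w x y z
  assume f: "f \<in> hom1 CAT w x" and g: "g \<in> hom1 CAT x y" and h: "h \<in> hom1 CAT y z"
  obtain F where F: "f = (w, x, F)" "cat_functor w x F" using f by (rule CAT_hom1_cases)
  obtain G where G: "g = (x, y, G)" using g by (rule CAT_hom1_cases)
  obtain H where H: "h = (y, z, H)" using h by (rule CAT_hom1_cases)
  interpret cat_functor w x F by (rule F(2))
  show "(h \<odot>\<^bsub>CAT\<^esub> g) \<odot>\<^bsub>CAT\<^esub> f = h \<odot>\<^bsub>CAT\<^esub> g \<odot>\<^bsub>CAT\<^esub> f"
    unfolding F G H by (auto intro!: func_eqI[of w])
next
  fix f f' :: "('a, 'b) cat_func" and \<alpha> x y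
  assume f: "f \<in> hom1 CAT x y" and \<alpha>: "\<alpha> \<in> hom2 CAT f f'"
  obtain F where F: "f = (x, y, F)" using f by (rule CAT_hom1_cases)
  obtain F' \<eta> where F': "\<alpha> = ((x, y, F), (x, y, F'), \<eta>)" "(x, y, F) \<in> cat_funcs" "(x, y, F') \<in> cat_funcs"
    "nat_transformation x y F F' \<eta>" "\<eta> \<in> extensional (Obj x)"
    using \<alpha> unfolding F by (rule CAT_hom2_cases)
  interpret f: nat_transformation x y F F' \<eta> by (rule F'(4))
  show "\<alpha> \<star>\<^bsub>CAT\<^esub> id2 CAT (Unit CAT x) = \<alpha>" "id2 CAT (Unit CAT y) \<star>\<^bsub>CAT\<^esub> \<alpha> = \<alpha>"
    using F' by (auto simp: cat_funcs_iff intro!: func_eqI[of x] extensionalityI[of _ "Obj x"])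
next
  fix f g h f' g' h' :: "('a, 'b) cat_func" and \<alpha> \<beta> \<gamma> w x y z
  assume f: "f \<in> hom1 CAT w x" and g: "g \<in> hom1 CAT x y" and h: "h \<in> hom1 CAT y z"
    and \<alpha>: "\<alpha> \<in> hom2 CAT f f'" and \<beta>: "\<beta> \<in> hom2 CAT g g'" and \<gamma>: "\<gamma> \<in> hom2 CAT h h'"
  obtain F where F: "f = (w, x, F)" using f by (rule CAT_hom1_cases)
  obtain G where G: "g = (x, y, G)" using g by (rule CAT_hom1_cases)
  obtain H where H: "h = (y, z, H)" using h by (rule CAT_hom1_cases)
  obtain F' \<eta> where F': "\<alpha> = ((w, x, F), (w, x, F'), \<eta>)" "nat_transformation w x F F' \<eta>"
    using \<alpha> unfolding F by (rule CAT_hom2_cases)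
  obtain G' \<theta> where G': "\<beta> = ((x, y, G), (x, y, G'), \<theta>)" "nat_transformation x y G G' \<theta>"
    using \<beta> unfolding G by (rule CAT_hom2_cases)
  obtain H' \<kappa> where H': "\<gamma> = ((y, z, H), (y, z, H'), \<kappa>)" "nat_transformation y z H H' \<kappa>"
    using \<gamma> unfolding H by (rule CAT_hom2_cases)
  interpret f: nat_transformation w x F F' \<eta> by (rule F'(2))
  interpret g: nat_transformation x y G G' \<theta> by (rule G'(2))
  interpret h: nat_transformation y z H H' \<kappa> by (rule H'(2))
  show "(\<gamma> \<star>\<^bsub>CAT\<^esub> \<beta>) \<star>\<^bsub>CAT\<^esub> \<alpha> = \<gamma> \<star>\<^bsub>CAT\<^esub> \<beta> \<star>\<^bsub>CAT\<^esub> \<alpha>"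
    unfolding F' G' H' by (auto intro!: func_eqI[of w] extensionalityI[of _ "Obj w"])
next
  fix f g :: "('a, 'b) cat_func" and x y z assume f: "f \<in> hom1 CAT x y" and g: "g \<in> hom1 CAT y z"
  obtain F where F: "f = (x, y, F)" "cat_functor x y F" using f by (rule CAT_hom1_cases)
  obtain G where G: "g = (y, z, G)" "cat_functor y z G" using g by (rule CAT_hom1_cases)
  interpret F: cat_functor x y F by (rule F(2))
  interpret G: cat_functor y z G by (rule G(2))
  show "id2 CAT g \<star>\<^bsub>CAT\<^esub> id2 CAT f = id2 CAT (g \<odot>\<^bsub>CAT\<^esub> f)"
    unfolding F G by (auto intro!: extensionalityI[of _ "Obj x"])
next
  fix f g f' g' f'' g'' :: "('a, 'b) cat_func" and \<alpha> \<alpha>' \<beta> \<beta>' x y z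
  assume f: "f \<in> hom1 CAT x y" and g: "g \<in> hom1 CAT y z" and \<alpha>: "\<alpha> \<in> hom2 CAT f f'" and \<alpha>': "\<alpha>' \<in> hom2 CAT f' f''"
    and \<beta>: "\<beta> \<in> hom2 CAT g g'" and \<beta>': "\<beta>' \<in> hom2 CAT g' g''"
  obtain F where F: "f = (x, y, F)" using f by (rule CAT_hom1_cases)
  obtain G where G: "g = (y, z, G)" using g by (rule CAT_hom1_cases)
  obtain F' \<eta> where F': "\<alpha> = ((x, y, F), (x, y, F'), \<eta>)" "f' = (x, y, F')" "nat_transformation x y F F' \<eta>"
    using \<alpha> unfolding F by (rule CAT_hom2_cases)
  obtain F'' \<eta>' where F'': "\<alpha>' = ((x, y, F'), (x, y, F''), \<eta>')" "nat_transformation x y F' F'' \<eta>'"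
    using \<alpha>' unfolding F' by (rule CAT_hom2_cases)
  obtain G' \<theta> where G': "\<beta> = ((y, z, G), (y, z, G'), \<theta>)" "g' = (y, z, G')" "nat_transformation y z G G' \<theta>"
    using \<beta> unfolding G by (rule CAT_hom2_cases)
  obtain G'' \<theta>' where G'': "\<beta>' = ((y, z, G'), (y, z, G''), \<theta>')" "nat_transformation y z G' G'' \<theta>'"
    using \<beta>' unfolding G' by (rule CAT_hom2_cases)
  interpret f: nat_transformation x y F F' \<eta> by (rule F'(3))
  interpret f': nat_transformation x y F' F'' \<eta>' by (rule F''(2))
  interpret g: nat_transformation y z G G' \<theta> by (rule G'(3))
  interpret g': nat_transformation y z G' G'' \<theta>' by (rule G''(2))
  have "\<theta> (FObj F'' u) \<cdot>\<^bsub>z\<^esub> (FArr G (\<eta>' u) \<cdot>\<^bsub>z\<^esub> FArr G (\<eta> u)) = FArr G' (\<eta>' u) \<cdot>\<^bsub>z\<^esub> (\<theta> (FObj F' u) \<cdot>\<^bsub>z\<^esub> FArr G (\<eta> u))"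
    if "u \<in> Obj x" for u
    using g.natural_right[of "\<eta>' u" "FArr G (\<eta> u)"] that by simp
  then show "(\<beta>' \<bullet>\<^bsub>CAT\<^esub> \<beta>) \<star>\<^bsub>CAT\<^esub> (\<alpha>' \<bullet>\<^bsub>CAT\<^esub> \<alpha>) = (\<beta>' \<star>\<^bsub>CAT\<^esub> \<alpha>') \<bullet>\<^bsub>CAT\<^esub> (\<beta> \<star>\<^bsub>CAT\<^esub> \<alpha>)"
    unfolding F' F'' G' G'' by (auto intro!: extensionalityI[of _ "Obj x"])
qed

section \<open>The 2-category of normal pseudo-functors\<close>

locale pseudonat = F: pseudofunctor A B F + G: pseudofunctor A B G
  for A :: "('o, 'm, 'c) two_cat" and B :: "('p, 'n, 'd) two_cat" and F G +
  fixes \<sigma> :: "('o, 'm, 'n, 'd) ptrans"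
  assumes pn: "pseudo_natural A B F G \<sigma>"
begin

lemma cmp [simp]:
  assumes "x \<in> Ob A"
  shows "Cmp \<sigma> x \<in> Mor B" "Src B (Cmp \<sigma> x) = PO F x" "Trg B (Cmp \<sigma> x) = PO G x"
  using pn assms by (auto simp: pseudo_natural_def hom1_def)

lemma sq [simp]:
  assumes "a \<in> Mor A"
  shows "Sq \<sigma> a \<in> Cell B" "Dom (Vert B) (Sq \<sigma> a) = P1 G a \<odot>\<^bsub>B\<^esub> Cmp \<sigma> (Src A a)"
    "Cod (Vert B) (Sq \<sigma> a) = Cmp \<sigma> (Trg A a) \<odot>\<^bsub>B\<^esub> P1 F a" "invertible (Vert B) (Sq \<sigma> a)"
  using pn[unfolded pseudo_natural_def, THEN conjunct2, THEN conjunct1, rule_format, of "Src A a" "Trg A a" a] assms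
  by (auto simp: hom1_def hom_def)

lemma sq_natural:
  assumes "\<alpha> \<in> Cell A"
  shows "Sq \<sigma> (Cod (Vert A) \<alpha>) \<bullet>\<^bsub>B\<^esub> (P2 G \<alpha> \<star>\<^bsub>B\<^esub> id2 B (Cmp \<sigma> (Src A (Dom (Vert A) \<alpha>)))) =
    (id2 B (Cmp \<sigma> (Trg A (Dom (Vert A) \<alpha>))) \<star>\<^bsub>B\<^esub> P2 F \<alpha>) \<bullet>\<^bsub>B\<^esub> Sq \<sigma> (Dom (Vert A) \<alpha>)"
  using pn[unfolded pseudo_natural_def, THEN conjunct2, THEN conjunct2, THEN conjunct1, rule_format,
      of "Src A (Dom (Vert A) \<alpha>)" "Trg A (Dom (Vert A) \<alpha>)" "Dom (Vert A) \<alpha>" "Cod (Vert A) \<alpha>" \<alpha>] assms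
  by (auto simp: hom1_def hom_def)

lemma sq_unit [simp]: "x \<in> Ob A \<Longrightarrow> Sq \<sigma> (Unit A x) = id2 B (Cmp \<sigma> x)"
  using pn by (auto simp: pseudo_natural_def)

lemma sq_comp:
  assumes "a \<in> Mor A" "b \<in> Mor A" "Trg A a = Src A b"
  shows "Sq \<sigma> (b \<odot>\<^bsub>A\<^esub> a) \<bullet>\<^bsub>B\<^esub> (PC G b a \<star>\<^bsub>B\<^esub> id2 B (Cmp \<sigma> (Src A a))) =
      (id2 B (Cmp \<sigma> (Trg A b)) \<star>\<^bsub>B\<^esub> PC F b a) \<bullet>\<^bsub>B\<^esub> (Sq \<sigma> b \<star>\<^bsub>B\<^esub> id2 B (P1 F a)) \<bullet>\<^bsub>B\<^esub>
        (id2 B (P1 G b) \<star>\<^bsub>B\<^esub> Sq \<sigma> a)"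
  using pn[unfolded pseudo_natural_def, THEN conjunct2, THEN conjunct2, THEN conjunct2, THEN conjunct2, rule_format,
      of "Src A a" "Src A b" "Trg A b" a b] assms
  by (auto simp: hom1_def)

end

lemma pseudo_naturalI:
  assumes "two_category A" "two_category B"
    and cmp: "\<And>x. x \<in> Ob A \<Longrightarrow> Cmp \<sigma> x \<in> Mor B \<and> Src B (Cmp \<sigma> x) = PO F x \<and> Trg B (Cmp \<sigma> x) = PO G x"
    and sq: "\<And>a. a \<in> Mor A \<Longrightarrow> Sq \<sigma> a \<in> Cell B \<and> Dom (Vert B) (Sq \<sigma> a) = P1 G a \<odot>\<^bsub>B\<^esub> Cmp \<sigma> (Src A a) \<and>
      Cod (Vert B) (Sq \<sigma> a) = Cmp \<sigma> (Trg A a) \<odot>\<^bsub>B\<^esub> P1 F a \<and> invertible (Vert B) (Sq \<sigma> a)"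
    and natural: "\<And>\<alpha>. \<alpha> \<in> Cell A \<Longrightarrow>
      Sq \<sigma> (Cod (Vert A) \<alpha>) \<bullet>\<^bsub>B\<^esub> (P2 G \<alpha> \<star>\<^bsub>B\<^esub> id2 B (Cmp \<sigma> (Src A (Dom (Vert A) \<alpha>)))) =
      (id2 B (Cmp \<sigma> (Trg A (Dom (Vert A) \<alpha>))) \<star>\<^bsub>B\<^esub> P2 F \<alpha>) \<bullet>\<^bsub>B\<^esub> Sq \<sigma> (Dom (Vert A) \<alpha>)"
    and unit: "\<And>x. x \<in> Ob A \<Longrightarrow> Sq \<sigma> (Unit A x) = id2 B (Cmp \<sigma> x)"
    and comp: "\<And>a b. a \<in> Mor A \<Longrightarrow> b \<in> Mor A \<Longrightarrow> Trg A a = Src A b \<Longrightarrow>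
      Sq \<sigma> (b \<odot>\<^bsub>A\<^esub> a) \<bullet>\<^bsub>B\<^esub> (PC G b a \<star>\<^bsub>B\<^esub> id2 B (Cmp \<sigma> (Src A a))) =
      (id2 B (Cmp \<sigma> (Trg A b)) \<star>\<^bsub>B\<^esub> PC F b a) \<bullet>\<^bsub>B\<^esub> (Sq \<sigma> b \<star>\<^bsub>B\<^esub> id2 B (P1 F a)) \<bullet>\<^bsub>B\<^esub>
        (id2 B (P1 G b) \<star>\<^bsub>B\<^esub> Sq \<sigma> a)"
  shows "pseudo_natural A B F G \<sigma>"
  using cmp sq natural unit comp
  unfolding pseudo_natural_def by (auto simp: hom1_def hom_def)

locale modification = S: pseudonat A B F G \<sigma> + T: pseudonat A B F G \<tau>
  for A :: "('o, 'm, 'c) two_cat" and B :: "('p, 'n, 'd) two_cat" and F G \<sigma> \<tau> +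
  fixes \<mu> :: "'o \<Rightarrow> 'd"
  assumes is_mod: "is_modification A B F G \<sigma> \<tau> \<mu>"
begin

lemma component [simp]:
  assumes "x \<in> Ob A"
  shows "\<mu> x \<in> Cell B" "Dom (Vert B) (\<mu> x) = Cmp \<sigma> x" "Cod (Vert B) (\<mu> x) = Cmp \<tau> x"
  using is_mod assms by (auto simp: is_modification_def hom_def)

lemma natural:
  "a \<in> Mor A \<Longrightarrow> Sq \<tau> a \<bullet>\<^bsub>B\<^esub> (id2 B (P1 G a) \<star>\<^bsub>B\<^esub> \<mu> (Src A a)) = (\<mu> (Trg A a) \<star>\<^bsub>B\<^esub> id2 B (P1 F a)) \<bullet>\<^bsub>B\<^esub> Sq \<sigma> a"
  using is_mod by (auto simp: is_modification_def hom1_def)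

end

lemma is_modificationI:
  assumes "\<And>x. x \<in> Ob A \<Longrightarrow> \<mu> x \<in> Cell B \<and> Dom (Vert B) (\<mu> x) = Cmp \<sigma> x \<and> Cod (Vert B) (\<mu> x) = Cmp \<tau> x"
    and "\<And>a. a \<in> Mor A \<Longrightarrow>
      Sq \<tau> a \<bullet>\<^bsub>B\<^esub> (id2 B (P1 G a) \<star>\<^bsub>B\<^esub> \<mu> (Src A a)) = (\<mu> (Trg A a) \<star>\<^bsub>B\<^esub> id2 B (P1 F a)) \<bullet>\<^bsub>B\<^esub> Sq \<sigma> a"
  shows "is_modification A B F G \<sigma> \<tau> \<mu>"
  using assms by (auto simp: is_modification_def hom1_def hom_def)

definition ptrans_comp :: "('o, 'm, 'c) two_cat \<Rightarrow> ('p, 'n, 'd) two_cat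
    \<Rightarrow> ('o, 'm, 'n, 'd) ptrans \<Rightarrow> ('o, 'm, 'n, 'd) ptrans \<Rightarrow> ('o, 'm, 'n, 'd) ptrans" where
  "ptrans_comp A B \<tau> \<sigma> = \<lparr>
    Cmp = \<lambda>x \<in> Ob A. Cmp \<tau> x \<odot>\<^bsub>B\<^esub> Cmp \<sigma> x,
    Sq = \<lambda>a \<in> Mor A. (id2 B (Cmp \<tau> (Trg A a)) \<star>\<^bsub>B\<^esub> Sq \<sigma> a) \<bullet>\<^bsub>B\<^esub> (Sq \<tau> a \<star>\<^bsub>B\<^esub> id2 B (Cmp \<sigma> (Src A a)))\<rparr>"

definition ptrans_id :: "('o, 'm, 'c) two_cat \<Rightarrow> ('p, 'n, 'd) two_cat
    \<Rightarrow> ('o, 'm, 'c, 'p, 'n, 'd) psfun \<Rightarrow> ('o, 'm, 'n, 'd) ptrans" where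
  "ptrans_id A B F = \<lparr>Cmp = \<lambda>x \<in> Ob A. Unit B (PO F x), Sq = \<lambda>a \<in> Mor A. id2 B (P1 F a)\<rparr>"

lemma ptrans_simps [simp]:
  "x \<in> Ob A \<Longrightarrow> Cmp (ptrans_comp A B \<tau> \<sigma>) x = Cmp \<tau> x \<odot>\<^bsub>B\<^esub> Cmp \<sigma> x"
  "a \<in> Mor A \<Longrightarrow> Sq (ptrans_comp A B \<tau> \<sigma>) a =
    (id2 B (Cmp \<tau> (Trg A a)) \<star>\<^bsub>B\<^esub> Sq \<sigma> a) \<bullet>\<^bsub>B\<^esub> (Sq \<tau> a \<star>\<^bsub>B\<^esub> id2 B (Cmp \<sigma> (Src A a)))"
  "x \<in> Ob A \<Longrightarrow> Cmp (ptrans_id A B F) x = Unit B (PO F x)"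
  "a \<in> Mor A \<Longrightarrow> Sq (ptrans_id A B F) a = id2 B (P1 F a)"
  "Cmp (ptrans_comp A B \<tau> \<sigma>) \<in> extensional (Ob A)" "Sq (ptrans_comp A B \<tau> \<sigma>) \<in> extensional (Mor A)"
  "Cmp (ptrans_id A B F) \<in> extensional (Ob A)" "Sq (ptrans_id A B F) \<in> extensional (Mor A)"
  by (simp_all add: ptrans_comp_def ptrans_id_def)

lemma ptrans_eqI:
  assumes "\<And>x. x \<in> Ob A \<Longrightarrow> Cmp \<sigma> x = Cmp \<tau> x" "\<And>a. a \<in> Mor A \<Longrightarrow> Sq \<sigma> a = Sq \<tau> a"
    "Cmp \<sigma> \<in> extensional (Ob A)" "Sq \<sigma> \<in> extensional (Mor A)"
    "Cmp \<tau> \<in> extensional (Ob A)" "Sq \<tau> \<in> extensional (Mor A)"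
  shows "\<sigma> = (\<tau> :: ('o, 'm, 'n, 'd) ptrans)"
  using assms by (intro ptrans.equality extensionalityI[of _ "Ob A"] extensionalityI[of _ "Mor A"]) auto

lemma Ps_simps [simp]:
  "Ob (Ps A B) = {F. normal_pseudofunctor A B F}" "Mor (Ps A B) = ps_mors A B" "Cell (Ps A B) = ps_cells A B"
  "Dom (Vert (Ps A B)) = asrc" "Cod (Vert (Ps A B)) = atrg" "Src (Ps A B) = asrc" "Trg (Ps A B) = atrg"
  "Unit (Ps A B) F = (F, F, ptrans_id A B F)"
  "id2 (Ps A B) s = (s, s, \<lambda>x \<in> Ob A. id2 B (Cmp (adat s) x))"
  "(t, u, \<nu>) \<bullet>\<^bsub>Ps A B\<^esub> (s, t', \<mu>) = (s, u, \<lambda>x \<in> Ob A. \<nu> x \<bullet>\<^bsub>B\<^esub> \<mu> x)"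
  "(G, H, \<tau>) \<odot>\<^bsub>Ps A B\<^esub> (F, G', \<sigma>) = (F, H, ptrans_comp A B \<tau> \<sigma>)"
  "(t, t', \<nu>) \<star>\<^bsub>Ps A B\<^esub> (s, s', \<mu>) = (t \<odot>\<^bsub>Ps A B\<^esub> s, t' \<odot>\<^bsub>Ps A B\<^esub> s', \<lambda>x \<in> Ob A. \<nu> x \<star>\<^bsub>B\<^esub> \<mu> x)"
  by (simp_all add: Ps_def ptrans_id_def ptrans_comp_def ps_comp_def)

locale two_category_pair = A: two_category A + B: two_category B
  for A :: "('o, 'm, 'c) two_cat" and B :: "('p, 'n, 'd) two_cat"
begin

lemma pseudofunctor_iff: "pseudofunctor A B F \<longleftrightarrow> normal_pseudofunctor A B F"
  using A.two_category_axioms B.two_category_axioms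
  by (auto simp: pseudofunctor_def pseudofunctor_axioms_def)

lemma ps_mors_iff: "(F, G, \<sigma>) \<in> ps_mors A B \<longleftrightarrow>
    pseudonat A B F G \<sigma> \<and> Cmp \<sigma> \<in> extensional (Ob A) \<and> Sq \<sigma> \<in> extensional (Mor A)"
  by (auto simp: ps_mors_def pseudonat_def pseudonat_axioms_def pseudofunctor_iff)

lemma ps_cells_iff: "((F, G, \<sigma>), (F', G', \<tau>), \<mu>) \<in> ps_cells A B \<longleftrightarrow>
    (F, G, \<sigma>) \<in> ps_mors A B \<and> (F, G, \<tau>) \<in> ps_mors A B \<and> F' = F \<and> G' = G \<and>
    modification A B F G \<sigma> \<tau> \<mu> \<and> \<mu> \<in> extensional (Ob A)"
  by (auto simp: ps_cells_def modification_def modification_axioms_def ps_mors_iff)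

lemma ps_mors_cases:
  assumes "s \<in> ps_mors A B"
  obtains F G \<sigma> where "s = (F, G, \<sigma>)" "pseudonat A B F G \<sigma>" "Cmp \<sigma> \<in> extensional (Ob A)" "Sq \<sigma> \<in> extensional (Mor A)"
  using assms by (cases s) (auto simp: ps_mors_iff)

lemma ps_cells_cases:
  assumes "m \<in> ps_cells A B"
  obtains F G \<sigma> \<tau> \<mu> where "m = ((F, G, \<sigma>), (F, G, \<tau>), \<mu>)" "(F, G, \<sigma>) \<in> ps_mors A B" "(F, G, \<tau>) \<in> ps_mors A B"
    "modification A B F G \<sigma> \<tau> \<mu>" "\<mu> \<in> extensional (Ob A)"
proof -
  obtain F G \<sigma> F' G' \<tau> \<mu> where m: "m = ((F, G, \<sigma>), (F', G', \<tau>), \<mu>)"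
    by (metis surj_pair)
  show thesis
    using assms that unfolding m ps_cells_iff by blast
qed

lemma pseudonat_id:
  assumes "pseudofunctor A B F"
  shows "pseudonat A B F F (ptrans_id A B F)"
proof -
  interpret F: pseudofunctor A B F by fact
  have "pseudo_natural A B F F (ptrans_id A B F)"
    by (rule pseudo_naturalI[OF A.two_category_axioms B.two_category_axioms]) auto
  then show ?thesis
    by unfold_locales
qed

text \<open>The axioms of a composite follow by pasting those of the factors; the compositor axiom needs in
addition that the 2-morphism component of \<open>\<tau>\<close> at \<open>b\<close> slides past that of \<open>\<sigma>\<close> at \<open>a\<close>.\<close>

lemma pseudonat_comp:
  assumes "pseudonat A B F G \<sigma>" "pseudonat A B G H \<tau>"
  shows "pseudonat A B F H (ptrans_comp A B \<tau> \<sigma>)"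
proof -
  interpret s: pseudonat A B F G \<sigma> by fact
  interpret t: pseudonat A B G H \<tau> by fact
  let ?i = "id2 B"
  have "pseudo_natural A B F H (ptrans_comp A B \<tau> \<sigma>)"
  proof (rule pseudo_naturalI[OF A.two_category_axioms B.two_category_axioms])
    fix \<alpha> assume \<alpha> [simp]: "\<alpha> \<in> Cell A"
    define x y a b where "x = Src A (Dom (Vert A) \<alpha>)" "y = Trg A (Dom (Vert A) \<alpha>)" "a = Dom (Vert A) \<alpha>" "b = Cod (Vert A) \<alpha>"
    have [simp]: "x \<in> Ob A" "y \<in> Ob A" "a \<in> Mor A" "b \<in> Mor A" "Src A a = x" "Trg A a = y" "Src A b = x" "Trg A b = y"
      "Dom (Vert A) \<alpha> = a" "Cod (Vert A) \<alpha> = b"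
      by (simp_all add: x_y_a_b_def)
    have "((?i (Cmp \<tau> y) \<star>\<^bsub>B\<^esub> Sq \<sigma> b) \<bullet>\<^bsub>B\<^esub> (Sq \<tau> b \<star>\<^bsub>B\<^esub> ?i (Cmp \<sigma> x))) \<bullet>\<^bsub>B\<^esub> (P2 H \<alpha> \<star>\<^bsub>B\<^esub> ?i (Cmp \<tau> x \<odot>\<^bsub>B\<^esub> Cmp \<sigma> x)) =
        (?i (Cmp \<tau> y) \<star>\<^bsub>B\<^esub> Sq \<sigma> b) \<bullet>\<^bsub>B\<^esub> ((Sq \<tau> b \<bullet>\<^bsub>B\<^esub> (P2 H \<alpha> \<star>\<^bsub>B\<^esub> ?i (Cmp \<tau> x))) \<star>\<^bsub>B\<^esub> ?i (Cmp \<sigma> x))"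
      by simp
    also have "\<dots> = (?i (Cmp \<tau> y) \<star>\<^bsub>B\<^esub> (Sq \<sigma> b \<bullet>\<^bsub>B\<^esub> (P2 G \<alpha> \<star>\<^bsub>B\<^esub> ?i (Cmp \<sigma> x)))) \<bullet>\<^bsub>B\<^esub> (Sq \<tau> a \<star>\<^bsub>B\<^esub> ?i (Cmp \<sigma> x))"
      using t.sq_natural[OF \<alpha>] by simp
    also have "\<dots> = (?i (Cmp \<tau> y \<odot>\<^bsub>B\<^esub> Cmp \<sigma> y) \<star>\<^bsub>B\<^esub> P2 F \<alpha>) \<bullet>\<^bsub>B\<^esub> (?i (Cmp \<tau> y) \<star>\<^bsub>B\<^esub> Sq \<sigma> a) \<bullet>\<^bsub>B\<^esub> (Sq \<tau> a \<star>\<^bsub>B\<^esub> ?i (Cmp \<sigma> x))"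
      using s.sq_natural[OF \<alpha>] by simp
    finally show "Sq (ptrans_comp A B \<tau> \<sigma>) (Cod (Vert A) \<alpha>) \<bullet>\<^bsub>B\<^esub>
        (P2 H \<alpha> \<star>\<^bsub>B\<^esub> ?i (Cmp (ptrans_comp A B \<tau> \<sigma>) (Src A (Dom (Vert A) \<alpha>)))) =
        (?i (Cmp (ptrans_comp A B \<tau> \<sigma>) (Trg A (Dom (Vert A) \<alpha>))) \<star>\<^bsub>B\<^esub> P2 F \<alpha>) \<bullet>\<^bsub>B\<^esub>
        Sq (ptrans_comp A B \<tau> \<sigma>) (Dom (Vert A) \<alpha>)"
      by simp
  next
    fix a b assume ab [simp]: "a \<in> Mor A" "b \<in> Mor A" and ab': "Trg A a = Src A b"
    define x y z where "x = Src A a" "y = Src A b" "z = Trg A b"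
    have [simp]: "x \<in> Ob A" "y \<in> Ob A" "z \<in> Ob A" "Src A a = x" "Trg A a = y" "Src A b = y" "Trg A b = z"
      by (simp_all add: x_y_z_def ab')
    have exchange: "(?i (Cmp \<tau> z \<odot>\<^bsub>B\<^esub> P1 G b) \<star>\<^bsub>B\<^esub> Sq \<sigma> a) \<bullet>\<^bsub>B\<^esub> (Sq \<tau> b \<star>\<^bsub>B\<^esub> ?i (P1 G a \<odot>\<^bsub>B\<^esub> Cmp \<sigma> x)) =
        (Sq \<tau> b \<star>\<^bsub>B\<^esub> ?i (Cmp \<sigma> y \<odot>\<^bsub>B\<^esub> P1 F a)) \<bullet>\<^bsub>B\<^esub> (?i (P1 H b \<odot>\<^bsub>B\<^esub> Cmp \<tau> y) \<star>\<^bsub>B\<^esub> Sq \<sigma> a)"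
      using B.whisker_exchange[of "Sq \<sigma> a" "Sq \<tau> b"] by simp
    have "((?i (Cmp \<tau> z) \<star>\<^bsub>B\<^esub> Sq \<sigma> (b \<odot>\<^bsub>A\<^esub> a)) \<bullet>\<^bsub>B\<^esub> (Sq \<tau> (b \<odot>\<^bsub>A\<^esub> a) \<star>\<^bsub>B\<^esub> ?i (Cmp \<sigma> x))) \<bullet>\<^bsub>B\<^esub>
          (PC H b a \<star>\<^bsub>B\<^esub> ?i (Cmp \<tau> x \<odot>\<^bsub>B\<^esub> Cmp \<sigma> x)) =
        (?i (Cmp \<tau> z) \<star>\<^bsub>B\<^esub> Sq \<sigma> (b \<odot>\<^bsub>A\<^esub> a)) \<bullet>\<^bsub>B\<^esub> ((Sq \<tau> (b \<odot>\<^bsub>A\<^esub> a) \<bullet>\<^bsub>B\<^esub> (PC H b a \<star>\<^bsub>B\<^esub> ?i (Cmp \<tau> x))) \<star>\<^bsub>B\<^esub> ?i (Cmp \<sigma> x))"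
      by simp
    also have "\<dots> = (?i (Cmp \<tau> z) \<star>\<^bsub>B\<^esub> (Sq \<sigma> (b \<odot>\<^bsub>A\<^esub> a) \<bullet>\<^bsub>B\<^esub> (PC G b a \<star>\<^bsub>B\<^esub> ?i (Cmp \<sigma> x)))) \<bullet>\<^bsub>B\<^esub>
        (Sq \<tau> b \<star>\<^bsub>B\<^esub> ?i (P1 G a \<odot>\<^bsub>B\<^esub> Cmp \<sigma> x)) \<bullet>\<^bsub>B\<^esub> (?i (P1 H b) \<star>\<^bsub>B\<^esub> Sq \<tau> a \<star>\<^bsub>B\<^esub> ?i (Cmp \<sigma> x))"
      using t.sq_comp[OF ab ab'] by simp
    also have "\<dots> = (?i (Cmp \<tau> z \<odot>\<^bsub>B\<^esub> Cmp \<sigma> z) \<star>\<^bsub>B\<^esub> PC F b a) \<bullet>\<^bsub>B\<^esub> (?i (Cmp \<tau> z) \<star>\<^bsub>B\<^esub> Sq \<sigma> b \<star>\<^bsub>B\<^esub> ?i (P1 F a)) \<bullet>\<^bsub>B\<^esub>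
        ((?i (Cmp \<tau> z \<odot>\<^bsub>B\<^esub> P1 G b) \<star>\<^bsub>B\<^esub> Sq \<sigma> a) \<bullet>\<^bsub>B\<^esub> (Sq \<tau> b \<star>\<^bsub>B\<^esub> ?i (P1 G a \<odot>\<^bsub>B\<^esub> Cmp \<sigma> x))) \<bullet>\<^bsub>B\<^esub>
        (?i (P1 H b) \<star>\<^bsub>B\<^esub> Sq \<tau> a \<star>\<^bsub>B\<^esub> ?i (Cmp \<sigma> x))"
      using s.sq_comp[OF ab ab'] by simp
    also have "\<dots> = (?i (Cmp \<tau> z \<odot>\<^bsub>B\<^esub> Cmp \<sigma> z) \<star>\<^bsub>B\<^esub> PC F b a) \<bullet>\<^bsub>B\<^esub>
        (((?i (Cmp \<tau> z) \<star>\<^bsub>B\<^esub> Sq \<sigma> b) \<bullet>\<^bsub>B\<^esub> (Sq \<tau> b \<star>\<^bsub>B\<^esub> ?i (Cmp \<sigma> y))) \<star>\<^bsub>B\<^esub> ?i (P1 F a)) \<bullet>\<^bsub>B\<^esub>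
        (?i (P1 H b) \<star>\<^bsub>B\<^esub> ((?i (Cmp \<tau> y) \<star>\<^bsub>B\<^esub> Sq \<sigma> a) \<bullet>\<^bsub>B\<^esub> (Sq \<tau> a \<star>\<^bsub>B\<^esub> ?i (Cmp \<sigma> x))))"
      unfolding exchange by simp
    finally show "Sq (ptrans_comp A B \<tau> \<sigma>) (b \<odot>\<^bsub>A\<^esub> a) \<bullet>\<^bsub>B\<^esub> (PC H b a \<star>\<^bsub>B\<^esub> ?i (Cmp (ptrans_comp A B \<tau> \<sigma>) (Src A a))) =
        (?i (Cmp (ptrans_comp A B \<tau> \<sigma>) (Trg A b)) \<star>\<^bsub>B\<^esub> PC F b a) \<bullet>\<^bsub>B\<^esub>
        (Sq (ptrans_comp A B \<tau> \<sigma>) b \<star>\<^bsub>B\<^esub> ?i (P1 F a)) \<bullet>\<^bsub>B\<^esub> (?i (P1 H b) \<star>\<^bsub>B\<^esub> Sq (ptrans_comp A B \<tau> \<sigma>) a)"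
      by simp
  qed auto
  then show ?thesis
    by unfold_locales
qed

lemma modification_id:
  assumes "pseudonat A B F G \<sigma>"
  shows "modification A B F G \<sigma> \<sigma> (\<lambda>x \<in> Ob A. id2 B (Cmp \<sigma> x))"
proof -
  interpret s: pseudonat A B F G \<sigma> by fact
  have "is_modification A B F G \<sigma> \<sigma> (\<lambda>x \<in> Ob A. id2 B (Cmp \<sigma> x))"
    by (rule is_modificationI) auto
  then show ?thesis
    by unfold_locales
qed

lemma modification_vcomp:
  assumes "modification A B F G \<rho> \<sigma> \<mu>" "modification A B F G \<sigma> \<tau> \<nu>"
  shows "modification A B F G \<rho> \<tau> (\<lambda>x \<in> Ob A. \<nu> x \<bullet>\<^bsub>B\<^esub> \<mu> x)"
proof -
  interpret m: modification A B F G \<rho> \<sigma> \<mu> by fact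
  interpret n: modification A B F G \<sigma> \<tau> \<nu> by fact
  have "is_modification A B F G \<rho> \<tau> (\<lambda>x \<in> Ob A. \<nu> x \<bullet>\<^bsub>B\<^esub> \<mu> x)"
  proof (rule is_modificationI)
    fix a assume a [simp]: "a \<in> Mor A"
    let ?l = "\<lambda>\<alpha>. id2 B (P1 G a) \<star>\<^bsub>B\<^esub> \<alpha>" and ?r = "\<lambda>\<alpha>. \<alpha> \<star>\<^bsub>B\<^esub> id2 B (P1 F a)"
    have "Sq \<tau> a \<bullet>\<^bsub>B\<^esub> ?l (\<nu> (Src A a) \<bullet>\<^bsub>B\<^esub> \<mu> (Src A a)) = (Sq \<tau> a \<bullet>\<^bsub>B\<^esub> ?l (\<nu> (Src A a))) \<bullet>\<^bsub>B\<^esub> ?l (\<mu> (Src A a))"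
      by simp
    also have "\<dots> = ?r (\<nu> (Trg A a)) \<bullet>\<^bsub>B\<^esub> (Sq \<sigma> a \<bullet>\<^bsub>B\<^esub> ?l (\<mu> (Src A a)))"
      unfolding n.natural[OF a] by simp
    also have "\<dots> = ?r (\<nu> (Trg A a) \<bullet>\<^bsub>B\<^esub> \<mu> (Trg A a)) \<bullet>\<^bsub>B\<^esub> Sq \<rho> a"
      unfolding m.natural[OF a] by simp
    finally show "Sq \<tau> a \<bullet>\<^bsub>B\<^esub> ?l ((\<lambda>x \<in> Ob A. \<nu> x \<bullet>\<^bsub>B\<^esub> \<mu> x) (Src A a)) = ?r ((\<lambda>x \<in> Ob A. \<nu> x \<bullet>\<^bsub>B\<^esub> \<mu> x) (Trg A a)) \<bullet>\<^bsub>B\<^esub> Sq \<rho> a"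
      by simp
  qed simp
  then show ?thesis
    by unfold_locales
qed

text \<open>The interchange law splits the two sides into a part for \<open>\<nu>\<close> and a part for \<open>\<mu>\<close>, and each
part is transformed by the modification axiom of its factor.\<close>

lemma modification_hcomp:
  assumes "modification A B F G \<sigma> \<sigma>' \<mu>" "modification A B G H \<tau> \<tau>' \<nu>"
  shows "modification A B F H (ptrans_comp A B \<tau> \<sigma>) (ptrans_comp A B \<tau>' \<sigma>') (\<lambda>x \<in> Ob A. \<nu> x \<star>\<^bsub>B\<^esub> \<mu> x)"
proof -
  interpret m: modification A B F G \<sigma> \<sigma>' \<mu> by fact
  interpret n: modification A B G H \<tau> \<tau>' \<nu> by fact
  interpret c: pseudonat A B F H "ptrans_comp A B \<tau> \<sigma>"
    by (rule pseudonat_comp[OF m.S.pseudonat_axioms n.S.pseudonat_axioms])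
  interpret c': pseudonat A B F H "ptrans_comp A B \<tau>' \<sigma>'"
    by (rule pseudonat_comp[OF m.T.pseudonat_axioms n.T.pseudonat_axioms])
  let ?i = "id2 B"
  have "is_modification A B F H (ptrans_comp A B \<tau> \<sigma>) (ptrans_comp A B \<tau>' \<sigma>') (\<lambda>x \<in> Ob A. \<nu> x \<star>\<^bsub>B\<^esub> \<mu> x)"
  proof (rule is_modificationI)
    fix a assume a [simp]: "a \<in> Mor A"
    define x y where "x = Src A a" "y = Trg A a"
    have [simp]: "x \<in> Ob A" "y \<in> Ob A" "Src A a = x" "Trg A a = y"
      by (simp_all add: x_y_def)
    have "((?i (Cmp \<tau>' y) \<star>\<^bsub>B\<^esub> Sq \<sigma>' a) \<bullet>\<^bsub>B\<^esub> (Sq \<tau>' a \<star>\<^bsub>B\<^esub> ?i (Cmp \<sigma>' x))) \<bullet>\<^bsub>B\<^esub> (?i (P1 H a) \<star>\<^bsub>B\<^esub> \<nu> x \<star>\<^bsub>B\<^esub> \<mu> x) =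
        (?i (Cmp \<tau>' y) \<star>\<^bsub>B\<^esub> Sq \<sigma>' a) \<bullet>\<^bsub>B\<^esub> ((Sq \<tau>' a \<bullet>\<^bsub>B\<^esub> (?i (P1 H a) \<star>\<^bsub>B\<^esub> \<nu> x)) \<star>\<^bsub>B\<^esub> (?i (Cmp \<sigma>' x) \<bullet>\<^bsub>B\<^esub> \<mu> x))"
      by (subst B.HC2_vcomp) simp_all
    also have "\<dots> = (?i (Cmp \<tau>' y) \<star>\<^bsub>B\<^esub> Sq \<sigma>' a) \<bullet>\<^bsub>B\<^esub> (((\<nu> y \<star>\<^bsub>B\<^esub> ?i (P1 G a)) \<bullet>\<^bsub>B\<^esub> Sq \<tau> a) \<star>\<^bsub>B\<^esub> (\<mu> x \<bullet>\<^bsub>B\<^esub> ?i (Cmp \<sigma> x)))"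
      using n.natural[OF a] by simp
    also have "\<dots> = ((?i (Cmp \<tau>' y) \<star>\<^bsub>B\<^esub> Sq \<sigma>' a) \<bullet>\<^bsub>B\<^esub> (\<nu> y \<star>\<^bsub>B\<^esub> (?i (P1 G a) \<star>\<^bsub>B\<^esub> \<mu> x))) \<bullet>\<^bsub>B\<^esub> (Sq \<tau> a \<star>\<^bsub>B\<^esub> ?i (Cmp \<sigma> x))"
      by (subst B.HC2_vcomp) simp_all
    also have "(?i (Cmp \<tau>' y) \<star>\<^bsub>B\<^esub> Sq \<sigma>' a) \<bullet>\<^bsub>B\<^esub> (\<nu> y \<star>\<^bsub>B\<^esub> (?i (P1 G a) \<star>\<^bsub>B\<^esub> \<mu> x)) =
        (?i (Cmp \<tau>' y) \<bullet>\<^bsub>B\<^esub> \<nu> y) \<star>\<^bsub>B\<^esub> (Sq \<sigma>' a \<bullet>\<^bsub>B\<^esub> (?i (P1 G a) \<star>\<^bsub>B\<^esub> \<mu> x))"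
      by (rule B.HC2_vcomp[symmetric]) simp_all
    also have "\<dots> = (\<nu> y \<bullet>\<^bsub>B\<^esub> ?i (Cmp \<tau> y)) \<star>\<^bsub>B\<^esub> ((\<mu> y \<star>\<^bsub>B\<^esub> ?i (P1 F a)) \<bullet>\<^bsub>B\<^esub> Sq \<sigma> a)"
      using m.natural[OF a] by simp
    also have "\<dots> = (\<nu> y \<star>\<^bsub>B\<^esub> \<mu> y \<star>\<^bsub>B\<^esub> ?i (P1 F a)) \<bullet>\<^bsub>B\<^esub> (?i (Cmp \<tau> y) \<star>\<^bsub>B\<^esub> Sq \<sigma> a)"
      by (rule B.HC2_vcomp) simp_all
    finally show "Sq (ptrans_comp A B \<tau>' \<sigma>') a \<bullet>\<^bsub>B\<^esub> (?i (P1 H a) \<star>\<^bsub>B\<^esub> (\<lambda>x \<in> Ob A. \<nu> x \<star>\<^bsub>B\<^esub> \<mu> x) (Src A a)) =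
        ((\<lambda>x \<in> Ob A. \<nu> x \<star>\<^bsub>B\<^esub> \<mu> x) (Trg A a) \<star>\<^bsub>B\<^esub> ?i (P1 F a)) \<bullet>\<^bsub>B\<^esub> Sq (ptrans_comp A B \<tau> \<sigma>) a"
      by simp
  qed simp
  then show ?thesis
    by unfold_locales
qed

lemma Ps_hom1_cases:
  assumes "s \<in> hom1 (Ps A B) F G"
  obtains \<sigma> where "s = (F, G, \<sigma>)" "pseudonat A B F G \<sigma>" "Cmp \<sigma> \<in> extensional (Ob A)" "Sq \<sigma> \<in> extensional (Mor A)"
  using assms by (auto simp: hom1_def elim!: ps_mors_cases)

lemma Ps_hom2_cases:
  assumes "m \<in> hom2 (Ps A B) (F, G, \<sigma>) t"
  obtains \<tau> \<mu> where "m = ((F, G, \<sigma>), (F, G, \<tau>), \<mu>)" "t = (F, G, \<tau>)" "(F, G, \<sigma>) \<in> ps_mors A B" "(F, G, \<tau>) \<in> ps_mors A B"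
    "modification A B F G \<sigma> \<tau> \<mu>" "\<mu> \<in> extensional (Ob A)"
  using assms by (auto simp: hom_def elim!: ps_cells_cases)

lemma category_Ps_Vert: "category (Vert (Ps A B))"
proof
  fix f assume "f \<in> Cell (Ps A B)"
  then show "Dom (Vert (Ps A B)) f \<in> Mor (Ps A B)" "Cod (Vert (Ps A B)) f \<in> Mor (Ps A B)"
    by (auto elim: ps_cells_cases)
next
  fix s assume "s \<in> Mor (Ps A B)"
  then obtain F G \<sigma> where s: "s = (F, G, \<sigma>)" "(F, G, \<sigma>) \<in> ps_mors A B" "pseudonat A B F G \<sigma>"
    by (auto simp: ps_mors_iff elim!: ps_mors_cases)
  then show "id2 (Ps A B) s \<in> hom2 (Ps A B) s s"
    using modification_id[OF s(3)] by (simp add: hom_def ps_cells_iff)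
next
  fix m n s t u assume m: "m \<in> hom2 (Ps A B) s t" and n: "n \<in> hom2 (Ps A B) t u"
  obtain F G \<sigma> where s: "s = (F, G, \<sigma>)" by (metis surj_pair)
  obtain \<tau> \<mu> where m': "m = ((F, G, \<sigma>), (F, G, \<tau>), \<mu>)" "t = (F, G, \<tau>)" "(F, G, \<sigma>) \<in> ps_mors A B" "modification A B F G \<sigma> \<tau> \<mu>"
    using m unfolding s by (rule Ps_hom2_cases)
  obtain \<upsilon> \<nu> where n': "n = ((F, G, \<tau>), (F, G, \<upsilon>), \<nu>)" "u = (F, G, \<upsilon>)" "(F, G, \<upsilon>) \<in> ps_mors A B" "modification A B F G \<tau> \<upsilon> \<nu>"
    using n unfolding m' by (rule Ps_hom2_cases)
  show "n \<bullet>\<^bsub>Ps A B\<^esub> m \<in> hom2 (Ps A B) s u"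
    using modification_vcomp[OF m'(4) n'(4)] m'(3) n'(3) unfolding s m'(1) n'(1,2) by (simp add: hom_def ps_cells_iff)
next
  fix m s t assume m: "m \<in> hom2 (Ps A B) s t"
  obtain F G \<sigma> where s: "s = (F, G, \<sigma>)" by (metis surj_pair)
  obtain \<tau> \<mu> where m': "m = ((F, G, \<sigma>), (F, G, \<tau>), \<mu>)" "t = (F, G, \<tau>)" "modification A B F G \<sigma> \<tau> \<mu>" "\<mu> \<in> extensional (Ob A)"
    using m unfolding s by (rule Ps_hom2_cases)
  interpret m: modification A B F G \<sigma> \<tau> \<mu> by (rule m'(3))
  show "m \<bullet>\<^bsub>Ps A B\<^esub> id2 (Ps A B) s = m" "id2 (Ps A B) t \<bullet>\<^bsub>Ps A B\<^esub> m = m"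
    using m'(4) unfolding s m'(1,2) by (auto intro!: extensionalityI[of _ "Ob A"])
next
  fix m n k s t u v
  assume m: "m \<in> hom2 (Ps A B) s t" and n: "n \<in> hom2 (Ps A B) t u" and k: "k \<in> hom2 (Ps A B) u v"
  obtain F G \<sigma> where s: "s = (F, G, \<sigma>)" by (metis surj_pair)
  obtain \<tau> \<mu> where m': "m = ((F, G, \<sigma>), (F, G, \<tau>), \<mu>)" "t = (F, G, \<tau>)" "modification A B F G \<sigma> \<tau> \<mu>"
    using m unfolding s by (rule Ps_hom2_cases)
  obtain \<upsilon> \<nu> where n': "n = ((F, G, \<tau>), (F, G, \<upsilon>), \<nu>)" "u = (F, G, \<upsilon>)" "modification A B F G \<tau> \<upsilon> \<nu>"
    using n unfolding m' by (rule Ps_hom2_cases)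
  obtain \<phi> \<kappa> where k': "k = ((F, G, \<upsilon>), (F, G, \<phi>), \<kappa>)" "modification A B F G \<upsilon> \<phi> \<kappa>"
    using k unfolding n' by (rule Ps_hom2_cases)
  interpret m: modification A B F G \<sigma> \<tau> \<mu> by (rule m'(3))
  interpret n: modification A B F G \<tau> \<upsilon> \<nu> by (rule n'(3))
  interpret k: modification A B F G \<upsilon> \<phi> \<kappa> by (rule k'(2))
  show "(k \<bullet>\<^bsub>Ps A B\<^esub> n) \<bullet>\<^bsub>Ps A B\<^esub> m = k \<bullet>\<^bsub>Ps A B\<^esub> n \<bullet>\<^bsub>Ps A B\<^esub> m"
    unfolding m'(1) n'(1) k'(1) by (auto intro!: extensionalityI[of _ "Ob A"])
qed

theorem two_category_Ps: "two_category (Ps A B)"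
proof (rule two_category.intro)
  show "category (Vert (Ps A B))"
    by (rule category_Ps_Vert)
  fix f assume "f \<in> Mor (Ps A B)"
  then show "Src (Ps A B) f \<in> Ob (Ps A B)" "Trg (Ps A B) f \<in> Ob (Ps A B)"
    by (auto simp: ps_mors_def)
next
  fix m s t assume "m \<in> hom2 (Ps A B) s t"
  then show "Src (Ps A B) s = Src (Ps A B) t" "Trg (Ps A B) s = Trg (Ps A B) t"
    by (auto simp: hom_def elim!: ps_cells_cases)
next
  fix F assume "F \<in> Ob (Ps A B)"
  then show "Unit (Ps A B) F \<in> hom1 (Ps A B) F F"
    using pseudonat_id[of F] by (simp add: hom1_def ps_mors_iff pseudofunctor_iff)
next
  fix s t F G H assume s: "s \<in> hom1 (Ps A B) F G" and t: "t \<in> hom1 (Ps A B) G H"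
  obtain \<sigma> where \<sigma>: "s = (F, G, \<sigma>)" "pseudonat A B F G \<sigma>" using s by (rule Ps_hom1_cases)
  obtain \<tau> where \<tau>: "t = (G, H, \<tau>)" "pseudonat A B G H \<tau>" using t by (rule Ps_hom1_cases)
  show "t \<odot>\<^bsub>Ps A B\<^esub> s \<in> hom1 (Ps A B) F H"
    using pseudonat_comp[OF \<sigma>(2) \<tau>(2)] by (simp add: \<sigma>(1) \<tau>(1) hom1_def ps_mors_iff)
next
  fix s t s' t' m n F G H
  assume s: "s \<in> hom1 (Ps A B) F G" and t: "t \<in> hom1 (Ps A B) G H"
    and m: "m \<in> hom2 (Ps A B) s s'" and n: "n \<in> hom2 (Ps A B) t t'"
  obtain \<sigma> where \<sigma>: "s = (F, G, \<sigma>)" "pseudonat A B F G \<sigma>" using s by (rule Ps_hom1_cases)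
  obtain \<tau> where \<tau>: "t = (G, H, \<tau>)" "pseudonat A B G H \<tau>" using t by (rule Ps_hom1_cases)
  obtain \<sigma>' \<mu> where m': "m = ((F, G, \<sigma>), (F, G, \<sigma>'), \<mu>)" "s' = (F, G, \<sigma>')" "modification A B F G \<sigma> \<sigma>' \<mu>"
    using m unfolding \<sigma> by (rule Ps_hom2_cases)
  obtain \<tau>' \<nu> where n': "n = ((G, H, \<tau>), (G, H, \<tau>'), \<nu>)" "t' = (G, H, \<tau>')" "modification A B G H \<tau> \<tau>' \<nu>"
    using n unfolding \<tau> by (rule Ps_hom2_cases)
  interpret m: modification A B F G \<sigma> \<sigma>' \<mu> by (rule m'(3))
  interpret n: modification A B G H \<tau> \<tau>' \<nu> by (rule n'(3))
  show "n \<star>\<^bsub>Ps A B\<^esub> m \<in> hom2 (Ps A B) (t \<odot>\<^bsub>Ps A B\<^esub> s) (t' \<odot>\<^bsub>Ps A B\<^esub> s')"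
    using modification_hcomp[OF m'(3) n'(3)] pseudonat_comp[OF \<sigma>(2) \<tau>(2)]
      pseudonat_comp[OF m.T.pseudonat_axioms n.T.pseudonat_axioms]
    unfolding m'(1,2) n'(1,2) \<sigma>(1) \<tau>(1) by (simp add: hom_def ps_cells_iff ps_mors_iff)
next
  fix s F G assume s: "s \<in> hom1 (Ps A B) F G"
  obtain \<sigma> where \<sigma>: "s = (F, G, \<sigma>)" "pseudonat A B F G \<sigma>" "Cmp \<sigma> \<in> extensional (Ob A)" "Sq \<sigma> \<in> extensional (Mor A)"
    using s by (rule Ps_hom1_cases)
  interpret s: pseudonat A B F G \<sigma> by (rule \<sigma>(2))
  show "s \<odot>\<^bsub>Ps A B\<^esub> Unit (Ps A B) F = s" "Unit (Ps A B) G \<odot>\<^bsub>Ps A B\<^esub> s = s"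
    unfolding \<sigma>(1) using \<sigma>(3,4) by (auto intro!: ptrans_eqI[of A])
next
  fix s t u F G H K
  assume s: "s \<in> hom1 (Ps A B) F G" and t: "t \<in> hom1 (Ps A B) G H" and u: "u \<in> hom1 (Ps A B) H K"
  obtain \<sigma> where \<sigma>: "s = (F, G, \<sigma>)" "pseudonat A B F G \<sigma>" using s by (rule Ps_hom1_cases)
  obtain \<tau> where \<tau>: "t = (G, H, \<tau>)" "pseudonat A B G H \<tau>" using t by (rule Ps_hom1_cases)
  obtain \<upsilon> where \<upsilon>: "u = (H, K, \<upsilon>)" "pseudonat A B H K \<upsilon>" using u by (rule Ps_hom1_cases)
  interpret s: pseudonat A B F G \<sigma> by (rule \<sigma>(2))
  interpret t: pseudonat A B G H \<tau> by (rule \<tau>(2))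
  interpret u: pseudonat A B H K \<upsilon> by (rule \<upsilon>(2))
  show "(u \<odot>\<^bsub>Ps A B\<^esub> t) \<odot>\<^bsub>Ps A B\<^esub> s = u \<odot>\<^bsub>Ps A B\<^esub> t \<odot>\<^bsub>Ps A B\<^esub> s"
    unfolding \<sigma>(1) \<tau>(1) \<upsilon>(1) by (auto intro!: ptrans_eqI[of A])
next
  fix s s' m F G assume s: "s \<in> hom1 (Ps A B) F G" and m: "m \<in> hom2 (Ps A B) s s'"
  obtain \<sigma> where \<sigma>: "s = (F, G, \<sigma>)" using s by (rule Ps_hom1_cases)
  obtain \<sigma>' \<mu> where m': "m = ((F, G, \<sigma>), (F, G, \<sigma>'), \<mu>)" "(F, G, \<sigma>) \<in> ps_mors A B" "(F, G, \<sigma>') \<in> ps_mors A B"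
    "modification A B F G \<sigma> \<sigma>' \<mu>" "\<mu> \<in> extensional (Ob A)"
    using m unfolding \<sigma> by (rule Ps_hom2_cases)
  interpret m: modification A B F G \<sigma> \<sigma>' \<mu> by (rule m'(4))
  show "m \<star>\<^bsub>Ps A B\<^esub> id2 (Ps A B) (Unit (Ps A B) F) = m" "id2 (Ps A B) (Unit (Ps A B) G) \<star>\<^bsub>Ps A B\<^esub> m = m"
    unfolding m'(1) using m'(2,3,5) by (auto simp: ps_mors_iff intro!: ptrans_eqI[of A] extensionalityI[of _ "Ob A"])
next
  fix s t u s' t' u' m n k F G H K
  assume s: "s \<in> hom1 (Ps A B) F G" and t: "t \<in> hom1 (Ps A B) G H" and u: "u \<in> hom1 (Ps A B) H K"
    and m: "m \<in> hom2 (Ps A B) s s'" and n: "n \<in> hom2 (Ps A B) t t'" and k: "k \<in> hom2 (Ps A B) u u'"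
  obtain \<sigma> where \<sigma>: "s = (F, G, \<sigma>)" using s by (rule Ps_hom1_cases)
  obtain \<tau> where \<tau>: "t = (G, H, \<tau>)" using t by (rule Ps_hom1_cases)
  obtain \<upsilon> where \<upsilon>: "u = (H, K, \<upsilon>)" using u by (rule Ps_hom1_cases)
  obtain \<sigma>' \<mu> where m': "m = ((F, G, \<sigma>), (F, G, \<sigma>'), \<mu>)" "modification A B F G \<sigma> \<sigma>' \<mu>"
    using m unfolding \<sigma> by (rule Ps_hom2_cases)
  obtain \<tau>' \<nu> where n': "n = ((G, H, \<tau>), (G, H, \<tau>'), \<nu>)" "modification A B G H \<tau> \<tau>' \<nu>"
    using n unfolding \<tau> by (rule Ps_hom2_cases)
  obtain \<upsilon>' \<kappa> where k': "k = ((H, K, \<upsilon>), (H, K, \<upsilon>'), \<kappa>)" "modification A B H K \<upsilon> \<upsilon>' \<kappa>"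
    using k unfolding \<upsilon> by (rule Ps_hom2_cases)
  interpret m: modification A B F G \<sigma> \<sigma>' \<mu> by (rule m'(2))
  interpret n: modification A B G H \<tau> \<tau>' \<nu> by (rule n'(2))
  interpret k: modification A B H K \<upsilon> \<upsilon>' \<kappa> by (rule k'(2))
  show "(k \<star>\<^bsub>Ps A B\<^esub> n) \<star>\<^bsub>Ps A B\<^esub> m = k \<star>\<^bsub>Ps A B\<^esub> n \<star>\<^bsub>Ps A B\<^esub> m"
    unfolding m'(1) n'(1) k'(1) by (auto intro!: ptrans_eqI[of A] extensionalityI[of _ "Ob A"])
next
  fix s t F G H assume s: "s \<in> hom1 (Ps A B) F G" and t: "t \<in> hom1 (Ps A B) G H"
  obtain \<sigma> where \<sigma>: "s = (F, G, \<sigma>)" "pseudonat A B F G \<sigma>" using s by (rule Ps_hom1_cases)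
  obtain \<tau> where \<tau>: "t = (G, H, \<tau>)" "pseudonat A B G H \<tau>" using t by (rule Ps_hom1_cases)
  interpret s: pseudonat A B F G \<sigma> by (rule \<sigma>(2))
  interpret t: pseudonat A B G H \<tau> by (rule \<tau>(2))
  show "id2 (Ps A B) t \<star>\<^bsub>Ps A B\<^esub> id2 (Ps A B) s = id2 (Ps A B) (t \<odot>\<^bsub>Ps A B\<^esub> s)"
    unfolding \<sigma>(1) \<tau>(1) by (auto intro!: extensionalityI[of _ "Ob A"])
next
  fix s t s' t' s'' t'' m m' n n' F G H
  assume s: "s \<in> hom1 (Ps A B) F G" and t: "t \<in> hom1 (Ps A B) G H"
    and m: "m \<in> hom2 (Ps A B) s s'" and m': "m' \<in> hom2 (Ps A B) s' s''"
    and n: "n \<in> hom2 (Ps A B) t t'" and n': "n' \<in> hom2 (Ps A B) t' t''"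
  obtain \<sigma> where \<sigma>: "s = (F, G, \<sigma>)" using s by (rule Ps_hom1_cases)
  obtain \<tau> where \<tau>: "t = (G, H, \<tau>)" using t by (rule Ps_hom1_cases)
  obtain \<sigma>' \<mu> where \<mu>: "m = ((F, G, \<sigma>), (F, G, \<sigma>'), \<mu>)" "s' = (F, G, \<sigma>')" "modification A B F G \<sigma> \<sigma>' \<mu>"
    using m unfolding \<sigma> by (rule Ps_hom2_cases)
  obtain \<sigma>'' \<mu>' where \<mu>': "m' = ((F, G, \<sigma>'), (F, G, \<sigma>''), \<mu>')" "modification A B F G \<sigma>' \<sigma>'' \<mu>'"
    using m' unfolding \<mu> by (rule Ps_hom2_cases)
  obtain \<tau>' \<nu> where \<nu>: "n = ((G, H, \<tau>), (G, H, \<tau>'), \<nu>)" "t' = (G, H, \<tau>')" "modification A B G H \<tau> \<tau>' \<nu>"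
    using n unfolding \<tau> by (rule Ps_hom2_cases)
  obtain \<tau>'' \<nu>' where \<nu>': "n' = ((G, H, \<tau>'), (G, H, \<tau>''), \<nu>')" "modification A B G H \<tau>' \<tau>'' \<nu>'"
    using n' unfolding \<nu> by (rule Ps_hom2_cases)
  interpret m: modification A B F G \<sigma> \<sigma>' \<mu> by (rule \<mu>(3))
  interpret m': modification A B F G \<sigma>' \<sigma>'' \<mu>' by (rule \<mu>'(2))
  interpret n: modification A B G H \<tau> \<tau>' \<nu> by (rule \<nu>(3))
  interpret n': modification A B G H \<tau>' \<tau>'' \<nu>' by (rule \<nu>'(2))
  show "(n' \<bullet>\<^bsub>Ps A B\<^esub> n) \<star>\<^bsub>Ps A B\<^esub> (m' \<bullet>\<^bsub>Ps A B\<^esub> m) = (n' \<star>\<^bsub>Ps A B\<^esub> m') \<bullet>\<^bsub>Ps A B\<^esub> (n \<star>\<^bsub>Ps A B\<^esub> m)"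
    unfolding \<mu>(1) \<mu>'(1) \<nu>(1) \<nu>'(1) by (auto intro!: extensionalityI[of _ "Ob A"] B.HC2_vcomp)
qed

end

section \<open>The representable 2-functors\<close>

text \<open>Components of the operations of \<open>CAT\<close>, expressed without taking the packaged data apart. They
allow computations with components to be combined with the abstract laws of a 2-category.\<close>

lemma CAT_access:
  "x \<in> Obj (Src CAT f) \<Longrightarrow> FObj (adat (g \<odot>\<^bsub>CAT\<^esub> f)) x = FObj (adat g) (FObj (adat f) x)"
  "\<phi> \<in> Arr (Src CAT f) \<Longrightarrow> FArr (adat (g \<odot>\<^bsub>CAT\<^esub> f)) \<phi> = FArr (adat g) (FArr (adat f) \<phi>)"
  "x \<in> Obj A \<Longrightarrow> FObj (adat (Unit CAT A)) x = x" "\<phi> \<in> Arr A \<Longrightarrow> FArr (adat (Unit CAT A)) \<phi> = \<phi>"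
  "x \<in> Obj (Src CAT f) \<Longrightarrow> adat (id2 CAT f) x = Ident (Trg CAT f) (FObj (adat f) x)"
  "x \<in> Obj (Src CAT (Dom (Vert CAT) \<alpha>)) \<Longrightarrow> adat (\<beta> \<bullet>\<^bsub>CAT\<^esub> \<alpha>) x =
    Comp (Trg CAT (Dom (Vert CAT) \<alpha>)) (adat \<beta> x) (adat \<alpha> x)"
  "x \<in> Obj (Src CAT (Dom (Vert CAT) \<alpha>)) \<Longrightarrow> adat (\<beta> \<star>\<^bsub>CAT\<^esub> \<alpha>) x =
    Comp (Trg CAT (Dom (Vert CAT) \<beta>)) (adat \<beta> (FObj (adat (Cod (Vert CAT) \<alpha>)) x)) (FArr (adat (Dom (Vert CAT) \<beta>)) (adat \<alpha> x))"
  subgoal by (cases f; cases g) simp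
  subgoal by (cases f; cases g) simp
  subgoal by simp
  subgoal by simp
  subgoal by (cases f) simp
  subgoal by (cases \<alpha>; cases \<beta>; cases "fst \<alpha>") auto
  subgoal by (cases \<alpha>; cases \<beta>; cases "fst \<alpha>"; cases "fst \<beta>"; cases "fst (snd \<alpha>)"; cases "fst (snd \<beta>)") auto
  done

lemma CAT_mor_eqI:
  assumes "f \<in> Mor CAT" "g \<in> Mor CAT" "Src CAT f = Src CAT g" "Trg CAT f = Trg CAT g"
    and "\<And>x. x \<in> Obj (Src CAT g) \<Longrightarrow> FObj (adat f) x = FObj (adat g) x"
    and "\<And>\<phi>. \<phi> \<in> Arr (Src CAT g) \<Longrightarrow> FArr (adat f) \<phi> = FArr (adat g) \<phi>"
  shows "f = g"
proof -
  obtain A B F G where "f = (A, B, F)" "g = (A, B, G)"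
    "FObj F \<in> extensional (Obj A)" "FArr F \<in> extensional (Arr A)"
    "FObj G \<in> extensional (Obj A)" "FArr G \<in> extensional (Arr A)"
    using assms(1-4) by (auto elim!: cat_funcs_cases)
  then show ?thesis
    using assms(5,6) by (auto intro: func_eqI[of A])
qed

lemma CAT_cell_eqI:
  assumes "\<alpha> \<in> Cell CAT" "\<beta> \<in> Cell CAT" "Dom (Vert CAT) \<alpha> = Dom (Vert CAT) \<beta>" "Cod (Vert CAT) \<alpha> = Cod (Vert CAT) \<beta>"
    and "\<And>x. x \<in> Obj (Src CAT (Dom (Vert CAT) \<beta>)) \<Longrightarrow> adat \<alpha> x = adat \<beta> x"
  shows "\<alpha> = \<beta>"
  using assms by (auto elim!: cat_nats_cases intro: extensionalityI)

interpretation CAT: two_category CAT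
  by (rule two_category_CAT)

text \<open>The actions of \<open>C(X,-)\<close> and \<open>C(-,Z)\<close> on 2-morphisms. Together with \<open>whisker_func\<close> and
\<open>cowhisker_func\<close> they form strict 2-functors to \<open>CAT\<close>, of which the second is contravariant on
1-morphisms.\<close>

definition whisker_nat :: "('o, 'm, 'c) two_cat \<Rightarrow> 'o \<Rightarrow> 'c \<Rightarrow> ('m, 'c) cat_nat" where
  "whisker_nat C X \<beta> = (whisker_func C X (Dom (Vert C) \<beta>), whisker_func C X (Cod (Vert C) \<beta>),
    \<lambda>f \<in> hom1 C X (Src C (Dom (Vert C) \<beta>)). \<beta> \<star>\<^bsub>C\<^esub> id2 C f)"

definition cowhisker_nat :: "('o, 'm, 'c) two_cat \<Rightarrow> 'c \<Rightarrow> 'o \<Rightarrow> ('m, 'c) cat_nat" where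
  "cowhisker_nat C \<gamma> Z = (cowhisker_func C (Dom (Vert C) \<gamma>) Z, cowhisker_func C (Cod (Vert C) \<gamma>) Z,
    \<lambda>f \<in> hom1 C (Trg C (Dom (Vert C) \<gamma>)) Z. id2 C f \<star>\<^bsub>C\<^esub> \<gamma>)"

context two_category
begin

lemma whisker_functor:
  assumes "u \<in> Mor A"
  shows "cat_functor (hom_cat A X (Src A u)) (hom_cat A X (Trg A u))
    (restrict_func (hom_cat A X (Src A u)) \<lparr>FObj = \<lambda>f. u \<odot> f, FArr = \<lambda>\<alpha>. id2 A u \<star> \<alpha>\<rparr>)"
  by (intro cat_functor.intro cat_functor_axioms.intro category_hom_cat)
    (use assms in \<open>auto simp: is_functor_def hom_def hom1_def hom_cat_simps restrict_func_def\<close>)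

lemma whisker_func [simp]:
  assumes "u \<in> Mor A"
  shows "whisker_func A X u \<in> Mor CAT" "Src CAT (whisker_func A X u) = hom_cat A X (Src A u)"
    "Trg CAT (whisker_func A X u) = hom_cat A X (Trg A u)"
    "f \<in> hom1 A X (Src A u) \<Longrightarrow> FObj (adat (whisker_func A X u)) f = u \<odot> f"
    "\<alpha> \<in> Cell A \<Longrightarrow> Dom (Vert A) \<alpha> \<in> hom1 A X (Src A u) \<Longrightarrow> FArr (adat (whisker_func A X u)) \<alpha> = id2 A u \<star> \<alpha>"
  using whisker_functor[OF assms] by (auto simp: whisker_func_def cat_funcs_iff hom_cat_simps restrict_func_def)

lemma cowhisker_functor:
  assumes "c \<in> Mor A"
  shows "cat_functor (hom_cat A (Trg A c) Z) (hom_cat A (Src A c) Z)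
    (restrict_func (hom_cat A (Trg A c) Z) \<lparr>FObj = \<lambda>f. f \<odot> c, FArr = \<lambda>\<alpha>. \<alpha> \<star> id2 A c\<rparr>)"
  by (intro cat_functor.intro cat_functor_axioms.intro category_hom_cat)
    (use assms in \<open>auto simp: is_functor_def hom_def hom1_def hom_cat_simps restrict_func_def\<close>)

lemma cowhisker_func [simp]:
  assumes "c \<in> Mor A"
  shows "cowhisker_func A c Z \<in> Mor CAT" "Src CAT (cowhisker_func A c Z) = hom_cat A (Trg A c) Z"
    "Trg CAT (cowhisker_func A c Z) = hom_cat A (Src A c) Z"
    "f \<in> hom1 A (Trg A c) Z \<Longrightarrow> FObj (adat (cowhisker_func A c Z)) f = f \<odot> c"
    "\<alpha> \<in> Cell A \<Longrightarrow> Dom (Vert A) \<alpha> \<in> hom1 A (Trg A c) Z \<Longrightarrow> FArr (adat (cowhisker_func A c Z)) \<alpha> = \<alpha> \<star> id2 A c"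
  using cowhisker_functor[OF assms] by (auto simp: cowhisker_func_def cat_funcs_iff hom_cat_simps restrict_func_def)

lemma whisker_nat [simp]:
  assumes "\<beta> \<in> Cell A"
  shows "whisker_nat A X \<beta> \<in> Cell CAT" "Dom (Vert CAT) (whisker_nat A X \<beta>) = whisker_func A X (Dom (Vert A) \<beta>)"
    "Cod (Vert CAT) (whisker_nat A X \<beta>) = whisker_func A X (Cod (Vert A) \<beta>)"
    "f \<in> hom1 A X (Src A (Dom (Vert A) \<beta>)) \<Longrightarrow> adat (whisker_nat A X \<beta>) f = \<beta> \<star> id2 A f"
proof -
  let ?A = "hom_cat A X (Src A (Dom (Vert A) \<beta>))" and ?B = "hom_cat A X (Trg A (Dom (Vert A) \<beta>))"
  let ?F = "\<lambda>u. restrict_func ?A \<lparr>FObj = \<lambda>f. u \<odot> f, FArr = \<lambda>\<alpha>. id2 A u \<star> \<alpha>\<rparr>"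
  have F: "cat_functor ?A ?B (?F (Dom (Vert A) \<beta>))" "cat_functor ?A ?B (?F (Cod (Vert A) \<beta>))"
    using whisker_functor[of "Dom (Vert A) \<beta>" X] whisker_functor[of "Cod (Vert A) \<beta>" X] assms by simp_all
  have "nat_trans ?A ?B (?F (Dom (Vert A) \<beta>)) (?F (Cod (Vert A) \<beta>)) (\<lambda>f \<in> Obj ?A. \<beta> \<star> id2 A f)"
  proof (rule nat_transI[OF category_hom_cat category_hom_cat])
    fix \<alpha> assume "\<alpha> \<in> Arr ?A"
    then have \<alpha>: "\<alpha> \<in> Cell A" "Src A (Dom (Vert A) \<alpha>) = X" "Trg A (Dom (Vert A) \<alpha>) = Src A (Dom (Vert A) \<beta>)"
      by (simp_all add: hom_cat_simps hom1_def)
    then show "(\<lambda>f \<in> Obj ?A. \<beta> \<star> id2 A f) (Cod ?A \<alpha>) \<cdot>\<^bsub>?B\<^esub> FArr (?F (Dom (Vert A) \<beta>)) \<alpha> =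
        FArr (?F (Cod (Vert A) \<beta>)) \<alpha> \<cdot>\<^bsub>?B\<^esub> (\<lambda>f \<in> Obj ?A. \<beta> \<star> id2 A f) (Dom ?A \<alpha>)"
      using assms whisker_exchange[of \<alpha> \<beta>] by (simp add: hom_cat_simps hom1_def)
  qed (use assms in \<open>auto simp: hom_cat_simps hom1_def\<close>)
  then have "nat_transformation ?A ?B (?F (Dom (Vert A) \<beta>)) (?F (Cod (Vert A) \<beta>)) (\<lambda>f \<in> Obj ?A. \<beta> \<star> id2 A f)"
    using F by (simp add: nat_transformation_def nat_transformation_axioms_def)
  then show "whisker_nat A X \<beta> \<in> Cell CAT" "Dom (Vert CAT) (whisker_nat A X \<beta>) = whisker_func A X (Dom (Vert A) \<beta>)"
    "Cod (Vert CAT) (whisker_nat A X \<beta>) = whisker_func A X (Cod (Vert A) \<beta>)"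
    "f \<in> hom1 A X (Src A (Dom (Vert A) \<beta>)) \<Longrightarrow> adat (whisker_nat A X \<beta>) f = \<beta> \<star> id2 A f"
    using F assms by (auto simp: whisker_nat_def whisker_func_def cat_nats_iff cat_funcs_iff hom_cat_simps restrict_func_def)
qed

lemma cowhisker_nat [simp]:
  assumes "\<gamma> \<in> Cell A"
  shows "cowhisker_nat A \<gamma> Z \<in> Cell CAT" "Dom (Vert CAT) (cowhisker_nat A \<gamma> Z) = cowhisker_func A (Dom (Vert A) \<gamma>) Z"
    "Cod (Vert CAT) (cowhisker_nat A \<gamma> Z) = cowhisker_func A (Cod (Vert A) \<gamma>) Z"
    "f \<in> hom1 A (Trg A (Dom (Vert A) \<gamma>)) Z \<Longrightarrow> adat (cowhisker_nat A \<gamma> Z) f = id2 A f \<star> \<gamma>"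
proof -
  let ?A = "hom_cat A (Trg A (Dom (Vert A) \<gamma>)) Z" and ?B = "hom_cat A (Src A (Dom (Vert A) \<gamma>)) Z"
  let ?F = "\<lambda>c. restrict_func ?A \<lparr>FObj = \<lambda>f. f \<odot> c, FArr = \<lambda>\<alpha>. \<alpha> \<star> id2 A c\<rparr>"
  have F: "cat_functor ?A ?B (?F (Dom (Vert A) \<gamma>))" "cat_functor ?A ?B (?F (Cod (Vert A) \<gamma>))"
    using cowhisker_functor[of "Dom (Vert A) \<gamma>" Z] cowhisker_functor[of "Cod (Vert A) \<gamma>" Z] assms by simp_all
  have "nat_trans ?A ?B (?F (Dom (Vert A) \<gamma>)) (?F (Cod (Vert A) \<gamma>)) (\<lambda>f \<in> Obj ?A. id2 A f \<star> \<gamma>)"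
  proof (rule nat_transI[OF category_hom_cat category_hom_cat])
    fix \<alpha> assume "\<alpha> \<in> Arr ?A"
    then have \<alpha>: "\<alpha> \<in> Cell A" "Src A (Dom (Vert A) \<alpha>) = Trg A (Dom (Vert A) \<gamma>)" "Trg A (Dom (Vert A) \<alpha>) = Z"
      by (simp_all add: hom_cat_simps hom1_def)
    then show "(\<lambda>f \<in> Obj ?A. id2 A f \<star> \<gamma>) (Cod ?A \<alpha>) \<cdot>\<^bsub>?B\<^esub> FArr (?F (Dom (Vert A) \<gamma>)) \<alpha> =
        FArr (?F (Cod (Vert A) \<gamma>)) \<alpha> \<cdot>\<^bsub>?B\<^esub> (\<lambda>f \<in> Obj ?A. id2 A f \<star> \<gamma>) (Dom ?A \<alpha>)"
      using assms whisker_exchange[of \<gamma> \<alpha>] by (simp add: hom_cat_simps hom1_def)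
  qed (use assms in \<open>auto simp: hom_cat_simps hom1_def\<close>)
  then have "nat_transformation ?A ?B (?F (Dom (Vert A) \<gamma>)) (?F (Cod (Vert A) \<gamma>)) (\<lambda>f \<in> Obj ?A. id2 A f \<star> \<gamma>)"
    using F by (simp add: nat_transformation_def nat_transformation_axioms_def)
  then show "cowhisker_nat A \<gamma> Z \<in> Cell CAT" "Dom (Vert CAT) (cowhisker_nat A \<gamma> Z) = cowhisker_func A (Dom (Vert A) \<gamma>) Z"
    "Cod (Vert CAT) (cowhisker_nat A \<gamma> Z) = cowhisker_func A (Cod (Vert A) \<gamma>) Z"
    "f \<in> hom1 A (Trg A (Dom (Vert A) \<gamma>)) Z \<Longrightarrow> adat (cowhisker_nat A \<gamma> Z) f = id2 A f \<star> \<gamma>"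
    using F assms by (auto simp: cowhisker_nat_def cowhisker_func_def cat_nats_iff cat_funcs_iff hom_cat_simps restrict_func_def)
qed

end

text \<open>From here on \<open>CAT\<close> is used through the laws of a 2-category; unfolding its operations would
destroy their left-hand sides.\<close>

declare CAT_simps [simp del]

context two_category
begin

lemma hom_cat_ob [simp]: "hom_cat A x y \<in> Ob CAT"
  by (simp add: CAT_simps category_hom_cat)

lemmas CAT_compute = CAT_access hom_cat_simps hom1_def

lemma whisker_func_unit [simp]: "x \<in> Ob A \<Longrightarrow> whisker_func A X (Unit A x) = Unit CAT (hom_cat A X x)"
  by (rule CAT_mor_eqI) (auto simp: CAT_compute)

lemma whisker_func_comp [simp]:
  "u \<in> Mor A \<Longrightarrow> v \<in> Mor A \<Longrightarrow> Trg A u = Src A v \<Longrightarrow> whisker_func A X (v \<odot> u) = whisker_func A X v \<odot>\<^bsub>CAT\<^esub> whisker_func A X u"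
  by (rule CAT_mor_eqI) (auto simp: CAT_compute)

lemma whisker_nat_ident [simp]: "u \<in> Mor A \<Longrightarrow> whisker_nat A X (id2 A u) = id2 CAT (whisker_func A X u)"
  by (rule CAT_cell_eqI) (auto simp: CAT_compute)

lemma whisker_nat_vcomp [simp]:
  assumes "\<alpha> \<in> Cell A" "\<beta> \<in> Cell A" "Cod (Vert A) \<alpha> = Dom (Vert A) \<beta>"
  shows "whisker_nat A X (\<beta> \<bullet>\<^bsub>A\<^esub> \<alpha>) = whisker_nat A X \<beta> \<bullet>\<^bsub>CAT\<^esub> whisker_nat A X \<alpha>"
proof (rule CAT_cell_eqI)
  have "Src A (Dom (Vert A) \<beta>) = Src A (Dom (Vert A) \<alpha>)"
    using assms by (simp flip: assms(3))
  then show "adat (whisker_nat A X (\<beta> \<bullet>\<^bsub>A\<^esub> \<alpha>)) f = adat (whisker_nat A X \<beta> \<bullet>\<^bsub>CAT\<^esub> whisker_nat A X \<alpha>) f"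
    if "f \<in> Obj (Src CAT (Dom (Vert CAT) (whisker_nat A X \<beta> \<bullet>\<^bsub>CAT\<^esub> whisker_nat A X \<alpha>)))" for f
    using assms that by (auto simp: CAT_compute)
qed (use assms in auto)

text \<open>The component of the right-hand side at \<open>f\<close> is a vertical composite of whiskerings, and equals
the horizontal composite by the exchange law.\<close>

lemma whisker_nat_hcomp [simp]:
  assumes "\<alpha> \<in> Cell A" "\<beta> \<in> Cell A" "Trg A (Dom (Vert A) \<alpha>) = Src A (Dom (Vert A) \<beta>)"
  shows "whisker_nat A X (\<beta> \<star> \<alpha>) = whisker_nat A X \<beta> \<star>\<^bsub>CAT\<^esub> whisker_nat A X \<alpha>"
proof (rule CAT_cell_eqI)
  fix f assume "f \<in> Obj (Src CAT (Dom (Vert CAT) (whisker_nat A X \<beta> \<star>\<^bsub>CAT\<^esub> whisker_nat A X \<alpha>)))"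
  then have f: "f \<in> Mor A" "Src A f = X" "Trg A f = Src A (Dom (Vert A) \<alpha>)"
    using assms by (auto simp: CAT_compute)
  then show "adat (whisker_nat A X (\<beta> \<star> \<alpha>)) f = adat (whisker_nat A X \<beta> \<star>\<^bsub>CAT\<^esub> whisker_nat A X \<alpha>) f"
    using assms whisker_exchange[of "\<alpha> \<star> id2 A f" \<beta>] by (simp add: CAT_compute)
qed (use assms in auto)

lemma whisker_nat_invertible [simp]:
  assumes "invertible (Vert A) \<beta>"
  shows "invertible (Vert CAT) (whisker_nat A X \<beta>)"
  by (rule CAT.V.invertibleI[of _ "whisker_nat A X (V.inv_of \<beta>)"])
    (use assms in \<open>simp_all flip: whisker_nat_vcomp\<close>)

lemma cowhisker_func_unit [simp]: "x \<in> Ob A \<Longrightarrow> cowhisker_func A (Unit A x) Z = Unit CAT (hom_cat A x Z)"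
  by (rule CAT_mor_eqI) (auto simp: CAT_compute)

lemma cowhisker_func_comp [simp]:
  "c \<in> Mor A \<Longrightarrow> d \<in> Mor A \<Longrightarrow> Trg A c = Src A d \<Longrightarrow> cowhisker_func A (d \<odot> c) Z = cowhisker_func A c Z \<odot>\<^bsub>CAT\<^esub> cowhisker_func A d Z"
  by (rule CAT_mor_eqI) (auto simp: CAT_compute)

lemma cowhisker_nat_ident [simp]: "c \<in> Mor A \<Longrightarrow> cowhisker_nat A (id2 A c) Z = id2 CAT (cowhisker_func A c Z)"
  by (rule CAT_cell_eqI) (auto simp: CAT_compute)

lemma cowhisker_nat_vcomp [simp]:
  assumes "\<alpha> \<in> Cell A" "\<beta> \<in> Cell A" "Cod (Vert A) \<alpha> = Dom (Vert A) \<beta>"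
  shows "cowhisker_nat A (\<beta> \<bullet>\<^bsub>A\<^esub> \<alpha>) Z = cowhisker_nat A \<beta> Z \<bullet>\<^bsub>CAT\<^esub> cowhisker_nat A \<alpha> Z"
proof (rule CAT_cell_eqI)
  have "Trg A (Dom (Vert A) \<beta>) = Trg A (Dom (Vert A) \<alpha>)"
    using assms by (simp flip: assms(3))
  then show "adat (cowhisker_nat A (\<beta> \<bullet>\<^bsub>A\<^esub> \<alpha>) Z) f = adat (cowhisker_nat A \<beta> Z \<bullet>\<^bsub>CAT\<^esub> cowhisker_nat A \<alpha> Z) f"
    if "f \<in> Obj (Src CAT (Dom (Vert CAT) (cowhisker_nat A \<beta> Z \<bullet>\<^bsub>CAT\<^esub> cowhisker_nat A \<alpha> Z)))" for f
    using assms that by (auto simp: CAT_compute)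
qed (use assms in auto)

lemma cowhisker_nat_hcomp [simp]:
  assumes "\<alpha> \<in> Cell A" "\<beta> \<in> Cell A" "Trg A (Dom (Vert A) \<alpha>) = Src A (Dom (Vert A) \<beta>)"
  shows "cowhisker_nat A (\<beta> \<star> \<alpha>) Z = cowhisker_nat A \<alpha> Z \<star>\<^bsub>CAT\<^esub> cowhisker_nat A \<beta> Z"
proof (rule CAT_cell_eqI)
  fix f assume "f \<in> Obj (Src CAT (Dom (Vert CAT) (cowhisker_nat A \<alpha> Z \<star>\<^bsub>CAT\<^esub> cowhisker_nat A \<beta> Z)))"
  then have f: "f \<in> Mor A" "Src A f = Trg A (Dom (Vert A) \<beta>)" "Trg A f = Z"
    using assms by (auto simp: CAT_compute)
  then show "adat (cowhisker_nat A (\<beta> \<star> \<alpha>) Z) f = adat (cowhisker_nat A \<alpha> Z \<star>\<^bsub>CAT\<^esub> cowhisker_nat A \<beta> Z) f"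
    using assms whisker_exchange[of \<alpha> "id2 A f \<star> \<beta>"] by (simp add: CAT_compute)
qed (use assms in auto)

text \<open>Precomposition and postcomposition commute by associativity. The three forms of this fact, for
1-morphisms and for a 2-morphism in either place, make \<open>C(c,F-)\<close> pseudo-natural and
\<open>C(\<gamma>,F-)\<close> a modification.\<close>

lemma cowhisker_whisker_func:
  assumes "c \<in> Mor A" "u \<in> Mor A"
  shows "cowhisker_func A c (Trg A u) \<odot>\<^bsub>CAT\<^esub> whisker_func A (Trg A c) u =
    whisker_func A (Src A c) u \<odot>\<^bsub>CAT\<^esub> cowhisker_func A c (Src A u)"
  by (rule CAT_mor_eqI) (use assms in \<open>auto simp: CAT_compute\<close>)

lemma whisker_nat_cowhisker:
  assumes "c \<in> Mor A" "\<beta> \<in> Cell A"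
  shows "whisker_nat A (Src A c) \<beta> \<star>\<^bsub>CAT\<^esub> id2 CAT (cowhisker_func A c (Src A (Dom (Vert A) \<beta>))) =
    id2 CAT (cowhisker_func A c (Trg A (Dom (Vert A) \<beta>))) \<star>\<^bsub>CAT\<^esub> whisker_nat A (Trg A c) \<beta>"
  by (rule CAT_cell_eqI)
    (use assms cowhisker_whisker_func[of c "Dom (Vert A) \<beta>"] cowhisker_whisker_func[of c "Cod (Vert A) \<beta>"] in
      \<open>auto simp: CAT_compute\<close>)

lemma whisker_cowhisker_nat:
  assumes "u \<in> Mor A" "\<gamma> \<in> Cell A"
  shows "id2 CAT (whisker_func A (Src A (Dom (Vert A) \<gamma>)) u) \<star>\<^bsub>CAT\<^esub> cowhisker_nat A \<gamma> (Src A u) =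
    cowhisker_nat A \<gamma> (Trg A u) \<star>\<^bsub>CAT\<^esub> id2 CAT (whisker_func A (Trg A (Dom (Vert A) \<gamma>)) u)"
  by (rule CAT_cell_eqI)
    (use assms cowhisker_whisker_func[of "Dom (Vert A) \<gamma>" u] cowhisker_whisker_func[of "Cod (Vert A) \<gamma>" u] in
      \<open>auto simp: CAT_compute\<close>)

end

section \<open>The 2-functor C(-,F)\<close>

context pseudofunctor
begin

lemma hom_psfun_simps [simp]:
  "PO (hom_psfun A B F X) i = hom_cat B X (PO F i)"
  "P1 (hom_psfun A B F X) u = whisker_func B X (P1 F u)"
  "\<theta> \<in> Cell A \<Longrightarrow> P2 (hom_psfun A B F X) \<theta> = whisker_nat B X (P2 F \<theta>)"
  "u \<in> Mor A \<Longrightarrow> v \<in> Mor A \<Longrightarrow> Trg A u = Src A v \<Longrightarrow> PC (hom_psfun A B F X) v u = whisker_nat B X (PC F v u)"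
  by (simp_all add: hom_psfun_def whisker_nat_def)

text \<open>\<open>C(X,F-)\<close> is the composite of \<open>F\<close> with the strict 2-functor \<open>C(X,-)\<close>, so its axioms are the
images of those of \<open>F\<close>.\<close>

lemma normal_pseudofunctor_hom_psfun: "normal_pseudofunctor A CAT (hom_psfun A B F X)"
proof (rule normal_pseudofunctorI[OF A.two_category_axioms two_category_CAT])
  fix \<alpha> \<beta> assume "\<alpha> \<in> Cell A" "\<beta> \<in> Cell A" "Trg A (Dom (Vert A) \<alpha>) = Src A (Dom (Vert A) \<beta>)"
  then show "PC (hom_psfun A B F X) (Cod (Vert A) \<beta>) (Cod (Vert A) \<alpha>) \<bullet>\<^bsub>CAT\<^esub>
      (P2 (hom_psfun A B F X) \<beta> \<star>\<^bsub>CAT\<^esub> P2 (hom_psfun A B F X) \<alpha>) =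
      P2 (hom_psfun A B F X) (\<beta> \<star>\<^bsub>A\<^esub> \<alpha>) \<bullet>\<^bsub>CAT\<^esub> PC (hom_psfun A B F X) (Dom (Vert A) \<beta>) (Dom (Vert A) \<alpha>)"
    by (simp add: pc_natural flip: B.whisker_nat_vcomp B.whisker_nat_hcomp)
next
  fix a b c assume "a \<in> Mor A" "b \<in> Mor A" "c \<in> Mor A" "Trg A a = Src A b" "Trg A b = Src A c"
  then show "PC (hom_psfun A B F X) c (b \<odot>\<^bsub>A\<^esub> a) \<bullet>\<^bsub>CAT\<^esub>
      (id2 CAT (P1 (hom_psfun A B F X) c) \<star>\<^bsub>CAT\<^esub> PC (hom_psfun A B F X) b a) =
      PC (hom_psfun A B F X) (c \<odot>\<^bsub>A\<^esub> b) a \<bullet>\<^bsub>CAT\<^esub>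
      (PC (hom_psfun A B F X) c b \<star>\<^bsub>CAT\<^esub> id2 CAT (P1 (hom_psfun A B F X) a))"
    by (simp add: pc_assoc flip: B.whisker_nat_vcomp B.whisker_nat_hcomp B.whisker_nat_ident)
qed auto

lemma pseudofunctor_hom_psfun: "pseudofunctor A CAT (hom_psfun A B F X)"
  by (intro pseudofunctor.intro pseudofunctor_axioms.intro A.two_category_axioms two_category_CAT
      normal_pseudofunctor_hom_psfun)

lemma hom_ptrans_eq:
  "hom_ptrans A B F c = (hom_psfun A B F (Trg B c), hom_psfun A B F (Src B c), adat (hom_ptrans A B F c))"
  by (simp add: hom_ptrans_def)

lemma hom_ptrans_simps:
  "i \<in> Ob A \<Longrightarrow> Cmp (adat (hom_ptrans A B F c)) i = cowhisker_func B c (PO F i)"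
  "u \<in> Mor A \<Longrightarrow> Sq (adat (hom_ptrans A B F c)) u =
    id2 CAT (whisker_func B (Src B c) (P1 F u) \<odot>\<^bsub>CAT\<^esub> cowhisker_func B c (PO F (Src A u)))"
  "Cmp (adat (hom_ptrans A B F c)) \<in> extensional (Ob A)" "Sq (adat (hom_ptrans A B F c)) \<in> extensional (Mor A)"
  by (simp_all add: hom_ptrans_def)

text \<open>All 2-morphism components are identities; they are stated at one of the two equal composites
of postcomposition with \<open>F u\<close> and precomposition with \<open>c\<close>.\<close>

lemma pseudonat_hom_ptrans:
  assumes c: "c \<in> Mor B"
  shows "pseudonat A CAT (hom_psfun A B F (Trg B c)) (hom_psfun A B F (Src B c)) (adat (hom_ptrans A B F c))"
proof -
  have comm: "cowhisker_func B c (PO F (Trg A u)) \<odot>\<^bsub>CAT\<^esub> whisker_func B (Trg B c) (P1 F u) =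
      whisker_func B (Src B c) (P1 F u) \<odot>\<^bsub>CAT\<^esub> cowhisker_func B c (PO F (Src A u))" if "u \<in> Mor A" for u
    using B.cowhisker_whisker_func[OF c, of "P1 F u"] that by simp
  have comm2: "whisker_nat B (Src B c) \<beta> \<star>\<^bsub>CAT\<^esub> id2 CAT (cowhisker_func B c x) =
      id2 CAT (cowhisker_func B c y) \<star>\<^bsub>CAT\<^esub> whisker_nat B (Trg B c) \<beta>"
    if "\<beta> \<in> Cell B" "Src B (Dom (Vert B) \<beta>) = x" "Trg B (Dom (Vert B) \<beta>) = y" for \<beta> x y
    using B.whisker_nat_cowhisker[OF c that(1)] that(2,3) by simp
  have "pseudo_natural A CAT (hom_psfun A B F (Trg B c)) (hom_psfun A B F (Src B c)) (adat (hom_ptrans A B F c))"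
  proof (rule pseudo_naturalI[OF A.two_category_axioms two_category_CAT])
    fix \<alpha> assume \<alpha>: "\<alpha> \<in> Cell A"
    let ?\<sigma> = "adat (hom_ptrans A B F c)" and ?a = "Dom (Vert A) \<alpha>"
    let ?c = "\<lambda>i. cowhisker_func B c (PO F i)"
    have "Sq ?\<sigma> (Cod (Vert A) \<alpha>) \<bullet>\<^bsub>CAT\<^esub> (P2 (hom_psfun A B F (Src B c)) \<alpha> \<star>\<^bsub>CAT\<^esub> id2 CAT (Cmp ?\<sigma> (Src A ?a))) =
        whisker_nat B (Src B c) (P2 F \<alpha>) \<star>\<^bsub>CAT\<^esub> id2 CAT (?c (Src A ?a))"
      using c \<alpha> by (simp add: hom_ptrans_simps)
    also have "\<dots> = id2 CAT (?c (Trg A ?a)) \<star>\<^bsub>CAT\<^esub> whisker_nat B (Trg B c) (P2 F \<alpha>)"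
      using \<alpha> by (intro comm2) simp_all
    also have "\<dots> = (id2 CAT (?c (Trg A ?a)) \<star>\<^bsub>CAT\<^esub> whisker_nat B (Trg B c) (P2 F \<alpha>)) \<bullet>\<^bsub>CAT\<^esub>
        id2 CAT (?c (Trg A ?a) \<odot>\<^bsub>CAT\<^esub> whisker_func B (Trg B c) (P1 F ?a))"
      using c \<alpha> by simp
    also have "id2 CAT (?c (Trg A ?a) \<odot>\<^bsub>CAT\<^esub> whisker_func B (Trg B c) (P1 F ?a)) = Sq ?\<sigma> ?a"
      using \<alpha> by (subst comm) (simp_all add: hom_ptrans_simps)
    finally show "Sq ?\<sigma> (Cod (Vert A) \<alpha>) \<bullet>\<^bsub>CAT\<^esub>
        (P2 (hom_psfun A B F (Src B c)) \<alpha> \<star>\<^bsub>CAT\<^esub> id2 CAT (Cmp ?\<sigma> (Src A ?a))) =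
        (id2 CAT (Cmp ?\<sigma> (Trg A ?a)) \<star>\<^bsub>CAT\<^esub> P2 (hom_psfun A B F (Trg B c)) \<alpha>) \<bullet>\<^bsub>CAT\<^esub> Sq ?\<sigma> ?a"
      using \<alpha> by (simp add: hom_ptrans_simps)
  next
    fix a b assume ab: "a \<in> Mor A" "b \<in> Mor A" "Trg A a = Src A b"
    let ?\<sigma> = "adat (hom_ptrans A B F c)" and ?X = "Src B c" and ?Y = "Trg B c"
    let ?c = "\<lambda>i. cowhisker_func B c (PO F i)"
    have "?c (Trg A b) \<odot>\<^bsub>CAT\<^esub> whisker_func B ?Y (P1 F b) \<odot>\<^bsub>CAT\<^esub> whisker_func B ?Y (P1 F a) =
        (?c (Trg A b) \<odot>\<^bsub>CAT\<^esub> whisker_func B ?Y (P1 F b)) \<odot>\<^bsub>CAT\<^esub> whisker_func B ?Y (P1 F a)"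
      using c ab by simp
    also have "\<dots> = whisker_func B ?X (P1 F b) \<odot>\<^bsub>CAT\<^esub> (?c (Src A b) \<odot>\<^bsub>CAT\<^esub> whisker_func B ?Y (P1 F a))"
      unfolding comm[OF ab(2)] using c ab by simp
    also have "\<dots> = whisker_func B ?X (P1 F b) \<odot>\<^bsub>CAT\<^esub> whisker_func B ?X (P1 F a) \<odot>\<^bsub>CAT\<^esub> ?c (Src A a)"
      using comm[OF ab(1)] ab(3) by simp
    finally have slide: "?c (Trg A b) \<odot>\<^bsub>CAT\<^esub> whisker_func B ?Y (P1 F b) \<odot>\<^bsub>CAT\<^esub> whisker_func B ?Y (P1 F a) =
        whisker_func B ?X (P1 F b) \<odot>\<^bsub>CAT\<^esub> whisker_func B ?X (P1 F a) \<odot>\<^bsub>CAT\<^esub> ?c (Src A a)" .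
    have "Sq ?\<sigma> (b \<odot>\<^bsub>A\<^esub> a) \<bullet>\<^bsub>CAT\<^esub> (PC (hom_psfun A B F ?X) b a \<star>\<^bsub>CAT\<^esub> id2 CAT (Cmp ?\<sigma> (Src A a))) =
        whisker_nat B ?X (PC F b a) \<star>\<^bsub>CAT\<^esub> id2 CAT (?c (Src A a))"
      using c ab by (simp add: hom_ptrans_simps)
    also have "\<dots> = id2 CAT (?c (Trg A b)) \<star>\<^bsub>CAT\<^esub> whisker_nat B ?Y (PC F b a)"
      using ab by (intro comm2) simp_all
    also have "\<dots> = (id2 CAT (?c (Trg A b)) \<star>\<^bsub>CAT\<^esub> whisker_nat B ?Y (PC F b a)) \<bullet>\<^bsub>CAT\<^esub>
        id2 CAT (?c (Trg A b) \<odot>\<^bsub>CAT\<^esub> whisker_func B ?Y (P1 F b) \<odot>\<^bsub>CAT\<^esub> whisker_func B ?Y (P1 F a))"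
      using c ab by simp
    also have "id2 CAT (?c (Trg A b) \<odot>\<^bsub>CAT\<^esub> whisker_func B ?Y (P1 F b) \<odot>\<^bsub>CAT\<^esub> whisker_func B ?Y (P1 F a)) =
        (Sq ?\<sigma> b \<star>\<^bsub>CAT\<^esub> id2 CAT (P1 (hom_psfun A B F ?Y) a)) \<bullet>\<^bsub>CAT\<^esub> (id2 CAT (P1 (hom_psfun A B F ?X) b) \<star>\<^bsub>CAT\<^esub> Sq ?\<sigma> a)"
      using c ab comm[OF ab(1)] by (simp add: hom_ptrans_simps slide)
    finally show "Sq ?\<sigma> (b \<odot>\<^bsub>A\<^esub> a) \<bullet>\<^bsub>CAT\<^esub> (PC (hom_psfun A B F ?X) b a \<star>\<^bsub>CAT\<^esub> id2 CAT (Cmp ?\<sigma> (Src A a))) =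
        (id2 CAT (Cmp ?\<sigma> (Trg A b)) \<star>\<^bsub>CAT\<^esub> PC (hom_psfun A B F ?Y) b a) \<bullet>\<^bsub>CAT\<^esub>
        (Sq ?\<sigma> b \<star>\<^bsub>CAT\<^esub> id2 CAT (P1 (hom_psfun A B F ?Y) a)) \<bullet>\<^bsub>CAT\<^esub> (id2 CAT (P1 (hom_psfun A B F ?X) b) \<star>\<^bsub>CAT\<^esub> Sq ?\<sigma> a)"
      using ab by (simp add: hom_ptrans_simps(1))
  qed (use c comm in \<open>simp_all add: hom_ptrans_simps\<close>)
  then show ?thesis
    by (intro pseudonat.intro pseudonat_axioms.intro pseudofunctor_hom_psfun)
qed

text \<open>The modification \<open>C(\<gamma>,F-)\<close>.\<close>

definition hom_cell :: "'d \<Rightarrow> _" where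
  "hom_cell \<gamma> = (hom_ptrans A B F (Dom (Vert B) \<gamma>), hom_ptrans A B F (Cod (Vert B) \<gamma>),
    \<lambda>i \<in> Ob A. cowhisker_nat B \<gamma> (PO F i))"

lemma HomF_simps:
  "PO (HomF A B F) = hom_psfun A B F" "P1 (HomF A B F) = hom_ptrans A B F" "P2 (HomF A B F) = hom_cell"
  "PC (HomF A B F) d c = id2 (Ps A CAT) (hom_ptrans A B F (d \<odot>\<^bsub>two_op B\<^esub> c))"
  by (simp_all add: HomF_def hom_cell_def cowhisker_nat_def fun_eq_iff)

lemma hom_ptrans_in [simp]:
  assumes "c \<in> Mor B"
  shows "hom_ptrans A B F c \<in> Mor (Ps A CAT)" "Src (Ps A CAT) (hom_ptrans A B F c) = hom_psfun A B F (Trg B c)"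
    "Trg (Ps A CAT) (hom_ptrans A B F c) = hom_psfun A B F (Src B c)"
proof -
  interpret P: two_category_pair A CAT ..
  show "hom_ptrans A B F c \<in> Mor (Ps A CAT)"
    using pseudonat_hom_ptrans[OF assms]
    by (subst hom_ptrans_eq) (simp add: P.ps_mors_iff hom_ptrans_simps(3,4))
  show "Src (Ps A CAT) (hom_ptrans A B F c) = hom_psfun A B F (Trg B c)"
    "Trg (Ps A CAT) (hom_ptrans A B F c) = hom_psfun A B F (Src B c)"
    by (simp_all add: hom_ptrans_def)
qed

lemma hom_cell_in [simp]:
  assumes \<gamma>: "\<gamma> \<in> Cell B"
  shows "hom_cell \<gamma> \<in> Cell (Ps A CAT)" "Dom (Vert (Ps A CAT)) (hom_cell \<gamma>) = hom_ptrans A B F (Dom (Vert B) \<gamma>)"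
    "Cod (Vert (Ps A CAT)) (hom_cell \<gamma>) = hom_ptrans A B F (Cod (Vert B) \<gamma>)"
proof -
  interpret P: two_category_pair A CAT ..
  let ?s = "hom_ptrans A B F (Dom (Vert B) \<gamma>)" and ?t = "hom_ptrans A B F (Cod (Vert B) \<gamma>)"
  let ?\<mu> = "\<lambda>i \<in> Ob A. cowhisker_nat B \<gamma> (PO F i)"
  let ?X = "Src B (Dom (Vert B) \<gamma>)" and ?Y = "Trg B (Dom (Vert B) \<gamma>)"
  have "is_modification A CAT (hom_psfun A B F ?Y) (hom_psfun A B F ?X) (adat ?s) (adat ?t) ?\<mu>"
  proof (rule is_modificationI)
    fix a assume a: "a \<in> Mor A"
    have comm: "id2 CAT (whisker_func B ?X (P1 F a)) \<star>\<^bsub>CAT\<^esub> cowhisker_nat B \<gamma> (PO F (Src A a)) =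
        cowhisker_nat B \<gamma> (PO F (Trg A a)) \<star>\<^bsub>CAT\<^esub> id2 CAT (whisker_func B ?Y (P1 F a))"
      using B.whisker_cowhisker_nat[of "P1 F a" \<gamma>] a \<gamma> by simp
    have c: "whisker_func B ?X (P1 F a) \<odot>\<^bsub>CAT\<^esub> cowhisker_func B (Dom (Vert B) \<gamma>) (PO F (Src A a)) =
        cowhisker_func B (Dom (Vert B) \<gamma>) (PO F (Trg A a)) \<odot>\<^bsub>CAT\<^esub> whisker_func B ?Y (P1 F a)"
      using B.cowhisker_whisker_func[of "Dom (Vert B) \<gamma>" "P1 F a"] a \<gamma> by simp
    show "Sq (adat ?t) a \<bullet>\<^bsub>CAT\<^esub> (id2 CAT (P1 (hom_psfun A B F ?X) a) \<star>\<^bsub>CAT\<^esub> ?\<mu> (Src A a)) =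
        (?\<mu> (Trg A a) \<star>\<^bsub>CAT\<^esub> id2 CAT (P1 (hom_psfun A B F ?Y) a)) \<bullet>\<^bsub>CAT\<^esub> Sq (adat ?s) a"
    proof -
      have "Sq (adat ?t) a \<bullet>\<^bsub>CAT\<^esub> (id2 CAT (P1 (hom_psfun A B F ?X) a) \<star>\<^bsub>CAT\<^esub> ?\<mu> (Src A a)) =
          id2 CAT (whisker_func B ?X (P1 F a)) \<star>\<^bsub>CAT\<^esub> cowhisker_nat B \<gamma> (PO F (Src A a))"
        using a \<gamma> by (simp add: hom_ptrans_simps)
      also have "\<dots> = (?\<mu> (Trg A a) \<star>\<^bsub>CAT\<^esub> id2 CAT (P1 (hom_psfun A B F ?Y) a)) \<bullet>\<^bsub>CAT\<^esub> Sq (adat ?s) a"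
        unfolding comm using a \<gamma> by (simp add: hom_ptrans_simps c)
      finally show ?thesis .
    qed
  qed (use \<gamma> in \<open>simp add: hom_ptrans_simps\<close>)
  then have "modification A CAT (hom_psfun A B F ?Y) (hom_psfun A B F ?X) (adat ?s) (adat ?t) ?\<mu>"
    using pseudonat_hom_ptrans[of "Dom (Vert B) \<gamma>"] pseudonat_hom_ptrans[of "Cod (Vert B) \<gamma>"] \<gamma>
    by (simp add: modification_def modification_axioms_def)
  moreover have "?s = (hom_psfun A B F ?Y, hom_psfun A B F ?X, adat ?s)" "?t = (hom_psfun A B F ?Y, hom_psfun A B F ?X, adat ?t)"
    using \<gamma> by (simp_all add: hom_ptrans_def)
  moreover have "?s \<in> ps_mors A CAT" "?t \<in> ps_mors A CAT"
    using hom_ptrans_in(1)[of "Dom (Vert B) \<gamma>"] hom_ptrans_in(1)[of "Cod (Vert B) \<gamma>"] \<gamma> by simp_all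
  ultimately have "(?s, ?t, ?\<mu>) \<in> ps_cells A CAT"
    by (metis P.ps_cells_iff restrict_extensional)
  then show "hom_cell \<gamma> \<in> Cell (Ps A CAT)"
    by (simp add: hom_cell_def)
qed (simp_all add: hom_cell_def)

lemma hom_ptrans_unit:
  assumes "X \<in> Ob B"
  shows "hom_ptrans A B F (Unit B X) = Unit (Ps A CAT) (hom_psfun A B F X)"
proof -
  have "adat (hom_ptrans A B F (Unit B X)) = ptrans_id A CAT (hom_psfun A B F X)"
    by (rule ptrans_eqI[of A]) (use assms in \<open>simp_all add: hom_ptrans_simps\<close>)
  then show ?thesis
    using assms by (subst hom_ptrans_eq) simp
qed

lemma hom_ptrans_comp:
  assumes "c \<in> Mor B" "d \<in> Mor B" "Trg B c = Src B d"
  shows "hom_ptrans A B F (d \<odot>\<^bsub>B\<^esub> c) = hom_ptrans A B F c \<odot>\<^bsub>Ps A CAT\<^esub> hom_ptrans A B F d"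
proof -
  have "adat (hom_ptrans A B F (d \<odot>\<^bsub>B\<^esub> c)) = ptrans_comp A CAT (adat (hom_ptrans A B F c)) (adat (hom_ptrans A B F d))"
  proof (rule ptrans_eqI[of A])
    fix u assume u: "u \<in> Mor A"
    let ?c = "\<lambda>i. cowhisker_func B c (PO F i)" and ?d = "\<lambda>i. cowhisker_func B d (PO F i)"
    let ?w = "\<lambda>x. whisker_func B x (P1 F u)"
    have "?c (Trg A u) \<odot>\<^bsub>CAT\<^esub> ?w (Src B d) \<odot>\<^bsub>CAT\<^esub> ?d (Src A u) = (?c (Trg A u) \<odot>\<^bsub>CAT\<^esub> ?w (Trg B c)) \<odot>\<^bsub>CAT\<^esub> ?d (Src A u)"
      using assms u by simp
    also have "\<dots> = ?w (Src B c) \<odot>\<^bsub>CAT\<^esub> ?c (Src A u) \<odot>\<^bsub>CAT\<^esub> ?d (Src A u)"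
      using B.cowhisker_whisker_func[of c "P1 F u"] assms u by simp
    finally show "Sq (adat (hom_ptrans A B F (d \<odot>\<^bsub>B\<^esub> c))) u =
        Sq (ptrans_comp A CAT (adat (hom_ptrans A B F c)) (adat (hom_ptrans A B F d))) u"
      using assms u by (simp add: hom_ptrans_simps)
  qed (use assms in \<open>simp_all add: hom_ptrans_simps\<close>)
  then show ?thesis
    using assms by (subst (1 2 3) hom_ptrans_eq) simp
qed

lemma hom_cell_ident: "c \<in> Mor B \<Longrightarrow> hom_cell (id2 B c) = id2 (Ps A CAT) (hom_ptrans A B F c)"
  by (auto simp: hom_cell_def hom_ptrans_simps intro!: extensionalityI[of _ "Ob A"])

lemma hom_cell_vcomp:
  assumes "\<alpha> \<in> Cell B" "\<beta> \<in> Cell B" "Cod (Vert B) \<alpha> = Dom (Vert B) \<beta>"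
  shows "hom_cell (\<beta> \<bullet>\<^bsub>B\<^esub> \<alpha>) = hom_cell \<beta> \<bullet>\<^bsub>Ps A CAT\<^esub> hom_cell \<alpha>"
  using assms by (auto simp: hom_cell_def intro!: extensionalityI[of _ "Ob A"])

lemma hom_cell_hcomp:
  assumes "\<alpha> \<in> Cell B" "\<beta> \<in> Cell B" "Trg B (Dom (Vert B) \<alpha>) = Src B (Dom (Vert B) \<beta>)"
  shows "hom_cell (\<beta> \<star>\<^bsub>B\<^esub> \<alpha>) = hom_cell \<alpha> \<star>\<^bsub>Ps A CAT\<^esub> hom_cell \<beta>"
  using assms by (auto simp: hom_cell_def hom_ptrans_comp intro!: extensionalityI[of _ "Ob A"])

end

text \<open>As for \<open>CAT\<close>, the abstract laws of a 2-category take over from the componentwise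
description.\<close>

declare Ps_simps [simp del]

text \<open>On 1-morphisms \<open>C(-,F)\<close> is strictly functorial, which lets its compositors be identities; what
remains is functoriality of precomposition on 2-morphisms.\<close>

theorem (in pseudofunctor) normal_pseudofunctor_HomF:
  "normal_pseudofunctor (two_op B) (Ps A CAT) (HomF A B F)"
proof -
  interpret P: two_category_pair A CAT ..
  interpret Ps: two_category "Ps A CAT"
    by (rule P.two_category_Ps)
  have ob [simp]: "hom_psfun A B F X \<in> Ob (Ps A CAT)" for X
    using normal_pseudofunctor_hom_psfun by (simp add: Ps_simps)
  show ?thesis
    by (rule normal_pseudofunctorI[OF B.two_category_two_op P.two_category_Ps])
      (simp_all add: HomF_simps hom_ptrans_unit hom_ptrans_comp hom_cell_ident hom_cell_vcomp hom_cell_hcomp)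
qed

section \<open>Weighted bi-limits as bi-initial objects\<close>

text \<open>All four conditions hold for the same pairs \<open>(X, \<lambda>)\<close>, namely those at which evaluation is an
equivalence on every hom-category. The first half of the third condition follows from its second
half, since fully faithful functors lift isomorphisms.\<close>

theorem theorem7p20:
  fixes I :: "('i, 'im, 'ic) two_cat"
    and C :: "('o, 'm, 'c) two_cat"
    and F :: "('i, 'im, 'ic, 'o, 'm, 'c) psfun"
    and W :: "('i, 'im, 'ic, ('m, 'c) cat, ('m, 'c) cat_func, ('m, 'c) cat_nat) psfun"
  assumes "two_category I" and "two_category C"
    and "normal_pseudofunctor I C F" and "normal_pseudofunctor I CAT W"
  shows "let
      PsI = Ps I (CAT :: (('m, 'c) cat, ('m, 'c) cat_func, ('m, 'c) cat_nat) two_cat);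
      CF = HomF I C F;
      cond_i = (\<exists>X l. weighted_bilimit I C F W X l);
      cond_ii = (\<exists>X \<in> Ob C. \<exists>l \<in> hom1 PsI W (PO CF X).
        double_bi_initial (Hslice (two_op C) PsI CF W) (X, l));
      cond_iii = (\<exists>X \<in> Ob C. \<exists>l \<in> hom1 PsI W (PO CF X).
        bi_initial (slice (two_op C) PsI CF W) (X, l) \<and>
        bi_initial (slice (Ar2 (two_op C)) (Ar2 PsI) (Ar2_psfun (two_op C) PsI CF) W) (X, id2 PsI l));
      cond_iv = (\<exists>X \<in> Ob C. \<exists>l \<in> hom1 PsI W (PO CF X).
        bi_initial (slice (Ar2 (two_op C)) (Ar2 PsI) (Ar2_psfun (two_op C) PsI CF) W) (X, id2 PsI l))
    in (cond_i \<longleftrightarrow> cond_ii) \<and> (cond_ii \<longleftrightarrow> cond_iii) \<and> (cond_iii \<longleftrightarrow> cond_iv)"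
proof -
  define PsI where "PsI = Ps I (CAT :: (('m, 'c) cat, ('m, 'c) cat_func, ('m, 'c) cat_nat) two_cat)"
  define CF where "CF = HomF I C F"
  interpret F: pseudofunctor I C F
    using assms by (simp add: pseudofunctor_def pseudofunctor_axioms_def)
  interpret P: two_category_pair I "CAT :: (('m, 'c) cat, ('m, 'c) cat_func, ('m, 'c) cat_nat) two_cat" ..
  interpret G: pseudofunctor "two_op C" PsI CF
    unfolding PsI_def CF_def
    by (intro pseudofunctor.intro pseudofunctor_axioms.intro F.B.two_category_two_op P.two_category_Ps
        F.normal_pseudofunctor_HomF)
  define eq where "eq X l \<longleftrightarrow> (\<forall>Y \<in> Ob C.
      fully_faithful (hom_cat C Y X) (hom_cat PsI W (PO CF Y)) (eval_functor PsI CF l) \<and>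
      ess_surjective (hom_cat C Y X) (hom_cat PsI W (PO CF Y)) (eval_functor PsI CF l))" for X l
  have hom_op: "hom_cat (two_op C) X Y = hom_cat C Y X" for X Y
    by (simp add: hom_cat_def)
  have i: "weighted_bilimit I C F W X l \<longleftrightarrow> X \<in> Ob C \<and> l \<in> hom1 PsI W (PO CF X) \<and> eq X l" for X l
  proof -
    have "adjoint_equivalence (hom_cat C Y X) (hom_cat PsI W (PO CF Y)) (eval_functor PsI CF l) \<longleftrightarrow>
        fully_faithful (hom_cat C Y X) (hom_cat PsI W (PO CF Y)) (eval_functor PsI CF l) \<and>
        ess_surjective (hom_cat C Y X) (hom_cat PsI W (PO CF Y)) (eval_functor PsI CF l)"
      if "X \<in> Ob C" "l \<in> hom1 PsI W (PO CF X)" "Y \<in> Ob C" for Y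
      using cat_functor.adjoint_equivalence_iff[OF G.eval_functor[of X Y l W]] that by (simp add: hom_op)
    then show ?thesis
      unfolding weighted_bilimit_def PsI_def[symmetric] CF_def[symmetric] eval_functor_def[symmetric] eq_def
      by blast
  qed
  have ii: "double_bi_initial (Hslice (two_op C) PsI CF W) (X, l) \<longleftrightarrow> X \<in> Ob C \<and> l \<in> hom1 PsI W (PO CF X) \<and> eq X l" for X l
    unfolding G.double_bi_initial_Hslice_iff hom_op eq_def by simp
  have iv: "bi_initial (slice (Ar2 (two_op C)) (Ar2 PsI) (Ar2_psfun (two_op C) PsI CF) W) (X, id2 PsI l) \<longleftrightarrow> X \<in> Ob C \<and> eq X l"
    if "l \<in> hom1 PsI W (PO CF X)" for X l
    unfolding G.bi_initial_slice_Ar2_iff[OF that] hom_op eq_def by simp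
  have iii: "bi_initial (slice (two_op C) PsI CF W) (X, l)"
    if "l \<in> hom1 PsI W (PO CF X)" "bi_initial (slice (Ar2 (two_op C)) (Ar2 PsI) (Ar2_psfun (two_op C) PsI CF) W) (X, id2 PsI l)" for X l
    by (rule G.bi_initial_slice_if_Ar2[OF that])
  show ?thesis
    unfolding Let_def PsI_def[symmetric] CF_def[symmetric] i ii using iv iii by blast
qed

end
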